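(* Let $(A,\mu)$ be a Lie algebroid, and let $N$ be a vector bundle endomorphism of $A$. If $N$ is a Nijenhuis tensor for $(A,\mu)$, then $\mathcal N=\begin{pmatrix}N&0\\0&-{}^tN\end{pmatrix}$ is a weak deforming tensor for the Courant algebroid $(A\oplus A^*,\mu)$, and $\{\widetilde{\mathcal N},\mu\}$ is a Courant algebroid structure on $A\oplus A^*$, which is the double of the trivial Lie bialgebroid $((A,\mu_N),(A^*,0))$ defined by $(A,\mu_N)$.
   Context: Let $A$ be a (smooth, real, finite rank) vector bundle over a manifold $M$, and equip $E=A\oplus A^*$ with the canonical symmetric bilinear form $\langle X+\xi,Y+\eta\rangle=\xi(Y)+\eta(X)$. $\mathcal A=\bigoplus_k\mathcal A^k$ is the graded algebra of functions on the graded manifold $T^*[2]A[1]$, with its canonical Poisson bracket $\{\cdot,\cdot\}$ of degree $-2$ (the big bracket), with $\{a,b\}=-(-1)^{|a||b|}\{b,a\}$ and the graded Leibniz and Jacobi identities. For a local basis $(e_\alpha)$ of $\Gamma A$ with dual basis $(\epsilon^\alpha)$, local coordinates are $(x^i,\tau^\alpha,p_i,\theta_\alpha)$ of degrees $0,1,2,1$, with non-vanishing brackets $\{x^i,p_j\}=\delta^i_j$, $\{\tau^\alpha,\theta_\beta\}=\delta^\alpha_\beta$. $\mathcal A^0=C^\infty(M)$; $\mathcal A^1=\Gamma(A\oplus A^* )$, with $X=X^\alpha e_\alpha$ identified with $X^\alpha\theta_\alpha$ and $\xi=\xi_\alpha\epsilon^\alpha$ with $\xi_\alpha\tau^\alpha$;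 $\{u,v\}=\langle u,v\rangle$ for sections of $E$. A Lie algebroid structure on $A$ is given by $\mu\in\mathcal A^3$, locally a combination with coefficients in $C^\infty(M)$ of terms $\tau^\alpha p_i$ and $\tau^\alpha\tau^\beta\theta_\gamma$, with $\{\mu,\mu\}=0$: anchor $\rho(X)f=\{\{X,\mu\},f\}$, bracket $[X,Y]^\mu=\{\{X,\mu\},Y\}$. A Courant algebroid structure on $A\oplus A^*$ is an element $\Theta\in\mathcal A^3$ with $\{\Theta,\Theta\}=0$; its Dorfman bracket is $\{\{u,\Theta\},v\}$ and its anchor $\rho(u)f=\{\{u,\Theta\},f\}$. If $(A,\mu)$ is a Lie algebroid, the pair $((A,\mu),(A^*,0))$, where $A^*$ has zero anchor and bracket, is called a trivial Lie bialgebroid; its double is the Courant algebroid $A\oplus A^*$ with $\Theta=\mu$. For a skew-symmetric endomorphism $\mathcal N$ of $E$ ($\langle\mathcal Nu,v\rangle+\langle u,\mathcal Nv\rangle=0$), $\widetilde{\mathcal N}\in\mathcal A^2$ is the unique element with $\mathcal N(u)=\{u,\widetilde{\mathcal N}\}$ for all $u\in\Gamma E$. $\mathcal N$ is a weak deforming tensor for $\Theta$ if $\{\Theta,\{\{\widetilde{\mathcal N},\Theta\},\widetilde{\mathcal N}\}\}=0$, i.e. if $\{\{\widetilde{\mathcal N},\Theta\},\widetilde{\mathcal N}\}$ is a cocycle for $\mathrm d_\Theta=\{\Theta,\cdot\}$. An endomorphism $N$ of $A$ is identified with the element of $\mathcal A^2$ given locally by $N^\alpha_\beta\tau^\beta\theta_\alpha$;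 $\mu_N=\{N,\mu\}$, with associated bracket $[X,Y]^\mu_N=[NX,Y]^\mu+[X,NY]^\mu-N[X,Y]^\mu$. $N$ is a Nijenhuis tensor for $(A,\mu)$ if $(T_\mu N)(X,Y)=[NX,NY]^\mu-N[X,Y]^\mu_N$ vanishes for all sections $X,Y$ of $A$. *)

theory Defs
  imports "HOL-Analysis.Analysis" "HOL-Library.Multiset"
begin

section \<open>Smooth functions in coordinates\<close>

text \<open>
  The model space is the library's \<^const>\<open>Euclidean_space\<close>, a topology on
  \<^typ>\<open>nat \<Rightarrow> real\<close> with points \<open>y\<close> such that \<open>y i = 0\<close> for \<open>i \<ge> n\<close>.
  Dimension \<open>0\<close> is allowed, so that Lie algebras (base a point) are included.
\<close>

definition pderiv_at :: "nat \<Rightarrow> ((nat \<Rightarrow> real) \<Rightarrow> real) \<Rightarrow> (nat \<Rightarrow> real) \<Rightarrow> real" where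
  "pderiv_at i f y = deriv (\<lambda>t. f (y(i := t))) (y i)"

primrec Ck_on :: "nat \<Rightarrow> nat \<Rightarrow> (nat \<Rightarrow> real) set \<Rightarrow> ((nat \<Rightarrow> real) \<Rightarrow> real) \<Rightarrow> bool" where
  "Ck_on 0 n V f \<longleftrightarrow> continuous_map (subtopology (Euclidean_space n) V) euclideanreal f"
| "Ck_on (Suc k) n V f \<longleftrightarrow>
     continuous_map (subtopology (Euclidean_space n) V) euclideanreal f \<and>
     (\<forall>i<n. (\<forall>y\<in>V. (\<lambda>t. f (y(i := t))) differentiable (at (y i))) \<and>
            Ck_on k n V (pderiv_at i f))"

text \<open>Only used for \<open>V\<close> open in \<open>Euclidean_space n\<close>.\<close>

definition Cinf_on :: "nat \<Rightarrow> (nat \<Rightarrow> real) set \<Rightarrow> ((nat \<Rightarrow> real) \<Rightarrow> real) \<Rightarrow> bool" where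
  "Cinf_on n V f \<longleftrightarrow> (\<forall>k. Ck_on k n V f)"


section \<open>Manifolds and vector bundles\<close>

text \<open>
  A chart is a domain with its coordinate map; a local frame is a domain with the local
  sections \<open>e\<^sub>0, \<dots>, e\<^bsub>r-1\<^esub>\<close>. The fibres are subspaces of one ambient vector space, which
  carries no further structure: the smooth structure of the bundle is that given by
  its local frames.
\<close>

type_synonym 'm chart = "'m set \<times> ('m \<Rightarrow> nat \<Rightarrow> real)"
type_synonym ('m, 'v) frame = "'m set \<times> (nat \<Rightarrow> 'm \<Rightarrow> 'v)"

record ('m, 'v) vbundle =
  base :: "'m topology"
  bdim :: nat
  charts :: "'m chart set"
  fibre :: "'m \<Rightarrow> 'v set"
  rnk :: nat
  frames :: "('m, 'v) frame set"

definition chart_inv :: "'m chart \<Rightarrow> (nat \<Rightarrow> real) \<Rightarrow> 'm" where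
  "chart_inv c = inv_into (fst c) (snd c)"

definition smooth_manifold :: "'m topology \<Rightarrow> nat \<Rightarrow> 'm chart set \<Rightarrow> bool" where
  "smooth_manifold M n C \<longleftrightarrow>
     Hausdorff_space M \<and> second_countable M \<and>
     \<Union> (fst ` C) = topspace M \<and>
     (\<forall>(U, \<phi>)\<in>C. openin M U \<and> openin (Euclidean_space n) (\<phi> ` U) \<and>
        homeomorphic_map (subtopology M U) (subtopology (Euclidean_space n) (\<phi> ` U)) \<phi>) \<and>
     (\<forall>c\<in>C. \<forall>d\<in>C. \<forall>i<n.
        Cinf_on n (snd c ` (fst c \<inter> fst d)) (\<lambda>y. snd d (chart_inv c y) i))"

text \<open>\<open>smooth B W f\<close>: \<open>f\<close> is smooth on the open subset \<open>W\<close> of the base.\<close>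

definition smooth :: "('m, 'v) vbundle \<Rightarrow> 'm set \<Rightarrow> ('m \<Rightarrow> real) \<Rightarrow> bool" where
  "smooth B W f \<longleftrightarrow>
     (\<forall>c\<in>charts B. Cinf_on (bdim B) (snd c ` (fst c \<inter> W)) (f \<circ> chart_inv c))"

text \<open>The coordinate vector field \<open>\<partial>/\<partial>x\<^sup>i\<close> of a chart, applied to a function on the base.\<close>

definition partial :: "'m chart \<Rightarrow> nat \<Rightarrow> ('m \<Rightarrow> real) \<Rightarrow> 'm \<Rightarrow> real" where
  "partial c i f x = pderiv_at i (f \<circ> chart_inv c) (snd c x)"

text \<open>\<open>frame_coeff B e \<alpha> x v\<close> is \<open>\<epsilon>\<^sup>\<alpha>(v)\<close>, with \<open>(\<epsilon>\<^sup>\<alpha>)\<close> the basis dual to \<open>(e\<^sub>\<alpha>)\<close> at \<open>x\<close>.\<close>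

definition frame_coeff ::
  "('m, 'v::real_vector) vbundle \<Rightarrow> ('m, 'v) frame \<Rightarrow> nat \<Rightarrow> 'm \<Rightarrow> 'v \<Rightarrow> real" where
  "frame_coeff B e \<alpha> x v = representation ((\<lambda>\<beta>. snd e \<beta> x) ` {..<rnk B}) v (snd e \<alpha> x)"

text \<open>Fibres over points outside the base are set to \<open>{0}\<close>, which makes all sections,
  as functions on the whole type, vanish there.\<close>

definition vector_bundle :: "('m, 'v::real_vector) vbundle \<Rightarrow> bool" where
  "vector_bundle B \<longleftrightarrow>
     smooth_manifold (base B) (bdim B) (charts B) \<and>
     (\<forall>x. x \<notin> topspace (base B) \<longrightarrow> fibre B x = {0}) \<and>
     \<Union> (fst ` frames B) = topspace (base B) \<and>
     (\<forall>(V, e)\<in>frames B. openin (base B) V \<and>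
        (\<forall>x\<in>V. inj_on (\<lambda>\<alpha>. e \<alpha> x) {..<rnk B} \<and>
                independent ((\<lambda>\<alpha>. e \<alpha> x) ` {..<rnk B}) \<and>
                span ((\<lambda>\<alpha>. e \<alpha> x) ` {..<rnk B}) = fibre B x)) \<and>
     (\<forall>e\<in>frames B. \<forall>e'\<in>frames B. \<forall>\<alpha><rnk B. \<forall>\<beta><rnk B.
        smooth B (fst e \<inter> fst e') (\<lambda>x. frame_coeff B e' \<alpha> x (snd e \<beta> x)))"

definition sections :: "('m, 'v::real_vector) vbundle \<Rightarrow> ('m \<Rightarrow> 'v) set" where
  "sections B = {X. (\<forall>x. X x \<in> fibre B x) \<and>
     (\<forall>e\<in>frames B. \<forall>\<alpha><rnk B. smooth B (fst e) (\<lambda>x. frame_coeff B e \<alpha> x (X x)))}"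

definition dual_fibre :: "('m, 'v::real_vector) vbundle \<Rightarrow> 'm \<Rightarrow> ('v \<Rightarrow> real) set" where
  "dual_fibre B x = {\<xi>. (\<forall>v. v \<notin> fibre B x \<longrightarrow> \<xi> v = 0) \<and>
     (\<forall>v\<in>fibre B x. \<forall>w\<in>fibre B x. \<xi> (v + w) = \<xi> v + \<xi> w) \<and>
     (\<forall>t. \<forall>v\<in>fibre B x. \<xi> (t *\<^sub>R v) = t * \<xi> v)}"

definition dual_sections :: "('m, 'v::real_vector) vbundle \<Rightarrow> ('m \<Rightarrow> 'v \<Rightarrow> real) set" where
  "dual_sections B = {\<xi>. (\<forall>x. \<xi> x \<in> dual_fibre B x) \<and>
     (\<forall>e\<in>frames B. \<forall>\<alpha><rnk B. smooth B (fst e) (\<lambda>x. \<xi> x (snd e \<alpha> x)))}"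

text \<open>Sections of \<open>E = A \<oplus> A\<^sup>*\<close>.\<close>

definition E_sections ::
  "('m, 'v::real_vector) vbundle \<Rightarrow> ('m \<Rightarrow> 'v \<times> ('v \<Rightarrow> real)) set" where
  "E_sections B = {u. (\<lambda>x. fst (u x)) \<in> sections B \<and> (\<lambda>x. snd (u x)) \<in> dual_sections B}"

definition endomorphism :: "('m, 'v::real_vector) vbundle \<Rightarrow> ('m \<Rightarrow> 'v \<Rightarrow> 'v) \<Rightarrow> bool" where
  "endomorphism B N \<longleftrightarrow>
     (\<forall>x. (\<forall>v. v \<notin> fibre B x \<longrightarrow> N x v = 0) \<and>
          (\<forall>v\<in>fibre B x. N x v \<in> fibre B x) \<and>
          (\<forall>v\<in>fibre B x. \<forall>w\<in>fibre B x. N x (v + w) = N x v + N x w) \<and>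
          (\<forall>t. \<forall>v\<in>fibre B x. N x (t *\<^sub>R v) = t *\<^sub>R N x v)) \<and>
     (\<forall>e\<in>frames B. \<forall>\<alpha><rnk B. \<forall>\<beta><rnk B.
        smooth B (fst e) (\<lambda>x. frame_coeff B e \<alpha> x (N x (snd e \<beta> x))))"

definition E_form :: "'v \<times> ('v \<Rightarrow> real) \<Rightarrow> 'v \<times> ('v \<Rightarrow> real) \<Rightarrow> real" where
  "E_form u v = snd u (fst v) + snd v (fst u)"

definition E_endomorphism ::
  "('m, 'v::real_vector) vbundle \<Rightarrow>
   ('m \<Rightarrow> 'v \<times> ('v \<Rightarrow> real) \<Rightarrow> 'v \<times> ('v \<Rightarrow> real)) \<Rightarrow> bool" where
  "E_endomorphism B \<N> \<longleftrightarrow>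
     (\<forall>x. \<forall>u\<in>fibre B x \<times> dual_fibre B x.
        \<N> x u \<in> fibre B x \<times> dual_fibre B x \<and>
        (\<forall>v\<in>fibre B x \<times> dual_fibre B x.
           \<N> x (fst u + fst v, \<lambda>w. snd u w + snd v w) =
             (fst (\<N> x u) + fst (\<N> x v), \<lambda>w. snd (\<N> x u) w + snd (\<N> x v) w)) \<and>
        (\<forall>t. \<N> x (t *\<^sub>R fst u, \<lambda>w. t * snd u w) =
             (t *\<^sub>R fst (\<N> x u), \<lambda>w. t * snd (\<N> x u) w))) \<and>
     (\<forall>u\<in>E_sections B. (\<lambda>x. \<N> x (u x)) \<in> E_sections B)"

definition skew_endomorphism ::
  "('m, 'v::real_vector) vbundle \<Rightarrow>
   ('m \<Rightarrow> 'v \<times> ('v \<Rightarrow> real) \<Rightarrow> 'v \<times> ('v \<Rightarrow> real)) \<Rightarrow> bool" where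
  "skew_endomorphism B \<N> \<longleftrightarrow> E_endomorphism B \<N> \<and>
     (\<forall>x. \<forall>u\<in>fibre B x \<times> dual_fibre B x. \<forall>v\<in>fibre B x \<times> dual_fibre B x.
        E_form (\<N> x u) v + E_form u (\<N> x v) = 0)"

text \<open>The transpose of \<open>N\<close>, and the block matrix with diagonal \<open>N, - \<^sup>tN\<close>.\<close>

definition transpose_endo :: "('m \<Rightarrow> 'v \<Rightarrow> 'v) \<Rightarrow> 'm \<Rightarrow> ('v \<Rightarrow> real) \<Rightarrow> ('v \<Rightarrow> real)" where
  "transpose_endo N x \<xi> = (\<lambda>v. \<xi> (N x v))"

definition block_endo ::
  "('m \<Rightarrow> 'v \<Rightarrow> 'v) \<Rightarrow> 'm \<Rightarrow> 'v \<times> ('v \<Rightarrow> real) \<Rightarrow> 'v \<times> ('v \<Rightarrow> real)" where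
  "block_endo N x u = (N x (fst u), \<lambda>v. - transpose_endo N x (snd u) v)"


section \<open>The algebra generated by \<open>p\<^sub>i\<close>, \<open>\<tau>\<^sup>\<alpha>\<close>, \<open>\<theta>\<^sub>\<alpha>\<close>\<close>

datatype odd_gen = Tau nat | Theta nat

instantiation odd_gen :: linorder
begin

fun less_eq_odd_gen :: "odd_gen \<Rightarrow> odd_gen \<Rightarrow> bool" where
  "Tau \<alpha> \<le> Tau \<beta> \<longleftrightarrow> \<alpha> \<le> \<beta>"
| "Tau \<alpha> \<le> Theta \<beta> \<longleftrightarrow> True"
| "Theta \<alpha> \<le> Tau \<beta> \<longleftrightarrow> False"
| "Theta \<alpha> \<le> Theta \<beta> \<longleftrightarrow> \<alpha> \<le> \<beta>"

definition less_odd_gen :: "odd_gen \<Rightarrow> odd_gen \<Rightarrow> bool" where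
  "a < b \<longleftrightarrow> a \<le> b \<and> \<not> b \<le> (a::odd_gen)"

instance
proof
  fix a b c :: odd_gen
  show "a < b \<longleftrightarrow> a \<le> b \<and> \<not> b \<le> a" by (rule less_odd_gen_def)
  show "a \<le> a" by (cases a) auto
  show "a \<le> c" if "a \<le> b" "b \<le> c" using that by (cases a; cases b; cases c) auto
  show "a = b" if "a \<le> b" "b \<le> a" using that by (cases a; cases b) auto
  show "a \<le> b \<or> b \<le> a" by (cases a; cases b) auto
qed

end

text \<open>
  The monomial \<open>(P, S)\<close> is the product of the \<open>p\<^sub>i\<close>, \<open>i \<in># P\<close>, and of the odd generators in
  \<open>S\<close>, the latter taken in increasing order. An element of the algebra is its family of
  coefficients.
\<close>

type_synonym mono = "nat multiset \<times> odd_gen set"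
type_synonym gpoly = "mono \<Rightarrow> real"

text \<open>Sign of the reordering of \<open>e\<^sub>S e\<^sub>T\<close> into increasing order, for disjoint \<open>S, T\<close>.\<close>

definition koszul :: "odd_gen set \<Rightarrow> odd_gen set \<Rightarrow> real" where
  "koszul S T = (-1) ^ card {(s, t). s \<in> S \<and> t \<in> T \<and> t < s}"

definition gmul :: "gpoly \<Rightarrow> gpoly \<Rightarrow> gpoly" where
  "gmul a b = (\<lambda>(P, S). \<Sum>Q | Q \<subseteq># P. \<Sum>T\<in>Pow S.
     koszul T (S - T) * a (Q, T) * b (P - Q, S - T))"

definition gmono :: "mono \<Rightarrow> gpoly" where
  "gmono m = (\<lambda>m'. if m' = m then 1 else 0)"

definition d_p :: "nat \<Rightarrow> gpoly \<Rightarrow> gpoly" where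
  "d_p i a = (\<lambda>(P, S). real (Suc (count P i)) * a (add_mset i P, S))"

text \<open>Left and right derivatives with respect to an odd generator.\<close>

definition d_left :: "odd_gen \<Rightarrow> gpoly \<Rightarrow> gpoly" where
  "d_left g a = (\<lambda>(P, S). if g \<in> S then 0 else koszul {g} S * a (P, insert g S))"

definition d_right :: "odd_gen \<Rightarrow> gpoly \<Rightarrow> gpoly" where
  "d_right g a = (\<lambda>(P, S). if g \<in> S then 0 else koszul S {g} * a (P, insert g S))"

text \<open>Monomials of degree \<open>k\<close>: \<open>p\<^sub>i\<close> has degree 2, \<open>\<tau>\<^sup>\<alpha>\<close> and \<open>\<theta>\<^sub>\<alpha>\<close> have degree 1.\<close>

definition monomials :: "nat \<Rightarrow> nat \<Rightarrow> nat \<Rightarrow> mono set" where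
  "monomials n r k = {(P, S). set_mset P \<subseteq> {..<n} \<and> S \<subseteq> Tau ` {..<r} \<union> Theta ` {..<r} \<and>
     2 * size P + card S = k}"


section \<open>Functions on \<open>T\<^sup>*[2]A[1]\<close> and the big bracket\<close>

text \<open>
  A function is a family of local expressions, one for each pair of a chart \<open>(x\<^sup>i)\<close> and a
  frame \<open>(e\<^sub>\<alpha>)\<close>, on the intersection of the two domains, in the coordinates
  \<open>(x\<^sup>i, \<tau>\<^sup>\<alpha>, p\<^sub>i, \<theta>\<^sub>\<alpha>)\<close> that they determine. Coefficients are functions of the
  point of the base and are \<open>0\<close> outside that intersection, so that equality of functions
  is equality in HOL.
\<close>

type_synonym ('m, 'v) gfun = "'m chart \<Rightarrow> ('m, 'v) frame \<Rightarrow> 'm \<Rightarrow> gpoly"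

text \<open>
  The new coordinates in terms of the old ones, for a change from \<open>(c, e)\<close> to \<open>(c', e')\<close>;
  it is the cotangent lift of the change of coordinates of \<open>A[1]\<close>. With
  \<open>g\<^sup>\<alpha>\<^sub>\<beta> = \<epsilon>'\<^sup>\<alpha>(e\<^sub>\<beta>)\<close> and \<open>h = g\<^sup>-\<^sup>1\<close>:
    \<open>\<tau>'\<^sup>\<alpha> = g\<^sup>\<alpha>\<^sub>\<beta> \<tau>\<^sup>\<beta>\<close>, \<open>\<theta>'\<^sub>\<alpha> = h\<^sup>\<beta>\<^sub>\<alpha> \<theta>\<^sub>\<beta>\<close>,
    \<open>p'\<^sub>j = (\<partial>x\<^sup>i/\<partial>x'\<^sup>j) p\<^sub>i + h\<^sup>\<gamma>\<^sub>\<alpha> (\<partial>g\<^sup>\<alpha>\<^sub>\<delta>/\<partial>x'\<^sup>j) \<tau>\<^sup>\<delta> \<theta>\<^sub>\<gamma>\<close>.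
  The second term in \<open>p'\<^sub>j\<close> is what \<open>{\<tau>'\<^sup>\<alpha>, p'\<^sub>j} = 0\<close> requires.
\<close>

fun odd_change ::
  "('m, 'v::real_vector) vbundle \<Rightarrow> ('m, 'v) frame \<Rightarrow> ('m, 'v) frame \<Rightarrow> 'm \<Rightarrow> odd_gen \<Rightarrow> gpoly"
where
  "odd_change B e e' x (Tau \<alpha>) = (\<lambda>m. \<Sum>\<beta><rnk B.
     frame_coeff B e' \<alpha> x (snd e \<beta> x) * gmono ({#}, {Tau \<beta>}) m)"
| "odd_change B e e' x (Theta \<alpha>) = (\<lambda>m. \<Sum>\<beta><rnk B.
     frame_coeff B e \<beta> x (snd e' \<alpha> x) * gmono ({#}, {Theta \<beta>}) m)"

definition p_change ::
  "('m, 'v::real_vector) vbundle \<Rightarrow> 'm chart \<Rightarrow> ('m, 'v) frame \<Rightarrow>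
   'm chart \<Rightarrow> ('m, 'v) frame \<Rightarrow> 'm \<Rightarrow> nat \<Rightarrow> gpoly" where
  "p_change B c e c' e' x j = (\<lambda>m.
     (\<Sum>i<bdim B. partial c' j (\<lambda>y. snd c y i) x * gmono ({#i#}, {}) m) +
     (\<Sum>\<gamma><rnk B. \<Sum>\<delta><rnk B. \<Sum>\<alpha><rnk B.
        frame_coeff B e \<gamma> x (snd e' \<alpha> x) *
        partial c' j (\<lambda>y. frame_coeff B e' \<alpha> y (snd e \<delta> y)) x *
        gmono ({#}, {Tau \<delta>, Theta \<gamma>}) m))"

definition mono_change ::
  "('m, 'v::real_vector) vbundle \<Rightarrow> 'm chart \<Rightarrow> ('m, 'v) frame \<Rightarrow>
   'm chart \<Rightarrow> ('m, 'v) frame \<Rightarrow> 'm \<Rightarrow> mono \<Rightarrow> gpoly" where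
  "mono_change B c e c' e' x = (\<lambda>(P, S).
     foldr gmul (map (p_change B c e c' e' x) (sorted_list_of_multiset P) @
                 map (odd_change B e e' x) (sorted_list_of_set S))
       (gmono ({#}, {})))"

text \<open>The homogeneous component \<open>\<A>\<^sup>k\<close>.\<close>

definition graded_functions :: "('m, 'v::real_vector) vbundle \<Rightarrow> nat \<Rightarrow> ('m, 'v) gfun set" where
  "graded_functions B k = {a.
     (\<forall>c e x m. a c e x m \<noteq> 0 \<longrightarrow>
        c \<in> charts B \<and> e \<in> frames B \<and> x \<in> fst c \<inter> fst e \<and> m \<in> monomials (bdim B) (rnk B) k) \<and>
     (\<forall>c\<in>charts B. \<forall>e\<in>frames B. \<forall>m. smooth B (fst c \<inter> fst e) (\<lambda>x. a c e x m)) \<and>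
     (\<forall>c\<in>charts B. \<forall>e\<in>frames B. \<forall>c'\<in>charts B. \<forall>e'\<in>frames B.
        \<forall>x\<in>fst c \<inter> fst e \<inter> fst c' \<inter> fst e'. \<forall>m.
          a c e x m = (\<Sum>m'\<in>monomials (bdim B) (rnk B) k.
             a c' e' x m' * mono_change B c e c' e' x m' m))}"

definition zero_gfun :: "('m, 'v) gfun" where
  "zero_gfun = (\<lambda>c e x m. 0)"

definition add_gfun :: "('m, 'v) gfun \<Rightarrow> ('m, 'v) gfun \<Rightarrow> ('m, 'v) gfun" where
  "add_gfun a b = (\<lambda>c e x m. a c e x m + b c e x m)"

text \<open>
  The Poisson bracket of degree \<open>-2\<close> with \<open>{x\<^sup>i, p\<^sub>j} = \<delta>\<^sup>i\<^sub>j\<close>, \<open>{\<tau>\<^sup>\<alpha>, \<theta>\<^sub>\<beta>} = \<delta>\<^sup>\<alpha>\<^sub>\<beta>\<close>, a graded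
  derivation \<open>{a, bc} = {a, b}c + (-1)\<^bsup>|a||b|\<^esup> b{a, c}\<close> in its second argument: right
  derivatives of \<open>a\<close> are paired with left derivatives of \<open>b\<close>.
\<close>

definition big_bracket ::
  "('m, 'v) vbundle \<Rightarrow> ('m, 'v) gfun \<Rightarrow> ('m, 'v) gfun \<Rightarrow> ('m, 'v) gfun" where
  "big_bracket B a b = (\<lambda>c e x m.
     if c \<in> charts B \<and> e \<in> frames B \<and> x \<in> fst c \<inter> fst e then
       (\<Sum>i<bdim B.
          gmul (\<lambda>m'. partial c i (\<lambda>y. a c e y m') x) (d_p i (b c e x)) m -
          gmul (d_p i (a c e x)) (\<lambda>m'. partial c i (\<lambda>y. b c e y m') x) m) +
       (\<Sum>\<alpha><rnk B.
          gmul (d_right (Tau \<alpha>) (a c e x)) (d_left (Theta \<alpha>) (b c e x)) m +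
          gmul (d_right (Theta \<alpha>) (a c e x)) (d_left (Tau \<alpha>) (b c e x)) m)
     else 0)"

text \<open>The identification of \<open>\<Gamma>E\<close> with \<open>\<A>\<^sup>1\<close>: \<open>X + \<xi>\<close> goes to \<open>X\<^sup>\<alpha> \<theta>\<^sub>\<alpha> + \<xi>\<^sub>\<alpha> \<tau>\<^sup>\<alpha>\<close>.\<close>

definition section_gfun ::
  "('m, 'v::real_vector) vbundle \<Rightarrow> ('m \<Rightarrow> 'v \<times> ('v \<Rightarrow> real)) \<Rightarrow> ('m, 'v) gfun" where
  "section_gfun B u = (\<lambda>c e x m.
     if c \<in> charts B \<and> e \<in> frames B \<and> x \<in> fst c \<inter> fst e then
       (\<Sum>\<alpha><rnk B. frame_coeff B e \<alpha> x (fst (u x)) * gmono ({#}, {Theta \<alpha>}) m +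
                 snd (u x) (snd e \<alpha> x) * gmono ({#}, {Tau \<alpha>}) m)
     else 0)"

abbreviation vector_gfun :: "('m, 'v::real_vector) vbundle \<Rightarrow> ('m \<Rightarrow> 'v) \<Rightarrow> ('m, 'v) gfun" where
  "vector_gfun B X \<equiv> section_gfun B (\<lambda>x. (X x, \<lambda>v. 0))"

text \<open>The identification of an endomorphism \<open>N\<close> of \<open>A\<close> with \<open>N\<^sup>\<alpha>\<^sub>\<beta> \<tau>\<^sup>\<beta> \<theta>\<^sub>\<alpha> \<in> \<A>\<^sup>2\<close>.\<close>

definition endo_gfun ::
  "('m, 'v::real_vector) vbundle \<Rightarrow> ('m \<Rightarrow> 'v \<Rightarrow> 'v) \<Rightarrow> ('m, 'v) gfun" where
  "endo_gfun B N = (\<lambda>c e x m.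
     if c \<in> charts B \<and> e \<in> frames B \<and> x \<in> fst c \<inter> fst e then
       (\<Sum>\<alpha><rnk B. \<Sum>\<beta><rnk B.
          frame_coeff B e \<alpha> x (N x (snd e \<beta> x)) * gmono ({#}, {Tau \<beta>, Theta \<alpha>}) m)
     else 0)"

text \<open>The element of \<open>\<A>\<^sup>2\<close> representing a skew-symmetric endomorphism of \<open>E\<close>.\<close>

definition tilde ::
  "('m, 'v::real_vector) vbundle \<Rightarrow>
   ('m \<Rightarrow> 'v \<times> ('v \<Rightarrow> real) \<Rightarrow> 'v \<times> ('v \<Rightarrow> real)) \<Rightarrow> ('m, 'v) gfun" where
  "tilde B \<N> = (THE a. a \<in> graded_functions B 2 \<and>
     (\<forall>u\<in>E_sections B. section_gfun B (\<lambda>x. \<N> x (u x)) = big_bracket B (section_gfun B u) a))"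


section \<open>Lie algebroids, Lie bialgebroids, Courant algebroids\<close>

text \<open>A Lie algebroid structure on \<open>A\<close> is a combination of terms \<open>\<tau>\<^sup>\<alpha> p\<^sub>i\<close> and \<open>\<tau>\<^sup>\<alpha> \<tau>\<^sup>\<beta> \<theta>\<^sub>\<gamma>\<close>.\<close>

definition lie_algebroid ::
  "('m, 'v::real_vector) vbundle \<Rightarrow> ('m, 'v) gfun \<Rightarrow> bool" where
  "lie_algebroid B \<mu> \<longleftrightarrow> \<mu> \<in> graded_functions B 3 \<and>
     (\<forall>c e x m. \<mu> c e x m \<noteq> 0 \<longrightarrow>
        (\<exists>\<alpha> i. m = ({#i#}, {Tau \<alpha>})) \<or>
        (\<exists>\<alpha> \<beta> \<gamma>. m = ({#}, {Tau \<alpha>, Tau \<beta>, Theta \<gamma>}))) \<and>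
     big_bracket B \<mu> \<mu> = zero_gfun"

text \<open>The same for \<open>A\<^sup>*\<close>: the roles of \<open>\<tau>\<close> and \<open>\<theta>\<close> are exchanged.\<close>

definition dual_lie_algebroid ::
  "('m, 'v::real_vector) vbundle \<Rightarrow> ('m, 'v) gfun \<Rightarrow> bool" where
  "dual_lie_algebroid B \<gamma> \<longleftrightarrow> \<gamma> \<in> graded_functions B 3 \<and>
     (\<forall>c e x m. \<gamma> c e x m \<noteq> 0 \<longrightarrow>
        (\<exists>\<alpha> i. m = ({#i#}, {Theta \<alpha>})) \<or>
        (\<exists>\<alpha> \<beta> \<delta>. m = ({#}, {Theta \<alpha>, Theta \<beta>, Tau \<delta>}))) \<and>
     big_bracket B \<gamma> \<gamma> = zero_gfun"

definition lie_bialgebroid ::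
  "('m, 'v::real_vector) vbundle \<Rightarrow> ('m, 'v) gfun \<Rightarrow> ('m, 'v) gfun \<Rightarrow> bool" where
  "lie_bialgebroid B \<mu> \<gamma> \<longleftrightarrow>
     lie_algebroid B \<mu> \<and> dual_lie_algebroid B \<gamma> \<and> big_bracket B \<mu> \<gamma> = zero_gfun"

text \<open>The element defining the double; for the trivial Lie bialgebroid \<open>((A,\<mu>),(A\<^sup>*,0))\<close>
  the second argument is \<^const>\<open>zero_gfun\<close>.\<close>

definition double :: "('m, 'v) gfun \<Rightarrow> ('m, 'v) gfun \<Rightarrow> ('m, 'v) gfun" where
  "double \<mu> \<gamma> = add_gfun \<mu> \<gamma>"

definition courant_algebroid ::
  "('m, 'v::real_vector) vbundle \<Rightarrow> ('m, 'v) gfun \<Rightarrow> bool" where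
  "courant_algebroid B \<Theta> \<longleftrightarrow>
     \<Theta> \<in> graded_functions B 3 \<and> big_bracket B \<Theta> \<Theta> = zero_gfun"

definition weak_deforming_tensor ::
  "('m, 'v::real_vector) vbundle \<Rightarrow> ('m, 'v) gfun \<Rightarrow>
   ('m \<Rightarrow> 'v \<times> ('v \<Rightarrow> real) \<Rightarrow> 'v \<times> ('v \<Rightarrow> real)) \<Rightarrow> bool" where
  "weak_deforming_tensor B \<Theta> \<N> \<longleftrightarrow>
     courant_algebroid B \<Theta> \<and> skew_endomorphism B \<N> \<and>
     big_bracket B \<Theta> (big_bracket B (big_bracket B (tilde B \<N>) \<Theta>) (tilde B \<N>)) = zero_gfun"

text \<open>The bracket \<open>[X, Y]\<^sup>\<mu> = {{X, \<mu>}, Y}\<close> as a section of \<open>A\<close>.\<close>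

definition lie_bracket ::
  "('m, 'v::real_vector) vbundle \<Rightarrow> ('m, 'v) gfun \<Rightarrow> ('m \<Rightarrow> 'v) \<Rightarrow> ('m \<Rightarrow> 'v) \<Rightarrow> 'm \<Rightarrow> 'v" where
  "lie_bracket B \<mu> X Y = (THE Z. Z \<in> sections B \<and>
     vector_gfun B Z = big_bracket B (big_bracket B (vector_gfun B X) \<mu>) (vector_gfun B Y))"

text \<open>The bracket \<open>[X, Y]\<^sup>\<mu>\<^sub>N\<close>.\<close>

definition deformed_bracket ::
  "('m, 'v::real_vector) vbundle \<Rightarrow> ('m, 'v) gfun \<Rightarrow> ('m \<Rightarrow> 'v \<Rightarrow> 'v) \<Rightarrow>
   ('m \<Rightarrow> 'v) \<Rightarrow> ('m \<Rightarrow> 'v) \<Rightarrow> 'm \<Rightarrow> 'v" where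
  "deformed_bracket B \<mu> N X Y = (\<lambda>x.
     lie_bracket B \<mu> (\<lambda>y. N y (X y)) Y x + lie_bracket B \<mu> X (\<lambda>y. N y (Y y)) x -
     N x (lie_bracket B \<mu> X Y x))"

definition nijenhuis_torsion ::
  "('m, 'v::real_vector) vbundle \<Rightarrow> ('m, 'v) gfun \<Rightarrow> ('m \<Rightarrow> 'v \<Rightarrow> 'v) \<Rightarrow>
   ('m \<Rightarrow> 'v) \<Rightarrow> ('m \<Rightarrow> 'v) \<Rightarrow> 'm \<Rightarrow> 'v" where
  "nijenhuis_torsion B \<mu> N X Y = (\<lambda>x.
     lie_bracket B \<mu> (\<lambda>y. N y (X y)) (\<lambda>y. N y (Y y)) x -
     N x (deformed_bracket B \<mu> N X Y x))"

definition nijenhuis_tensor ::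
  "('m, 'v::real_vector) vbundle \<Rightarrow> ('m, 'v) gfun \<Rightarrow> ('m \<Rightarrow> 'v \<Rightarrow> 'v) \<Rightarrow> bool" where
  "nijenhuis_tensor B \<mu> N \<longleftrightarrow>
     (\<forall>X\<in>sections B. \<forall>Y\<in>sections B. nijenhuis_torsion B \<mu> N X Y = (\<lambda>x. 0))"

text \<open>\<open>\<mu>\<^sub>N = {N, \<mu>}\<close>.\<close>

definition deformed_structure ::
  "('m, 'v::real_vector) vbundle \<Rightarrow> ('m, 'v) gfun \<Rightarrow> ('m \<Rightarrow> 'v \<Rightarrow> 'v) \<Rightarrow> ('m, 'v) gfun" where
  "deformed_structure B \<mu> N = big_bracket B (endo_gfun B N) \<mu>"

end

theory Submission
  imports Defs
begin

text \<open>
  Neither \<open>N\<close> nor a section \<open>X\<close> of \<open>A\<close> involves the momenta \<open>p\<^sub>i\<close>, so the operators \<open>D\<^sub>N = {N, \<cdot>}\<close> and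
  \<open>D\<^sub>X = {X, \<cdot>}\<close> are derivations of the coordinate expressions at a single point which only depend on
  the 1-jets of \<open>N\<close> and \<open>X\<close> there. Comparing derivations on generators gives \<open>[D\<^sub>X, D\<^sub>N] = D\<^bsub>NX\<^esub>\<close> and the
  compatibility with changes of coordinates. As \<open>[X, Y] = - D\<^sub>Y D\<^sub>X \<mu>\<close>, it follows that
  \<open>D\<^sub>Y D\<^sub>X K = - 2 T(X, Y)\<close> for \<open>K = {N, {N, \<mu>}} - {N\<^sup>2, \<mu>}\<close> and the torsion \<open>T\<close> of \<open>N\<close>. If \<open>T = 0\<close>,
  then \<open>K = 0\<close>, because bump functions provide global sections with arbitrary 1-jet at a point.
  The Jacobi identity for \<open>D\<^sub>N\<close> turns \<open>{\<mu>, \<mu>} = 0\<close> into \<open>{\<mu>, {N, \<mu>}} = 0\<close>, likewise for \<open>N\<^sup>2\<close>. Hence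
  \<open>{\<mu>, {N, \<mu>\<^sub>N}} = {\<mu>, {N\<^sup>2, \<mu>}} = 0\<close>, and applying \<open>D\<^sub>N\<close> to \<open>{\<mu>, \<mu>\<^sub>N} = 0\<close> gives \<open>{\<mu>\<^sub>N, \<mu>\<^sub>N} = 0\<close>.
  In rank \<open>0\<close> the element \<open>tilde B (block_endo N)\<close> is not determined by its characterization, but then \<open>\<mu> = 0\<close>.
\<close>

section \<open>The algebra of coordinate expressions\<close>

text \<open>A bracket at a point involves the 1-jets of both arguments, so the derivatives of
  \<open>{N, a}\<close> bring in second derivatives of the coefficients of \<open>N\<close>. The
  Jacobi identity for \<open>{N, \<cdot>}\<close> thus rests on the symmetry of second partial
  derivatives, and invariance under changes of coordinates on the chain rule; hence the calculus
  below. The quadratic term in the transformation of the momenta has to absorb the derivatives of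
  the transition matrices. The signs come from skew symmetry for even elements:
  \<open>{N, X} = - N X\<close>, and \<open>{X, \<mu>}\<close> is even. Two sections detect
  \<open>K\<close> because it consists of terms \<open>\<tau> p\<close> and
  \<open>\<tau> \<tau> \<theta>\<close>: a section equal to a frame vector to first order removes a
  \<open>\<tau>\<close>, and one that vanishes at the point, with one prescribed derivative, turns a
  momentum into a \<open>\<theta>\<close>. Both \<open>lie_bracket\<close> and \<open>tilde\<close>
  are definite descriptions, so existence and uniqueness must come first; for the bracket this means
  gluing local expressions. In rank \<open>0\<close> every element of degree 2 satisfies the
  condition in \<open>tilde\<close>, since \<open>E\<close> has only the zero section.\<close>

lemma koszul_empty [simp]: "koszul {} T = 1" "koszul S {} = 1"
  by (auto simp: koszul_def)

lemma koszul_square [simp]: "koszul S T * koszul S T = 1"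
  by (simp add: koszul_def flip: power_mult_distrib)

lemma finite_inversions: "finite S \<Longrightarrow> finite T \<Longrightarrow> finite {(s, t). s \<in> S \<and> t \<in> T \<and> t < (s::odd_gen)}"
  by (rule finite_subset[of _ "S \<times> T"]) auto

lemma koszul_Un_left:
  assumes "finite S" "finite T" "finite U" "S \<inter> T = {}"
  shows "koszul (S \<union> T) U = koszul S U * koszul T U"
proof -
  have "{(s, t). s \<in> S \<union> T \<and> t \<in> U \<and> t < s} =
      {(s, t). s \<in> S \<and> t \<in> U \<and> t < s} \<union> {(s, t). s \<in> T \<and> t \<in> U \<and> t < s}"
    by auto
  moreover have "card \<dots> = card {(s, t). s \<in> S \<and> t \<in> U \<and> t < s} + card {(s, t). s \<in> T \<and> t \<in> U \<and> t < s}"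
    by (rule card_Un_disjoint) (use assms in \<open>auto simp: finite_inversions\<close>)
  ultimately show ?thesis by (simp add: koszul_def power_add)
qed

lemma koszul_Un_right:
  assumes "finite S" "finite T" "finite U" "S \<inter> T = {}"
  shows "koszul U (S \<union> T) = koszul U S * koszul U T"
proof -
  have "{(s, t). s \<in> U \<and> t \<in> S \<union> T \<and> t < s} =
      {(s, t). s \<in> U \<and> t \<in> S \<and> t < s} \<union> {(s, t). s \<in> U \<and> t \<in> T \<and> t < s}"
    by auto
  moreover have "card \<dots> = card {(s, t). s \<in> U \<and> t \<in> S \<and> t < s} + card {(s, t). s \<in> U \<and> t \<in> T \<and> t < s}"
    by (rule card_Un_disjoint) (use assms in \<open>auto simp: finite_inversions\<close>)
  ultimately show ?thesis by (simp add: koszul_def power_add)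
qed

text \<open>Every pair in \<open>S \<times> T\<close> is an inversion in exactly one of the two
  orders, so the two inversion counts add up to \<open>card S * card T\<close>.\<close>

lemma koszul_swap:
  assumes "finite S" "finite T" "S \<inter> T = {}"
  shows "koszul S T = (-1) ^ (card S * card T) * koszul T S"
proof -
  have "bij_betw prod.swap {(s, t). s \<in> T \<and> t \<in> S \<and> t < s} {(s, t). s \<in> S \<and> t \<in> T \<and> s < t}"
    by (rule bij_betwI[where g = prod.swap]) auto
  then have c: "card {(s, t). s \<in> T \<and> t \<in> S \<and> t < s} = card {(s, t). s \<in> S \<and> t \<in> T \<and> s < t}"
    by (rule bij_betw_same_card)
  have "S \<times> T = {(s, t). s \<in> S \<and> t \<in> T \<and> t < s} \<union> {(s, t). s \<in> S \<and> t \<in> T \<and> s < t}"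
    using assms(3) by (auto simp: not_less_iff_gr_or_eq)
  moreover have "card \<dots> = card {(s, t). s \<in> S \<and> t \<in> T \<and> t < s} + card {(s, t). s \<in> S \<and> t \<in> T \<and> s < t}"
  proof (rule card_Un_disjoint)
    show "finite {(s, t). s \<in> S \<and> t \<in> T \<and> s < t}"
      by (rule finite_subset[of _ "S \<times> T"]) (use assms in auto)
  qed (use assms in \<open>auto simp: finite_inversions\<close>)
  ultimately have "card S * card T =
      card {(s, t). s \<in> S \<and> t \<in> T \<and> t < s} + card {(s, t). s \<in> T \<and> t \<in> S \<and> t < s}"
    by (metis c card_cartesian_product)
  then have "(-1) ^ (card S * card T) = koszul S T * koszul T S"
    by (simp add: koszul_def power_add)
  then show ?thesis by (simp add: mult.assoc)
qed

text \<open>Restricting \<open>gpoly\<close> to finite supports makes the monomials a basis;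
  excluding infinite sets of odd generators removes the monomials on which \<open>card\<close> and
  the sums in \<open>gmul\<close> only return default values. As a type, it can be made an instance
  of the library's algebra classes.\<close>

typedef gp = "{a :: gpoly. finite {m. a m \<noteq> 0} \<and> (\<forall>P S. infinite S \<longrightarrow> a (P, S) = 0)}"
  morphisms coef Gp
  by (rule exI[of _ "\<lambda>m. 0"]) auto

setup_lifting type_definition_gp

lemma coef_infinite: "infinite S \<Longrightarrow> coef a (P, S) = 0"
  using coef[of a] by auto

lemma finite_coef: "finite {m. coef a m \<noteq> 0}"
  using coef[of a] by auto

lemma gp_eqI: "(\<And>P S. finite S \<Longrightarrow> coef a (P, S) = coef b (P, S)) \<Longrightarrow> a = b"
  by (metis coef_infinite coef_inject ext surj_pair)

lemma finite_nonzero_pair: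
  assumes "finite {m. a m \<noteq> (0::real)}" "finite {m. b m \<noteq> (0::real)}"
  shows "finite {m. a m + b m \<noteq> 0}" "finite {m. a m \<noteq> b m}"
  by (rule finite_subset[OF _ finite_UnI[OF assms]]; auto)+

instantiation gp :: real_vector
begin
lift_definition zero_gp :: gp is "\<lambda>m. 0" by auto
lift_definition plus_gp :: "gp \<Rightarrow> gp \<Rightarrow> gp" is "\<lambda>a b m. a m + b m"
  by (auto intro: finite_nonzero_pair)
lift_definition minus_gp :: "gp \<Rightarrow> gp \<Rightarrow> gp" is "\<lambda>a b m. a m - b m"
  by (auto intro: finite_nonzero_pair)
lift_definition uminus_gp :: "gp \<Rightarrow> gp" is "\<lambda>a m. - a m" by auto
lift_definition scaleR_gp :: "real \<Rightarrow> gp \<Rightarrow> gp" is "\<lambda>r a m. r * a m"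
  by (rule conjI, erule conjE, erule rev_finite_subset) auto

lemma coef_arith [simp]:
  "coef 0 m = 0" "coef (a + b) m = coef a m + coef b m" "coef (a - b) m = coef a m - coef b m"
  "coef (- a) m = - coef a m" "coef (r *\<^sub>R a) m = r * coef a m"
  by (simp_all add: zero_gp.rep_eq plus_gp.rep_eq minus_gp.rep_eq uminus_gp.rep_eq scaleR_gp.rep_eq)

instance
  by standard (rule gp_eqI; simp add: algebra_simps)+

end

lemma coef_sum: "coef (sum f A) m = (\<Sum>i\<in>A. coef (f i) m)"
  by (induction A rule: infinite_finite_induct) auto

lift_definition mon :: "mono \<Rightarrow> gp" is "\<lambda>m m'. if finite (snd m) \<and> m' = m then 1 else 0"
  by (auto intro: rev_finite_subset[of "{_}"])

lemma coef_mon: "coef (mon m) m' = (if finite (snd m) \<and> m' = m then 1 else 0)"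
  by transfer simp

lemma coef_mon_finite: "finite S \<Longrightarrow> coef (mon (P, S)) = gmono (P, S)"
  by (auto simp: coef_mon gmono_def)

lemma gp_expand:
  assumes "finite A" "\<And>m. coef a m \<noteq> 0 \<Longrightarrow> m \<in> A"
  shows "a = (\<Sum>m\<in>A. coef a m *\<^sub>R mon m)"
proof (rule gp_eqI)
  fix P :: "nat multiset" and S :: "odd_gen set" assume S: "finite S"
  have "(\<Sum>m\<in>A. coef a m * coef (mon m) (P, S)) = (\<Sum>m\<in>A. if m = (P, S) then coef a m else 0)"
    by (rule sum.cong) (use S in \<open>auto simp: coef_mon\<close>)
  then show "coef a (P, S) = coef (\<Sum>m\<in>A. coef a m *\<^sub>R mon m) (P, S)"
    using assms by (auto simp: coef_sum)
qed

text \<open>Reduces an identity that is linear in an argument to monomials, where only Koszul signs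
  and multiplicities are left to compare.\<close>

lemma gp_induct [case_names mon add scale]:
  assumes mon: "\<And>P S. finite S \<Longrightarrow> Q (mon (P, S))"
    and add: "\<And>a b. Q a \<Longrightarrow> Q b \<Longrightarrow> Q (a + b)"
    and scale: "\<And>r a. Q a \<Longrightarrow> Q (r *\<^sub>R a)"
  shows "Q a"
proof -
  have z: "Q 0" using scale[of "mon ({#}, {})" 0] mon[of "{}" "{#}"] by simp
  have "Q (\<Sum>m\<in>A. coef a m *\<^sub>R mon m)" if "finite A" "\<And>m. m \<in> A \<Longrightarrow> finite (snd m)" for A
    using that
  proof (induction A rule: finite_induct)
    case (insert m A)
    obtain P S where m: "m = (P, S)" by (cases m)
    then have "finite S" using insert.prems[of m] by simp
    then show ?case using insert m by (simp add: add scale mon)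
  qed (use z in simp)
  from this[OF finite_coef[of a]] coef_infinite[of _ a] gp_expand[of _ a, OF finite_coef] show ?thesis
    by force
qed

section \<open>The graded product and its associativity\<close>

lemma finite_submultisets: "finite {Q. Q \<subseteq># (P :: 'a multiset)}"
proof (induction P)
  case (add x P)
  have "{Q. Q \<subseteq># add_mset x P} \<subseteq> {Q. Q \<subseteq># P} \<union> add_mset x ` {Q. Q \<subseteq># P}"
  proof
    fix Q assume "Q \<in> {Q. Q \<subseteq># add_mset x P}"
    then show "Q \<in> {Q. Q \<subseteq># P} \<union> add_mset x ` {Q. Q \<subseteq># P}"
    proof (cases "x \<in># Q")
      case True
      then have "Q = add_mset x (Q - {#x#})" by simp
      moreover have "Q - {#x#} \<subseteq># P" using \<open>Q \<in> _\<close> by (simp add: subset_eq_diff_conv)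
      ultimately show ?thesis by blast
    next
      case False
      then have "Q \<subseteq># P" using \<open>Q \<in> _\<close> unfolding subseteq_mset_def not_in_iff mem_Collect_eq
        by (metis count_add_mset le0)
      then show ?thesis by blast
    qed
  qed
  with add show ?case by (auto intro: finite_subset)
qed simp

lemma gmul_support:
  assumes "gmul a b (P, S) \<noteq> 0"
  shows "\<exists>Q T. Q \<subseteq># P \<and> T \<subseteq> S \<and> a (Q, T) \<noteq> 0 \<and> b (P - Q, S - T) \<noteq> 0 \<and> finite S"
proof -
  \<comment> \<open>A sum over an infinite index set is \<open>0\<close>, so a nonzero coefficient
    forces \<open>S\<close> to be finite.\<close>
  have "finite (Pow S)"
  proof (rule ccontr)
    assume "infinite (Pow S)"
    then show False using assms unfolding gmul_def by simp
  qed
  then have S: "finite S" by simp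
  from assms have "(\<Sum>Q | Q \<subseteq># P. \<Sum>T\<in>Pow S. koszul T (S - T) * a (Q, T) * b (P - Q, S - T)) \<noteq> 0"
    by (simp add: gmul_def)
  then obtain Q where Q: "Q \<in> {Q. Q \<subseteq># P}"
      "(\<Sum>T\<in>Pow S. koszul T (S - T) * a (Q, T) * b (P - Q, S - T)) \<noteq> 0"
    by (rule sum.not_neutral_contains_not_neutral)
  from Q(2) obtain T where "T \<in> Pow S" "koszul T (S - T) * a (Q, T) * b (P - Q, S - T) \<noteq> 0"
    by (rule sum.not_neutral_contains_not_neutral)
  with S Q(1) show ?thesis by auto
qed

instantiation gp :: "{times, one}"
begin
lift_definition times_gp :: "gp \<Rightarrow> gp \<Rightarrow> gp" is gmul
proof (intro conjI)
  fix a b :: gpoly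
  assume a: "finite {m. a m \<noteq> 0} \<and> (\<forall>P S. infinite S \<longrightarrow> a (P, S) = 0)"
    and b: "finite {m. b m \<noteq> 0} \<and> (\<forall>P S. infinite S \<longrightarrow> b (P, S) = 0)"
  \<comment> \<open>A monomial of the product arises by merging one monomial of each factor, so the
    support lies in the image of a finite set.\<close>
  let ?f = "\<lambda>((P, S), (Q, T)). (P + Q, S \<union> T) :: mono"
  have "{m. gmul a b m \<noteq> 0} \<subseteq> ?f ` ({m. a m \<noteq> 0} \<times> {m. b m \<noteq> 0})"
  proof
    fix m assume "m \<in> {m. gmul a b m \<noteq> 0}"
    then obtain P S where m: "m = (P, S)" "gmul a b (P, S) \<noteq> 0" by (cases m) auto
    from gmul_support[OF m(2)] obtain Q T where
      QT: "Q \<subseteq># P" "T \<subseteq> S" "a (Q, T) \<noteq> 0" "b (P - Q, S - T) \<noteq> 0" by blast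
    have "m = ?f ((Q, T), (P - Q, S - T))" using QT m by auto
    then show "m \<in> ?f ` ({m. a m \<noteq> 0} \<times> {m. b m \<noteq> 0})" using QT by blast
  qed
  then show "finite {m. gmul a b m \<noteq> 0}"
    by (rule finite_subset) (use a b in auto)
  show "\<forall>P S. infinite S \<longrightarrow> gmul a b (P, S) = 0"
    by (intro allI impI) (metis gmul_support)
qed
definition "one_gp = mon ({#}, {})"
instance ..
end

lemma coef_mult: "coef (a * b) = gmul (coef a) (coef b)"
  by transfer simp

lemma gp_bilinear:
  "(a + b) * c = a * c + b * (c::gp)" "a * (b + c) = a * b + a * (c::gp)"
  "(r *\<^sub>R a) * b = r *\<^sub>R (a * b)" "a * (r *\<^sub>R b) = r *\<^sub>R (a * b)" for a b c :: gp
  by (rule gp_eqI; simp add: coef_mult gmul_def sum_distrib_left algebra_simps flip: sum.distrib)+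

lemma gp_mult_0: "0 * a = (0::gp)" "a * 0 = (0::gp)" for a :: gp
  using gp_bilinear(3)[of 0 0 a] gp_bilinear(4)[of a 0 0] by simp_all

text \<open>Of all the splittings in \<open>gmul\<close> only the one that recovers both factors
  contributes. Product identities are checked on monomials with this rule.\<close>

lemma mon_mult:
  assumes "finite S" "finite T"
  shows "mon (P, S) * mon (Q, T) = (if S \<inter> T = {} then koszul S T *\<^sub>R mon (P + Q, S \<union> T) else 0)"
proof (rule gp_eqI)
  fix R U assume U: "finite (U :: odd_gen set)"
  have "coef (mon (P, S) * mon (Q, T)) (R, U) =
      (\<Sum>Q' | Q' \<subseteq># R. \<Sum>T'\<in>Pow U. if Q' = P then (if T' = S then
         koszul S (U - S) * gmono (Q, T) (R - P, U - S) else 0) else 0)"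
    by (simp add: coef_mult gmul_def coef_mon_finite assms)
      (intro sum.cong, auto simp: gmono_def)
  also have "\<dots> = (\<Sum>Q' | Q' \<subseteq># R. if Q' = P then (\<Sum>T'\<in>Pow U. if T' = S then
         koszul S (U - S) * gmono (Q, T) (R - P, U - S) else 0) else 0)"
    by (intro sum.cong) auto
  also have "\<dots> = (if P \<subseteq># R \<and> S \<subseteq> U then koszul S (U - S) * gmono (Q, T) (R - P, U - S) else 0)"
    using U by (simp add: sum.delta finite_submultisets)
  also have "\<dots> = coef (if S \<inter> T = {} then koszul S T *\<^sub>R mon (P + Q, S \<union> T) else 0) (R, U)"
    using assms by (auto simp: coef_mon_finite gmono_def)
  finally show "coef (mon (P, S) * mon (Q, T)) (R, U) = \<dots>" .
qed

text \<open>Associativity is the cocycle identity of the sign, which follows because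
  \<open>koszul\<close> is multiplicative over disjoint unions in either argument.\<close>

lemma gp_mult_assoc: "a * b * c = a * (b * (c::gp))"
proof (induction a rule: gp_induct)
  case (mon P S)
  note S = mon
  show ?case
  proof (induction b rule: gp_induct)
    case (mon Q T)
    note T = mon
    show ?case
    proof (induction c rule: gp_induct)
      case (mon R U)
      have "koszul (S \<union> T) U * koszul S T = koszul S (T \<union> U) * koszul T U"
        if "S \<inter> T = {}" "T \<inter> U = {}" "S \<inter> U = {}"
        using that S T mon by (simp add: koszul_Un_left koszul_Un_right)
      with S T mon show ?case
        by (cases "S \<inter> T = {}"; cases "T \<inter> U = {}"; cases "S \<inter> U = {}")
          (simp_all add: mon_mult gp_bilinear gp_mult_0 Int_Un_distrib Int_Un_distrib2 Un_assoc add.assoc mult.commute)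
    qed (auto simp: gp_bilinear)
  qed (auto simp: gp_bilinear)
qed (auto simp: gp_bilinear)

instance gp :: real_algebra_1
proof
  fix a b c :: gp and r :: real
  show "a * b * c = a * (b * c)" by (rule gp_mult_assoc)
  show "1 * a = a"
    by (induction a rule: gp_induct) (auto simp: one_gp_def mon_mult gp_bilinear)
  show "a * 1 = a"
    by (induction a rule: gp_induct) (auto simp: one_gp_def mon_mult gp_bilinear)
  show "(0::gp) \<noteq> 1"
  proof
    assume "(0::gp) = 1"
    then have "coef 0 ({#}, {}) = coef 1 ({#}, {})" by simp
    then show False by (simp add: one_gp_def coef_mon)
  qed
qed (auto simp: gp_bilinear)

section \<open>Parity and the derivatives with respect to the generators\<close>

lift_definition parity :: "gp \<Rightarrow> gp" is "\<lambda>a m. (-1) ^ card (snd m) * a m"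
  by (rule conjI, erule conjE, erule rev_finite_subset) auto

lift_definition dp :: "nat \<Rightarrow> gp \<Rightarrow> gp" is d_p
proof (intro conjI)
  fix i :: nat and a :: gpoly
  assume a: "finite {m. a m \<noteq> 0} \<and> (\<forall>P S. infinite S \<longrightarrow> a (P, S) = 0)"
  let ?f = "\<lambda>(P, S). (P - {#i#}, S)"
  have "{m. d_p i a m \<noteq> 0} \<subseteq> ?f ` {m. a m \<noteq> 0}"
    by (force simp: d_p_def image_iff)
  then show "finite {m. d_p i a m \<noteq> 0}" by (rule finite_subset) (use a in auto)
qed (auto simp: d_p_def)

lift_definition dl :: "odd_gen \<Rightarrow> gp \<Rightarrow> gp" is d_left
proof (intro conjI)
  fix g :: odd_gen and a :: gpoly
  assume a: "finite {m. a m \<noteq> 0} \<and> (\<forall>P S. infinite S \<longrightarrow> a (P, S) = 0)"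
  let ?f = "\<lambda>(P, S). (P, S - {g})"
  have "{m. d_left g a m \<noteq> 0} \<subseteq> ?f ` {m. a m \<noteq> 0}"
    by (force simp: d_left_def image_iff split: if_splits)
  then show "finite {m. d_left g a m \<noteq> 0}" by (rule finite_subset) (use a in auto)
qed (auto simp: d_left_def)

text \<open>\<open>parity\<close> is the automorphism that changes the sign of odd elements; the
  momenta are even and do not count. Taking a generator out of a product of \<open>k\<close> odd
  ones at the right instead of the left end costs \<open>(-1) ^ (k - 1)\<close>, which is the sign
  that \<open>parity\<close> gives to the remaining \<open>k - 1\<close> factors.
  \<open>coef_dr\<close> confirms the agreement with \<open>d_right\<close>.\<close>

definition dr :: "odd_gen \<Rightarrow> gp \<Rightarrow> gp" where
  "dr g a = parity (dl g a)"

lemma coef_dp: "coef (dp i a) = d_p i (coef a)"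
  by transfer simp

lemma coef_dl: "coef (dl g a) = d_left g (coef a)"
  by transfer simp

lemma coef_parity: "coef (parity a) m = (-1) ^ card (snd m) * coef a m"
  by transfer simp

lemma coef_dr: "coef (dr g a) = d_right g (coef a)"
proof
  fix m :: mono
  obtain P S where m: "m = (P, S)" by (cases m)
  show "coef (dr g a) m = d_right g (coef a) m"
  proof (cases "finite S \<and> g \<notin> S")
    case True
    then have "koszul S {g} = (-1) ^ card S * koszul {g} S"
      using koszul_swap[of S "{g}"] by auto
    with True show ?thesis by (simp add: m dr_def coef_parity coef_dl d_left_def d_right_def)
  qed (auto simp: m dr_def coef_parity coef_dl d_left_def d_right_def coef_infinite)
qed

lemma linear_dp: "linear (dp i)"
  by (intro linearI gp_eqI) (auto simp: coef_dp d_p_def algebra_simps)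

lemma linear_dl: "linear (dl g)"
  by (intro linearI gp_eqI) (auto simp: coef_dl d_left_def algebra_simps)

lemma linear_parity: "linear parity"
  by (intro linearI gp_eqI) (auto simp: coef_parity algebra_simps)

lemma linear_dr: "linear (dr g)"
  unfolding dr_def[abs_def] using linear_compose[OF linear_dl linear_parity] by (simp add: o_def)

lemmas linear_rules = linear_add linear_diff linear_neg linear_0 linear_scale linear_sum

lemmas linear_simps =
  linear_rules[OF linear_dp] linear_rules[OF linear_dl] linear_rules[OF linear_dr]
  linear_rules[OF linear_parity]

lemma dp_mon: "finite S \<Longrightarrow> dp i (mon (P, S)) = real (count P i) *\<^sub>R mon (P - {#i#}, S)"
proof (rule gp_eqI)
  fix Q T assume "finite S" "finite (T::odd_gen set)"
  moreover have "Q = P - {#i#} \<and> count P i > 0" if "P = add_mset i Q" for P using that by simp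
  moreover have "count P i = 0" if "P \<noteq> add_mset i (P - {#i#})"
    using that by (metis count_inI insert_DiffM)
  ultimately show "coef (dp i (mon (P, S))) (Q, T) = coef (real (count P i) *\<^sub>R mon (P - {#i#}, S)) (Q, T)"
    by (auto simp: coef_dp d_p_def coef_mon_finite gmono_def)
qed

lemma dl_mon:
  assumes "finite S"
  shows "dl g (mon (P, S)) = (if g \<in> S then koszul {g} (S - {g}) *\<^sub>R mon (P, S - {g}) else 0)"
  by (rule gp_eqI) (use assms in \<open>auto simp: coef_dl d_left_def coef_mon_finite gmono_def\<close>)

lemma parity_mon: "finite S \<Longrightarrow> parity (mon (P, S)) = (-1) ^ card S *\<^sub>R mon (P, S)"
  by (rule gp_eqI) (auto simp: coef_parity coef_mon)

lemma parity_parity [simp]: "parity (parity a) = a"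
  by (rule gp_eqI) (auto simp: coef_parity simp flip: mult.assoc power_add)

lemma parity_mult: "parity (a * b) = parity a * parity b"
proof (induction a rule: gp_induct)
  case (mon P S)
  note S = mon
  show ?case
  proof (induction b rule: gp_induct)
    case (mon Q T)
    with S show ?case
      by (auto simp: mon_mult parity_mon linear_simps card_Un_disjoint power_add)
  qed (auto simp: algebra_simps linear_simps)
qed (auto simp: algebra_simps linear_simps)

lemma parity_1 [simp]: "parity 1 = 1"
  by (simp add: one_gp_def parity_mon)

lemma dp_mult: "dp i (a * b) = dp i a * b + a * dp i b"
proof (induction a rule: gp_induct)
  case (mon P S)
  note S = mon
  show ?case
  proof (induction b rule: gp_induct)
    case (mon Q T)
    have 1: "(r * real (count P i)) *\<^sub>R mon (P - {#i#} + Q, U) =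
        (r * real (count P i)) *\<^sub>R mon (P + Q - {#i#}, U)" for r U
      by (cases "i \<in># P") (auto simp: not_in_iff)
    have 2: "(r * real (count Q i)) *\<^sub>R mon (P + (Q - {#i#}), U) =
        (r * real (count Q i)) *\<^sub>R mon (P + Q - {#i#}, U)" for r U
      by (cases "i \<in># Q") (auto simp: not_in_iff)
    show ?case
    proof (cases "S \<inter> T = {}")
      case True
      then show ?thesis using S mon
        by (simp add: mon_mult dp_mon linear_simps 1 2 mult.commute[of "real _"] distrib_left scaleR_add_left scaleR_add_right)
    qed (use S mon in \<open>simp add: mon_mult dp_mon linear_simps\<close>)
  qed (auto simp: algebra_simps linear_simps)
qed (auto simp: algebra_simps linear_simps)

text \<open>The cases are which of the two factors contain \<open>g\<close>; signs are compared by
  splitting \<open>g\<close> off from \<open>S\<close> or \<open>T\<close>, using that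
  \<open>koszul\<close> is multiplicative over disjoint unions.\<close>

lemma dl_mult: "dl g (a * b) = dl g a * b + parity a * dl g b"
proof (induction a rule: gp_induct)
  case (mon P S)
  note S = mon
  show ?case
  proof (induction b rule: gp_induct)
    case (mon Q T)
    show ?case
    proof (cases "S \<inter> T = {}")
      case True
      consider "g \<in> S" "g \<notin> T" | "g \<in> T" "g \<notin> S" | "g \<notin> S" "g \<notin> T" using True by auto
      then show ?thesis
      proof cases
        case 1
        let ?S = "S - {g}"
        have k: "koszul S T = koszul {g} T * koszul ?S T"
          using koszul_Un_left[of "{g}" ?S T] S mon 1 by (simp add: insert_absorb)
        have l: "koszul {g} (?S \<union> T) = koszul {g} ?S * koszul {g} T"
          using koszul_Un_right[of ?S T "{g}"] S mon True by blast
        have "S \<union> T - {g} = ?S \<union> T" using 1 by auto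
        then show ?thesis using 1 S mon True k l koszul_square[of "{g}" T]
          by (auto simp: mon_mult dl_mon linear_simps)
      next
        case 2
        let ?T = "T - {g}"
        have k: "koszul S T = koszul S {g} * koszul S ?T"
          using koszul_Un_right[of "{g}" ?T S] S mon 2 by (simp add: insert_absorb)
        have l: "koszul {g} (S \<union> ?T) = koszul {g} S * koszul {g} ?T"
          using koszul_Un_right[of S ?T "{g}"] S mon True by blast
        have s: "koszul S {g} = (-1) ^ card S * koszul {g} S"
          using koszul_swap[of S "{g}"] S 2 by auto
        have "S \<union> T - {g} = S \<union> ?T" "S \<inter> ?T = {}" using 2 True by auto
        then show ?thesis using 2 S mon True k l s koszul_square[of "{g}" S]
          by (auto simp: mon_mult dl_mon parity_mon linear_simps)
      qed (use S mon True in \<open>auto simp: mon_mult dl_mon linear_simps\<close>)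
    next
      case False
      then show ?thesis
      proof (cases "S \<inter> T = {g}")
        case True
        \<comment> \<open>The product vanishes, but both terms on the right are nonzero. They cancel
          because \<open>card S\<close> and \<open>card ?S\<close> differ by one.\<close>
        let ?S = "S - {g}" and ?T = "T - {g}"
        have g: "g \<in> S" "g \<in> T" "?S \<inter> T = {}" "S \<inter> ?T = {}" "S \<union> ?T = ?S \<union> T" using True by auto
        have k: "koszul ?S T = koszul ?S {g} * koszul ?S ?T"
          using koszul_Un_right[of "{g}" ?T ?S] S mon g by (simp add: insert_absorb)
        have l: "koszul S ?T = koszul {g} ?T * koszul ?S ?T"
          using koszul_Un_left[of "{g}" ?S ?T] S mon g by (simp add: insert_absorb)
        have s: "koszul ?S {g} = (-1) ^ card ?S * koszul {g} ?S"
          using koszul_swap[of ?S "{g}"] S by auto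
        have c: "card S = Suc (card ?S)" using S g by (metis card.remove)
        have "koszul {g} ?S * koszul ?S T = - ((-1) ^ card S * koszul {g} ?T * koszul S ?T)"
          unfolding k l s c using koszul_square[of "{g}" ?S] koszul_square[of "{g}" ?T] by simp
        then show ?thesis using S mon g False
          by (auto simp: mon_mult dl_mon parity_mon linear_simps simp flip: scaleR_add_left)
      next
        case 2: False
        have "(S - {g}) \<inter> T \<noteq> {}" "S \<inter> (T - {g}) \<noteq> {}" using False 2 by auto
        then show ?thesis using S mon False
          by (auto simp: mon_mult dl_mon parity_mon linear_simps)
      qed
    qed
  qed (auto simp: algebra_simps linear_simps)
qed (auto simp: algebra_simps linear_simps)

text \<open>The hypothesis cannot be carried through an induction over sums. So the claim is proved
  for \<open>a + parity a\<close>, twice the even part of an arbitrary \<open>a\<close>, and halved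
  at the end. \<open>odd_comm\<close> does the same with \<open>a - parity a\<close>.\<close>

lemma even_comm:
  assumes "parity a = a"
  shows "a * b = b * a"
proof -
  have "(a + parity a) * b = b * (a + parity a)"
  proof (induction a rule: gp_induct)
    case (mon P S)
    note S = mon
    show ?case
    proof (induction b rule: gp_induct)
      case (mon Q T)
      with S show ?case using koszul_swap[of S T]
        by (cases "even (card S)") (auto simp: parity_mon mon_mult Int_commute Un_commute add.commute algebra_simps)
    qed (simp_all add: algebra_simps)
  next
    case (add a1 a2)
    show ?case
      using arg_cong2[where f = plus, OF add] by (simp add: linear_simps algebra_simps)
  next
    case (scale r a)
    show ?case
      using arg_cong[where f = "scaleR r", OF scale] by (simp add: linear_simps algebra_simps)
  qed
  then show ?thesis by (simp add: assms flip: scaleR_2)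
qed

lemma odd_comm:
  assumes "parity a = - a"
  shows "a * b = parity b * a"
proof -
  have "(a - parity a) * b = parity b * (a - parity a)"
  proof (induction a rule: gp_induct)
    case (mon P S)
    note S = mon
    show ?case
    proof (induction b rule: gp_induct)
      case (mon Q T)
      with S show ?case using koszul_swap[of S T]
        by (cases "even (card S)"; cases "even (card T)")
          (auto simp: parity_mon mon_mult Int_commute Un_commute add.commute algebra_simps)
    next
      case (add b1 b2)
      show ?case
        using arg_cong2[where f = plus, OF add] by (simp add: linear_simps algebra_simps)
    next
      case (scale r b)
      show ?case
        using arg_cong[where f = "scaleR r", OF scale] by (simp add: linear_simps algebra_simps)
    qed
  next
    case (add a1 a2)
    show ?case
      using arg_cong2[where f = plus, OF add] by (simp add: linear_simps algebra_simps)
  next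
    case (scale r a)
    show ?case
      using arg_cong[where f = "scaleR r", OF scale] by (simp add: linear_simps algebra_simps)
  qed
  then show ?thesis by (simp add: assms flip: scaleR_2)
qed

lemma dp_dp: "dp i (dp j a) = dp j (dp i a)"
  by (rule gp_eqI) (auto simp: coef_dp d_p_def add_mset_commute)

lemma dp_dl: "dp i (dl g a) = dl g (dp i a)"
  by (rule gp_eqI) (auto simp: coef_dp coef_dl d_p_def d_left_def)

lemma dp_parity: "dp i (parity a) = parity (dp i a)"
  by (rule gp_eqI) (auto simp: coef_dp coef_parity d_p_def)

lemma dp_dr: "dp i (dr g a) = dr g (dp i a)"
  by (simp add: dr_def dp_parity dp_dl)

lemma parity_dl: "parity (dl g a) = - dl g (parity a)"
  by (rule gp_eqI) (auto simp: coef_dl coef_parity d_left_def)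

lemma dl_dl: "dl g (dl h a) = - dl h (dl g a)"
proof (rule gp_eqI)
  fix P S assume S: "finite (S :: odd_gen set)"
  show "coef (dl g (dl h a)) (P, S) = coef (- dl h (dl g a)) (P, S)"
  proof (cases "g \<in> S \<or> h \<in> S \<or> g = h")
    case False
    have "koszul {h} (insert g S) = koszul {h} {g} * koszul {h} S"
      "koszul {g} (insert h S) = koszul {g} {h} * koszul {g} S"
      using koszul_Un_right[of "{g}" S "{h}"] koszul_Un_right[of "{h}" S "{g}"] S False by auto
    moreover have "koszul {g} {h} = - koszul {h} {g}" using koszul_swap[of "{g}" "{h}"] False by auto
    ultimately show ?thesis using False by (auto simp: coef_dl d_left_def insert_commute)
  qed (auto simp: coef_dl d_left_def)
qed

lemma parity_dr: "parity (dr g a) = - dr g (parity a)"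
  by (simp add: dr_def parity_dl linear_simps)

lemma dr_dl: "dr h (dl g a) = dl g (dr h a)"
  unfolding dr_def dl_dl[of h g] by (simp add: parity_dl linear_simps)

lemma dr_dr: "dr g (dr h a) = - dr h (dr g a)"
  unfolding dr_def by (simp add: parity_dl[of _ "dl _ _"] parity_dl linear_simps dl_dl[of g])

lemma dr_mult: "dr g (a * b) = a * dr g b + dr g a * parity b"
  by (simp add: dr_def dl_mult linear_simps parity_mult)

section \<open>The part of the bracket that pairs odd generators\<close>

fun dual_gen :: "odd_gen \<Rightarrow> odd_gen" where
  "dual_gen (Tau \<alpha>) = Theta \<alpha>"
| "dual_gen (Theta \<alpha>) = Tau \<alpha>"

definition odd_gens :: "nat \<Rightarrow> odd_gen set" where
  "odd_gens r = Tau ` {..<r} \<union> Theta ` {..<r}"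

lemma finite_odd_gens [simp]: "finite (odd_gens r)"
  by (simp add: odd_gens_def)

lemma dual_dual [simp]: "dual_gen (dual_gen u) = u"
  by (cases u) auto

lemma dual_in_odd_gens [simp]: "dual_gen u \<in> odd_gens r \<longleftrightarrow> u \<in> odd_gens r"
  by (cases u) (auto simp: odd_gens_def)

lemma sum_odd_gens_dual: "(\<Sum>u\<in>odd_gens r. f (dual_gen u)) = (\<Sum>u\<in>odd_gens r. f u)"
  by (rule sum.reindex_bij_witness[of _ dual_gen dual_gen]) auto

lemma sum_odd_gens:
  "(\<Sum>u\<in>odd_gens r. f u) = (\<Sum>\<alpha><r. f (Tau \<alpha>) + f (Theta \<alpha>))"
  unfolding odd_gens_def
  by (subst sum.union_disjoint) (auto simp: sum.reindex inj_on_def sum.distrib)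

text \<open>The second sum of \<open>big_bracket\<close>, with each conjugate pair indexed by a
  generator \<open>u\<close> and its partner \<open>dual_gen u\<close>; exchanging the arguments of
  the bracket then becomes a reindexing by \<open>dual_gen\<close>.\<close>

definition odd_br :: "nat \<Rightarrow> gp \<Rightarrow> gp \<Rightarrow> gp" where
  "odd_br r a b = (\<Sum>u\<in>odd_gens r. dr u a * dl (dual_gen u) b)"

lemma linear_odd_br: "linear (odd_br r a)" "linear (\<lambda>a. odd_br r a b)"
  by (rule linearI; simp add: odd_br_def linear_simps algebra_simps sum.distrib scaleR_sum_right)+

lemmas odd_br_simps = linear_rules[OF linear_odd_br(1)] linear_rules[OF linear_odd_br(2)]

text \<open>\<open>dr u w\<close> is odd, so moving it past \<open>parity a\<close> turns that into
  \<open>a\<close> and removes the sign of the Leibniz rule for \<open>dl\<close>. For odd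
  \<open>w\<close> it is even, and the sign stays.\<close>

lemma odd_br_mult_even:
  assumes "parity w = w"
  shows "odd_br r w (a * b) = odd_br r w a * b + a * odd_br r w b"
proof -
  have "dr u w * parity a = a * dr u w" for u
    using odd_comm[of "dr u w" "parity a"] assms by (simp add: parity_dr)
  then have "dr u w * (parity a * c) = a * (dr u w * c)" for u c
    by (metis mult.assoc)
  then show ?thesis
    by (simp add: odd_br_def dl_mult algebra_simps sum.distrib sum_distrib_left sum_distrib_right)
qed

lemma odd_br_mult_odd:
  assumes "parity w = - w"
  shows "odd_br r w (a * b) = odd_br r w a * b + parity a * odd_br r w b"
proof -
  have "dr u w * parity a = parity a * dr u w" for u
    using even_comm[of "dr u w" "parity a"] assms by (simp add: parity_dr linear_simps)
  then have "dr u w * (parity a * c) = parity a * (dr u w * c)" for u c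
    by (metis mult.assoc)
  then show ?thesis
    by (simp add: odd_br_def dl_mult algebra_simps sum.distrib sum_distrib_left sum_distrib_right)
qed

text \<open>Moving the odd factor \<open>dl (dual_gen u) w\<close> to the front turns the summand of
  \<open>u\<close> into minus the summand of \<open>dual_gen u\<close> in the exchanged bracket. In
  \<open>odd_br_odd_sym\<close> the moved factor is even, so no sign appears.\<close>

lemma odd_br_even_skew:
  assumes "parity w = w"
  shows "odd_br r a w = - odd_br r w a"
proof -
  have "dr u a * dl (dual_gen u) w = - (dr (dual_gen u) w * dl u a)" for u
    using odd_comm[of "dl (dual_gen u) w" "dl u a"] assms
    by (simp add: parity_dl dr_def linear_simps)
  then show ?thesis
    using sum_odd_gens_dual[of "\<lambda>u. dr u w * dl (dual_gen u) a" r]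
    by (simp add: odd_br_def sum_negf)
qed

lemma odd_br_odd_sym:
  assumes "parity a = - a" "parity b = - b"
  shows "odd_br r a b = odd_br r b a"
proof -
  have "dr u a * dl (dual_gen u) b = dr (dual_gen u) b * dl u a" for u
    using even_comm[of "dl (dual_gen u) b" "dl u a"] assms
    by (simp add: parity_dl dr_def linear_simps)
  then show ?thesis
    using sum_odd_gens_dual[of "\<lambda>u. dr u b * dl (dual_gen u) a" r]
    by (simp add: odd_br_def)
qed

lemma dl_odd_br:
  assumes "parity w = w"
  shows "dl g (odd_br r w b) = odd_br r (dl g w) b + odd_br r w (dl g b)"
  using assms
  by (simp add: odd_br_def linear_simps dl_mult parity_dr dr_dl sum.distrib dl_dl[of g])

text \<open>\<open>dr\<close> obeys a Leibniz rule from the right, whereas \<open>odd_br r w\<close>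
  differentiates its second argument from the left. Hence the arguments are exchanged first, and the
  derivative that falls on \<open>w\<close> remains as a correction.\<close>

lemma dr_odd_br:
  assumes "parity w = w"
  shows "dr g (odd_br r w a) = odd_br r w (dr g a) - (\<Sum>v\<in>odd_gens r. dr v a * dr g (dl (dual_gen v) w))"
proof -
  have "dr g (odd_br r w a) = - dr g (odd_br r a w)"
    using odd_br_even_skew[OF assms, of r a] by (simp add: linear_simps)
  also have "dr g (odd_br r a w) = (\<Sum>v\<in>odd_gens r. dr v a * dr g (dl (dual_gen v) w)) + odd_br r (dr g a) w"
    using assms
    by (simp add: odd_br_def linear_simps dr_mult parity_dl dr_dr[of g] sum.distrib)
  finally show ?thesis using odd_br_even_skew[OF assms, of r "dr g a"] by simp
qed

lemma dp_odd_br: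
  assumes "dp i w = 0"
  shows "dp i (odd_br r w b) = odd_br r w (dp i b)"
  using assms by (simp add: odd_br_def linear_simps dp_mult dp_dl dp_dr)

text \<open>\<open>act\<close> is \<open>{w, \<cdot>}\<close> at a point, for \<open>w\<close> free of the \<open>p\<^sub>i\<close>, and \<open>brk\<close> is \<open>{a, b}\<close>; primes stand for
  derivatives with respect to the \<open>x\<^sup>i\<close>.\<close>

definition act :: "nat \<Rightarrow> nat \<Rightarrow> gp \<Rightarrow> (nat \<Rightarrow> gp) \<Rightarrow> gp \<Rightarrow> gp" where
  "act n r w w' b = (\<Sum>i<n. w' i * dp i b) + odd_br r w b"

definition brk :: "nat \<Rightarrow> nat \<Rightarrow> gp \<Rightarrow> (nat \<Rightarrow> gp) \<Rightarrow> gp \<Rightarrow> (nat \<Rightarrow> gp) \<Rightarrow> gp" where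
  "brk n r a a' b b' = (\<Sum>i<n. a' i * dp i b - dp i a * b' i) + odd_br r a b"

lemma brk_eq_act:
  assumes "\<And>i. i < n \<Longrightarrow> dp i w = 0"
  shows "brk n r w w' b b' = act n r w w' b"
  using assms by (simp add: brk_def act_def)

lemma linear_act: "linear (act n r w w')"
  by (rule linearI)
    (simp_all add: act_def odd_br_simps linear_simps algebra_simps sum.distrib scaleR_sum_right)

lemmas act_simps = linear_rules[OF linear_act]

lemma act_mult_even:
  assumes "parity w = w" "\<And>i. i < n \<Longrightarrow> parity (w' i) = w' i"
  shows "act n r w w' (a * b) = act n r w w' a * b + a * act n r w w' b"
proof -
  have "w' i * (a * c) = a * (w' i * c)" if "i < n" for i c
    using even_comm[OF assms(2)[OF that], of a] by (metis mult.assoc)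
  then show ?thesis
    by (simp add: act_def dp_mult odd_br_mult_even[OF assms(1)] algebra_simps sum.distrib sum_distrib_left sum_distrib_right)
qed

lemma act_mult_odd:
  assumes "parity w = - w" "\<And>i. i < n \<Longrightarrow> parity (w' i) = - w' i"
  shows "act n r w w' (a * b) = act n r w w' a * b + parity a * act n r w w' b"
proof -
  have "w' i * (a * c) = parity a * (w' i * c)" if "i < n" for i c
    using odd_comm[OF assms(2)[OF that], of a] by (metis mult.assoc)
  then show ?thesis
    by (simp add: act_def dp_mult odd_br_mult_odd[OF assms(1)] algebra_simps sum.distrib sum_distrib_left sum_distrib_right)
qed

lemma brk_even_skew:
  assumes "parity w = w" "\<And>i. i < n \<Longrightarrow> parity (w' i) = w' i" "\<And>i. i < n \<Longrightarrow> dp i w = 0"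
  shows "brk n r a a' w w' = - act n r w w' a"
proof -
  have "(\<Sum>i<n. dp i a * w' i) = (\<Sum>i<n. w' i * dp i a)"
    by (rule sum.cong) (simp_all add: even_comm[OF assms(2)])
  then show ?thesis
    using assms(3) by (simp add: brk_def act_def sum_negf odd_br_even_skew[OF assms(1)])
qed

text \<open>On odd elements the bracket is symmetric. This makes \<open>{\<mu>, \<mu>} = 0\<close> a
  genuine condition, and it gives the factor two when \<open>{N, \<cdot>}\<close> is applied to
  it.\<close>

lemma brk_odd_sym:
  assumes "parity a = - a" "parity b = - b"
    "\<And>i. i < n \<Longrightarrow> parity (a' i) = - a' i" "\<And>i. i < n \<Longrightarrow> parity (b' i) = - b' i"
  shows "brk n r a a' b b' = brk n r b b' a a'"
proof -
  have "a' i * dp i b - dp i a * b' i = b' i * dp i a - dp i b * a' i" if "i < n" for i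
  proof -
    have "a' i * dp i b = - (dp i b * a' i)" "b' i * dp i a = - (dp i a * b' i)"
      using odd_comm[of "a' i" "dp i b"] odd_comm[of "b' i" "dp i a"] assms that
      by (simp_all flip: dp_parity add: linear_simps)
    then show ?thesis by simp
  qed
  then show ?thesis by (simp add: brk_def odd_br_odd_sym[OF assms(1,2)])
qed

section \<open>Generators, and the action of a momentum-free element on them\<close>

definition pvar :: "nat \<Rightarrow> gp" where
  "pvar i = mon ({#i#}, {})"

definition ovar :: "odd_gen \<Rightarrow> gp" where
  "ovar g = mon ({#}, {g})"

lemma pvar_mon: "finite S \<Longrightarrow> pvar i * mon (P, S) = mon (add_mset i P, S)"
  by (simp add: pvar_def mon_mult)

lemma ovar_mon:
  "finite S \<Longrightarrow> ovar g * mon (P, S) = (if g \<in> S then 0 else koszul {g} S *\<^sub>R mon (P, insert g S))"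
  by (simp add: ovar_def mon_mult)

text \<open>Multiplying by one generator at a time suits derivations and algebra homomorphisms,
  whose value on a product with a generator is given by the Leibniz or the product rule.\<close>

lemma gp_gen_induct [case_names one p odd add scale]:
  assumes one: "Q 1"
    and p: "\<And>i a. Q a \<Longrightarrow> Q (pvar i * a)"
    and odd: "\<And>g a. Q a \<Longrightarrow> Q (ovar g * a)"
    and add: "\<And>a b. Q a \<Longrightarrow> Q b \<Longrightarrow> Q (a + b)"
    and scale: "\<And>r a. Q a \<Longrightarrow> Q (r *\<^sub>R a)"
  shows "Q a"
proof (induction a rule: gp_induct)
  case (mon P S)
  show ?case
  proof (induction P)
    case empty
    from mon show ?case
    proof (induction S)
      case empty
      with one show ?case by (simp add: one_gp_def)
    next
      case (insert g S)
      then have "mon ({#}, insert g S) = koszul {g} S *\<^sub>R (ovar g * mon ({#}, S))"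
        by (simp add: ovar_mon)
      with insert show ?case by (simp add: odd scale)
    qed
  next
    case (add i P)
    then show ?case using p[OF add, of i] mon by (simp add: pvar_mon)
  qed
qed (fact add scale)+

lemma parity_gens [simp]: "parity (pvar i) = pvar i" "parity (ovar g) = - ovar g"
  by (simp_all add: pvar_def ovar_def parity_mon)

lemma dp_gens [simp]: "dp i (pvar j) = (if i = j then 1 else 0)" "dp i (ovar g) = 0"
  by (auto simp: pvar_def ovar_def dp_mon one_gp_def)

lemma dl_gens [simp]: "dl g (pvar j) = 0" "dl g (ovar h) = (if g = h then 1 else 0)"
  by (auto simp: pvar_def ovar_def dl_mon one_gp_def)

lemma dp_1 [simp]: "dp i 1 = 0" and dl_1 [simp]: "dl g 1 = 0" and dr_1 [simp]: "dr g 1 = 0"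
  by (simp_all add: one_gp_def dp_mon dl_mon dr_def linear_simps)

lemma dr_gens [simp]: "dr g (pvar j) = 0" "dr g (ovar h) = (if g = h then 1 else 0)"
  by (auto simp: dr_def linear_simps)

lemma act_dp:
  assumes "dp i w = 0" "\<And>j. j < n \<Longrightarrow> dp i (w' j) = 0"
  shows "act n r w w' (dp i b) = dp i (act n r w w' b)"
  using assms by (simp add: act_def linear_simps dp_mult dp_odd_br dp_dp[of i])

text \<open>The failure to commute is the action of the differentiated \<open>w\<close>. In
  \<open>act_dp\<close> there is no such term, as neither \<open>w\<close> nor its derivatives
  contain momenta.\<close>

lemma act_dl:
  assumes "parity w = w" "\<And>i. i < n \<Longrightarrow> parity (w' i) = w' i"
  shows "act n r w w' (dl g b) =
    dl g (act n r w w' b) - act n r (dl g w) (\<lambda>i. dl g (w' i)) b"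
  using assms by (simp add: act_def linear_simps dl_mult dl_odd_br dp_dl sum.distrib)

lemma act_dr:
  assumes "parity w = w" "\<And>i. i < n \<Longrightarrow> parity (w' i) = w' i"
  shows "act n r w w' (dr g b) =
    dr g (act n r w w' b) - (\<Sum>j<n. dp j b * dr g (w' j)) +
    (\<Sum>v\<in>odd_gens r. dr v b * dr g (dl (dual_gen v) w))"
proof -
  have "dr g (w' j * dp j b) = dp j b * dr g (w' j) + w' j * dp j (dr g b)" if "j < n" for j
  proof -
    have "dr g (w' j * dp j b) = dr g (dp j b * w' j)"
      by (simp add: even_comm[OF assms(2)[OF that]])
    also have "\<dots> = dp j b * dr g (w' j) + dr g (dp j b) * w' j"
      by (simp add: dr_mult assms(2)[OF that])
    finally show ?thesis
      by (simp add: even_comm[OF assms(2)[OF that]] dp_dr)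
  qed
  then show ?thesis
    by (simp add: act_def linear_simps dr_odd_br[OF assms(1)] sum.distrib)
qed

text \<open>The Jacobi identity \<open>{w, {a, b}} = {{w, a}, b} + {a, {w, b}}\<close> at a point, for \<open>w\<close> even and
  free of the \<open>p\<^sub>i\<close>.\<close>

lemma brk_Jacobi:
  assumes w: "parity w = w" "\<And>i. i < n \<Longrightarrow> dp i w = 0"
    and w': "\<And>i. i < n \<Longrightarrow> parity (w' i) = w' i" "\<And>i j. i < n \<Longrightarrow> j < n \<Longrightarrow> dp i (w' j) = 0"
    and w'': "\<And>i j. i < n \<Longrightarrow> j < n \<Longrightarrow> parity (w'' i j) = w'' i j"
      "\<And>i j. i < n \<Longrightarrow> j < n \<Longrightarrow> w'' i j = w'' j i"
  shows "act n r w w' (brk n r a a' b b') =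
    brk n r (act n r w w' a) (\<lambda>i. act n r (w' i) (w'' i) a + act n r w w' (a' i)) b b' +
    brk n r a a' (act n r w w' b) (\<lambda>i. act n r (w' i) (w'' i) b + act n r w w' (b' i))"
proof -
  let ?A = "act n r w w'"
  let ?G = "odd_gens r"
  note A_mult = act_mult_even[where w' = w' and n = n, OF w(1) w'(1)]
  note A_dp = act_dp[where w' = w' and n = n, OF w(2) w'(2)]
  \<comment> \<open>The second odd derivatives of \<open>w\<close> that \<open>act_dr\<close> and
    \<open>act_dl\<close> leave behind form the same double sum with the indices exchanged, and
    cancel.\<close>
  have swap: "(\<Sum>u\<in>?G. \<Sum>v\<in>?G. dr v a * dr u (dl (dual_gen v) w) * dl (dual_gen u) b) =
      (\<Sum>u\<in>?G. dr u a * odd_br r (dl (dual_gen u) w) b)"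
    by (subst sum.swap) (simp add: odd_br_def sum_distrib_left mult.assoc)
  have "?A (odd_br r a b) = (\<Sum>u\<in>?G. ?A (dr u a) * dl (dual_gen u) b + dr u a * ?A (dl (dual_gen u) b))"
    by (simp add: odd_br_def act_simps A_mult)
  also have "\<dots> = odd_br r (?A a) b + odd_br r a (?A b)
      - (\<Sum>u\<in>?G. \<Sum>j<n. dp j a * dr u (w' j) * dl (dual_gen u) b)
      + (\<Sum>u\<in>?G. \<Sum>v\<in>?G. dr v a * dr u (dl (dual_gen v) w) * dl (dual_gen u) b)
      - (\<Sum>u\<in>?G. \<Sum>j<n. dr u a * dl (dual_gen u) (w' j) * dp j b)
      - (\<Sum>u\<in>?G. dr u a * odd_br r (dl (dual_gen u) w) b)"
    by (simp add: act_dr[OF w(1) w'(1)] act_dl[OF w(1) w'(1)] odd_br_def[of r "?A a"] odd_br_def[of r a]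
        act_def[of n r "dl _ w"] algebra_simps sum.distrib sum_subtractf sum_distrib_left sum_distrib_right)
  also have "\<dots> = odd_br r (?A a) b + odd_br r a (?A b)
      - (\<Sum>j<n. dp j a * odd_br r (w' j) b) - (\<Sum>j<n. odd_br r a (w' j) * dp j b)"
    unfolding swap
    by (subst (1 2) sum.swap) (simp add: odd_br_def sum_distrib_left sum_distrib_right mult.assoc)
  also have "(\<Sum>j<n. odd_br r a (w' j) * dp j b) = - (\<Sum>j<n. odd_br r (w' j) a * dp j b)"
    by (simp add: odd_br_even_skew[OF w'(1)] sum_negf)
  finally have odd: "?A (odd_br r a b) = odd_br r (?A a) b + odd_br r a (?A b)
      - (\<Sum>j<n. dp j a * odd_br r (w' j) b) + (\<Sum>j<n. odd_br r (w' j) a * dp j b)" by simp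
  have even: "?A (\<Sum>i<n. a' i * dp i b - dp i a * b' i) =
      (\<Sum>i<n. ?A (a' i) * dp i b + a' i * dp i (?A b) - dp i (?A a) * b' i - dp i a * ?A (b' i))"
    by (simp add: act_simps A_mult A_dp algebra_simps)
  \<comment> \<open>The symmetry of the second derivatives \<open>w''\<close> enters here. Since
    they are even, relabelling the indices identifies the two double sums, which occur below with
    opposite signs.\<close>
  have "(\<Sum>i<n. \<Sum>j<n. dp i a * (w'' i j * dp j b)) = (\<Sum>i<n. \<Sum>j<n. w'' j i * (dp i a * dp j b))"
  proof (intro sum.cong refl)
    fix i j assume "i \<in> {..<n}" "j \<in> {..<n}"
    then show "dp i a * (w'' i j * dp j b) = w'' j i * (dp i a * dp j b)"
      using even_comm[OF w''(1)[of j i], of "dp i a"] w''(2)[of i j] by (simp flip: mult.assoc)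
  qed
  also have "\<dots> = (\<Sum>i<n. \<Sum>j<n. w'' i j * (dp j a * dp i b))"
    by (rule sum.swap)
  finally have ww: "(\<Sum>i<n. \<Sum>j<n. dp i a * (w'' i j * dp j b)) = (\<Sum>i<n. \<Sum>j<n. w'' i j * (dp j a * dp i b))" .
  \<comment> \<open>What remains of these terms are exactly the cross terms in
    \<open>odd\<close>.\<close>
  have "(\<Sum>i<n. act n r (w' i) (w'' i) a * dp i b - dp i a * act n r (w' i) (w'' i) b) =
      (\<Sum>i<n. odd_br r (w' i) a * dp i b) - (\<Sum>i<n. dp i a * odd_br r (w' i) b)"
    using ww by (simp add: act_def algebra_simps sum.distrib sum_subtractf sum_distrib_left sum_distrib_right)
  then show ?thesis
    unfolding brk_def linear_add[OF linear_act] odd even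
    by (simp add: algebra_simps sum.distrib sum_subtractf)
qed

section \<open>Substitution homomorphisms, and derivations determined by generators\<close>

lemma odd_square:
  assumes "parity a = - a"
  shows "a * a = 0"
proof -
  have "a * a = - (a * a)" using odd_comm[OF assms, of a] assms by simp
  then have "2 *\<^sub>R (a * a) = 0" unfolding scaleR_2 by (metis add.right_inverse)
  then show ?thesis by simp
qed

lemma odd_anticomm: "parity a = - a \<Longrightarrow> parity b = - b \<Longrightarrow> a * b = - (b * a)"
  using odd_comm[of a b] by simp

text \<open>An assignment that preserves parity respects the commutation relations of the
  generators, so it extends to an algebra homomorphism. \<open>subst_mon\<close> multiplies the
  images in the order used by \<open>mono_change\<close>, so that changes of coordinates become an
  instance.\<close>

locale gp_subst =
  fixes p :: "nat \<Rightarrow> gp" and q :: "odd_gen \<Rightarrow> gp"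
  assumes p_even: "parity (p i) = p i" and q_odd: "parity (q g) = - q g"
begin

definition subst_mon :: "mono \<Rightarrow> gp" where
  "subst_mon = (\<lambda>(P, S). foldr (*) (map p (sorted_list_of_multiset P) @ map q (sorted_list_of_set S)) 1)"

definition subst :: "gp \<Rightarrow> gp" where
  "subst a = (\<Sum>m | coef a m \<noteq> 0. coef a m *\<^sub>R subst_mon m)"

lemma subst_sum:
  assumes "finite A" "\<And>m. coef a m \<noteq> 0 \<Longrightarrow> m \<in> A"
  shows "subst a = (\<Sum>m\<in>A. coef a m *\<^sub>R subst_mon m)"
  unfolding subst_def by (rule sum.mono_neutral_left) (use assms in auto)

lemma linear_subst: "linear subst"
proof (rule linearI)
  fix a b :: gp and r :: real
  let ?A = "{m. coef a m \<noteq> 0} \<union> {m. coef b m \<noteq> 0}"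
  have "subst c = (\<Sum>m\<in>?A. coef c m *\<^sub>R subst_mon m)" if "c = a + b \<or> c = a \<or> c = b" for c
    by (rule subst_sum) (use that in \<open>auto simp: finite_coef\<close>)
  then show "subst (a + b) = subst a + subst b"
    by (simp add: scaleR_add_left sum.distrib)
  have "subst c = (\<Sum>m | coef a m \<noteq> 0. coef c m *\<^sub>R subst_mon m)" if "c = r *\<^sub>R a \<or> c = a" for c
    by (rule subst_sum) (use that in \<open>auto simp: finite_coef\<close>)
  then show "subst (r *\<^sub>R a) = r *\<^sub>R subst a"
    by (simp add: scaleR_sum_right)
qed

lemmas subst_simps = linear_rules[OF linear_subst]

lemma subst_mon [simp]: "finite S \<Longrightarrow> subst (mon (P, S)) = subst_mon (P, S)"
  by (subst subst_sum[of "{(P, S)}"]) (auto simp: coef_mon split: if_splits)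

lemma subst_1 [simp]: "subst 1 = 1"
  by (simp add: one_gp_def subst_mon_def)

lemma foldr_p_insort: "foldr (*) (map p (insort i xs)) c = p i * foldr (*) (map p xs) c"
proof (induction xs)
  case (Cons j xs)
  have "p i * (p j * d) = p j * (p i * d)" for d
    using even_comm[OF p_even[of i], of "p j"] by (simp flip: mult.assoc)
  with Cons show ?case by simp
qed simp

lemma subst_pvar_mult [simp]: "subst (pvar i * a) = p i * subst a"
proof (induction a rule: gp_induct)
  case (mon P S)
  have "sorted_list_of_multiset (add_mset i P) = insort i (sorted_list_of_multiset P)" by simp
  with mon show ?case by (simp add: pvar_mon subst_mon_def foldr_p_insort)
qed (simp_all add: distrib_left subst_simps)

text \<open>Inserting \<open>g\<close> into the sorted product moves \<open>q g\<close> past the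
  images of the smaller generators, with one sign for each, and these are what
  \<open>koszul {g}\<close> counts.\<close>

lemma q_foldr_insort:
  assumes "sorted xs" "distinct xs" "g \<notin> set xs"
  shows "q g * foldr (*) (map q xs) 1 = koszul {g} (set xs) *\<^sub>R foldr (*) (map q (insort g xs)) 1"
  using assms
proof (induction xs)
  case (Cons h xs)
  show ?case
  proof (cases "g \<le> h")
    case True
    then have "{(s, t). s \<in> {g} \<and> t \<in> set (h # xs) \<and> t < s} = {}"
      using Cons.prems by (auto dest: order.strict_trans1)
    then have "koszul {g} (set (h # xs)) = 1" unfolding koszul_def by (simp only: card.empty power_0)
    then show ?thesis using True by simp
  next
    case False
    then have "h < g" by simp
    then have "{(s, t). s = g \<and> t = h \<and> t < s} = {(g, h)}" by auto
    then have "koszul {g} {h} = - 1" by (simp add: koszul_def)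
    then have k: "koszul {g} (insert h (set xs)) = - koszul {g} (set xs)"
      using koszul_Un_right[of "{h}" "set xs" "{g}"] Cons.prems by simp
    have "q g * (q h * c) = - (q h * (q g * c))" for c
      using odd_anticomm[OF q_odd[of g] q_odd[of h]] by (simp flip: mult.assoc)
    with Cons False k show ?thesis by simp
  qed
qed simp

lemma q_foldr_zero: "g \<in> set xs \<Longrightarrow> q g * foldr (*) (map q xs) 1 = 0"
proof (induction xs)
  case (Cons h xs)
  have "q g * (q h * c) = - (q h * (q g * c))" for c
    using odd_anticomm[OF q_odd[of g] q_odd[of h]] by (simp flip: mult.assoc)
  moreover have "q g * (q g * c) = 0" for c
    using odd_square[OF q_odd[of g]] by (simp flip: mult.assoc)
  ultimately show ?case using Cons by auto
qed simp

lemma q_foldr_p: "q g * foldr (*) (map p xs) c = foldr (*) (map p xs) (q g * c)"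
proof (induction xs)
  case (Cons i xs)
  have "q g * (p i * d) = p i * (q g * d)" for d
    using even_comm[OF p_even[of i], of "q g"] by (simp flip: mult.assoc)
  with Cons show ?case by simp
qed simp

lemma foldr_p_scaleR: "foldr (*) (map p xs) (r *\<^sub>R c) = r *\<^sub>R foldr (*) (map p xs) c"
  by (induction xs) auto

lemma foldr_p_zero: "foldr (*) (map p xs) 0 = 0"
  by (induction xs) auto

lemma subst_ovar_mult [simp]: "subst (ovar g * a) = q g * subst a"
proof (induction a rule: gp_induct)
  case (mon P S)
  let ?p = "map p (sorted_list_of_multiset P)" and ?xs = "sorted_list_of_set S"
  show ?case
  proof (cases "g \<in> S")
    case True
    then have "q g * foldr (*) (map q ?xs) 1 = 0" using mon by (intro q_foldr_zero) simp
    then show ?thesis using True mon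
      by (simp add: ovar_mon subst_mon_def q_foldr_p foldr_p_zero subst_simps)
  next
    case False
    then have "q g * foldr (*) (map q ?xs) 1 = koszul {g} S *\<^sub>R foldr (*) (map q (insort g ?xs)) 1"
      using mon q_foldr_insort[of ?xs g] by simp
    moreover have "sorted_list_of_set (insert g S) = insort g ?xs" using mon False by simp
    ultimately show ?thesis using False mon
      by (simp add: ovar_mon subst_mon_def q_foldr_p foldr_p_scaleR subst_simps)
  qed
qed (simp_all add: distrib_left subst_simps)

lemma subst_gens [simp]: "subst (pvar i) = p i" "subst (ovar g) = q g"
  using subst_pvar_mult[of i 1] subst_ovar_mult[of g 1] by simp_all

lemma subst_mult: "subst (a * b) = subst a * subst b"
  by (induction a rule: gp_gen_induct) (simp_all add: mult.assoc distrib_right subst_simps)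

lemma subst_parity: "subst (parity a) = parity (subst a)"
  by (induction a rule: gp_gen_induct)
    (simp_all add: parity_mult p_even q_odd linear_simps subst_simps)

text \<open>Both sides are derivations along \<open>subst\<close>, hence determined by the generators.\<close>

lemma subst_intertwines:
  assumes D: "linear D" "\<And>a b. D (a * b) = D a * b + s a * D b"
    and D': "linear D'" "\<And>a b. D' (a * b) = D' a * b + s a * D' b"
    and s: "\<And>a. subst (s a) = s (subst a)" "s 1 = 1"
    and gens: "\<And>i. D (p i) = subst (D' (pvar i))" "\<And>g. D (q g) = subst (D' (ovar g))"
  shows "D (subst a) = subst (D' a)"
proof (induction a rule: gp_gen_induct)
  case one
  \<comment> \<open>The Leibniz rule at \<open>1 * 1\<close> forces a derivation to vanish on
    \<open>1\<close>.\<close>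
  have "D 1 = 0" "D' 1 = 0" using D(2)[of 1 1] D'(2)[of 1 1] s(2) by simp_all
  then show ?case by (simp add: subst_simps)
next
  case (p i a)
  then show ?case using s(1)[of "pvar i"] by (simp add: D(2) D'(2) gens subst_simps subst_mult)
next
  case (odd g a)
  then show ?case using s(1)[of "ovar g"] by (simp add: D(2) D'(2) gens subst_simps subst_mult)
qed (simp_all add: linear_rules[OF D(1)] linear_rules[OF D'(1)] subst_simps)

end

text \<open>\<open>s\<close> is the twist in the Leibniz rule: the identity for even derivations,
  \<open>parity\<close> for odd ones.\<close>

lemma derivations_eqI:
  assumes D: "linear D" "\<And>a b. D (a * b) = D a * b + s a * D b"
    and D': "linear D'" "\<And>a b. D' (a * b) = D' a * b + s a * D' b"
    and s: "s 1 = 1"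
    and gens: "\<And>i. D (pvar i) = D' (pvar i)" "\<And>g. D (ovar g) = D' (ovar g)"
  shows "D a = D' a"
proof (induction a rule: gp_gen_induct)
  case one
  show ?case using D(2)[of 1 1] D'(2)[of 1 1] s by simp
qed (simp_all add: D(2) D'(2) gens linear_rules[OF D(1)] linear_rules[OF D'(1)])

section \<open>Calculus on coordinate domains\<close>

definition has_pderiv :: "nat \<Rightarrow> ((nat \<Rightarrow> real) \<Rightarrow> real) \<Rightarrow> (nat \<Rightarrow> real) \<Rightarrow> real \<Rightarrow> bool" where
  "has_pderiv i f y D \<longleftrightarrow> ((\<lambda>t. f (y(i := t))) has_real_derivative D) (at (y i))"

lemma has_pderiv_imp: "has_pderiv i f y D \<Longrightarrow> pderiv_at i f y = D"
  unfolding has_pderiv_def pderiv_at_def by (rule DERIV_imp_deriv)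

lemma has_pderiv_iff:
  "has_pderiv i f y (pderiv_at i f y) \<longleftrightarrow> (\<lambda>t. f (y(i := t))) differentiable (at (y i))"
  unfolding has_pderiv_def pderiv_at_def by (simp add: DERIV_deriv_iff_real_differentiable)

text \<open>A basic open set of the product topology restricts each coordinate to an open set. The
  coordinates beyond \<open>n\<close> are fixed at \<open>0\<close>, so a common radius is the
  minimum of finitely many.\<close>

lemma openin_Euclidean_box:
  assumes "openin (Euclidean_space n) V" "y \<in> V"
  obtains \<epsilon> where "\<epsilon> > 0"
    "\<And>z. (\<And>i. i < n \<Longrightarrow> \<bar>z i - y i\<bar> < \<epsilon>) \<Longrightarrow> (\<And>i. i \<ge> n \<Longrightarrow> z i = 0) \<Longrightarrow> z \<in> V"
proof -
  obtain T where T: "openin (powertop_real UNIV) T" "V = T \<inter> {x. \<forall>i\<ge>n. x i = 0}"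
    using assms(1) unfolding Euclidean_space_def openin_subtopology by blast
  obtain X where X: "y \<in> (\<Pi>\<^sub>E i\<in>UNIV. X i)" "\<And>i. openin euclideanreal (X i)" "(\<Pi>\<^sub>E i\<in>UNIV. X i) \<subseteq> T"
    using product_topology_open_contains_basis[OF T(1), of y] assms(2) T(2) by blast
  have "\<exists>e>0. \<forall>t. \<bar>t - y i\<bar> < e \<longrightarrow> t \<in> X i" for i
    using X(1) X(2)[of i] by (force simp: open_dist dist_real_def PiE_iff)
  then obtain e where e: "\<And>i. e i > 0" "\<And>i t. \<bar>t - y i\<bar> < e i \<Longrightarrow> t \<in> X i" by metis
  \<comment> \<open>The \<open>1\<close> keeps the set nonempty when \<open>n = 0\<close>.\<close>
  define \<epsilon> where "\<epsilon> = Min (insert 1 (e ` {..<n}))"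
  have "\<epsilon> > 0" using e(1) by (simp add: \<epsilon>_def)
  moreover have "z \<in> V" if z: "\<And>i. i < n \<Longrightarrow> \<bar>z i - y i\<bar> < \<epsilon>" "\<And>i. i \<ge> n \<Longrightarrow> z i = 0" for z
  proof -
    have "z i \<in> X i" for i
    proof (cases "i < n")
      case True
      then have "\<epsilon> \<le> e i" by (simp add: \<epsilon>_def)
      then show ?thesis using z(1)[OF True] e(2) by force
    next
      case False
      then have "z i = y i" using z(2)[of i] assms(2) T(2) by simp
      then show ?thesis using X(1) by auto
    qed
    then show ?thesis using X(3) z(2) T(2) by (auto simp: PiE_iff)
  qed
  ultimately show ?thesis using that by blast
qed

lemma openin_Euclidean_zero: "openin (Euclidean_space n) V \<Longrightarrow> y \<in> V \<Longrightarrow> i \<ge> n \<Longrightarrow> y i = 0"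
  using openin_subset[of "Euclidean_space n" V] by (auto simp: topspace_Euclidean_space)

text \<open>On subsets of the model space the abstract topology is that of the type
  \<open>nat \<Rightarrow> real\<close>, so the rules for \<open>continuous_on\<close> become
  available.\<close>

lemma continuous_map_Euclidean_iff:
  assumes "openin (Euclidean_space n) V"
  shows "continuous_map (subtopology (Euclidean_space n) V) euclideanreal f \<longleftrightarrow> continuous_on V f"
proof -
  have "V \<subseteq> {x. \<forall>i\<ge>n. x i = 0}"
    using openin_subset[OF assms] by (simp add: topspace_Euclidean_space)
  then have "subtopology (Euclidean_space n) V = top_of_set V"
    by (simp add: Euclidean_space_def subtopology_subtopology Int_absorb1 euclidean_product_topology)
  then show ?thesis by simp
qed

lemma continuous_on_box:
  assumes "openin (Euclidean_space n) V" "continuous_on V f" "y \<in> V" "e > (0::real)"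
  obtains \<delta> where "\<delta> > 0"
    "\<And>z. (\<And>i. i < n \<Longrightarrow> \<bar>z i - y i\<bar> < \<delta>) \<Longrightarrow> (\<And>i. i \<ge> n \<Longrightarrow> z i = 0) \<Longrightarrow> z \<in> V \<and> \<bar>f z - f y\<bar> < e"
proof -
  let ?U = "{z \<in> V. f z \<in> ball (f y) e}"
  have "openin (subtopology (Euclidean_space n) V) {z \<in> topspace (subtopology (Euclidean_space n) V). f z \<in> ball (f y) e}"
    by (rule openin_continuous_map_preimage[of _ euclideanreal])
      (use assms in \<open>auto simp: continuous_map_Euclidean_iff\<close>)
  moreover have "topspace (subtopology (Euclidean_space n) V) = V"
    using openin_subset[OF assms(1)] by auto
  ultimately have "openin (subtopology (Euclidean_space n) V) ?U" by metis
  then have "openin (Euclidean_space n) ?U"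
    using openin_open_subtopology[OF assms(1)] by blast
  moreover have "y \<in> ?U" using assms by simp
  ultimately obtain \<delta> where "\<delta> > 0"
      "\<And>z. (\<And>i. i < n \<Longrightarrow> \<bar>z i - y i\<bar> < \<delta>) \<Longrightarrow> (\<And>i. i \<ge> n \<Longrightarrow> z i = 0) \<Longrightarrow> z \<in> ?U"
    by (rule openin_Euclidean_box) blast
  then show ?thesis using that[of \<delta>] by (auto simp: dist_real_def abs_minus_commute)
qed

text \<open>A derivative in a coordinate direction sees a function only along this line; hence
  functions that agree on an open set have the same partial derivatives there.\<close>

lemma eventually_line_in:
  assumes "openin (Euclidean_space n) V" "y \<in> V" "i < n"
  shows "eventually (\<lambda>t. y(i := t) \<in> V) (nhds (y i))"
proof -
  obtain \<epsilon> where \<epsilon>: "\<epsilon> > 0"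
      "\<And>z. (\<And>i. i < n \<Longrightarrow> \<bar>z i - y i\<bar> < \<epsilon>) \<Longrightarrow> (\<And>i. i \<ge> n \<Longrightarrow> z i = 0) \<Longrightarrow> z \<in> V"
    using openin_Euclidean_box[OF assms(1,2)] by blast
  have "y(i := t) \<in> V" if "dist t (y i) < \<epsilon>" for t
    by (rule \<epsilon>(2)) (use that \<epsilon>(1) assms openin_Euclidean_zero[OF assms(1,2)] in \<open>auto simp: dist_real_def\<close>)
  then show ?thesis unfolding eventually_nhds_metric using \<epsilon>(1) by blast
qed

lemma has_pderiv_cong:
  assumes "openin (Euclidean_space n) V" "y \<in> V" "i < n" "\<And>z. z \<in> V \<Longrightarrow> f z = g z"
  shows "has_pderiv i f y D \<longleftrightarrow> has_pderiv i g y D"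
  unfolding has_pderiv_def
  by (rule DERIV_cong_ev[OF refl _ refl])
    (use eventually_line_in[OF assms(1-3)] assms(4) in \<open>auto elim: eventually_mono\<close>)

lemma pderiv_at_cong:
  assumes "openin (Euclidean_space n) V" "y \<in> V" "i < n" "\<And>z. z \<in> V \<Longrightarrow> f z = g z"
  shows "pderiv_at i f y = pderiv_at i g y"
  unfolding pderiv_at_def
  by (rule deriv_cong_ev)
    (use eventually_line_in[OF assms(1-3)] assms(4) in \<open>auto elim: eventually_mono\<close>)

lemma Ck_on_cong:
  assumes "openin (Euclidean_space n) V" "\<And>z. z \<in> V \<Longrightarrow> f z = g z"
  shows "Ck_on k n V f \<longleftrightarrow> Ck_on k n V g"
  using assms(2)
proof (induction k arbitrary: f g)
  case 0
  then show ?case by (simp add: continuous_map_Euclidean_iff[OF assms(1)] cong: continuous_on_cong)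
next
  case (Suc k)
  have "continuous_on V f \<longleftrightarrow> continuous_on V g"
    by (rule continuous_on_cong) (use Suc.prems in auto)
  moreover have "(\<lambda>t. f (y(i := t))) differentiable (at (y i)) \<longleftrightarrow> (\<lambda>t. g (y(i := t))) differentiable (at (y i))"
    if "i < n" "y \<in> V" for i y
    using has_pderiv_cong[OF assms(1) that(2,1), where f = f and g = g, OF Suc.prems]
    unfolding has_pderiv_iff[symmetric] by (metis has_pderiv_imp)
  moreover have "Ck_on k n V (pderiv_at i f) \<longleftrightarrow> Ck_on k n V (pderiv_at i g)" if "i < n" for i
    by (rule Suc.IH) (use pderiv_at_cong[OF assms(1) _ that] Suc.prems in blast)
  ultimately show ?case by (auto simp: continuous_map_Euclidean_iff[OF assms(1)])
qed

lemma Ck_on_continuous: "openin (Euclidean_space n) V \<Longrightarrow> Ck_on k n V f \<Longrightarrow> continuous_on V f"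
  by (cases k) (auto simp: continuous_map_Euclidean_iff)

lemma Ck_on_SucD:
  assumes "Ck_on (Suc k) n V f" "i < n"
  shows "Ck_on k n V (pderiv_at i f)" "y \<in> V \<Longrightarrow> has_pderiv i f y (pderiv_at i f y)"
  using assms by (auto simp: has_pderiv_iff)

text \<open>Any candidate for the partial derivative will do: on the open set it agrees with
  \<open>pderiv_at i f\<close>, and \<open>Ck_on_cong\<close> transfers its regularity.\<close>

lemma Ck_on_SucI:
  assumes V: "openin (Euclidean_space n) V" and "continuous_on V f"
    and "\<And>i. i < n \<Longrightarrow> \<exists>g. Ck_on k n V g \<and> (\<forall>y\<in>V. has_pderiv i f y (g y))"
  shows "Ck_on (Suc k) n V f"
proof -
  have "Ck_on k n V (pderiv_at i f) \<and> (\<forall>y\<in>V. has_pderiv i f y (pderiv_at i f y))" if i: "i < n" for i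
  proof -
    obtain g where g: "Ck_on k n V g" "\<forall>y\<in>V. has_pderiv i f y (g y)" using assms(3)[OF i] by blast
    then have "\<forall>y\<in>V. pderiv_at i f y = g y" by (blast dest: has_pderiv_imp)
    then show ?thesis using g Ck_on_cong[OF V, of "pderiv_at i f" g] by auto
  qed
  then show ?thesis using assms(2) by (simp add: continuous_map_Euclidean_iff[OF V] has_pderiv_iff)
qed

lemma Ck_on_Suc_imp: "Ck_on (Suc k) n V f \<Longrightarrow> Ck_on k n V f"
  by (induction k arbitrary: f) auto

lemma Ck_on_subset: "Ck_on k n V f \<Longrightarrow> U \<subseteq> V \<Longrightarrow> Ck_on k n U f"
proof (induction k arbitrary: f)
  case (Suc k)
  then have "continuous_map (subtopology (Euclidean_space n) U) euclideanreal f"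
    by (auto intro: continuous_map_from_subtopology_mono)
  with Suc show ?case by auto
qed (auto intro: continuous_map_from_subtopology_mono)

lemma Ck_on_local:
  assumes V: "openin (Euclidean_space n) V"
    and "\<And>y. y \<in> V \<Longrightarrow> \<exists>U. openin (Euclidean_space n) U \<and> y \<in> U \<and> U \<subseteq> V \<and> Ck_on k n U f"
  shows "Ck_on k n V f"
  using assms(2)
proof (induction k arbitrary: f)
  case 0
  have "continuous (at y within V) f" if y: "y \<in> V" for y
  proof -
    obtain U where U: "openin (Euclidean_space n) U" "y \<in> U" "U \<subseteq> V" "Ck_on 0 n U f"
      using 0[OF y] by blast
    obtain T where T: "open T" "U = T \<inter> {x. \<forall>i\<ge>n. x i = 0}"
      using U(1) unfolding Euclidean_space_def openin_subtopology euclidean_product_topology by auto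
    have "continuous (at y within U) f"
      using Ck_on_continuous[OF U(1,4)] U(2) by (simp add: continuous_on_eq_continuous_within)
    moreover have "at y within U = at y within V"
      by (rule at_within_nhd[of _ T])
        (use T U openin_Euclidean_zero[OF V] in auto)
    ultimately show ?thesis by simp
  qed
  then show ?case by (simp add: continuous_map_Euclidean_iff[OF V] continuous_on_eq_continuous_within)
next
  case (Suc k)
  have "Ck_on k n V f"
    by (rule Suc.IH) (meson Suc.prems Ck_on_Suc_imp)
  then have "continuous_map (subtopology (Euclidean_space n) V) euclideanreal f"
    using Ck_on_continuous[OF V] continuous_map_Euclidean_iff[OF V] by blast
  moreover have "Ck_on k n V (pderiv_at i f)" if "i < n" for i
    by (rule Suc.IH) (meson Suc.prems Ck_on_SucD(1)[OF _ that])
  moreover have "has_pderiv i f y (pderiv_at i f y)" if "i < n" "y \<in> V" for i y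
    using Suc.prems[OF that(2)] Ck_on_SucD(2)[OF _ that(1)] by meson
  ultimately show ?case by (simp add: has_pderiv_iff)
qed

lemma Ck_on_const: "openin (Euclidean_space n) V \<Longrightarrow> Ck_on k n V (\<lambda>y. c)"
proof (induction k arbitrary: c)
  case (Suc k)
  show ?case
    by (rule Ck_on_SucI[OF Suc.prems])
      (use Suc in \<open>auto intro!: exI[of _ "\<lambda>y. 0"] simp: has_pderiv_def\<close>)
qed simp

lemma continuous_on_coord: "continuous_on V (\<lambda>y :: nat \<Rightarrow> real. y j)"
  by (rule continuous_on_subset[OF continuous_on_product_coordinates]) auto

lemma Ck_on_coord:
  assumes "openin (Euclidean_space n) V"
  shows "Ck_on k n V (\<lambda>y. y j)"
proof (cases k)
  case 0
  then show ?thesis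
    by (simp add: continuous_map_Euclidean_iff[OF assms] continuous_on_coord)
next
  case (Suc l)
  have "has_pderiv i (\<lambda>y. y j) y (if i = j then 1 else 0)" for i and y :: "nat \<Rightarrow> real"
    by (auto simp: has_pderiv_def)
  then show ?thesis unfolding Suc
    by (intro Ck_on_SucI[OF assms]) (auto intro!: continuous_on_coord Ck_on_const[OF assms])
qed

lemma Ck_on_add:
  assumes V: "openin (Euclidean_space n) V"
  shows "Ck_on k n V f \<Longrightarrow> Ck_on k n V g \<Longrightarrow> Ck_on k n V (\<lambda>y. f y + g y)"
proof (induction k arbitrary: f g)
  case 0
  then show ?case by (auto simp: continuous_map_Euclidean_iff[OF V] intro: continuous_intros)
next
  case (Suc k)
  show ?case
  proof (rule Ck_on_SucI[OF V])
    fix i assume i: "i < n"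
    show "\<exists>h. Ck_on k n V h \<and> (\<forall>y\<in>V. has_pderiv i (\<lambda>y. f y + g y) y (h y))"
    proof (intro exI conjI ballI)
      show "Ck_on k n V (\<lambda>y. pderiv_at i f y + pderiv_at i g y)"
        using Suc.IH[OF Ck_on_SucD(1)[OF Suc.prems(1) i] Ck_on_SucD(1)[OF Suc.prems(2) i]] .
      show "has_pderiv i (\<lambda>y. f y + g y) y (pderiv_at i f y + pderiv_at i g y)" if "y \<in> V" for y
        using DERIV_add[OF Ck_on_SucD(2)[OF Suc.prems(1) i that, unfolded has_pderiv_def]
            Ck_on_SucD(2)[OF Suc.prems(2) i that, unfolded has_pderiv_def]]
        by (simp add: has_pderiv_def)
    qed
  qed (intro continuous_on_add Ck_on_continuous[OF V Suc.prems(1)] Ck_on_continuous[OF V Suc.prems(2)])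
qed

lemma Ck_on_mult:
  assumes V: "openin (Euclidean_space n) V"
  shows "Ck_on k n V f \<Longrightarrow> Ck_on k n V g \<Longrightarrow> Ck_on k n V (\<lambda>y. f y * g y)"
proof (induction k arbitrary: f g)
  case 0
  then show ?case by (auto simp: continuous_map_Euclidean_iff[OF V] intro: continuous_intros)
next
  case (Suc k)
  show ?case
  proof (rule Ck_on_SucI[OF V])
    fix i assume i: "i < n"
    have "Ck_on k n V (\<lambda>y. pderiv_at i f y * g y + pderiv_at i g y * f y)"
      using Suc.prems Ck_on_Suc_imp Ck_on_SucD(1)[OF Suc.prems(1) i] Ck_on_SucD(1)[OF Suc.prems(2) i]
      by (intro Ck_on_add[OF V] Suc.IH) auto
    moreover have "has_pderiv i (\<lambda>y. f y * g y) y (pderiv_at i f y * g y + pderiv_at i g y * f y)" if "y \<in> V" for y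
      using DERIV_mult[OF Ck_on_SucD(2)[OF Suc.prems(1) i that, unfolded has_pderiv_def]
          Ck_on_SucD(2)[OF Suc.prems(2) i that, unfolded has_pderiv_def]]
      by (simp add: has_pderiv_def)
    ultimately show "\<exists>h. Ck_on k n V h \<and> (\<forall>y\<in>V. has_pderiv i (\<lambda>y. f y * g y) y (h y))"
      by blast
  qed (intro continuous_on_mult Ck_on_continuous[OF V Suc.prems(1)] Ck_on_continuous[OF V Suc.prems(2)])
qed

lemma Ck_on_sum:
  assumes "openin (Euclidean_space n) V" "\<And>a. a \<in> A \<Longrightarrow> Ck_on k n V (f a)"
  shows "Ck_on k n V (\<lambda>y. \<Sum>a\<in>A. f a y)"
  using assms(2)
  by (induction A rule: infinite_finite_induct) (auto intro: Ck_on_const Ck_on_add assms(1))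

section \<open>The chain rule and composition with smooth maps\<close>

lemma mvt_between:
  assumes "\<And>x. min a b \<le> x \<Longrightarrow> x \<le> max a b \<Longrightarrow> (f has_real_derivative f' x) (at x)"
  shows "\<exists>z. min a b \<le> z \<and> z \<le> max a b \<and> f b - f a = (b - a) * f' z"
proof (cases a b rule: linorder_cases)
  case less
  then obtain z where "a < z" "z < b" "f b - f a = (b - a) * f' z" using MVT2[of a b f f'] assms by auto
  then show ?thesis by (intro exI[of _ z]) auto
next
  case greater
  then obtain z where "b < z" "z < a" "f a - f b = (a - b) * f' z" using MVT2[of b a f f'] assms by auto
  then show ?thesis by (intro exI[of _ z]) (auto simp: algebra_simps)
qed (auto intro: exI[of _ b])

text \<open>The chain rule from continuous partial derivatives: the points \<open>hyb k t\<close>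
  switch from \<open>\<gamma> s\<close> to \<open>\<gamma> t\<close> one coordinate at a time, and
  each switch is controlled by the mean value theorem in that coordinate.\<close>

lemma C1_chain:
  fixes f :: "(nat \<Rightarrow> real) \<Rightarrow> real" and \<gamma> :: "real \<Rightarrow> nat \<Rightarrow> real"
  assumes V: "openin (Euclidean_space m) V"
    and f: "\<And>j z. j < m \<Longrightarrow> z \<in> V \<Longrightarrow> has_pderiv j f z (f' j z)" "\<And>j. j < m \<Longrightarrow> continuous_on V (f' j)"
    and \<gamma>: "\<And>j. j < m \<Longrightarrow> ((\<lambda>t. \<gamma> t j) has_real_derivative c j) (at s)" "\<gamma> s \<in> V"
      "eventually (\<lambda>t. \<gamma> t \<in> V) (nhds s)"
  shows "((\<lambda>t. f (\<gamma> t)) has_real_derivative (\<Sum>j<m. f' j (\<gamma> s) * c j)) (at s)"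
proof -
  define y where "y = \<gamma> s"
  have y: "y \<in> V" "\<And>j. j \<ge> m \<Longrightarrow> y j = 0" using \<gamma>(2) openin_Euclidean_zero[OF V] by (auto simp: y_def)
  define hyb where "hyb k t = (\<lambda>j. if j < k then \<gamma> t j else y j)" for k t
  have main: "((\<lambda>t. f (hyb k t)) has_real_derivative (\<Sum>j<k. f' j y * c j)) (at s)" if "k \<le> m" for k
    using that
  proof (induction k)
    case 0
    then show ?case by (simp add: hyb_def)
  next
    case (Suc k)
    then have k: "k < m" by simp
    let ?d = "\<lambda>t. f (hyb (Suc k) t) - f (hyb k t)"
    have hs: "hyb l s = y" for l by (auto simp: hyb_def y_def)
    \<comment> \<open>The difference quotient in the \<open>k\<close>-th coordinate, filled in with
      the derivative where its denominator vanishes, so that \<open>dq\<close> holds for every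
      \<open>t\<close>.\<close>
    define q where "q t = (if \<gamma> t k = y k then f' k y else ?d t / (\<gamma> t k - y k))" for t
    have upd: "hyb (Suc k) t = (hyb k t)(k := \<gamma> t k)" "hyb k t = (hyb k t)(k := y k)" for t
      by (auto simp: hyb_def less_Suc_eq)
    have q: "(q \<longlongrightarrow> f' k y) (at s)"
    proof (rule tendstoI)
      fix e :: real assume "e > 0"
      then obtain \<delta> where \<delta>: "\<delta> > 0"
        "\<And>z. (\<And>i. i < m \<Longrightarrow> \<bar>z i - y i\<bar> < \<delta>) \<Longrightarrow> (\<And>i. i \<ge> m \<Longrightarrow> z i = 0) \<Longrightarrow> z \<in> V \<and> \<bar>f' k z - f' k y\<bar> < e"
        using continuous_on_box[OF V f(2)[OF k] y(1)] by blast
      have "eventually (\<lambda>t. \<forall>j\<in>{..<m}. \<bar>\<gamma> t j - y j\<bar> < \<delta>) (at s)"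
      proof (rule eventually_ball_finite)
        show "\<forall>j\<in>{..<m}. \<forall>\<^sub>F t in at s. \<bar>\<gamma> t j - y j\<bar> < \<delta>"
        proof
          fix j assume "j \<in> {..<m}"
          then have "((\<lambda>t. \<gamma> t j) \<longlongrightarrow> y j) (at s)"
            using DERIV_isCont[OF \<gamma>(1)[of j]] by (simp add: isCont_def y_def)
          then show "\<forall>\<^sub>F t in at s. \<bar>\<gamma> t j - y j\<bar> < \<delta>"
            using tendstoD[OF _ \<delta>(1), of "\<lambda>t. \<gamma> t j" "y j" "at s"] by (simp add: dist_real_def)
        qed
      qed simp
      then show "\<forall>\<^sub>F t in at s. dist (q t) (f' k y) < e"
      proof (rule eventually_mono)
        fix t assume t: "\<forall>j\<in>{..<m}. \<bar>\<gamma> t j - y j\<bar> < \<delta>"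
        show "dist (q t) (f' k y) < e"
        proof (cases "\<gamma> t k = y k")
          case False
          have box: "(hyb k t)(k := u) \<in> V \<and> \<bar>f' k ((hyb k t)(k := u)) - f' k y\<bar> < e"
            if "min (y k) (\<gamma> t k) \<le> u" "u \<le> max (y k) (\<gamma> t k)" for u
          proof (rule \<delta>(2))
            have "\<bar>\<gamma> t k - y k\<bar> < \<delta>" using t k by simp
            then have "\<bar>u - y k\<bar> < \<delta>" using that by linarith
            then show "\<bar>((hyb k t)(k := u)) i - y i\<bar> < \<delta>" if "i < m" for i
              using t that \<delta>(1) by (auto simp: hyb_def)
          qed (use k y(2) in \<open>auto simp: hyb_def\<close>)
          have "((\<lambda>u. f ((hyb k t)(k := u))) has_real_derivative f' k ((hyb k t)(k := u))) (at u)"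
            if "min (y k) (\<gamma> t k) \<le> u" "u \<le> max (y k) (\<gamma> t k)" for u
            using f(1)[OF k, of "(hyb k t)(k := u)"] box[OF that] by (simp add: has_pderiv_def)
          from mvt_between[OF this] obtain z where z: "min (y k) (\<gamma> t k) \<le> z" "z \<le> max (y k) (\<gamma> t k)"
            "f ((hyb k t)(k := \<gamma> t k)) - f ((hyb k t)(k := y k)) = (\<gamma> t k - y k) * f' k ((hyb k t)(k := z))"
            by blast
          then have "?d t = (\<gamma> t k - y k) * f' k ((hyb k t)(k := z))"
            by (simp flip: upd)
          then have "q t = f' k ((hyb k t)(k := z))" using False by (simp add: q_def)
          then show ?thesis using box[OF z(1,2)] by (simp add: dist_real_def)
        qed (use \<open>e > 0\<close> in \<open>simp add: q_def\<close>)
      qed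
    qed
    have dq: "?d t = q t * (\<gamma> t k - y k)" for t
      using upd[of t] by (simp add: q_def)
    have "((\<lambda>t. (\<gamma> t k - y k) / (t - s)) \<longlongrightarrow> c k) (at s)"
      using \<gamma>(1)[OF k] by (simp add: has_field_derivative_iff y_def)
    from tendsto_mult[OF q this] have "((\<lambda>t. (?d t - ?d s) / (t - s)) \<longlongrightarrow> f' k y * c k) (at s)"
      by (simp add: dq hs)
    then have "(?d has_real_derivative f' k y * c k) (at s)"
      by (simp add: has_field_derivative_iff)
    from DERIV_add[OF this Suc.IH] k show ?case by (simp add: add.commute)
  qed
  have "eventually (\<lambda>t. f (hyb m t) = f (\<gamma> t)) (nhds s)"
    using \<gamma>(3)
  proof (rule eventually_mono)
    fix t assume "\<gamma> t \<in> V"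
    \<comment> \<open>After \<open>m\<close> switches only coordinates beyond \<open>m\<close> could
      differ, and these are \<open>0\<close> for points of \<open>V\<close>.\<close>
    then have "hyb m t = \<gamma> t" using openin_Euclidean_zero[OF V] y(2) by (fastforce simp: hyb_def)
    then show "f (hyb m t) = f (\<gamma> t)" by simp
  qed
  then show ?thesis using main[OF order_refl] DERIV_cong_ev[OF refl] by (metis y_def)
qed

lemma has_pderiv_comp:
  assumes V: "openin (Euclidean_space n) V" and W: "openin (Euclidean_space m) W"
    and \<phi>: "\<And>y. y \<in> V \<Longrightarrow> \<phi> y \<in> W" "\<And>j. j < m \<Longrightarrow> Cinf_on n V (\<lambda>y. \<phi> y j)"
    and f: "Ck_on (Suc k) m W f" and i: "i < n" and y: "y \<in> V"
  shows "has_pderiv i (\<lambda>y. f (\<phi> y)) y (\<Sum>j<m. pderiv_at j f (\<phi> y) * pderiv_at i (\<lambda>y. \<phi> y j) y)"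
proof -
  have "((\<lambda>t. f (\<phi> (y(i := t)))) has_real_derivative
      (\<Sum>j<m. pderiv_at j f (\<phi> (y(i := y i))) * pderiv_at i (\<lambda>y. \<phi> y j) y)) (at (y i))"
  proof (rule C1_chain[OF W])
    show "has_pderiv j f z (pderiv_at j f z)" if "j < m" "z \<in> W" for j z
      using Ck_on_SucD(2)[OF f that] .
    show "continuous_on W (pderiv_at j f)" if "j < m" for j
      using Ck_on_continuous[OF W Ck_on_SucD(1)[OF f that]] .
    show "((\<lambda>t. \<phi> (y(i := t)) j) has_real_derivative pderiv_at i (\<lambda>y. \<phi> y j) y) (at (y i))" if "j < m" for j
      using \<phi>(2)[OF that] Ck_on_SucD(2)[OF _ i y, of 0 "\<lambda>y. \<phi> y j"]
      unfolding Cinf_on_def has_pderiv_def by blast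
    show "\<forall>\<^sub>F t in nhds (y i). \<phi> (y(i := t)) \<in> W"
      using eventually_line_in[OF V y i] by (rule eventually_mono) (rule \<phi>(1))
  qed (use \<phi>(1) y in simp)
  then show ?thesis by (simp add: has_pderiv_def)
qed

text \<open>Induction on \<open>k\<close> for all \<open>f\<close> at once, because the chain rule
  expresses the partial derivatives of the composite by composites of the partial derivatives of
  \<open>f\<close>.\<close>

lemma Ck_on_comp:
  assumes V: "openin (Euclidean_space n) V" and W: "openin (Euclidean_space m) W"
    and \<phi>: "\<And>y. y \<in> V \<Longrightarrow> \<phi> y \<in> W" "\<And>j. j < m \<Longrightarrow> Cinf_on n V (\<lambda>y. \<phi> y j)"
  shows "Ck_on k m W f \<Longrightarrow> Ck_on k n V (\<lambda>y. f (\<phi> y))"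
proof (induction k arbitrary: f)
  \<comment> \<open>Continuity into the product topology concerns all coordinates; those beyond
    \<open>m\<close> vanish because \<open>\<phi>\<close> maps into \<open>W\<close>.\<close>
  have "continuous_on V (\<lambda>y. \<phi> y j)" for j
  proof (cases "j < m")
    case True
    then show ?thesis using \<phi>(2) Ck_on_continuous[OF V] unfolding Cinf_on_def by blast
  next
    case False
    then have "\<phi> y j = 0" if "y \<in> V" for y using openin_Euclidean_zero[OF W \<phi>(1)[OF that]] by simp
    then show ?thesis by (simp cong: continuous_on_cong)
  qed
  then have cont: "continuous_on V \<phi>" by (rule continuous_on_coordinatewise_then_product)
  have cont': "continuous_on V (\<lambda>y. f (\<phi> y))" if "continuous_on W f" for f :: "(nat \<Rightarrow> real) \<Rightarrow> real"
    by (rule continuous_on_compose2[OF that cont]) (use \<phi>(1) in auto)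
  {
    case 0
    then show ?case using cont' by (simp add: continuous_map_Euclidean_iff V W)
  next
    case (Suc k)
    show ?case
    proof (rule Ck_on_SucI[OF V])
      show "continuous_on V (\<lambda>y. f (\<phi> y))" using cont' Ck_on_continuous[OF W Suc.prems] .
      fix i assume i: "i < n"
      let ?g = "\<lambda>y. \<Sum>j<m. pderiv_at j f (\<phi> y) * pderiv_at i (\<lambda>y. \<phi> y j) y"
      have "Ck_on k n V ?g"
        by (intro Ck_on_sum[OF V] Ck_on_mult[OF V] Suc.IH Ck_on_SucD(1)[OF Suc.prems] Ck_on_SucD(1)[OF _ i])
          (use \<phi>(2) in \<open>auto simp: Cinf_on_def simp del: Ck_on.simps\<close>)
      moreover have "has_pderiv i (\<lambda>y. f (\<phi> y)) y (?g y)" if "y \<in> V" for y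
        by (rule has_pderiv_comp[OF V W \<phi> Suc.prems i that])
      ultimately show "\<exists>g. Ck_on k n V g \<and> (\<forall>y\<in>V. has_pderiv i (\<lambda>y. f (\<phi> y)) y (g y))" by blast
    qed
  }
qed

section \<open>Symmetry of second partial derivatives\<close>

lemma second_difference:
  assumes V: "openin (Euclidean_space n) V" and y: "y \<in> V" and ij: "i < n" "j < n" "i \<noteq> j"
    and f: "Ck_on 2 n V f" and h: "0 < h"
    and box: "\<And>z. (\<And>i. i < n \<Longrightarrow> \<bar>z i - y i\<bar> \<le> h) \<Longrightarrow> (\<And>i. i \<ge> n \<Longrightarrow> z i = 0) \<Longrightarrow> z \<in> V"
  shows "\<exists>z. (\<forall>i<n. \<bar>z i - y i\<bar> \<le> h) \<and> (\<forall>i\<ge>n. z i = 0) \<and>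
    f (y(i := y i + h, j := y j + h)) - f (y(i := y i + h)) - f (y(j := y j + h)) + f y =
    h * h * pderiv_at j (pderiv_at i f) z"
proof -
  have f2: "Ck_on (Suc (Suc 0)) n V f" using f by (simp add: numeral_2_eq_2)
  have inV: "y(i := s, j := t) \<in> V" if "y i \<le> s" "s \<le> y i + h" "y j \<le> t" "t \<le> y j + h" for s t
    by (rule box) (use that h ij openin_Euclidean_zero[OF V y] in auto)
  \<comment> \<open>The mean value theorem is applied to this difference in direction
    \<open>i\<close>, and then to \<open>pderiv_at i f\<close> in direction
    \<open>j\<close>.\<close>
  let ?\<phi> = "\<lambda>s. f (y(i := s, j := y j + h)) - f (y(i := s, j := y j))"
  let ?f = "pderiv_at i f"
  have di: "((\<lambda>s. f (y(i := s, j := t))) has_real_derivative ?f (y(i := s, j := t))) (at s)"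
    if "y i \<le> s" "s \<le> y i + h" "y j \<le> t" "t \<le> y j + h" for s t
    using Ck_on_SucD(2)[OF f2 ij(1) inV[OF that]] ij by (simp add: has_pderiv_def fun_upd_twist[of i j])
  have "(?\<phi> has_real_derivative ?f (y(i := s, j := y j + h)) - ?f (y(i := s, j := y j))) (at s)"
    if "y i \<le> s" "s \<le> y i + h" for s
    using that h by (intro DERIV_diff di) auto
  from MVT2[of "y i" "y i + h" ?\<phi>, OF _ this] h obtain s where s: "y i < s" "s < y i + h"
    "?\<phi> (y i + h) - ?\<phi> (y i) = h * (?f (y(i := s, j := y j + h)) - ?f (y(i := s, j := y j)))"
    by auto
  have "((\<lambda>t. ?f (y(i := s, j := t))) has_real_derivative pderiv_at j ?f (y(i := s, j := t))) (at t)"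
    if "y j \<le> t" "t \<le> y j + h" for t
    using Ck_on_SucD(2)[OF Ck_on_SucD(1)[OF f2 ij(1)] ij(2) inV[of s t]] s that by (simp add: has_pderiv_def)
  from MVT2[of "y j" "y j + h", OF _ this] h obtain t where t: "y j < t" "t < y j + h"
    "?f (y(i := s, j := y j + h)) - ?f (y(i := s, j := y j)) = h * pderiv_at j ?f (y(i := s, j := t))"
    by auto
  have "f (y(i := y i + h, j := y j + h)) - f (y(i := y i + h)) - f (y(j := y j + h)) + f y =
      ?\<phi> (y i + h) - ?\<phi> (y i)"
    using ij by (simp add: fun_upd_twist[of i j])
  with s t show ?thesis
    using ij h openin_Euclidean_zero[OF V y]
    by (intro exI[of _ "y(i := s, j := t)"]) auto
qed

text \<open>The second difference of \<open>f\<close> over a small square is symmetric in the two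
  directions. By \<open>second_difference\<close> the two mixed derivatives therefore take equal
  values at two points near \<open>y\<close>, and continuity brings their values at \<open>y\<close>
  within any \<open>e\<close> of each other.\<close>

lemma pderiv_at_commute:
  assumes V: "openin (Euclidean_space n) V" and y: "y \<in> V" and ij: "i < n" "j < n"
    and f: "Ck_on 2 n V f"
  shows "pderiv_at i (pderiv_at j f) y = pderiv_at j (pderiv_at i f) y"
proof (cases "i = j")
  case False
  let ?a = "pderiv_at i (pderiv_at j f)" and ?b = "pderiv_at j (pderiv_at i f)"
  have f2: "Ck_on (Suc (Suc 0)) n V f" using f by (simp add: numeral_2_eq_2)
  have cont: "continuous_on V ?a" "continuous_on V ?b"
    using Ck_on_continuous[OF V] Ck_on_SucD(1)[OF Ck_on_SucD(1)[OF f2]] ij by blast+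
  have "\<bar>?a y - ?b y\<bar> \<le> e" if "e > 0" for e
  proof -
    have e: "e / 2 > 0" using that by simp
    obtain \<delta>1 where d1: "\<delta>1 > 0"
      "\<And>z. (\<And>i. i < n \<Longrightarrow> \<bar>z i - y i\<bar> < \<delta>1) \<Longrightarrow> (\<And>i. i \<ge> n \<Longrightarrow> z i = 0) \<Longrightarrow> z \<in> V \<and> \<bar>?a z - ?a y\<bar> < e/2"
      using continuous_on_box[OF V cont(1) y e] by blast
    obtain \<delta>2 where d2: "\<delta>2 > 0"
      "\<And>z. (\<And>i. i < n \<Longrightarrow> \<bar>z i - y i\<bar> < \<delta>2) \<Longrightarrow> (\<And>i. i \<ge> n \<Longrightarrow> z i = 0) \<Longrightarrow> z \<in> V \<and> \<bar>?b z - ?b y\<bar> < e/2"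
      using continuous_on_box[OF V cont(2) y e] by blast
    define h where "h = min \<delta>1 \<delta>2 / 2"
    have h: "h > 0" "h < \<delta>1" "h < \<delta>2" using d1(1) d2(1) by (auto simp: h_def min_def)
    have box: "z \<in> V" if "\<And>i. i < n \<Longrightarrow> \<bar>z i - y i\<bar> \<le> h" "\<And>i. i \<ge> n \<Longrightarrow> z i = 0" for z
      using d1(2)[of z] that h by (meson le_less_trans)
    obtain z where z: "\<forall>i<n. \<bar>z i - y i\<bar> \<le> h" "\<forall>i\<ge>n. z i = 0"
      "f (y(i := y i + h, j := y j + h)) - f (y(i := y i + h)) - f (y(j := y j + h)) + f y = h * h * ?b z"
      using second_difference[OF V y ij False f h(1) box] by blast
    obtain w where w: "\<forall>i<n. \<bar>w i - y i\<bar> \<le> h" "\<forall>i\<ge>n. w i = 0"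
      "f (y(j := y j + h, i := y i + h)) - f (y(j := y j + h)) - f (y(i := y i + h)) + f y = h * h * ?a w"
      using second_difference[OF V y ij(2,1) False[symmetric] f h(1) box] by blast
    have "h * h * ?b z = h * h * ?a w"
      using z(3) w(3) unfolding fun_upd_twist[OF False, of y] by linarith
    then have "?b z = ?a w" using h(1) by simp
    moreover have "\<bar>?a w - ?a y\<bar> < e/2" using d1(2)[of w] w h by (meson le_less_trans)
    moreover have "\<bar>?b z - ?b y\<bar> < e/2" using d2(2)[of z] z h by (meson le_less_trans)
    ultimately show ?thesis by linarith
  qed
  then show ?thesis by (metis abs_le_zero_iff eq_iff_diff_eq_0 field_le_epsilon add_0)
qed simp

section \<open>Smooth functions and bump functions on the model space\<close>

lemma Cinf_on_eqI:
  "openin (Euclidean_space n) V \<Longrightarrow> Cinf_on n V f \<Longrightarrow> (\<And>z. z \<in> V \<Longrightarrow> f z = g z) \<Longrightarrow> Cinf_on n V g"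
  unfolding Cinf_on_def using Ck_on_cong by metis

lemma Cinf_on_subset: "Cinf_on n V f \<Longrightarrow> U \<subseteq> V \<Longrightarrow> Cinf_on n U f"
  unfolding Cinf_on_def using Ck_on_subset by blast

lemma Cinf_on_local:
  assumes "openin (Euclidean_space n) V"
    and "\<And>y. y \<in> V \<Longrightarrow> \<exists>U. openin (Euclidean_space n) U \<and> y \<in> U \<and> U \<subseteq> V \<and> Cinf_on n U f"
  shows "Cinf_on n V f"
  unfolding Cinf_on_def
  by (intro allI Ck_on_local[OF assms(1)]) (meson assms(2) Cinf_on_def)

lemma Cinf_on_pderiv: "Cinf_on n V f \<Longrightarrow> i < n \<Longrightarrow> Cinf_on n V (pderiv_at i f)"
  unfolding Cinf_on_def using Ck_on_SucD(1) by blast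

lemma Cinf_on_has_pderiv: "Cinf_on n V f \<Longrightarrow> i < n \<Longrightarrow> y \<in> V \<Longrightarrow> has_pderiv i f y (pderiv_at i f y)"
  unfolding Cinf_on_def using Ck_on_SucD(2) by blast

lemma Cinf_on_comp:
  assumes "openin (Euclidean_space n) V" "openin (Euclidean_space m) W"
    "\<And>y. y \<in> V \<Longrightarrow> \<phi> y \<in> W" "\<And>j. j < m \<Longrightarrow> Cinf_on n V (\<lambda>y. \<phi> y j)" "Cinf_on m W f"
  shows "Cinf_on n V (\<lambda>y. f (\<phi> y))"
  using assms(5) Ck_on_comp[OF assms(1-4)] unfolding Cinf_on_def by blast

text \<open>The function \<open>exp (- 1 / t)\<close> times powers of \<open>1 / t\<close>, extended
  by \<open>0\<close>. The powers make the family closed under differentiation up to linear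
  combinations, so smoothness follows by one induction for all members at once.\<close>

definition flat :: "nat \<Rightarrow> real \<Rightarrow> real" where
  "flat k t = (if t \<le> 0 then 0 else inverse t ^ k * exp (- inverse t))"

lemma flat_tendsto_0: "(flat k \<longlongrightarrow> 0) (at 0)"
proof -
  have "((\<lambda>t. inverse t ^ k / exp (inverse t)) \<longlongrightarrow> 0) (at_right (0::real))"
    by (rule filterlim_compose[OF tendsto_power_div_exp_0 filterlim_inverse_at_top_right])
  then have "(flat k \<longlongrightarrow> 0) (at_right 0)"
    by (rule Lim_transform_eventually)
      (auto simp: eventually_at_filter flat_def exp_minus field_simps)
  moreover have "(flat k \<longlongrightarrow> 0) (at_left 0)"
    by (rule tendsto_eventually) (auto simp: eventually_at_filter flat_def)
  ultimately show ?thesis by (simp add: filterlim_at_split)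
qed

lemma DERIV_flat: "(flat k has_real_derivative flat (k + 2) t - real k * flat (k + 1) t) (at t)"
proof (cases t "0::real" rule: linorder_cases)
  case less
  have "((\<lambda>t. 0) has_real_derivative 0) (at t)" by simp
  moreover have "\<forall>\<^sub>F s in nhds t. flat k s = 0"
    using eventually_nhds_in_open[of "{..<0}" t] less by (auto elim!: eventually_mono simp: flat_def)
  ultimately have "(flat k has_real_derivative 0) (at t)"
    using DERIV_cong_ev[OF refl _ refl, of "flat k" "\<lambda>t. 0" t 0] by simp
  then show ?thesis using less by (simp add: flat_def)
next
  case equal
  have "flat l 0 = 0" for l by (simp add: flat_def)
  \<comment> \<open>The difference quotient at \<open>0\<close> is the next member of the family,
    which tends to \<open>0\<close>.\<close>
  moreover have "flat k s / s = flat (k + 1) s" for s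
    by (simp add: flat_def field_simps)
  ultimately show ?thesis
    using flat_tendsto_0[of "k + 1"] equal by (simp add: has_field_derivative_iff)
next
  case greater
  have "((\<lambda>t. inverse t ^ k * exp (- inverse t)) has_real_derivative
      flat (k + 2) t - real k * flat (k + 1) t) (at t)"
  proof -
    have inv: "(inverse has_real_derivative - (inverse t)\<^sup>2) (at t)"
      using DERIV_inverse[of t] greater by (simp add: numeral_2_eq_2)
    have pow: "((\<lambda>t. inverse t ^ k) has_real_derivative - (real k * inverse t ^ (k + 1))) (at t)"
      by (rule DERIV_cong[OF DERIV_power[OF inv, of k]]) (cases k; simp add: power2_eq_square)
    have ex: "((\<lambda>t. exp (- inverse t)) has_real_derivative exp (- inverse t) * (inverse t)\<^sup>2) (at t)"
      using DERIV_chain2[OF DERIV_exp DERIV_minus[OF inv]] by simp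
    show ?thesis
      using DERIV_mult[OF pow ex] greater by (simp add: flat_def algebra_simps power2_eq_square)
  qed
  moreover have "\<forall>\<^sub>F s in nhds t. flat k s = inverse s ^ k * exp (- inverse s)"
    using eventually_nhds_in_open[of "{0<..}" t] greater by (auto elim!: eventually_mono simp: flat_def)
  ultimately show ?thesis by (simp only: DERIV_cong_ev[OF refl _ refl])
qed

lemma Ck_on_flat:
  assumes V: "openin (Euclidean_space n) V" and f: "Cinf_on n V f"
  shows "Ck_on k n V (\<lambda>y. flat l (f y))"
proof (induction k arbitrary: l)
  have "continuous_on UNIV (flat l)" for l
    by (intro continuous_at_imp_continuous_on ballI DERIV_isCont[OF DERIV_flat])
  moreover have "continuous_on V f" using f Ck_on_continuous[OF V] unfolding Cinf_on_def by blast
  ultimately have cont: "continuous_on V (\<lambda>y. flat l (f y))" for l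
    by (metis continuous_on_compose2 subset_UNIV)
  {
    case 0
    then show ?case using cont by (simp add: continuous_map_Euclidean_iff[OF V])
  next
    case (Suc k)
    show ?case
    proof (rule Ck_on_SucI[OF V cont])
      fix i assume i: "i < n"
      let ?g = "\<lambda>y. (flat (l + 2) (f y) + (- real l) * flat (l + 1) (f y)) * pderiv_at i f y"
      have "Ck_on k n V ?g"
        by (intro Ck_on_mult[OF V] Ck_on_add[OF V] Suc.IH Ck_on_const[OF V])
          (use Cinf_on_pderiv[OF f i] in \<open>simp add: Cinf_on_def\<close>)
      moreover have "has_pderiv i (\<lambda>y. flat l (f y)) y (?g y)" if "y \<in> V" for y
        using DERIV_chain2[OF DERIV_flat Cinf_on_has_pderiv[OF f i that, unfolded has_pderiv_def], of l]
        by (simp add: has_pderiv_def)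
      ultimately show "\<exists>g. Ck_on k n V g \<and> (\<forall>y\<in>V. has_pderiv i (\<lambda>y. flat l (f y)) y (g y))" by blast
    qed
  }
qed

text \<open>\<open>\<beta>\<close> is \<open>flat 0\<close> of \<open>g\<close>, the squared radius
  minus the squared distance from \<open>y\<close>, normalised at \<open>y\<close>. As
  \<open>g\<close> is maximal at \<open>y\<close>, the first derivatives vanish there; where
  \<open>g\<close> is positive, each coordinate is within \<open>\<delta>\<close> of that of
  \<open>y\<close>.\<close>

lemma Euclidean_bump:
  assumes V: "openin (Euclidean_space n) V" and y: "y \<in> V"
  obtains \<beta> K where "Cinf_on n (topspace (Euclidean_space n)) \<beta>" "\<beta> y = 1"
    "\<And>i. i < n \<Longrightarrow> has_pderiv i \<beta> y 0" "compactin (Euclidean_space n) K" "K \<subseteq> V"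
    "\<And>z. z \<in> topspace (Euclidean_space n) \<Longrightarrow> \<beta> z \<noteq> 0 \<Longrightarrow> z \<in> K"
proof -
  let ?E = "topspace (Euclidean_space n)"
  have E: "openin (Euclidean_space n) ?E" by simp
  obtain \<epsilon> where \<epsilon>: "\<epsilon> > 0"
    "\<And>z. (\<And>i. i < n \<Longrightarrow> \<bar>z i - y i\<bar> < \<epsilon>) \<Longrightarrow> (\<And>i. i \<ge> n \<Longrightarrow> z i = 0) \<Longrightarrow> z \<in> V"
    using openin_Euclidean_box[OF V y] by blast
  define \<delta> where "\<delta> = \<epsilon> / 2"
  have \<delta>: "0 < \<delta>" "\<delta> < \<epsilon>" using \<epsilon>(1) by (auto simp: \<delta>_def)
  \<comment> \<open>Written with sums and products only, for which \<open>Ck_on\<close> has closure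
    rules.\<close>
  define g where "g z = \<delta>\<^sup>2 + (\<Sum>i<n. (- 1) * ((z i + (- y i)) * (z i + (- y i))))" for z :: "nat \<Rightarrow> real"
  define \<beta> where "\<beta> z = inverse (flat 0 (\<delta>\<^sup>2)) * flat 0 (g z)" for z
  \<comment> \<open>A box instead of a ball: as a product of compact intervals, with
    \<open>{0}\<close> for the coordinates beyond \<open>n\<close>, it is compact by Tychonoff's
    theorem.\<close>
  define K where "K = (\<Pi>\<^sub>E i\<in>UNIV. if i < n then {y i - \<delta>..y i + \<delta>} else {0})"
  have K: "z \<in> K \<longleftrightarrow> (\<forall>i<n. \<bar>z i - y i\<bar> \<le> \<delta>) \<and> (\<forall>i\<ge>n. z i = 0)" for z
  proof -
    have "z i \<in> (if i < n then {y i - \<delta>..y i + \<delta>} else {0}) \<longleftrightarrow>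
        (if i < n then \<bar>z i - y i\<bar> \<le> \<delta> else z i = 0)" for i
      by (simp add: abs_le_iff) linarith
    then have "z \<in> K \<longleftrightarrow> (\<forall>i. if i < n then \<bar>z i - y i\<bar> \<le> \<delta> else z i = 0)"
      by (simp add: K_def PiE_iff)
    then show ?thesis by (meson not_less)
  qed
  have f0: "flat 0 (\<delta>\<^sup>2) \<noteq> 0" using \<delta> by (simp add: flat_def)
  have gy: "g (y(i := t)) = \<delta>\<^sup>2 - (t - y i)\<^sup>2" if "i < n" for i t
  proof -
    have "(\<Sum>j<n. (- 1) * (((y(i := t)) j + (- y j)) * ((y(i := t)) j + (- y j)))) =
        (\<Sum>j<n. if j = i then - (t - y i)\<^sup>2 else 0)"
      by (rule sum.cong) (auto simp: power2_eq_square)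
    then show ?thesis using that by (simp add: g_def)
  qed
  have "Cinf_on n ?E g"
    unfolding Cinf_on_def g_def
    by (intro allI Ck_on_add[OF E] Ck_on_sum[OF E] Ck_on_mult[OF E] Ck_on_const[OF E] Ck_on_coord[OF E])
  then have "Cinf_on n ?E \<beta>"
    unfolding Cinf_on_def[of n ?E \<beta>] \<beta>_def
    by (intro allI Ck_on_mult[OF E] Ck_on_const[OF E] Ck_on_flat[OF E])
  moreover have "\<beta> y = 1" using f0 by (simp add: \<beta>_def g_def)
  moreover have "has_pderiv i \<beta> y 0" if "i < n" for i
  proof -
    have "((\<lambda>t. \<delta>\<^sup>2 - (t - y i)\<^sup>2) has_real_derivative 0) (at (y i))"
      by (auto intro!: derivative_eq_intros)
    from DERIV_chain2[OF DERIV_flat this, of 0]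
    have "((\<lambda>t. flat 0 (\<delta>\<^sup>2 - (t - y i)\<^sup>2)) has_real_derivative 0) (at (y i))" by simp
    from DERIV_cmult[OF this] show ?thesis by (simp add: has_pderiv_def \<beta>_def gy[OF that])
  qed
  moreover have "compactin (Euclidean_space n) K"
  proof -
    have "compactin (powertop_real UNIV) K" unfolding K_def compactin_PiE by auto
    then show ?thesis using K by (auto simp: Euclidean_space_def compactin_subtopology)
  qed
  moreover have "K \<subseteq> V"
  proof
    fix z assume "z \<in> K"
    then show "z \<in> V" using K[of z] \<delta> by (intro \<epsilon>(2)) (auto intro: le_less_trans)
  qed
  moreover have "z \<in> K" if "z \<in> ?E" "\<beta> z \<noteq> 0" for z
  proof -
    have "g z > 0" using that(2) by (auto simp: \<beta>_def flat_def split: if_splits)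
    then have s: "(\<Sum>i<n. (z i - y i)\<^sup>2) < \<delta>\<^sup>2" by (simp add: g_def sum_negf power2_eq_square)
    have "\<bar>z i - y i\<bar> \<le> \<delta>" if "i < n" for i
    proof -
      have "(z i - y i)\<^sup>2 \<le> (\<Sum>i<n. (z i - y i)\<^sup>2)"
        by (rule member_le_sum) (use that in auto)
      with s have "\<bar>z i - y i\<bar>\<^sup>2 \<le> \<delta>\<^sup>2" by simp
      then show ?thesis using \<delta>(1) by (rule power2_le_imp_le[OF _ less_imp_le])
    qed
    then show ?thesis using K that(1) by (simp add: topspace_Euclidean_space)
  qed
  ultimately show ?thesis using that by blast
qed

section \<open>Smooth functions and sections of a vector bundle\<close>

locale smooth_bundle =
  fixes B :: "('m, 'v::real_vector) vbundle"
  assumes vector_bundle: "vector_bundle B"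
begin

abbreviation "M \<equiv> base B"
abbreviation "n \<equiv> bdim B"
abbreviation "r \<equiv> rnk B"

section \<open>Charts and their inverses\<close>

lemma manifold: "smooth_manifold M n (charts B)"
  using vector_bundle by (simp add: vector_bundle_def)

lemma Hausdorff: "Hausdorff_space M"
  using manifold by (simp add: smooth_manifold_def)

lemma chart_cover: "x \<in> topspace M \<Longrightarrow> \<exists>c\<in>charts B. x \<in> fst c"
  using manifold by (auto simp: smooth_manifold_def)

lemma frame_cover: "x \<in> topspace M \<Longrightarrow> \<exists>e\<in>frames B. x \<in> fst e"
  using vector_bundle by (auto simp: vector_bundle_def)

lemma open_chart: "c \<in> charts B \<Longrightarrow> openin M (fst c)"
  using manifold by (auto simp: smooth_manifold_def)

lemma open_frame: "e \<in> frames B \<Longrightarrow> openin M (fst e)"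
  using vector_bundle by (auto simp: vector_bundle_def)

lemma chart_homeo:
  assumes "c \<in> charts B"
  shows "homeomorphic_map (subtopology M (fst c)) (subtopology (Euclidean_space n) (snd c ` fst c)) (snd c)"
    and "openin (Euclidean_space n) (snd c ` fst c)"
  using manifold assms by (auto simp: smooth_manifold_def)

lemma topspace_chart: "c \<in> charts B \<Longrightarrow> topspace (subtopology M (fst c)) = fst c"
  using openin_subset[OF open_chart] by (simp add: inf.absorb2)

lemma chart_inj: "c \<in> charts B \<Longrightarrow> inj_on (snd c) (fst c)"
  by (metis homeomorphic_imp_injective_map chart_homeo(1) topspace_chart)

lemma chart_inv_chart [simp]: "c \<in> charts B \<Longrightarrow> x \<in> fst c \<Longrightarrow> chart_inv c (snd c x) = x"
  by (simp add: chart_inv_def chart_inj)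

lemma chart_chart_inv: "y \<in> snd c ` fst c \<Longrightarrow> snd c (chart_inv c y) = y \<and> chart_inv c y \<in> fst c"
  unfolding chart_inv_def by (metis f_inv_into_f inv_into_into)

lemma open_chart_image:
  assumes c: "c \<in> charts B" and W: "openin M W" "W \<subseteq> fst c"
  shows "openin (Euclidean_space n) (snd c ` W)"
proof -
  have "openin (subtopology M (fst c)) W"
    using W openin_open_subtopology[OF open_chart[OF c]] by blast
  then have "openin (subtopology (Euclidean_space n) (snd c ` fst c)) (snd c ` W)"
    using homeomorphic_map_openness_eq[OF chart_homeo(1)[OF c]] by blast
  then show ?thesis
    using openin_open_subtopology[OF chart_homeo(2)[OF c]] by blast
qed

lemma open_chart_image': "c \<in> charts B \<Longrightarrow> openin M W \<Longrightarrow> openin (Euclidean_space n) (snd c ` (fst c \<inter> W))"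
  by (rule open_chart_image) (auto simp: open_chart openin_Int)

lemma transition:
  "c \<in> charts B \<Longrightarrow> d \<in> charts B \<Longrightarrow> i < n \<Longrightarrow>
    Cinf_on n (snd c ` (fst c \<inter> fst d)) (\<lambda>y. snd d (chart_inv c y) i)"
  using manifold by (auto simp: smooth_manifold_def)

section \<open>Smooth functions on the base\<close>

lemma smoothD: "smooth B W f \<Longrightarrow> c \<in> charts B \<Longrightarrow> Cinf_on n (snd c ` (fst c \<inter> W)) (f \<circ> chart_inv c)"
  by (simp add: smooth_def)

lemma smooth_subset: "smooth B W f \<Longrightarrow> U \<subseteq> W \<Longrightarrow> smooth B U f"
  unfolding smooth_def by (blast intro: Cinf_on_subset)

lemma smooth_cong:
  assumes "openin M W" "\<And>x. x \<in> W \<Longrightarrow> f x = g x" "smooth B W f"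
  shows "smooth B W g"
  unfolding smooth_def
proof
  fix c assume c: "c \<in> charts B"
  have "(f \<circ> chart_inv c) z = (g \<circ> chart_inv c) z" if "z \<in> snd c ` (fst c \<inter> W)" for z
    using that c assms(2) by auto
  then show "Cinf_on n (snd c ` (fst c \<inter> W)) (g \<circ> chart_inv c)"
    by (rule Cinf_on_eqI[OF open_chart_image'[OF c assms(1)] smoothD[OF assms(3) c]])
qed

lemma smooth_const: "openin M W \<Longrightarrow> smooth B W (\<lambda>x. a)"
  unfolding smooth_def Cinf_on_def o_def by (intro ballI allI Ck_on_const open_chart_image')

lemma smooth_add: "openin M W \<Longrightarrow> smooth B W f \<Longrightarrow> smooth B W g \<Longrightarrow> smooth B W (\<lambda>x. f x + g x)"
  unfolding smooth_def Cinf_on_def o_def by (intro ballI allI Ck_on_add open_chart_image') auto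

lemma smooth_mult: "openin M W \<Longrightarrow> smooth B W f \<Longrightarrow> smooth B W g \<Longrightarrow> smooth B W (\<lambda>x. f x * g x)"
  unfolding smooth_def Cinf_on_def o_def by (intro ballI allI Ck_on_mult open_chart_image') auto

lemma smooth_sum: "openin M W \<Longrightarrow> (\<And>a. a \<in> A \<Longrightarrow> smooth B W (f a)) \<Longrightarrow> smooth B W (\<lambda>x. \<Sum>a\<in>A. f a x)"
  unfolding smooth_def Cinf_on_def o_def by (intro ballI allI Ck_on_sum open_chart_image') auto

lemma smooth_uminus: "openin M W \<Longrightarrow> smooth B W f \<Longrightarrow> smooth B W (\<lambda>x. - f x)"
  using smooth_mult[OF _ smooth_const[of W "-1"], of f] by simp

lemma smooth_local:
  assumes W: "openin M W" and "\<And>x. x \<in> W \<Longrightarrow> \<exists>U. openin M U \<and> x \<in> U \<and> smooth B (U \<inter> W) f"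
  shows "smooth B W f"
  unfolding smooth_def
proof
  fix c assume c: "c \<in> charts B"
  show "Cinf_on n (snd c ` (fst c \<inter> W)) (f \<circ> chart_inv c)"
  proof (rule Cinf_on_local[OF open_chart_image'[OF c W]])
    fix y assume "y \<in> snd c ` (fst c \<inter> W)"
    then obtain x where x: "x \<in> fst c" "x \<in> W" "y = snd c x" by blast
    then obtain U where U: "openin M U" "x \<in> U" "smooth B (U \<inter> W) f" using assms(2) by blast
    have "openin (Euclidean_space n) (snd c ` (fst c \<inter> (U \<inter> W)))"
      using open_chart_image'[OF c openin_Int[OF U(1) W]] .
    then show "\<exists>V. openin (Euclidean_space n) V \<and> y \<in> V \<and> V \<subseteq> snd c ` (fst c \<inter> W) \<and> Cinf_on n V (f \<circ> chart_inv c)"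
      using x U smoothD[OF U(3) c] by (intro exI[of _ "snd c ` (fst c \<inter> (U \<inter> W))"]) auto
  qed
qed

text \<open>The expression in another chart is the given one composed with a transition map, which
  is smooth by the compatibility of charts.\<close>

lemma smooth_in_chart:
  assumes c: "c \<in> charts B" and W: "openin M W" "W \<subseteq> fst c" and f: "Cinf_on n (snd c ` W) (f \<circ> chart_inv c)"
  shows "smooth B W f"
  unfolding smooth_def
proof
  fix d assume d: "d \<in> charts B"
  let ?V = "snd d ` (fst d \<inter> W)"
  have V: "openin (Euclidean_space n) ?V" using open_chart_image'[OF d W(1)] .
  have "Cinf_on n ?V (\<lambda>y. (f \<circ> chart_inv c) (snd c (chart_inv d y)))"
  proof (rule Cinf_on_comp[OF V open_chart_image[OF c W] _ _ f])
    show "snd c (chart_inv d y) \<in> snd c ` W" if "y \<in> ?V" for y using that d by auto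
    show "Cinf_on n ?V (\<lambda>y. snd c (chart_inv d y) j)" if "j < n" for j
      using transition[OF d c that] by (rule Cinf_on_subset) (use W(2) in auto)
  qed
  moreover have "(f \<circ> chart_inv c) (snd c (chart_inv d y)) = (f \<circ> chart_inv d) y" if "y \<in> ?V" for y
    using that W(2) c d by auto
  ultimately show "Cinf_on n ?V (f \<circ> chart_inv d)"
    by (rule Cinf_on_eqI[OF V])
qed

lemma smooth_coord: "c \<in> charts B \<Longrightarrow> smooth B (fst c) (\<lambda>x. snd c x i)"
proof (rule smooth_in_chart)
  assume c: "c \<in> charts B"
  have "Cinf_on n (snd c ` fst c) (\<lambda>y. y i)"
    unfolding Cinf_on_def by (intro allI Ck_on_coord[OF chart_homeo(2)[OF c]])
  moreover have "z i = ((\<lambda>x. snd c x i) \<circ> chart_inv c) z" if "z \<in> snd c ` fst c" for z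
    using chart_chart_inv[OF that] by simp
  ultimately show "Cinf_on n (snd c ` fst c) ((\<lambda>x. snd c x i) \<circ> chart_inv c)"
    by (rule Cinf_on_eqI[OF chart_homeo(2)[OF c]])
qed (auto simp: open_chart)

section \<open>Partial derivatives in a chart\<close>

lemma has_partial:
  assumes "c \<in> charts B" "openin M W" "W \<subseteq> fst c" "smooth B W f" "i < n" "x \<in> W"
  shows "has_pderiv i (f \<circ> chart_inv c) (snd c x) (partial c i f x)"
  unfolding partial_def
  by (rule Cinf_on_has_pderiv[OF smoothD[OF assms(4,1)] assms(5)]) (use assms in auto)

lemma partialI: "has_pderiv i (f \<circ> chart_inv c) (snd c x) D \<Longrightarrow> partial c i f x = D"
  unfolding partial_def by (rule has_pderiv_imp)

lemma partial_cong:
  assumes "c \<in> charts B" "openin M W" "W \<subseteq> fst c" "i < n" "x \<in> W" "\<And>y. y \<in> W \<Longrightarrow> f y = g y"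
  shows "partial c i f x = partial c i g x"
  unfolding partial_def
proof (rule pderiv_at_cong[OF open_chart_image[OF assms(1-3)] _ assms(4)])
  fix z assume "z \<in> snd c ` W"
  then obtain y where "y \<in> W" "z = snd c y" by blast
  then show "(f \<circ> chart_inv c) z = (g \<circ> chart_inv c) z"
    using assms(1,3) assms(6)[of y] by (simp add: subset_iff)
qed (use assms(5) in simp)

lemma partial_const [simp]: "partial c i (\<lambda>x. a) x = 0"
  by (rule partialI) (simp add: has_pderiv_def o_def)

lemma partial_add:
  assumes "c \<in> charts B" "openin M W" "W \<subseteq> fst c" "i < n" "x \<in> W" "smooth B W f" "smooth B W g"
  shows "partial c i (\<lambda>x. f x + g x) x = partial c i f x + partial c i g x"
  using DERIV_add[OF has_partial[OF assms(1-3,6,4,5), unfolded has_pderiv_def]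
      has_partial[OF assms(1-3,7,4,5), unfolded has_pderiv_def]]
  by (intro partialI) (simp add: has_pderiv_def o_def)

lemma partial_mult:
  assumes "c \<in> charts B" "openin M W" "W \<subseteq> fst c" "i < n" "x \<in> W" "smooth B W f" "smooth B W g"
  shows "partial c i (\<lambda>x. f x * g x) x = partial c i f x * g x + f x * partial c i g x"
proof -
  have "x \<in> fst c" using assms by auto
  with DERIV_mult[OF has_partial[OF assms(1-3,6,4,5), unfolded has_pderiv_def]
      has_partial[OF assms(1-3,7,4,5), unfolded has_pderiv_def]] assms(1)
  show ?thesis by (intro partialI) (simp add: has_pderiv_def o_def algebra_simps)
qed

lemma partial_cmult:
  assumes "c \<in> charts B" "openin M W" "W \<subseteq> fst c" "i < n" "x \<in> W" "smooth B W f"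
  shows "partial c i (\<lambda>x. a * f x) x = a * partial c i f x"
  using partial_mult[OF assms(1-5) smooth_const[OF assms(2)] assms(6), of a] by simp

lemma partial_sum:
  assumes "c \<in> charts B" "openin M W" "W \<subseteq> fst c" "i < n" "x \<in> W" "\<And>a. a \<in> A \<Longrightarrow> smooth B W (f a)"
  shows "partial c i (\<lambda>x. \<Sum>a\<in>A. f a x) x = (\<Sum>a\<in>A. partial c i (f a) x)"
  using assms(6)
proof (induction A rule: infinite_finite_induct)
  case (insert a A)
  then show ?case
    using partial_add[OF assms(1-5), of "f a" "\<lambda>x. \<Sum>a\<in>A. f a x"] smooth_sum[OF assms(2), of A f] by simp
qed simp_all

lemma partial_coord:
  assumes "c \<in> charts B" "x \<in> fst c" "i < n"
  shows "partial c i (\<lambda>x. snd c x j) x = (if i = j then 1 else 0)"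
proof (rule partialI)
  have "has_pderiv i (\<lambda>y. y j) (snd c x) (if i = j then 1 else 0)" by (auto simp: has_pderiv_def)
  moreover have "has_pderiv i ((\<lambda>x. snd c x j) \<circ> chart_inv c) (snd c x) D \<longleftrightarrow> has_pderiv i (\<lambda>y. y j) (snd c x) D" for D
    by (rule has_pderiv_cong[OF chart_homeo(2)[OF assms(1)] _ assms(3)])
      (use assms(2) chart_chart_inv[of _ c] in simp_all)
  ultimately show "has_pderiv i ((\<lambda>x. snd c x j) \<circ> chart_inv c) (snd c x) (if i = j then 1 else 0)" by simp
qed

lemma smooth_partial:
  assumes "c \<in> charts B" "openin M W" "W \<subseteq> fst c" "i < n" "smooth B W f"
  shows "smooth B W (partial c i f)"
proof (rule smooth_in_chart[OF assms(1-3)])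
  have V: "openin (Euclidean_space n) (snd c ` W)" using open_chart_image[OF assms(1-3)] .
  have "fst c \<inter> W = W" using assms(3) by blast
  then have "Cinf_on n (snd c ` W) (pderiv_at i (f \<circ> chart_inv c))"
    using Cinf_on_pderiv[OF smoothD[OF assms(5,1)] assms(4)] by simp
  moreover have "pderiv_at i (f \<circ> chart_inv c) z = (partial c i f \<circ> chart_inv c) z" if "z \<in> snd c ` W" for z
  proof -
    have "snd c (chart_inv c z) = z" using chart_chart_inv[of z c] that assms(3) by blast
    then show ?thesis by (simp add: partial_def)
  qed
  ultimately show "Cinf_on n (snd c ` W) (partial c i f \<circ> chart_inv c)"
    by (rule Cinf_on_eqI[OF V])
qed

text \<open>In the chart \<open>d\<close>, the function is its expression in \<open>c\<close> after
  the transition map; the factors \<open>partial d j (\<lambda>y. snd c y i)\<close> form the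
  Jacobian matrix of that map.\<close>

lemma partial_chain:
  assumes c: "c \<in> charts B" and d: "d \<in> charts B" and W: "openin M W" "W \<subseteq> fst c" "W \<subseteq> fst d"
    and j: "j < n" and x: "x \<in> W" and f: "smooth B W f"
  shows "partial d j f x = (\<Sum>i<n. partial d j (\<lambda>y. snd c y i) x * partial c i f x)"
proof (rule partialI)
  let ?V = "snd d ` W" and ?F = "\<lambda>y. (f \<circ> chart_inv c) (snd c (chart_inv d y))"
  have V: "openin (Euclidean_space n) ?V" using open_chart_image[OF d W(1,3)] .
  have "fst c \<inter> W = W" using W by blast
  then have F: "Cinf_on n (snd c ` W) (f \<circ> chart_inv c)" using smoothD[OF f c] by simp
  have dx: "chart_inv d (snd d x) = x" using x W d by auto
  have "has_pderiv j ?F (snd d x)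
      (\<Sum>i<n. pderiv_at i (f \<circ> chart_inv c) (snd c (chart_inv d (snd d x))) * pderiv_at j (\<lambda>y. snd c (chart_inv d y) i) (snd d x))"
  proof (rule has_pderiv_comp[OF V open_chart_image[OF c W(1,2)] _ _ F[unfolded Cinf_on_def, THEN spec] j])
    show "snd c (chart_inv d y) \<in> snd c ` W" if "y \<in> ?V" for y using that d W by (auto simp: subset_iff)
    show "Cinf_on n ?V (\<lambda>y. snd c (chart_inv d y) i)" if "i < n" for i
      using transition[OF d c that] by (rule Cinf_on_subset) (use W in auto)
  qed (use x in simp)
  then have "has_pderiv j ?F (snd d x) (\<Sum>i<n. partial d j (\<lambda>y. snd c y i) x * partial c i f x)"
    by (simp add: partial_def dx o_def mult.commute)
  moreover have "has_pderiv j ?F (snd d x) D \<longleftrightarrow> has_pderiv j (f \<circ> chart_inv d) (snd d x) D" for D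
  proof (rule has_pderiv_cong[OF V _ j])
    fix z assume "z \<in> ?V"
    then obtain y where "y \<in> W" "z = snd d y" by blast
    then show "?F z = (f \<circ> chart_inv d) z" using W c d by (simp add: subset_iff)
  qed (use x in simp)
  ultimately show "has_pderiv j (f \<circ> chart_inv d) (snd d x) (\<Sum>i<n. partial d j (\<lambda>y. snd c y i) x * partial c i f x)"
    by blast
qed

lemma partial_commute:
  assumes "c \<in> charts B" "openin M W" "W \<subseteq> fst c" "i < n" "j < n" "x \<in> W" "smooth B W f"
  shows "partial c i (partial c j f) x = partial c j (partial c i f) x"
proof -
  let ?F = "f \<circ> chart_inv c"
  have V: "openin (Euclidean_space n) (snd c ` W)" using open_chart_image[OF assms(1-3)] .
  have "fst c \<inter> W = W" using assms(3) by blast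
  then have F: "Ck_on 2 n (snd c ` W) ?F" using smoothD[OF assms(7,1)] unfolding Cinf_on_def by simp
  have *: "partial c i (partial c j f) x = pderiv_at i (pderiv_at j ?F) (snd c x)" if "i < n" for i j
    unfolding partial_def[of c i]
  proof (rule pderiv_at_cong[OF V _ that])
    fix z assume "z \<in> snd c ` W"
    then have "snd c (chart_inv c z) = z" using chart_chart_inv[of z c] assms(3) by blast
    then show "(partial c j f \<circ> chart_inv c) z = pderiv_at j ?F z" by (simp add: partial_def)
  qed (use assms(6) in simp)
  show ?thesis
    unfolding *[OF assms(4)] *[OF assms(5)]
    by (rule pderiv_at_commute[OF V _ assms(4,5) F]) (use assms in simp)
qed

text \<open>The closed set \<open>K\<close> is kept explicitly because its complement is the open
  set on which an extension by zero is smooth.\<close>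

definition bump :: "'m set \<Rightarrow> 'm set \<Rightarrow> ('m \<Rightarrow> real) \<Rightarrow> bool" where
  "bump W K f \<longleftrightarrow> closedin M K \<and> K \<subseteq> W \<and> smooth B (topspace M) f \<and> (\<forall>x. x \<notin> K \<longrightarrow> f x = 0)"

text \<open>Value \<open>1\<close> and vanishing first derivatives at \<open>x\<close> ensure that a
  product with this function keeps its 1-jet at \<open>x\<close>.\<close>

lemma bump_exists:
  assumes c: "c \<in> charts B" and W: "openin M W" "W \<subseteq> fst c" and x: "x \<in> W"
  obtains f K where "bump W K f" "f x = 1" "\<And>i. i < n \<Longrightarrow> partial c i f x = 0"
proof -
  let ?V = "snd c ` W"
  have V: "openin (Euclidean_space n) ?V" using open_chart_image[OF c W] .
  obtain \<beta> K where \<beta>: "Cinf_on n (topspace (Euclidean_space n)) \<beta>" "\<beta> (snd c x) = 1"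
    "\<And>i. i < n \<Longrightarrow> has_pderiv i \<beta> (snd c x) 0" "compactin (Euclidean_space n) K" "K \<subseteq> ?V"
    "\<And>z. z \<in> topspace (Euclidean_space n) \<Longrightarrow> \<beta> z \<noteq> 0 \<Longrightarrow> z \<in> K"
    using Euclidean_bump[OF V, of "snd c x"] x by blast
  define f where "f y = (if y \<in> W then \<beta> (snd c y) else 0)" for y
  define L where "L = chart_inv c ` K"
  have "compactin (subtopology (Euclidean_space n) (snd c ` fst c)) K"
    using \<beta>(4,5) W(2) by (auto simp: compactin_subtopology)
  moreover have "continuous_map (subtopology (Euclidean_space n) (snd c ` fst c)) M (chart_inv c)"
  proof -
    obtain g where g: "homeomorphic_maps (subtopology M (fst c)) (subtopology (Euclidean_space n) (snd c ` fst c)) (snd c) g"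
      using chart_homeo(1)[OF c] unfolding homeomorphic_map_maps by blast
    have "g y = chart_inv c y" if "y \<in> snd c ` fst c" for y
      using that g c openin_subset[OF open_chart[OF c]] by (auto simp: homeomorphic_maps_def)
    moreover have "topspace (subtopology (Euclidean_space n) (snd c ` fst c)) \<subseteq> snd c ` fst c" by simp
    ultimately show ?thesis
      using g continuous_map_eq[of "subtopology (Euclidean_space n) (snd c ` fst c)" M g "chart_inv c"]
      unfolding homeomorphic_maps_def continuous_map_in_subtopology by blast
  qed
  ultimately have "compactin M L" unfolding L_def by (rule image_compactin)
  \<comment> \<open>Here the Hausdorff property of the base enters: the compact set \<open>L\<close>
    is closed, so \<open>f\<close> is zero on the open set outside it.\<close>
  then have L: "closedin M L" using Hausdorff compactin_imp_closedin by blast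
  have LW: "L \<subseteq> W" using \<beta>(5) W(2) c unfolding L_def by fastforce
  have zero: "f y = 0" if "y \<notin> L" for y
  proof (cases "y \<in> W")
    case True
    then have y: "y \<in> fst c" using W by blast
    have "snd c y \<in> topspace (Euclidean_space n)"
      using True openin_subset[OF V] by blast
    moreover have "snd c y \<notin> K"
    proof
      assume "snd c y \<in> K"
      then have "chart_inv c (snd c y) \<in> L" unfolding L_def by blast
      then show False using that y c by simp
    qed
    ultimately show ?thesis using \<beta>(6) True by (auto simp: f_def)
  qed (simp add: f_def)
  have fW: "smooth B W f"
  proof (rule smooth_in_chart[OF c W])
    have "?V \<subseteq> topspace (Euclidean_space n)" using openin_subset[OF V] .
    then have "Cinf_on n ?V \<beta>" using \<beta>(1) Cinf_on_subset by blast
    moreover have "\<beta> z = (f \<circ> chart_inv c) z" if z: "z \<in> ?V" for z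
    proof -
      obtain y where "y \<in> W" "z = snd c y" using z by blast
      then show ?thesis using W(2) c by (simp add: f_def subset_iff)
    qed
    ultimately show "Cinf_on n ?V (f \<circ> chart_inv c)"
      by (rule Cinf_on_eqI[OF V])
  qed
  have "smooth B (topspace M) f"
  proof (rule smooth_local)
    fix y assume "y \<in> topspace M"
    show "\<exists>U. openin M U \<and> y \<in> U \<and> smooth B (U \<inter> topspace M) f"
    proof (cases "y \<in> W")
      case True
      then show ?thesis using fW W smooth_subset[of W f "W \<inter> topspace M"] by blast
    next
      case False
      let ?U = "topspace M - L"
      have U: "openin M ?U" using L by blast
      have "smooth B ?U f"
        by (rule smooth_cong[OF U _ smooth_const[OF U, of 0]]) (use zero in auto)
      then show ?thesis using U False LW \<open>y \<in> topspace M\<close>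
        by (intro exI[of _ ?U]) (auto intro: smooth_subset)
    qed
  qed simp
  moreover have "f x = 1" using x \<beta>(2) by (simp add: f_def)
  moreover have "partial c i f x = 0" if "i < n" for i
  proof (rule partialI)
    have "has_pderiv i (f \<circ> chart_inv c) (snd c x) D \<longleftrightarrow> has_pderiv i \<beta> (snd c x) D" for D
    proof (rule has_pderiv_cong[OF V _ that])
      fix z assume "z \<in> ?V"
      then obtain y where "y \<in> W" "z = snd c y" by blast
      then show "(f \<circ> chart_inv c) z = \<beta> z" using W(2) c by (simp add: f_def subset_iff)
    qed (use x in simp)
    then show "has_pderiv i (f \<circ> chart_inv c) (snd c x) 0" using \<beta>(3)[OF that] by blast
  qed
  ultimately show ?thesis using that[of L f] L LW zero unfolding bump_def by blast
qed

text \<open>\<open>g\<close> is controlled only on \<open>V \<inter> W\<close>; elsewhere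
  \<open>f\<close> is zero and hides it. This turns local expressions into global ones.\<close>

lemma smooth_bump_mult:
  assumes f: "bump W K f" and W: "openin M W" and V: "openin M V" and g: "smooth B (V \<inter> W) g"
  shows "smooth B V (\<lambda>x. f x * g x)"
proof (rule smooth_local[OF V])
  fix x assume x: "x \<in> V"
  show "\<exists>U. openin M U \<and> x \<in> U \<and> smooth B (U \<inter> V) (\<lambda>x. f x * g x)"
  proof (cases "x \<in> W")
    case True
    have "smooth B (W \<inter> V) (\<lambda>x. f x * g x)"
    proof (rule smooth_mult)
      show "smooth B (W \<inter> V) f"
        using f openin_subset[OF W] unfolding bump_def by (auto intro: smooth_subset)
      show "smooth B (W \<inter> V) g" using g by (simp add: Int_commute)
    qed (simp add: W V openin_Int)
    then show ?thesis using True W by blast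
  next
    case False
    let ?U = "topspace M - K"
    have U: "openin M ?U" using f by (auto simp: bump_def)
    have UV: "openin M (?U \<inter> V)" using U V by (rule openin_Int)
    have "smooth B (?U \<inter> V) (\<lambda>x. f x * g x)"
      by (rule smooth_cong[OF UV _ smooth_const[OF UV, of 0]]) (use f in \<open>auto simp: bump_def\<close>)
    moreover have "x \<in> ?U" using x openin_subset[OF V] False f by (auto simp: bump_def)
    ultimately show ?thesis using U by blast
  qed
qed

end

context smooth_bundle
begin

abbreviation "fc \<equiv> frame_coeff B"

section \<open>Fibres, frames and components of sections\<close>

lemma frame_basis:
  assumes "e \<in> frames B" "x \<in> fst e"
  shows "inj_on (\<lambda>\<alpha>. snd e \<alpha> x) {..<r}" "independent ((\<lambda>\<alpha>. snd e \<alpha> x) ` {..<r})"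
    "span ((\<lambda>\<alpha>. snd e \<alpha> x) ` {..<r}) = fibre B x"
  using vector_bundle assms by (auto simp: vector_bundle_def)

lemma subspace_fibre: "subspace (fibre B x)"
proof (cases "x \<in> topspace M")
  case True
  then show ?thesis using frame_cover frame_basis(3) subspace_span by metis
next
  case False
  then have "fibre B x = {0}" using vector_bundle by (auto simp: vector_bundle_def)
  then show ?thesis by simp
qed

lemma fibre_outside: "x \<notin> topspace M \<Longrightarrow> fibre B x = {0}"
  using vector_bundle by (auto simp: vector_bundle_def)

lemma fibre_0 [simp]: "0 \<in> fibre B x"
  using subspace_fibre subspace_0 by blast

lemma fibre_add: "v \<in> fibre B x \<Longrightarrow> w \<in> fibre B x \<Longrightarrow> v + w \<in> fibre B x"
  using subspace_fibre subspace_add by blast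

lemma fibre_scale: "v \<in> fibre B x \<Longrightarrow> t *\<^sub>R v \<in> fibre B x"
  using subspace_fibre subspace_scale by blast

lemma fibre_sum: "(\<And>i. i \<in> A \<Longrightarrow> f i \<in> fibre B x) \<Longrightarrow> sum f A \<in> fibre B x"
  using subspace_fibre subspace_sum by blast

lemma frame_in_fibre: "e \<in> frames B \<Longrightarrow> x \<in> fst e \<Longrightarrow> \<alpha> < r \<Longrightarrow> snd e \<alpha> x \<in> fibre B x"
  using frame_basis(3)[of e x] span_base[of "snd e \<alpha> x" "(\<lambda>\<alpha>. snd e \<alpha> x) ` {..<r}"] by auto

context
  fixes e x
  assumes e: "e \<in> frames B" and x: "x \<in> fst e"
begin

lemma coeff_add: "v \<in> fibre B x \<Longrightarrow> w \<in> fibre B x \<Longrightarrow> fc e \<alpha> x (v + w) = fc e \<alpha> x v + fc e \<alpha> x w"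
  unfolding frame_coeff_def using frame_basis[OF e x] by (simp add: representation_add)

lemma coeff_diff: "v \<in> fibre B x \<Longrightarrow> w \<in> fibre B x \<Longrightarrow> fc e \<alpha> x (v - w) = fc e \<alpha> x v - fc e \<alpha> x w"
  unfolding frame_coeff_def using frame_basis[OF e x] by (simp add: representation_diff)

lemma coeff_scale: "v \<in> fibre B x \<Longrightarrow> fc e \<alpha> x (t *\<^sub>R v) = t * fc e \<alpha> x v"
  unfolding frame_coeff_def using frame_basis[OF e x] by (simp add: representation_scale)

lemma coeff_0 [simp]: "fc e \<alpha> x 0 = 0"
  unfolding frame_coeff_def by (simp add: representation_zero)

lemma coeff_frame:
  assumes "\<alpha> < r" "\<beta> < r"
  shows "fc e \<alpha> x (snd e \<beta> x) = (if \<alpha> = \<beta> then 1 else 0)"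
  unfolding frame_coeff_def
  using representation_basis[OF frame_basis(2)[OF e x], of "snd e \<beta> x"] frame_basis(1)[OF e x] assms
  by (auto simp: inj_on_def)

lemma coeff_sum:
  assumes "finite A" "\<And>i. i \<in> A \<Longrightarrow> f i \<in> fibre B x"
  shows "fc e \<alpha> x (\<Sum>i\<in>A. f i) = (\<Sum>i\<in>A. fc e \<alpha> x (f i))"
  using assms by (induction A rule: finite_induct) (auto simp: coeff_add fibre_sum)

lemma coeff_expand:
  assumes "v \<in> fibre B x"
  shows "v = (\<Sum>\<alpha><r. fc e \<alpha> x v *\<^sub>R snd e \<alpha> x)"
proof -
  let ?b = "(\<lambda>\<alpha>. snd e \<alpha> x) ` {..<r}"
  have "(\<Sum>b\<in>?b. representation ?b v b *\<^sub>R b) = v"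
    by (rule sum_representation_eq[OF frame_basis(2)[OF e x]]) (use assms frame_basis(3)[OF e x] in auto)
  then show ?thesis
    by (simp add: sum.reindex[OF frame_basis(1)[OF e x]] frame_coeff_def)
qed

lemma coeff_sum_frame:
  assumes "\<alpha> < r"
  shows "fc e \<alpha> x (\<Sum>\<beta><r. a \<beta> *\<^sub>R snd e \<beta> x) = a \<alpha>"
proof -
  have "fc e \<alpha> x (\<Sum>\<beta><r. a \<beta> *\<^sub>R snd e \<beta> x) = (\<Sum>\<beta><r. fc e \<alpha> x (a \<beta> *\<^sub>R snd e \<beta> x))"
    by (rule coeff_sum) (auto simp: fibre_scale frame_in_fibre[OF e x])
  also have "\<dots> = (\<Sum>\<beta><r. if \<beta> = \<alpha> then a \<beta> else 0)"
    using assms by (intro sum.cong) (auto simp: frame_in_fibre[OF e x] coeff_scale coeff_frame)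
  finally show ?thesis using assms by simp
qed

lemma coeff_eqI:
  assumes "v \<in> fibre B x" "w \<in> fibre B x" "\<And>\<alpha>. \<alpha> < r \<Longrightarrow> fc e \<alpha> x v = fc e \<alpha> x w"
  shows "v = w"
  by (subst coeff_expand[OF assms(1)], subst coeff_expand[OF assms(2)]) (simp add: assms(3))

end

lemma coeff_change:
  assumes "e \<in> frames B" "e' \<in> frames B" "x \<in> fst e" "x \<in> fst e'" "v \<in> fibre B x"
  shows "fc e' \<alpha> x v = (\<Sum>\<beta><r. fc e' \<alpha> x (snd e \<beta> x) * fc e \<beta> x v)"
proof -
  have "fc e' \<alpha> x v = fc e' \<alpha> x (\<Sum>\<beta><r. fc e \<beta> x v *\<^sub>R snd e \<beta> x)"
    using coeff_expand[OF assms(1,3,5)] by simp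
  also have "\<dots> = (\<Sum>\<beta><r. fc e' \<alpha> x (snd e \<beta> x) * fc e \<beta> x v)"
    by (subst coeff_sum[OF assms(2,4)])
      (auto simp: fibre_scale frame_in_fibre[OF assms(1,3)] coeff_scale[OF assms(2,4)] mult.commute)
  finally show ?thesis .
qed

lemma coeff_change_inverse:
  assumes "e \<in> frames B" "e' \<in> frames B" "x \<in> fst e" "x \<in> fst e'" "\<alpha> < r" "\<gamma> < r"
  shows "(\<Sum>\<beta><r. fc e' \<alpha> x (snd e \<beta> x) * fc e \<beta> x (snd e' \<gamma> x)) = (if \<alpha> = \<gamma> then 1 else 0)"
  using coeff_change[OF assms(1-4) frame_in_fibre[OF assms(2,4,6)]] coeff_frame[OF assms(2,4,5,6)] by simp

lemma smooth_change:
  assumes "e \<in> frames B" "e' \<in> frames B" "\<alpha> < r" "\<beta> < r"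
  shows "smooth B (fst e \<inter> fst e') (\<lambda>x. fc e' \<alpha> x (snd e \<beta> x))"
  using vector_bundle assms unfolding vector_bundle_def by blast

lemma section_in_fibre: "X \<in> sections B \<Longrightarrow> X x \<in> fibre B x"
  by (simp add: sections_def)

lemma section_smooth: "X \<in> sections B \<Longrightarrow> e \<in> frames B \<Longrightarrow> \<alpha> < r \<Longrightarrow> smooth B (fst e) (\<lambda>x. fc e \<alpha> x (X x))"
  by (simp add: sections_def)

lemma sectionI:
  "(\<And>x. X x \<in> fibre B x) \<Longrightarrow>
    (\<And>e \<alpha>. e \<in> frames B \<Longrightarrow> \<alpha> < r \<Longrightarrow> smooth B (fst e) (\<lambda>x. fc e \<alpha> x (X x))) \<Longrightarrow> X \<in> sections B"
  by (simp add: sections_def)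

lemma section_eqI:
  assumes "X \<in> sections B" "Y \<in> sections B"
    "\<And>e x \<alpha>. e \<in> frames B \<Longrightarrow> x \<in> fst e \<Longrightarrow> \<alpha> < r \<Longrightarrow> fc e \<alpha> x (X x) = fc e \<alpha> x (Y x)"
  shows "X = Y"
proof
  fix x
  show "X x = Y x"
  proof (cases "x \<in> topspace M")
    case True
    then obtain e where "e \<in> frames B" "x \<in> fst e" using frame_cover by blast
    then show ?thesis using assms coeff_eqI section_in_fibre by metis
  next
    case False
    then show ?thesis using section_in_fibre[OF assms(1), of x] section_in_fibre[OF assms(2), of x] fibre_outside[of x] by auto
  qed
qed

lemma zero_section: "(\<lambda>x. 0) \<in> sections B"
proof (rule sectionI)
  fix e \<alpha> assume e: "e \<in> frames B"
  show "smooth B (fst e) (\<lambda>x. fc e \<alpha> x 0)"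
    by (rule smooth_cong[OF open_frame[OF e] _ smooth_const[OF open_frame[OF e], of 0]]) (simp add: e)
qed simp

lemma dual_section_smooth:
  "\<xi> \<in> dual_sections B \<Longrightarrow> e \<in> frames B \<Longrightarrow> \<alpha> < r \<Longrightarrow> smooth B (fst e) (\<lambda>x. \<xi> x (snd e \<alpha> x))"
  by (simp add: dual_sections_def)

lemma dual_section_linear:
  assumes "\<xi> \<in> dual_sections B"
  shows "v \<notin> fibre B x \<Longrightarrow> \<xi> x v = 0" "v \<in> fibre B x \<Longrightarrow> w \<in> fibre B x \<Longrightarrow> \<xi> x (v + w) = \<xi> x v + \<xi> x w"
    "v \<in> fibre B x \<Longrightarrow> \<xi> x (t *\<^sub>R v) = t * \<xi> x v"
  using assms unfolding dual_sections_def dual_fibre_def by blast+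

lemma dual_fibre_sum:
  assumes "\<xi> \<in> dual_fibre B x" "finite A" "\<And>i. i \<in> A \<Longrightarrow> f i \<in> fibre B x"
  shows "\<xi> (\<Sum>i\<in>A. f i) = (\<Sum>i\<in>A. \<xi> (f i))"
  using assms(2,3)
proof (induction A rule: finite_induct)
  case empty
  have "\<xi> (0 *\<^sub>R 0) = 0 * \<xi> 0" using assms(1) fibre_0 unfolding dual_fibre_def by blast
  then show ?case by simp
next
  case (insert a A)
  then have "\<xi> (f a + sum f A) = \<xi> (f a) + \<xi> (sum f A)"
    using assms(1) fibre_sum[of A f x] unfolding dual_fibre_def by blast
  with insert show ?case by simp
qed

lemma dual_fibre_expand:
  assumes "\<xi> \<in> dual_fibre B x" "e \<in> frames B" "x \<in> fst e" "v \<in> fibre B x"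
  shows "\<xi> v = (\<Sum>\<alpha><r. fc e \<alpha> x v * \<xi> (snd e \<alpha> x))"
proof -
  have "\<xi> v = \<xi> (\<Sum>\<alpha><r. fc e \<alpha> x v *\<^sub>R snd e \<alpha> x)"
    using coeff_expand[OF assms(2-4)] by simp
  also have "\<dots> = (\<Sum>\<alpha><r. \<xi> (fc e \<alpha> x v *\<^sub>R snd e \<alpha> x))"
    by (rule dual_fibre_sum[OF assms(1)]) (auto simp: fibre_scale frame_in_fibre[OF assms(2,3)])
  also have "\<dots> = (\<Sum>\<alpha><r. fc e \<alpha> x v * \<xi> (snd e \<alpha> x))"
    using assms(1) frame_in_fibre[OF assms(2,3)] by (intro sum.cong) (auto simp: dual_fibre_def)
  finally show ?thesis .
qed

lemma open_domain: "c \<in> charts B \<Longrightarrow> e \<in> frames B \<Longrightarrow> openin M (fst c \<inter> fst e)"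
  by (simp add: open_chart open_frame openin_Int)

section \<open>Global sections with prescribed 1-jet\<close>

context
  fixes c e x
  assumes c: "c \<in> charts B" and e: "e \<in> frames B" and x: "x \<in> fst c \<inter> fst e"
begin

text \<open>The frame section is multiplied by the affine function \<open>u\<close> with the
  prescribed value and slopes at \<open>x\<close>, and cut off by a bump. The bump is
  \<open>1\<close> at \<open>x\<close> with zero derivatives, so the product has the jet of
  \<open>u\<close>.\<close>

lemma section_with_jet:
  assumes \<alpha>: "\<alpha> < r"
  obtains X where "X \<in> sections B"
    "\<And>\<beta>. \<beta> < r \<Longrightarrow> fc e \<beta> x (X x) = (if \<beta> = \<alpha> then a else 0)"
    "\<And>i \<beta>. i < n \<Longrightarrow> \<beta> < r \<Longrightarrow> partial c i (\<lambda>y. fc e \<beta> y (X y)) x = (if \<beta> = \<alpha> then b i else 0)"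
proof -
  let ?W = "fst c \<inter> fst e"
  have W: "openin M ?W" "?W \<subseteq> fst c" using open_domain[OF c e] by auto
  obtain f K where f: "bump ?W K f" "f x = 1" "\<And>i. i < n \<Longrightarrow> partial c i f x = 0"
    using bump_exists[OF c W x] by blast
  define u where "u y = a + (\<Sum>j<n. b j * (snd c y j + - snd c x j))" for y
  have us: "smooth B ?W u"
    unfolding u_def
    by (intro smooth_add smooth_sum smooth_mult smooth_const W smooth_subset[OF smooth_coord[OF c]] Int_lower1)
  have sj: "smooth B ?W (\<lambda>y. b j * (snd c y j + - snd c x j))" for j
    by (intro smooth_add smooth_mult smooth_const W smooth_subset[OF smooth_coord[OF c]] Int_lower1)
  have ux: "u x = a" by (simp add: u_def)
  have du: "partial c i u x = b i" if i: "i < n" for i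
  proof -
    have "partial c i (\<lambda>y. b j * (snd c y j + - snd c x j)) x = (if j = i then b j else 0)" for j
    proof -
      have "smooth B ?W (\<lambda>y. snd c y j)" by (rule smooth_subset[OF smooth_coord[OF c]]) auto
      then have "partial c i (\<lambda>y. b j * (snd c y j + - snd c x j)) x =
          b j * (partial c i (\<lambda>y. snd c y j) x + partial c i (\<lambda>y. - snd c x j) x)"
        by (subst partial_cmult[OF c W i x], intro smooth_add smooth_const W)
          (simp_all only: partial_add[OF c W i x] smooth_const W)
      then show ?thesis using x partial_coord[OF c _ i, of x j] by simp
    qed
    then have "(\<Sum>j<n. partial c i (\<lambda>y. b j * (snd c y j + - snd c x j)) x) = b i" using i by simp
    then have "partial c i (\<lambda>y. \<Sum>j<n. b j * (snd c y j + - snd c x j)) x = b i"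
      by (rule trans[OF partial_sum[OF c W i x sj]])
    then show ?thesis
      unfolding u_def
      by (subst partial_add[OF c W i x smooth_const[OF W(1)] smooth_sum[OF W(1) sj]])
        (simp only: partial_const add_0)
  qed
  define X where "X y = (if y \<in> ?W then (f y * u y) *\<^sub>R snd e \<alpha> y else 0)" for y
  have fs: "smooth B ?W f"
    using f(1) openin_subset[OF W(1)] unfolding bump_def by (blast intro: smooth_subset)
  have X: "X \<in> sections B"
  proof (rule sectionI)
    show "X y \<in> fibre B y" for y using frame_in_fibre[OF e _ \<alpha>] by (simp add: X_def fibre_scale)
    fix e' \<beta> assume e': "e' \<in> frames B" and \<beta>: "\<beta> < r"
    let ?g = "\<lambda>y. u y * fc e' \<beta> y (snd e \<alpha> y)"
    have "smooth B (fst e' \<inter> ?W) ?g"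
      by (intro smooth_mult openin_Int open_frame[OF e'] W smooth_subset[OF us]
          smooth_subset[OF smooth_change[OF e e' \<beta> \<alpha>]]) auto
    from smooth_bump_mult[OF f(1) W(1) open_frame[OF e'] this]
    show "smooth B (fst e') (\<lambda>y. fc e' \<beta> y (X y))"
    proof (rule smooth_cong[OF open_frame[OF e'], rotated])
      fix y assume y: "y \<in> fst e'"
      show "f y * ?g y = fc e' \<beta> y (X y)"
      proof (cases "y \<in> ?W")
        case True
        then show ?thesis using coeff_scale[OF e' y frame_in_fibre[OF e _ \<alpha>]] by (simp add: X_def)
      next
        case False
        then have "f y = 0" using f(1) unfolding bump_def by blast
        then show ?thesis using False coeff_0[OF e' y] by (simp add: X_def)
      qed
    qed
  qed
  have co: "fc e \<beta> y (X y) = (if \<beta> = \<alpha> then f y * u y else 0)" if "\<beta> < r" "y \<in> ?W" for \<beta> y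
  proof -
    have y: "y \<in> fst e" using that(2) by blast
    have "fc e \<beta> y (X y) = f y * u y * fc e \<beta> y (snd e \<alpha> y)"
      using that(2) coeff_scale[OF e y frame_in_fibre[OF e y \<alpha>]] by (simp add: X_def)
    then show ?thesis using coeff_frame[OF e y that(1) \<alpha>] by simp
  qed
  show ?thesis
  proof (rule that[OF X])
    show "fc e \<beta> x (X x) = (if \<beta> = \<alpha> then a else 0)" if "\<beta> < r" for \<beta>
      using co[OF that x] f(2) ux by simp
    fix i \<beta> assume i: "i < n" and \<beta>: "\<beta> < r"
    have "partial c i (\<lambda>y. fc e \<beta> y (X y)) x = partial c i (\<lambda>y. if \<beta> = \<alpha> then f y * u y else 0) x"
      by (rule partial_cong[OF c W i x]) (rule co[OF \<beta>])
    also have "\<dots> = (if \<beta> = \<alpha> then b i else 0)"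
      using partial_mult[OF c W i x fs us] f(2) f(3)[OF i] du[OF i] by simp
    finally show "partial c i (\<lambda>y. fc e \<beta> y (X y)) x = (if \<beta> = \<alpha> then b i else 0)" .
  qed
qed

text \<open>The bracket with this covector is \<open>dl (Theta \<alpha>)\<close> at
  \<open>x\<close>, which the uniqueness in \<open>tilde_block_endo\<close> needs.\<close>

lemma dual_section_with_value:
  assumes \<alpha>: "\<alpha> < r"
  obtains \<xi> where "\<xi> \<in> dual_sections B"
    "\<And>\<beta>. \<beta> < r \<Longrightarrow> \<xi> x (snd e \<beta> x) = (if \<beta> = \<alpha> then 1 else 0)"
    "\<And>i \<beta>. i < n \<Longrightarrow> \<beta> < r \<Longrightarrow> partial c i (\<lambda>y. \<xi> y (snd e \<beta> y)) x = 0"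
proof -
  let ?W = "fst c \<inter> fst e"
  have W: "openin M ?W" "?W \<subseteq> fst c" using open_domain[OF c e] by auto
  obtain f K where f: "bump ?W K f" "f x = 1" "\<And>i. i < n \<Longrightarrow> partial c i f x = 0"
    using bump_exists[OF c W x] by blast
  define \<xi> where "\<xi> y v = (if y \<in> ?W \<and> v \<in> fibre B y then f y * fc e \<alpha> y v else 0)" for y v
  have "\<xi> \<in> dual_sections B"
    unfolding dual_sections_def
  proof (intro CollectI conjI allI ballI impI)
    show "\<xi> y \<in> dual_fibre B y" for y
      using coeff_add[OF e] coeff_scale[OF e]
      by (auto simp: dual_fibre_def \<xi>_def fibre_add fibre_scale algebra_simps)
    fix e' \<beta> assume e': "e' \<in> frames B" and \<beta>: "\<beta> < r"
    have "smooth B (fst e' \<inter> ?W) (\<lambda>y. fc e \<alpha> y (snd e' \<beta> y))"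
      by (rule smooth_subset[OF smooth_change[OF e' e \<alpha> \<beta>]]) auto
    from smooth_bump_mult[OF f(1) W(1) open_frame[OF e'] this]
    show "smooth B (fst e') (\<lambda>y. \<xi> y (snd e' \<beta> y))"
    proof (rule smooth_cong[OF open_frame[OF e'], rotated])
      fix y assume y: "y \<in> fst e'"
      have "f y = 0" if "y \<notin> ?W" using f(1) that unfolding bump_def by blast
      then show "f y * fc e \<alpha> y (snd e' \<beta> y) = \<xi> y (snd e' \<beta> y)"
        using frame_in_fibre[OF e' y \<beta>] by (simp add: \<xi>_def)
    qed
  qed
  moreover have co: "\<xi> y (snd e \<beta> y) = (if \<beta> = \<alpha> then f y else 0)" if "\<beta> < r" "y \<in> ?W" for \<beta> y
    using that frame_in_fibre[OF e, of y \<beta>] coeff_frame[OF e _ \<alpha> that(1), of y] by (simp add: \<xi>_def)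
  moreover have "partial c i (\<lambda>y. \<xi> y (snd e \<beta> y)) x = 0" if "i < n" "\<beta> < r" for i \<beta>
  proof -
    have "partial c i (\<lambda>y. \<xi> y (snd e \<beta> y)) x = partial c i (\<lambda>y. if \<beta> = \<alpha> then f y else 0) x"
      by (rule partial_cong[OF c W that(1) x]) (rule co[OF that(2)])
    then show ?thesis using f(3)[OF that(1)] by (cases "\<beta> = \<alpha>") simp_all
  qed
  ultimately show ?thesis using that[of \<xi>] x f(2) by simp
qed

end

section \<open>Endomorphisms of the bundle\<close>

lemma endo_fibre:
  assumes "endomorphism B N"
  shows "v \<in> fibre B x \<Longrightarrow> N x v \<in> fibre B x"
    "v \<in> fibre B x \<Longrightarrow> w \<in> fibre B x \<Longrightarrow> N x (v + w) = N x v + N x w"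
    "v \<in> fibre B x \<Longrightarrow> N x (t *\<^sub>R v) = t *\<^sub>R N x v"
    "v \<notin> fibre B x \<Longrightarrow> N x v = 0"
  using assms unfolding endomorphism_def by blast+

lemma endo_smooth:
  assumes "endomorphism B N" "e \<in> frames B" "\<alpha> < r" "\<beta> < r"
  shows "smooth B (fst e) (\<lambda>x. fc e \<alpha> x (N x (snd e \<beta> x)))"
  using assms unfolding endomorphism_def by blast

lemma endo_sum:
  assumes N: "endomorphism B N" and "finite A" "\<And>i. i \<in> A \<Longrightarrow> f i \<in> fibre B x"
  shows "N x (\<Sum>i\<in>A. f i) = (\<Sum>i\<in>A. N x (f i))"
  using assms(2,3)
proof (induction A rule: finite_induct)
  case empty
  show ?case using endo_fibre(3)[OF N fibre_0, of x 0] by simp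
next
  case (insert a A)
  then show ?case by (simp add: endo_fibre(2)[OF N] fibre_sum)
qed

lemma endo_diff:
  assumes N: "endomorphism B N" and "v \<in> fibre B x" "w \<in> fibre B x"
  shows "N x (v - w) = N x v - N x w"
  using endo_fibre(2)[OF N assms(2) fibre_scale[OF assms(3)], of "-1"] endo_fibre(3)[OF N assms(3), of "-1"] by simp

lemma endo_coeff:
  assumes N: "endomorphism B N" and e: "e \<in> frames B" "x \<in> fst e" and v: "v \<in> fibre B x"
  shows "fc e \<alpha> x (N x v) = (\<Sum>\<beta><r. fc e \<alpha> x (N x (snd e \<beta> x)) * fc e \<beta> x v)"
proof -
  note f = frame_in_fibre[OF e]
  have "N x v = N x (\<Sum>\<beta><r. fc e \<beta> x v *\<^sub>R snd e \<beta> x)"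
    using coeff_expand[OF e v] by simp
  also have "\<dots> = (\<Sum>\<beta><r. fc e \<beta> x v *\<^sub>R N x (snd e \<beta> x))"
    by (subst endo_sum[OF N]) (auto simp: fibre_scale f endo_fibre(3)[OF N])
  finally have "fc e \<alpha> x (N x v) = fc e \<alpha> x (\<Sum>\<beta><r. fc e \<beta> x v *\<^sub>R N x (snd e \<beta> x))" by simp
  also have "\<dots> = (\<Sum>\<beta><r. fc e \<alpha> x (fc e \<beta> x v *\<^sub>R N x (snd e \<beta> x)))"
    by (rule coeff_sum[OF e]) (auto simp: fibre_scale endo_fibre(1)[OF N] f)
  finally show ?thesis
    by (simp add: endo_fibre(1)[OF N] f coeff_scale[OF e] mult.commute)
qed

lemma endo_section:
  assumes N: "endomorphism B N" and X: "X \<in> sections B"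
  shows "(\<lambda>x. N x (X x)) \<in> sections B"
proof (rule sectionI)
  show "N x (X x) \<in> fibre B x" for x using endo_fibre(1)[OF N section_in_fibre[OF X]] .
  fix e \<alpha> assume e: "e \<in> frames B" and \<alpha>: "\<alpha> < r"
  have W: "openin M (fst e)" using open_frame[OF e] .
  have "smooth B (fst e) (\<lambda>x. \<Sum>\<beta><r. fc e \<alpha> x (N x (snd e \<beta> x)) * fc e \<beta> x (X x))"
    by (intro smooth_sum smooth_mult W endo_smooth[OF N e \<alpha>] section_smooth[OF X e]) auto
  then show "smooth B (fst e) (\<lambda>x. fc e \<alpha> x (N x (X x)))"
    by (rule smooth_cong[OF W, rotated]) (use endo_coeff[OF N e _ section_in_fibre[OF X]] in simp)
qed

lemma endo_compose:
  assumes N: "endomorphism B N"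
  shows "endomorphism B (\<lambda>x v. N x (N x v))"
  unfolding endomorphism_def
proof (intro conjI allI ballI impI)
  fix x v w and t :: real
  show "N x (N x v) = 0" if "v \<notin> fibre B x"
    using endo_fibre(4)[OF N that] endo_fibre(3)[OF N fibre_0, of x 0] by simp
  assume v: "v \<in> fibre B x"
  show "N x (N x v) \<in> fibre B x" using endo_fibre(1)[OF N] v by blast
  show "N x (N x (t *\<^sub>R v)) = t *\<^sub>R N x (N x v)" using endo_fibre[OF N] v by simp
  assume w: "w \<in> fibre B x"
  show "N x (N x (v + w)) = N x (N x v) + N x (N x w)" using endo_fibre[OF N] v w by simp
next
  fix e \<alpha> \<beta> assume e: "e \<in> frames B" and \<alpha>: "\<alpha> < r" and \<beta>: "\<beta> < r"
  have W: "openin M (fst e)" using open_frame[OF e] .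
  have "smooth B (fst e) (\<lambda>x. \<Sum>\<gamma><r. fc e \<alpha> x (N x (snd e \<gamma> x)) * fc e \<gamma> x (N x (snd e \<beta> x)))"
    by (intro smooth_sum smooth_mult W endo_smooth[OF N e]) (auto simp: \<alpha> \<beta>)
  then show "smooth B (fst e) (\<lambda>x. fc e \<alpha> x (N x (N x (snd e \<beta> x))))"
    by (rule smooth_cong[OF W, rotated])
      (use endo_coeff[OF N e _ endo_fibre(1)[OF N frame_in_fibre[OF e _ \<beta>]]] in simp)
qed

lemma dual_endo_section:
  assumes N: "endomorphism B N" and \<xi>: "\<xi> \<in> dual_sections B"
  shows "(\<lambda>x v. - \<xi> x (N x v)) \<in> dual_sections B"
  unfolding dual_sections_def
proof (intro CollectI conjI allI ballI impI)
  have z: "\<xi> x 0 = 0" for x using dual_section_linear(3)[OF \<xi> fibre_0, of x 0] by simp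
  show "(\<lambda>v. - \<xi> x (N x v)) \<in> dual_fibre B x" for x
    using endo_fibre[OF N, of _ x] dual_section_linear[OF \<xi>, of _ x]
    by (auto simp: dual_fibre_def z)
  fix e \<alpha> assume e: "e \<in> frames B" and \<alpha>: "\<alpha> < r"
  have W: "openin M (fst e)" using open_frame[OF e] .
  have "smooth B (fst e) (\<lambda>x. - (\<Sum>\<beta><r. fc e \<beta> x (N x (snd e \<alpha> x)) * \<xi> x (snd e \<beta> x)))"
    by (intro smooth_uminus smooth_sum smooth_mult W endo_smooth[OF N e _ \<alpha>] dual_section_smooth[OF \<xi> e]) auto
  then show "smooth B (fst e) (\<lambda>x. - \<xi> x (N x (snd e \<alpha> x)))"
  proof (rule smooth_cong[OF W, rotated])
    fix x assume x: "x \<in> fst e"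
    have "\<xi> x \<in> dual_fibre B x" using \<xi> by (simp add: dual_sections_def)
    from dual_fibre_expand[OF this e x endo_fibre(1)[OF N frame_in_fibre[OF e x \<alpha>]]]
    show "- (\<Sum>\<beta><r. fc e \<beta> x (N x (snd e \<alpha> x)) * \<xi> x (snd e \<beta> x)) = - \<xi> x (N x (snd e \<alpha> x))" by simp
  qed
qed

text \<open>Skew symmetry holds because each of the two mixed pairings occurs once through
  \<open>N\<close> and once, with the opposite sign, through the transpose.\<close>

lemma skew_block_endo:
  assumes N: "endomorphism B N"
  shows "skew_endomorphism B (block_endo N)"
proof -
  have "block_endo N x u \<in> fibre B x \<times> dual_fibre B x" if "u \<in> fibre B x \<times> dual_fibre B x" for x u
  proof -
    have "\<xi> 0 = 0" if "\<xi> \<in> dual_fibre B x" for \<xi>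
    proof -
      have "\<xi> (0 *\<^sub>R 0) = 0 * \<xi> 0" using that fibre_0 unfolding dual_fibre_def by blast
      then show ?thesis by simp
    qed
    then show ?thesis using that endo_fibre[OF N, of _ x]
      by (auto simp: block_endo_def transpose_endo_def dual_fibre_def)
  qed
  moreover have "(\<lambda>x. block_endo N x (u x)) \<in> E_sections B" if "u \<in> E_sections B" for u
    using that endo_section[OF N] dual_endo_section[OF N, of "\<lambda>x. snd (u x)"]
    by (simp add: E_sections_def block_endo_def transpose_endo_def)
  ultimately show ?thesis
    using endo_fibre[OF N]
    unfolding skew_endomorphism_def E_endomorphism_def
    by (auto simp: block_endo_def transpose_endo_def E_form_def algebra_simps)
qed

end

section \<open>Functions on the graded manifold in a chart and a frame\<close>

context smooth_bundle
begin

declare split_paired_All [simp del] split_paired_Ex [simp del]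

text \<open>The monomials are bounded uniformly over \<open>W\<close> and not just at each point, so
  that coefficientwise derivatives again have finite support.\<close>

definition smooth_field :: "'m set \<Rightarrow> ('m \<Rightarrow> gp) \<Rightarrow> bool" where
  "smooth_field W F \<longleftrightarrow> (\<forall>m. smooth B W (\<lambda>x. coef (F x) m)) \<and>
     (\<exists>A. finite A \<and> (\<forall>x\<in>W. \<forall>m. coef (F x) m \<noteq> 0 \<longrightarrow> m \<in> A))"

text \<open>\<open>Gp\<close> is unspecified outside its domain; \<open>coef_gpartial\<close> gives
  the intended coefficients for smooth fields.\<close>

definition gpartial :: "'m chart \<Rightarrow> nat \<Rightarrow> ('m \<Rightarrow> gp) \<Rightarrow> 'm \<Rightarrow> gp" where
  "gpartial c i F x = Gp (\<lambda>m. partial c i (\<lambda>y. coef (F y) m) x)"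

lemma smooth_fieldI:
  "(\<And>m. smooth B W (\<lambda>x. coef (F x) m)) \<Longrightarrow> finite A \<Longrightarrow>
    (\<And>x m. x \<in> W \<Longrightarrow> coef (F x) m \<noteq> 0 \<Longrightarrow> m \<in> A) \<Longrightarrow> smooth_field W F"
  unfolding smooth_field_def by blast

lemma smooth_field_coef: "smooth_field W F \<Longrightarrow> smooth B W (\<lambda>x. coef (F x) m)"
  by (simp add: smooth_field_def)

lemma smooth_field_cong:
  assumes "openin M W" "\<And>x. x \<in> W \<Longrightarrow> F x = G x" "smooth_field W F"
  shows "smooth_field W G"
proof -
  obtain A where "finite A" "\<forall>x\<in>W. \<forall>m. coef (F x) m \<noteq> 0 \<longrightarrow> m \<in> A"
    using assms(3) unfolding smooth_field_def by blast
  moreover have "smooth B W (\<lambda>x. coef (G x) m)" for m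
    by (rule smooth_cong[OF assms(1) _ smooth_field_coef[OF assms(3), of m]]) (simp add: assms(2))
  ultimately show ?thesis using assms(2) by (intro smooth_fieldI[of W G A]) auto
qed

text \<open>\<open>dp\<close>, \<open>dl\<close>, \<open>parity\<close> and negation all rescale
  coefficients and relabel monomials, so one argument serves them all; the finiteness condition
  bounds the monomials of the result.\<close>

lemma smooth_field_linear:
  assumes W: "openin M W" and F: "smooth_field W F" and L: "linear L"
    and coefL: "\<And>a m. coef (L a) m = k m * coef a (g m)"
    and fin: "\<And>A. finite A \<Longrightarrow> finite {m. k m \<noteq> 0 \<and> g m \<in> A}"
  shows "smooth_field W (\<lambda>x. L (F x))"
proof -
  obtain A where A: "finite A" "\<forall>x\<in>W. \<forall>m. coef (F x) m \<noteq> 0 \<longrightarrow> m \<in> A"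
    using F unfolding smooth_field_def by blast
  show ?thesis
  proof (rule smooth_fieldI[OF _ fin[OF A(1)]])
    show "smooth B W (\<lambda>x. coef (L (F x)) m)" for m
      unfolding coefL by (intro smooth_mult smooth_const W smooth_field_coef[OF F])
    show "m \<in> {m. k m \<noteq> 0 \<and> g m \<in> A}" if "x \<in> W" "coef (L (F x)) m \<noteq> 0" for x m
      using that A(2) by (auto simp: coefL)
  qed
qed

lemma coef_dp_eq: "coef (dp i a) m = real (Suc (count (fst m) i)) * coef a (add_mset i (fst m), snd m)"
  by (simp add: coef_dp d_p_def split: prod.split)

lemma coef_dl_eq:
  "coef (dl h a) m = (if h \<in> snd m \<or> infinite (snd m) then 0 else koszul {h} (snd m)) * coef a (fst m, insert h (snd m))"
  by (cases "finite (snd m)") (auto simp: coef_dl d_left_def coef_infinite split: prod.split)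

lemma smooth_field_dp: "openin M W \<Longrightarrow> smooth_field W F \<Longrightarrow> smooth_field W (\<lambda>x. dp i (F x))"
proof (rule smooth_field_linear[OF _ _ linear_dp coef_dp_eq])
  fix A :: "mono set" assume "finite A"
  have "inj (\<lambda>m :: mono. (add_mset i (fst m), snd m))" by (auto simp: inj_def prod_eq_iff)
  from finite_vimageI[OF \<open>finite A\<close> this]
  show "finite {m. real (Suc (count (fst m) i)) \<noteq> 0 \<and> (add_mset i (fst m), snd m) \<in> A}"
    by (rule rev_finite_subset) auto
qed

lemma smooth_field_dl: "openin M W \<Longrightarrow> smooth_field W F \<Longrightarrow> smooth_field W (\<lambda>x. dl h (F x))"
proof (rule smooth_field_linear[OF _ _ linear_dl coef_dl_eq])
  fix A :: "mono set" assume "finite A"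
  then have "finite ((\<lambda>(P, S). (P, S - {h})) ` A)" by simp
  then show "finite {m :: mono. (if h \<in> snd m \<or> infinite (snd m) then 0 else koszul {h} (snd m)) \<noteq> 0 \<and>
      (fst m, insert h (snd m)) \<in> A}"
    by (rule rev_finite_subset) (force split: if_splits)
qed

lemma smooth_field_parity: "openin M W \<Longrightarrow> smooth_field W F \<Longrightarrow> smooth_field W (\<lambda>x. parity (F x))"
  by (rule smooth_field_linear[OF _ _ linear_parity, of W F "\<lambda>m. (-1) ^ card (snd m)" "\<lambda>m. m"])
    (auto simp: coef_parity)

lemma smooth_field_dr: "openin M W \<Longrightarrow> smooth_field W F \<Longrightarrow> smooth_field W (\<lambda>x. dr h (F x))"
  unfolding dr_def by (intro smooth_field_parity smooth_field_dl)

lemma smooth_field_uminus: "openin M W \<Longrightarrow> smooth_field W F \<Longrightarrow> smooth_field W (\<lambda>x. - F x)"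
  by (rule smooth_field_linear[where k = "\<lambda>m. -1" and g = "\<lambda>m. m"])
    (auto intro!: linearI)

lemma smooth_field_const: "openin M W \<Longrightarrow> smooth_field W (\<lambda>x. a)"
  by (rule smooth_fieldI[OF smooth_const finite_coef[of a]]) auto

lemma smooth_field_add:
  assumes W: "openin M W" and F: "smooth_field W F" and G: "smooth_field W G"
  shows "smooth_field W (\<lambda>x. F x + G x)"
proof -
  obtain A where A: "finite A" "\<forall>x\<in>W. \<forall>m. coef (F x) m \<noteq> 0 \<longrightarrow> m \<in> A"
    using F unfolding smooth_field_def by blast
  obtain C where C: "finite C" "\<forall>x\<in>W. \<forall>m. coef (G x) m \<noteq> 0 \<longrightarrow> m \<in> C"
    using G unfolding smooth_field_def by blast
  show ?thesis
  proof (rule smooth_fieldI)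
    show "smooth B W (\<lambda>x. coef (F x + G x) m)" for m
      using smooth_add[OF W smooth_field_coef[OF F] smooth_field_coef[OF G]] by simp
    show "finite (A \<union> C)" using A(1) C(1) by simp
    fix x m assume "x \<in> W" "coef (F x + G x) m \<noteq> 0"
    then show "m \<in> A \<union> C" using A(2) C(2) by (cases "coef (F x) m = 0") auto
  qed
qed

lemma smooth_field_diff:
  "openin M W \<Longrightarrow> smooth_field W F \<Longrightarrow> smooth_field W G \<Longrightarrow> smooth_field W (\<lambda>x. F x - G x)"
  using smooth_field_add[of W F "\<lambda>x. - G x"] smooth_field_uminus[of W G] by simp

lemma smooth_field_sum:
  assumes W: "openin M W" and "\<And>a. a \<in> I \<Longrightarrow> smooth_field W (F a)"
  shows "smooth_field W (\<lambda>x. \<Sum>a\<in>I. F a x)"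
  using assms(2)
  by (induction I rule: infinite_finite_induct) (auto intro: smooth_field_const smooth_field_add W)

lemma smooth_field_scaleR:
  assumes W: "openin M W" and u: "smooth B W u"
  shows "smooth_field W (\<lambda>x. u x *\<^sub>R a)"
proof (rule smooth_fieldI[OF _ finite_coef[of a]])
  show "smooth B W (\<lambda>x. coef (u x *\<^sub>R a) m)" for m
    using smooth_mult[OF W u smooth_const[OF W]] by simp
qed auto

lemma smooth_field_mult:
  assumes W: "openin M W" and F: "smooth_field W F" and G: "smooth_field W G"
  shows "smooth_field W (\<lambda>x. F x * G x)"
proof -
  obtain A where A: "finite A" "\<forall>x\<in>W. \<forall>m. coef (F x) m \<noteq> 0 \<longrightarrow> m \<in> A"
    using F unfolding smooth_field_def by blast
  obtain C where C: "finite C" "\<forall>x\<in>W. \<forall>m. coef (G x) m \<noteq> 0 \<longrightarrow> m \<in> C"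
    using G unfolding smooth_field_def by blast
  let ?f = "\<lambda>((P, S), (Q, T)). (P + Q, S \<union> T) :: mono"
  show ?thesis
  proof (rule smooth_fieldI)
    fix m :: mono
    obtain P S where m: "m = (P, S)" by (cases m)
    show "smooth B W (\<lambda>x. coef (F x * G x) m)"
      unfolding m coef_mult gmul_def split
      by (intro smooth_sum smooth_mult W smooth_const smooth_field_coef F G)
  next
    show "finite (?f ` (A \<times> C))" using A(1) C(1) by simp
  next
    fix x and m :: mono assume x: "x \<in> W" and "coef (F x * G x) m \<noteq> 0"
    moreover obtain P S where m: "m = (P, S)" by (cases m)
    ultimately obtain Q T where QT: "Q \<subseteq># P" "T \<subseteq> S" "coef (F x) (Q, T) \<noteq> 0" "coef (G x) (P - Q, S - T) \<noteq> 0"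
      using gmul_support[of "coef (F x)" "coef (G x)" P S] by (auto simp: coef_mult)
    then have "m = ?f ((Q, T), (P - Q, S - T))" by (auto simp: m)
    moreover have "((Q, T), (P - Q, S - T)) \<in> A \<times> C" using QT A(2) C(2) x by auto
    ultimately show "m \<in> ?f ` (A \<times> C)" by blast
  qed
qed

lemmas smooth_field_intros = smooth_field_mult smooth_field_sum smooth_field_add smooth_field_diff
  smooth_field_uminus smooth_field_dp smooth_field_dl smooth_field_dr smooth_field_const smooth_field_scaleR

section \<open>Derivatives of smooth fields along a chart\<close>

context
  fixes c W
  assumes c: "c \<in> charts B" and W: "openin M W" "W \<subseteq> fst c"
begin

lemma coef_gpartial:
  assumes F: "smooth_field W F" and i: "i < n" and x: "x \<in> W"
  shows "coef (gpartial c i F x) m = partial c i (\<lambda>y. coef (F y) m) x"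
proof -
  obtain A where A: "finite A" "\<forall>x\<in>W. \<forall>m. coef (F x) m \<noteq> 0 \<longrightarrow> m \<in> A"
    using F unfolding smooth_field_def by blast
  have "partial c i (\<lambda>y. coef (F y) m) x = 0" if "m \<notin> A" for m
  proof -
    have "partial c i (\<lambda>y. coef (F y) m) x = partial c i (\<lambda>y. 0) x"
      by (rule partial_cong[OF c W i x]) (use A(2) that in auto)
    then show ?thesis by simp
  qed
  then have "finite {m. partial c i (\<lambda>y. coef (F y) m) x \<noteq> 0}"
    by (intro finite_subset[OF _ A(1)]) auto
  then show ?thesis
    unfolding gpartial_def by (subst Gp_inverse) (auto simp: coef_infinite)
qed

lemma smooth_field_gpartial:
  assumes F: "smooth_field W F" and i: "i < n"
  shows "smooth_field W (gpartial c i F)"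
proof -
  obtain A where A: "finite A" "\<forall>x\<in>W. \<forall>m. coef (F x) m \<noteq> 0 \<longrightarrow> m \<in> A"
    using F unfolding smooth_field_def by blast
  show ?thesis
  proof (rule smooth_fieldI[OF _ A(1)])
    show "smooth B W (\<lambda>x. coef (gpartial c i F x) m)" for m
      using smooth_partial[OF c W i smooth_field_coef[OF F]]
      by (rule smooth_cong[OF W(1), rotated]) (simp add: coef_gpartial[OF F i])
    show "m \<in> A" if "x \<in> W" "coef (gpartial c i F x) m \<noteq> 0" for x m
    proof (rule ccontr)
      assume "m \<notin> A"
      then have "partial c i (\<lambda>y. coef (F y) m) x = partial c i (\<lambda>y. 0) x"
        by (intro partial_cong[OF c W i that(1)]) (use A(2) in auto)
      then show False using that coef_gpartial[OF F i] by simp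
    qed
  qed
qed

lemma gpartial_cong:
  assumes "i < n" "x \<in> W" "\<And>y. y \<in> W \<Longrightarrow> F y = G y"
  shows "gpartial c i F x = gpartial c i G x"
proof -
  have "partial c i (\<lambda>y. coef (F y) m) x = partial c i (\<lambda>y. coef (G y) m) x" for m
    by (rule partial_cong[OF c W assms(1,2)]) (simp add: assms(3))
  then show ?thesis by (simp add: gpartial_def)
qed

lemma gpartial_linear:
  assumes F: "smooth_field W F" and LF: "smooth_field W (\<lambda>x. L (F x))" and i: "i < n" and x: "x \<in> W"
    and coefL: "\<And>a m. coef (L a) m = k m * coef a (g m)"
  shows "gpartial c i (\<lambda>x. L (F x)) x = L (gpartial c i F x)"
proof (rule gp_eqI)
  fix P :: "nat multiset" and S :: "odd_gen set"
  show "coef (gpartial c i (\<lambda>x. L (F x)) x) (P, S) = coef (L (gpartial c i F x)) (P, S)"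
    by (simp add: coef_gpartial[OF LF i x] coef_gpartial[OF F i x] coefL
        partial_cmult[OF c W i x smooth_field_coef[OF F]])
qed

lemma gpartial_dp:
  "smooth_field W F \<Longrightarrow> i < n \<Longrightarrow> x \<in> W \<Longrightarrow> gpartial c i (\<lambda>x. dp j (F x)) x = dp j (gpartial c i F x)"
  by (rule gpartial_linear[OF _ _ _ _ coef_dp_eq]) (auto intro: smooth_field_dp W)

lemma gpartial_dl:
  "smooth_field W F \<Longrightarrow> i < n \<Longrightarrow> x \<in> W \<Longrightarrow> gpartial c i (\<lambda>x. dl h (F x)) x = dl h (gpartial c i F x)"
  by (rule gpartial_linear[OF _ _ _ _ coef_dl_eq]) (auto intro: smooth_field_dl W)

lemma gpartial_parity:
  "smooth_field W F \<Longrightarrow> i < n \<Longrightarrow> x \<in> W \<Longrightarrow> gpartial c i (\<lambda>x. parity (F x)) x = parity (gpartial c i F x)"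
  by (rule gpartial_linear[where k = "\<lambda>m. (-1) ^ card (snd m)" and g = "\<lambda>m. m"])
    (auto intro: smooth_field_parity W simp: coef_parity)

lemma gpartial_uminus:
  "smooth_field W F \<Longrightarrow> i < n \<Longrightarrow> x \<in> W \<Longrightarrow> gpartial c i (\<lambda>x. - F x) x = - gpartial c i F x"
  by (rule gpartial_linear[where k = "\<lambda>m. -1" and g = "\<lambda>m. m"]) (auto intro: smooth_field_uminus W)

lemma gpartial_dr:
  "smooth_field W F \<Longrightarrow> i < n \<Longrightarrow> x \<in> W \<Longrightarrow> gpartial c i (\<lambda>x. dr h (F x)) x = dr h (gpartial c i F x)"
  unfolding dr_def by (simp add: gpartial_parity smooth_field_dl W gpartial_dl)

lemma gpartial_add:
  assumes F: "smooth_field W F" and G: "smooth_field W G" and i: "i < n" and x: "x \<in> W"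
  shows "gpartial c i (\<lambda>x. F x + G x) x = gpartial c i F x + gpartial c i G x"
proof (rule gp_eqI)
  fix P :: "nat multiset" and S :: "odd_gen set"
  show "coef (gpartial c i (\<lambda>x. F x + G x) x) (P, S) = coef (gpartial c i F x + gpartial c i G x) (P, S)"
    by (simp add: coef_gpartial[OF smooth_field_add[OF W(1) F G] i x] coef_gpartial[OF F i x] coef_gpartial[OF G i x]
        partial_add[OF c W i x smooth_field_coef[OF F] smooth_field_coef[OF G]])
qed

lemma gpartial_const: "i < n \<Longrightarrow> x \<in> W \<Longrightarrow> gpartial c i (\<lambda>x. a) x = 0"
  by (rule gp_eqI) (simp add: coef_gpartial[OF smooth_field_const[OF W(1)]])

lemma gpartial_sum:
  assumes "\<And>a. a \<in> I \<Longrightarrow> smooth_field W (F a)" and i: "i < n" and x: "x \<in> W"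
  shows "gpartial c i (\<lambda>x. \<Sum>a\<in>I. F a x) x = (\<Sum>a\<in>I. gpartial c i (F a) x)"
  using assms(1)
proof (induction I rule: infinite_finite_induct)
  case (insert a I)
  then show ?case
    using gpartial_add[OF _ smooth_field_sum[OF W(1)] i x, of "F a" I F] by simp
qed (simp_all add: gpartial_const[OF i x])

lemma gpartial_scaleR:
  assumes u: "smooth B W u" and i: "i < n" and x: "x \<in> W"
  shows "gpartial c i (\<lambda>x. u x *\<^sub>R a) x = partial c i u x *\<^sub>R a"
proof (rule gp_eqI)
  fix P :: "nat multiset" and S :: "odd_gen set"
  show "coef (gpartial c i (\<lambda>x. u x *\<^sub>R a) x) (P, S) = coef (partial c i u x *\<^sub>R a) (P, S)"
    using partial_cmult[OF c W i x u, of "coef a (P, S)"]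
    by (simp add: coef_gpartial[OF smooth_field_scaleR[OF W(1) u] i x] mult.commute)
qed

text \<open>A coefficient of the product is a fixed sum of products of coefficients, to which the
  ordinary product rule applies termwise.\<close>

lemma gpartial_mult:
  assumes F: "smooth_field W F" and G: "smooth_field W G" and i: "i < n" and x: "x \<in> W"
  shows "gpartial c i (\<lambda>x. F x * G x) x = gpartial c i F x * G x + F x * gpartial c i G x"
proof (rule gp_eqI)
  fix P :: "nat multiset" and S :: "odd_gen set"
  note sm = smooth_field_coef[OF F] smooth_field_coef[OF G] smooth_const[OF W(1)]
  have "coef (gpartial c i (\<lambda>x. F x * G x) x) (P, S) =
      partial c i (\<lambda>x. \<Sum>Q | Q \<subseteq># P. \<Sum>T\<in>Pow S. koszul T (S - T) * coef (F x) (Q, T) * coef (G x) (P - Q, S - T)) x"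
    by (simp add: coef_gpartial[OF smooth_field_mult[OF W(1) F G] i x] coef_mult gmul_def)
  also have "\<dots> = (\<Sum>Q | Q \<subseteq># P. \<Sum>T\<in>Pow S.
      partial c i (\<lambda>x. koszul T (S - T) * coef (F x) (Q, T) * coef (G x) (P - Q, S - T)) x)"
    by (subst partial_sum[OF c W i x], intro smooth_sum smooth_mult W sm)
      (intro sum.cong refl partial_sum[OF c W i x] smooth_mult W sm)
  also have "\<dots> = (\<Sum>Q | Q \<subseteq># P. \<Sum>T\<in>Pow S.
      koszul T (S - T) * coef (gpartial c i F x) (Q, T) * coef (G x) (P - Q, S - T) +
      koszul T (S - T) * coef (F x) (Q, T) * coef (gpartial c i G x) (P - Q, S - T))"
  proof (intro sum.cong refl)
    fix Q T
    show "partial c i (\<lambda>x. koszul T (S - T) * coef (F x) (Q, T) * coef (G x) (P - Q, S - T)) x =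
        koszul T (S - T) * coef (gpartial c i F x) (Q, T) * coef (G x) (P - Q, S - T) +
        koszul T (S - T) * coef (F x) (Q, T) * coef (gpartial c i G x) (P - Q, S - T)"
      by (subst partial_mult[OF c W i x smooth_mult[OF W(1) sm(3) sm(1)] sm(2)])
        (simp add: partial_cmult[OF c W i x sm(1)] coef_gpartial[OF F i x] coef_gpartial[OF G i x])
  qed
  also have "\<dots> = coef (gpartial c i F x * G x + F x * gpartial c i G x) (P, S)"
    by (simp add: coef_mult gmul_def sum.distrib)
  finally show "coef (gpartial c i (\<lambda>x. F x * G x) x) (P, S) = \<dots>" .
qed

lemma gpartial_commute:
  assumes F: "smooth_field W F" and i: "i < n" and j: "j < n" and x: "x \<in> W"
  shows "gpartial c i (gpartial c j F) x = gpartial c j (gpartial c i F) x"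
proof (rule gp_eqI)
  fix P :: "nat multiset" and S :: "odd_gen set"
  have "coef (gpartial c i (gpartial c j F) x) (P, S) = partial c i (partial c j (\<lambda>y. coef (F y) (P, S))) x"
    if i: "i < n" and j: "j < n" for i j
    unfolding coef_gpartial[OF smooth_field_gpartial[OF F j] i x]
    by (rule partial_cong[OF c W i x]) (rule coef_gpartial[OF F j])
  then show "coef (gpartial c i (gpartial c j F) x) (P, S) = coef (gpartial c j (gpartial c i F) x) (P, S)"
    using i j partial_commute[OF c W i j x smooth_field_coef[OF F]] by simp
qed

lemma smooth_field_odd_br:
  "smooth_field W F \<Longrightarrow> smooth_field W G \<Longrightarrow> smooth_field W (\<lambda>x. odd_br r (F x) (G x))"
  unfolding odd_br_def by (intro smooth_field_intros W)

lemma smooth_field_brk: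
  "smooth_field W F \<Longrightarrow> smooth_field W G \<Longrightarrow>
    smooth_field W (\<lambda>x. brk n r (F x) (\<lambda>i. gpartial c i F x) (G x) (\<lambda>i. gpartial c i G x))"
  unfolding brk_def
  by (intro smooth_field_intros smooth_field_odd_br smooth_field_gpartial W) auto

lemma gpartial_odd_br:
  assumes F: "smooth_field W F" and G: "smooth_field W G" and i: "i < n" and x: "x \<in> W"
  shows "gpartial c i (\<lambda>x. odd_br r (F x) (G x)) x =
    odd_br r (gpartial c i F x) (G x) + odd_br r (F x) (gpartial c i G x)"
  unfolding odd_br_def
  by (subst gpartial_sum[OF _ i x], intro smooth_field_intros W F G)
    (simp add: gpartial_mult smooth_field_dr smooth_field_dl W F G i x gpartial_dr gpartial_dl sum.distrib)

text \<open>Differentiating \<open>{w, F}\<close> brings in the second derivatives of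
  \<open>w\<close>; this is the form in which \<open>brk_Jacobi\<close> takes the derivatives of
  \<open>{w, a}\<close> and \<open>{w, b}\<close>.\<close>

lemma gpartial_act:
  assumes w: "smooth_field W w" and F: "smooth_field W F" and i: "i < n" and x: "x \<in> W"
  shows "gpartial c i (\<lambda>x. act n r (w x) (\<lambda>j. gpartial c j w x) (F x)) x =
    act n r (gpartial c i w x) (\<lambda>j. gpartial c i (gpartial c j w) x) (F x) +
    act n r (w x) (\<lambda>j. gpartial c j w x) (gpartial c i F x)"
proof -
  have s: "smooth_field W (\<lambda>x. gpartial c j w x * dp j (F x))" if "j < n" for j
    by (intro smooth_field_mult W smooth_field_gpartial[OF w that] smooth_field_dp F)
  have "gpartial c i (\<lambda>x. \<Sum>j<n. gpartial c j w x * dp j (F x)) x =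
      (\<Sum>j<n. gpartial c i (gpartial c j w) x * dp j (F x) + gpartial c j w x * dp j (gpartial c i F x))"
    by (subst gpartial_sum[OF s i x])
      (auto simp: gpartial_mult smooth_field_gpartial smooth_field_dp w F W i x gpartial_dp intro!: sum.cong)
  moreover have "smooth_field W (\<lambda>x. \<Sum>j<n. gpartial c j w x * dp j (F x))"
    by (rule smooth_field_sum[OF W(1)]) (use s in auto)
  ultimately show ?thesis
    unfolding act_def
    by (subst gpartial_add[OF _ smooth_field_odd_br[OF w F] i x])
      (simp_all add: gpartial_odd_br[OF w F i x] sum.distrib)
qed

end

end

section \<open>The big bracket and changes of coordinates\<close>

text \<open>\<open>{w, p_j}\<close> is the derivative of \<open>w\<close> along the
  \<open>j\<close>-th coordinate. Out of range indices give \<open>0\<close>, which fits the images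
  chosen for them in \<open>p_image\<close>.\<close>

lemma act_pvar: "act n r w w' (pvar j) = (if j < n then w' j else 0)"
proof -
  have "(\<Sum>i<n. w' i * dp i (pvar j)) = (\<Sum>i<n. if i = j then w' i else 0)"
    by (rule sum.cong) auto
  then show ?thesis by (simp add: act_def odd_br_def)
qed

lemma act_ovar: "act n r w w' (ovar g) = (if g \<in> odd_gens r then dr (dual_gen g) w else 0)"
proof -
  have "(\<Sum>u\<in>odd_gens r. dr u w * dl (dual_gen u) (ovar g)) = (\<Sum>u\<in>odd_gens r. if u = dual_gen g then dr u w else 0)"
    by (rule sum.cong) auto
  then show ?thesis by (simp add: act_def odd_br_def)
qed

lemma Tau_in_odd_gens [simp]: "Tau \<alpha> \<in> odd_gens r \<longleftrightarrow> \<alpha> < r"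
  and Theta_in_odd_gens [simp]: "Theta \<alpha> \<in> odd_gens r \<longleftrightarrow> \<alpha> < r"
  by (auto simp: odd_gens_def)

text \<open>There is no sign because every \<open>Tau\<close> precedes every \<open>Theta\<close> in
  the chosen order.\<close>

lemma ovar_Tau_Theta: "ovar (Tau \<delta>) * ovar (Theta \<gamma>) = mon ({#}, {Tau \<delta>, Theta \<gamma>})"
proof -
  have "{(s, t). s = Tau \<delta> \<and> t = Theta \<gamma> \<and> t < s} = {}" by (auto simp: less_odd_gen_def)
  then have "koszul {Tau \<delta>} {Theta \<gamma>} = 1"
    unfolding koszul_def singleton_iff by (simp only: card.empty power_0)
  then show ?thesis by (simp add: ovar_def mon_mult insert_commute)
qed

lemma coef_Gp: "finite {m. f m \<noteq> 0} \<Longrightarrow> (\<And>P S. infinite S \<Longrightarrow> f (P, S) = 0) \<Longrightarrow> coef (Gp f) = f"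
  by (rule Gp_inverse) auto

lemma finite_monomials: "finite (monomials n r k)"
proof -
  let ?L = "{xs. set xs \<subseteq> {..<n} \<and> length xs \<le> k}"
  have "finite (mset ` ?L \<times> Pow (Tau ` {..<r} \<union> Theta ` {..<r}))"
    using finite_lists_length_le[of "{..<n}" k] by simp
  moreover have "monomials n r k \<subseteq> mset ` ?L \<times> Pow (Tau ` {..<r} \<union> Theta ` {..<r})"
  proof
    fix m assume "m \<in> monomials n r k"
    then obtain P S where m: "m = (P, S)" "set_mset P \<subseteq> {..<n}" "S \<subseteq> Tau ` {..<r} \<union> Theta ` {..<r}"
      "2 * size P + card S = k" by (auto simp: monomials_def)
    obtain xs where "mset xs = P" using ex_mset by blast
    then have "P \<in> mset ` ?L" using m(2,4) by (intro image_eqI[of _ _ xs]) auto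
    then show "m \<in> mset ` ?L \<times> Pow (Tau ` {..<r} \<union> Theta ` {..<r})" using m(1,3) by blast
  qed
  ultimately show ?thesis by (rule finite_subset[rotated])
qed

lemma finite_monomial: "(P, S) \<in> monomials n r k \<Longrightarrow> finite S"
  unfolding monomials_def by (auto elim: finite_subset)

section \<open>Functions on the graded manifold as families of polynomials\<close>

context smooth_bundle
begin

text \<open>\<open>gf\<close> inserts the value \<open>0\<close> that a \<open>gfun\<close> takes
  off its domains; \<open>fld\<close> goes back to the type \<open>gp\<close>, where the algebra is
  available.\<close>

definition gf :: "('m chart \<Rightarrow> ('m, 'v) frame \<Rightarrow> 'm \<Rightarrow> gp) \<Rightarrow> ('m, 'v) gfun" where
  "gf F = (\<lambda>c e x m. if c \<in> charts B \<and> e \<in> frames B \<and> x \<in> fst c \<inter> fst e then coef (F c e x) m else 0)"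

definition fld :: "('m, 'v) gfun \<Rightarrow> 'm chart \<Rightarrow> ('m, 'v) frame \<Rightarrow> 'm \<Rightarrow> gp" where
  "fld a c e x = Gp (a c e x)"

text \<open>The class in which brackets are computed. It asks for smooth coefficients but not for
  compatibility between coordinate systems; it contains the \<open>graded_functions\<close> and is
  closed under \<open>big_bracket\<close>.\<close>

definition regular :: "('m, 'v) gfun \<Rightarrow> bool" where
  "regular a \<longleftrightarrow> a = gf (fld a) \<and>
     (\<forall>c\<in>charts B. \<forall>e\<in>frames B. smooth_field (fst c \<inter> fst e) (fld a c e))"

lemma fld_gf:
  "c \<in> charts B \<Longrightarrow> e \<in> frames B \<Longrightarrow> x \<in> fst c \<inter> fst e \<Longrightarrow> fld (gf F) c e x = F c e x"
  by (simp add: fld_def gf_def coef_inverse)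

lemma gf_cong:
  "(\<And>c e x. c \<in> charts B \<Longrightarrow> e \<in> frames B \<Longrightarrow> x \<in> fst c \<inter> fst e \<Longrightarrow> F c e x = G c e x) \<Longrightarrow> gf F = gf G"
  by (auto simp: gf_def fun_eq_iff)

lemma regular_gf:
  assumes "\<And>c e. c \<in> charts B \<Longrightarrow> e \<in> frames B \<Longrightarrow> smooth_field (fst c \<inter> fst e) (F c e)"
  shows "regular (gf F)"
  unfolding regular_def
proof (intro conjI ballI)
  show "gf F = gf (fld (gf F))" by (rule gf_cong) (simp add: fld_gf)
  fix c e assume c: "c \<in> charts B" and e: "e \<in> frames B"
  show "smooth_field (fst c \<inter> fst e) (fld (gf F) c e)"
    by (rule smooth_field_cong[OF open_domain[OF c e] _ assms[OF c e]]) (simp add: fld_gf c e)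
qed

lemma regular_eq_gf: "regular a \<Longrightarrow> a = gf (fld a)"
  by (simp add: regular_def)

lemma regular_smooth: "regular a \<Longrightarrow> c \<in> charts B \<Longrightarrow> e \<in> frames B \<Longrightarrow> smooth_field (fst c \<inter> fst e) (fld a c e)"
  by (simp add: regular_def)

lemma regular_eqI:
  assumes "regular a" "regular b"
    "\<And>c e x. c \<in> charts B \<Longrightarrow> e \<in> frames B \<Longrightarrow> x \<in> fst c \<inter> fst e \<Longrightarrow> fld a c e x = fld b c e x"
  shows "a = b"
  using regular_eq_gf[OF assms(1)] regular_eq_gf[OF assms(2)] gf_cong[of "fld a" "fld b"] assms(3) by simp

lemma coef_fld: "regular a \<Longrightarrow> coef (fld a c e x) = a c e x"
  if "c \<in> charts B" "e \<in> frames B" "x \<in> fst c \<inter> fst e"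
proof -
  assume "regular a"
  then have "a c e x = gf (fld a) c e x" using regular_eq_gf by metis
  then show ?thesis using that by (simp add: gf_def)
qed

definition brk_fld :: "('m, 'v) gfun \<Rightarrow> ('m, 'v) gfun \<Rightarrow> 'm chart \<Rightarrow> ('m, 'v) frame \<Rightarrow> 'm \<Rightarrow> gp" where
  "brk_fld a b c e x = brk n r (fld a c e x) (\<lambda>i. gpartial c i (fld a c e) x)
     (fld b c e x) (\<lambda>i. gpartial c i (fld b c e) x)"

text \<open>At each point the bracket of regular functions is \<open>brk\<close> of their values and
  first derivatives there, which gives access to the algebra of \<open>gp\<close>.\<close>

lemma big_bracket_eq_gf:
  assumes a: "regular a" and b: "regular b"
  shows "big_bracket B a b = gf (brk_fld a b)"
proof (intro ext)
  fix c e x m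
  show "big_bracket B a b c e x m = gf (brk_fld a b) c e x m"
  proof (cases "c \<in> charts B \<and> e \<in> frames B \<and> x \<in> fst c \<inter> fst e")
    case True
    then have c: "c \<in> charts B" and e: "e \<in> frames B" and x: "x \<in> fst c \<inter> fst e" by auto
    have d: "(\<lambda>m. partial c i (\<lambda>y. f c e y m) x) = coef (gpartial c i (fld f c e) x)"
      if "i < n" "regular f" for f i
    proof
      fix m
      have "partial c i (\<lambda>y. f c e y m) x = partial c i (\<lambda>y. coef (fld f c e y) m) x"
        by (rule partial_cong[OF c open_domain[OF c e] Int_lower1 that(1) x]) (simp add: coef_fld[OF c e _ that(2)])
      then show "partial c i (\<lambda>y. f c e y m) x = coef (gpartial c i (fld f c e) x) m"
        by (simp add: coef_gpartial[OF c open_domain[OF c e] Int_lower1 regular_smooth[OF that(2) c e] that(1) x])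
    qed
    show ?thesis
      using True unfolding big_bracket_def gf_def brk_fld_def brk_def odd_br_def sum_odd_gens
      by (simp add: coef_sum coef_mult coef_dp coef_dl coef_dr d a b
          coef_fld[OF c e x a] coef_fld[OF c e x b] add.commute cong: sum.cong_simp)
  qed (auto simp: big_bracket_def gf_def)
qed

lemma smooth_brk_fld:
  assumes "regular a" "regular b" "c \<in> charts B" "e \<in> frames B"
  shows "smooth_field (fst c \<inter> fst e) (brk_fld a b c e)"
  using smooth_field_brk[OF assms(3) open_domain[OF assms(3,4)] Int_lower1
      regular_smooth[OF assms(1,3,4)] regular_smooth[OF assms(2-4)]]
  by (simp add: brk_fld_def[abs_def])

lemma regular_big_bracket:
  assumes "regular a" "regular b"
  shows "regular (big_bracket B a b)"
  unfolding big_bracket_eq_gf[OF assms] by (rule regular_gf) (rule smooth_brk_fld[OF assms])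

lemma fld_big_bracket:
  assumes "regular a" "regular b" "c \<in> charts B" "e \<in> frames B" "x \<in> fst c \<inter> fst e"
  shows "fld (big_bracket B a b) c e x = brk_fld a b c e x"
  unfolding big_bracket_eq_gf[OF assms(1,2)] using assms(3-5) by (simp add: fld_gf)

lemma regular_zero: "regular zero_gfun"
proof -
  have "zero_gfun = gf (\<lambda>c e x. 0)" by (auto simp: zero_gfun_def gf_def fun_eq_iff)
  then show ?thesis using regular_gf[of "\<lambda>c e x. 0", OF smooth_field_const[OF open_domain]] by simp
qed

lemma fld_zero: "fld zero_gfun c e x = 0"
  by (rule gp_eqI) (auto simp: fld_def zero_gfun_def coef_Gp)

text \<open>Out of range indices go to \<open>0\<close>, since \<^const>\<open>frame_coeff\<close> has junk values there.\<close>

definition p_image ::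
  "'m chart \<Rightarrow> ('m, 'v) frame \<Rightarrow> 'm chart \<Rightarrow> ('m, 'v) frame \<Rightarrow> 'm \<Rightarrow> nat \<Rightarrow> gp" where
  "p_image c e c' e' x j = (if j < n then
     (\<Sum>i<n. partial c' j (\<lambda>y. snd c y i) x *\<^sub>R pvar i) +
     (\<Sum>\<gamma><r. \<Sum>\<delta><r. \<Sum>\<alpha><r.
        (fc e \<gamma> x (snd e' \<alpha> x) * partial c' j (\<lambda>y. fc e' \<alpha> y (snd e \<delta> y)) x) *\<^sub>R
        (ovar (Tau \<delta>) * ovar (Theta \<gamma>))) else 0)"

fun odd_image :: "('m, 'v) frame \<Rightarrow> ('m, 'v) frame \<Rightarrow> 'm \<Rightarrow> odd_gen \<Rightarrow> gp" where
  "odd_image e e' x (Tau \<alpha>) = (if \<alpha> < r then \<Sum>\<beta><r. fc e' \<alpha> x (snd e \<beta> x) *\<^sub>R ovar (Tau \<beta>) else 0)"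
| "odd_image e e' x (Theta \<alpha>) = (if \<alpha> < r then \<Sum>\<beta><r. fc e \<beta> x (snd e' \<alpha> x) *\<^sub>R ovar (Theta \<beta>) else 0)"

lemma gp_subst_change: "gp_subst (p_image c e c' e' x) (odd_image e e' x)"
proof
  show "parity (p_image c e c' e' x i) = p_image c e c' e' x i" for i
    by (simp add: p_image_def linear_simps parity_mult)
  show "parity (odd_image e e' x g) = - odd_image e e' x g" for g
    by (cases g) (simp_all add: linear_simps sum_negf)
qed

text \<open>Rewrites an expression in the coordinates of \<open>(c', e')\<close> in those of
  \<open>(c, e)\<close>. As a substitution it is an algebra homomorphism, which the description by
  \<open>mono_change\<close> does not show.\<close>

definition tr :: "'m chart \<Rightarrow> ('m, 'v) frame \<Rightarrow> 'm chart \<Rightarrow> ('m, 'v) frame \<Rightarrow> 'm \<Rightarrow> gp \<Rightarrow> gp" where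
  "tr c e c' e' x = gp_subst.subst (p_image c e c' e' x) (odd_image e e' x)"

lemma coef_pvar: "coef (pvar i) = gmono ({#i#}, {})"
  and coef_ovar: "coef (ovar g) = gmono ({#}, {g})"
  and coef_one: "coef 1 = gmono ({#}, {})"
  by (simp_all add: pvar_def ovar_def one_gp_def coef_mon_finite)

lemma coef_p_image: "j < n \<Longrightarrow> coef (p_image c e c' e' x j) = p_change B c e c' e' x j"
  by (rule ext) (simp add: p_image_def p_change_def coef_sum coef_pvar ovar_Tau_Theta coef_mon_finite)

lemma coef_odd_image: "g \<in> odd_gens r \<Longrightarrow> coef (odd_image e e' x g) = odd_change B e e' x g"
  by (rule ext) (cases g; simp add: coef_sum coef_ovar)

lemma coef_foldr: "coef (foldr (*) as 1) = foldr gmul (map coef as) (gmono ({#}, {}))"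
  by (induction "as") (simp_all add: coef_mult coef_one)

lemma coef_subst_mon:
  assumes "m \<in> monomials n r k"
  shows "coef (gp_subst.subst_mon (p_image c e c' e' x) (odd_image e e' x) m) = mono_change B c e c' e' x m"
proof -
  interpret gp_subst "p_image c e c' e' x" "odd_image e e' x" by (rule gp_subst_change)
  obtain P S where m: "m = (P, S)" by (cases m)
  then have PS: "set_mset P \<subseteq> {..<n}" "S \<subseteq> odd_gens r" using assms by (auto simp: monomials_def odd_gens_def)
  then have "finite S" using finite_subset finite_odd_gens by blast
  then have eqs: "map (coef \<circ> p_image c e c' e' x) (sorted_list_of_multiset P) = map (p_change B c e c' e' x) (sorted_list_of_multiset P)"
    "map (coef \<circ> odd_image e e' x) (sorted_list_of_set S) = map (odd_change B e e' x) (sorted_list_of_set S)"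
    using PS by (auto simp: coef_p_image coef_odd_image subset_iff)
  show ?thesis
    by (simp only: m subst_mon_def mono_change_def split coef_foldr map_append map_map eqs)
qed

text \<open>Identifies the substitution with the sum over \<open>mono_change\<close> in the
  definition of \<open>graded_functions\<close>. The support condition keeps all indices in range,
  where \<open>p_image\<close> and \<open>odd_image\<close> agree with \<open>p_change\<close> and
  \<open>odd_change\<close>.\<close>

lemma coef_tr:
  assumes "\<And>m. coef a m \<noteq> 0 \<Longrightarrow> m \<in> monomials n r k"
  shows "coef (tr c e c' e' x a) m = (\<Sum>m'\<in>monomials n r k. coef a m' * mono_change B c e c' e' x m' m)"
proof -
  interpret gp_subst "p_image c e c' e' x" "odd_image e e' x" by (rule gp_subst_change)
  have "subst a = (\<Sum>m\<in>monomials n r k. coef a m *\<^sub>R subst_mon m)"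
    by (rule subst_sum[OF finite_monomials]) (rule assms)
  then show ?thesis
    unfolding tr_def by (simp add: coef_sum coef_subst_mon cong: sum.cong_simp)
qed

text \<open>With the converse \<open>graded_functionsI\<close>, membership in
  \<open>graded_functions\<close> becomes regularity, support in degree \<open>k\<close> and
  invariance under \<open>tr\<close>.\<close>

lemma graded_functions_regular:
  assumes a: "a \<in> graded_functions B k"
  shows "regular a"
    "c \<in> charts B \<Longrightarrow> e \<in> frames B \<Longrightarrow> x \<in> fst c \<inter> fst e \<Longrightarrow> coef (fld a c e x) m \<noteq> 0 \<Longrightarrow> m \<in> monomials n r k"
    "c \<in> charts B \<Longrightarrow> e \<in> frames B \<Longrightarrow> c' \<in> charts B \<Longrightarrow> e' \<in> frames B \<Longrightarrow>
      x \<in> fst c \<inter> fst e \<inter> fst c' \<inter> fst e' \<Longrightarrow> fld a c e x = tr c e c' e' x (fld a c' e' x)"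
proof -
  have supp: "c \<in> charts B \<and> e \<in> frames B \<and> x \<in> fst c \<inter> fst e \<and> m \<in> monomials n r k" if "a c e x m \<noteq> 0" for c e x m
    using a that unfolding graded_functions_def by blast
  have cf: "coef (fld a c e x) = a c e x" for c e x
    unfolding fld_def
  proof (rule coef_Gp)
    show "finite {m. a c e x m \<noteq> 0}" by (rule finite_subset[OF _ finite_monomials]) (use supp in blast)
    show "a c e x (P, S) = 0" if "infinite S" for P S using supp finite_monomial that by blast
  qed
  show reg: "regular a"
    unfolding regular_def
  proof (intro conjI ballI)
    show "a = gf (fld a)" unfolding gf_def cf using supp by (intro ext) metis
    fix c e assume ce: "c \<in> charts B" "e \<in> frames B"
    then have "\<forall>m. smooth B (fst c \<inter> fst e) (\<lambda>x. a c e x m)" using a unfolding graded_functions_def by blast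
    then show "smooth_field (fst c \<inter> fst e) (fld a c e)"
      using supp by (intro smooth_fieldI[OF _ finite_monomials[of n r k]]) (auto simp: cf)
  qed
  show "m \<in> monomials n r k"
    if "c \<in> charts B" "e \<in> frames B" "x \<in> fst c \<inter> fst e" "coef (fld a c e x) m \<noteq> 0"
    using supp that cf by metis
  assume *: "c \<in> charts B" "e \<in> frames B" "c' \<in> charts B" "e' \<in> frames B" "x \<in> fst c \<inter> fst e \<inter> fst c' \<inter> fst e'"
  show "fld a c e x = tr c e c' e' x (fld a c' e' x)"
  proof (rule gp_eqI)
    fix P S
    have "a c e x (P, S) = (\<Sum>m'\<in>monomials n r k. a c' e' x m' * mono_change B c e c' e' x m' (P, S))"
      using a * unfolding graded_functions_def by blast
    then show "coef (fld a c e x) (P, S) = coef (tr c e c' e' x (fld a c' e' x)) (P, S)"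
      using coef_tr[of "fld a c' e' x" k] supp by (simp add: cf)
  qed
qed

lemma graded_functionsI:
  assumes "regular a"
    and supp: "\<And>c e x m. c \<in> charts B \<Longrightarrow> e \<in> frames B \<Longrightarrow> x \<in> fst c \<inter> fst e \<Longrightarrow> coef (fld a c e x) m \<noteq> 0 \<Longrightarrow>
      m \<in> monomials n r k"
    and tr: "\<And>c e c' e' x. c \<in> charts B \<Longrightarrow> e \<in> frames B \<Longrightarrow> c' \<in> charts B \<Longrightarrow> e' \<in> frames B \<Longrightarrow>
      x \<in> fst c \<inter> fst e \<inter> fst c' \<inter> fst e' \<Longrightarrow> fld a c e x = tr c e c' e' x (fld a c' e' x)"
  shows "a \<in> graded_functions B k"
  unfolding graded_functions_def
proof (intro CollectI conjI allI ballI impI)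
  fix c e x m assume nz: "a c e x m \<noteq> 0"
  have "a c e x m = gf (fld a) c e x m" using regular_eq_gf[OF assms(1)] by metis
  with nz have "(c \<in> charts B \<and> e \<in> frames B \<and> x \<in> fst c \<inter> fst e) \<and> coef (fld a c e x) m \<noteq> 0"
    unfolding gf_def by metis
  then show "c \<in> charts B" "e \<in> frames B" "x \<in> fst c \<inter> fst e" "m \<in> monomials n r k"
    using supp by blast+
next
  fix c e m assume c: "c \<in> charts B" and e: "e \<in> frames B"
  show "smooth B (fst c \<inter> fst e) (\<lambda>x. a c e x m)"
    by (rule smooth_cong[OF open_domain[OF c e] _ smooth_field_coef[OF regular_smooth[OF assms(1) c e], of m]])
      (simp add: coef_fld[OF c e _ assms(1)])
next
  fix c e c' e' x m
  assume *: "c \<in> charts B" "e \<in> frames B" "c' \<in> charts B" "e' \<in> frames B" "x \<in> fst c \<inter> fst e \<inter> fst c' \<inter> fst e'"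
  then have x: "x \<in> fst c \<inter> fst e" "x \<in> fst c' \<inter> fst e'" by auto
  have "coef (fld a c e x) m = (\<Sum>m'\<in>monomials n r k. coef (fld a c' e' x) m' * mono_change B c e c' e' x m' m)"
    unfolding tr[OF *] by (rule coef_tr) (rule supp[OF *(3,4) x(2)])
  then show "a c e x m = (\<Sum>m'\<in>monomials n r k. a c' e' x m' * mono_change B c e c' e' x m' m)"
    by (simp add: coef_fld[OF *(1,2) x(1) assms(1)] coef_fld[OF *(3,4) x(2) assms(1)])
qed

section \<open>Local fields of endomorphisms and sections, and their actions\<close>

definition endo_field :: "('m \<Rightarrow> 'v \<Rightarrow> 'v) \<Rightarrow> ('m, 'v) frame \<Rightarrow> 'm \<Rightarrow> gp" where
  "endo_field N e x = (\<Sum>\<alpha><r. \<Sum>\<beta><r. fc e \<alpha> x (N x (snd e \<beta> x)) *\<^sub>R (ovar (Tau \<beta>) * ovar (Theta \<alpha>)))"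

definition section_field :: "('m \<Rightarrow> 'v \<times> ('v \<Rightarrow> real)) \<Rightarrow> ('m, 'v) frame \<Rightarrow> 'm \<Rightarrow> gp" where
  "section_field u e x = (\<Sum>\<alpha><r. fc e \<alpha> x (fst (u x)) *\<^sub>R ovar (Theta \<alpha>) + snd (u x) (snd e \<alpha> x) *\<^sub>R ovar (Tau \<alpha>))"

lemma endo_gfun_eq: "endo_gfun B N = gf (\<lambda>c. endo_field N)"
  by (intro ext) (simp add: endo_gfun_def gf_def endo_field_def coef_sum ovar_Tau_Theta coef_mon_finite)

lemma section_gfun_eq: "section_gfun B u = gf (\<lambda>c. section_field u)"
  by (intro ext) (simp add: section_gfun_def gf_def section_field_def coef_sum coef_ovar)

lemma smooth_endo_field:
  assumes N: "endomorphism B N" and e: "e \<in> frames B" and W: "openin M W" "W \<subseteq> fst e"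
  shows "smooth_field W (endo_field N e)"
  unfolding endo_field_def
  by (intro smooth_field_sum smooth_field_scaleR W smooth_subset[OF endo_smooth[OF N e] W(2)]) auto

lemma gpartial_endo_field:
  assumes N: "endomorphism B N" and e: "e \<in> frames B" and c: "c \<in> charts B"
    and W: "openin M W" "W \<subseteq> fst c" "W \<subseteq> fst e" and i: "i < n" and x: "x \<in> W"
  shows "gpartial c i (endo_field N e) x =
    (\<Sum>\<alpha><r. \<Sum>\<beta><r. partial c i (\<lambda>y. fc e \<alpha> y (N y (snd e \<beta> y))) x *\<^sub>R (ovar (Tau \<beta>) * ovar (Theta \<alpha>)))"
proof -
  have s: "smooth B W (\<lambda>x. fc e \<alpha> x (N x (snd e \<beta> x)))" if "\<alpha> < r" "\<beta> < r" for \<alpha> \<beta>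
    by (rule smooth_subset[OF endo_smooth[OF N e that] W(3)])
  have "gpartial c i (\<lambda>x. \<Sum>\<beta><r. fc e \<alpha> x (N x (snd e \<beta> x)) *\<^sub>R (ovar (Tau \<beta>) * ovar (Theta \<alpha>))) x =
      (\<Sum>\<beta><r. partial c i (\<lambda>y. fc e \<alpha> y (N y (snd e \<beta> y))) x *\<^sub>R (ovar (Tau \<beta>) * ovar (Theta \<alpha>)))" if "\<alpha> < r" for \<alpha>
    by (subst gpartial_sum[OF c W(1,2) _ i x])
      (auto intro!: smooth_field_scaleR W s sum.cong gpartial_scaleR[OF c W(1,2) _ i x] simp: that)
  then show ?thesis
    unfolding endo_field_def[abs_def]
    by (subst gpartial_sum[OF c W(1,2) _ i x])
      (auto intro!: smooth_field_scaleR smooth_field_sum W s)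
qed

lemma smooth_section_field:
  assumes u: "u \<in> E_sections B" and e: "e \<in> frames B" and W: "openin M W" "W \<subseteq> fst e"
  shows "smooth_field W (section_field u e)"
proof -
  have "smooth B W (\<lambda>x. fc e \<alpha> x (fst (u x)))" "smooth B W (\<lambda>x. snd (u x) (snd e \<alpha> x))" if "\<alpha> < r" for \<alpha>
    using u section_smooth[OF _ e that] dual_section_smooth[OF _ e that] smooth_subset[OF _ W(2)]
    unfolding E_sections_def by blast+
  then show ?thesis
    unfolding section_field_def
    by (intro smooth_field_sum smooth_field_add smooth_field_scaleR W) auto
qed

lemma gpartial_section_field:
  assumes u: "u \<in> E_sections B" and e: "e \<in> frames B" and c: "c \<in> charts B"
    and W: "openin M W" "W \<subseteq> fst c" "W \<subseteq> fst e" and i: "i < n" and x: "x \<in> W"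
  shows "gpartial c i (section_field u e) x =
    (\<Sum>\<alpha><r. partial c i (\<lambda>y. fc e \<alpha> y (fst (u y))) x *\<^sub>R ovar (Theta \<alpha>) +
      partial c i (\<lambda>y. snd (u y) (snd e \<alpha> y)) x *\<^sub>R ovar (Tau \<alpha>))"
proof -
  have s: "smooth B W (\<lambda>x. fc e \<alpha> x (fst (u x)))" "smooth B W (\<lambda>x. snd (u x) (snd e \<alpha> x))" if "\<alpha> < r" for \<alpha>
    using u section_smooth[OF _ e that] dual_section_smooth[OF _ e that] smooth_subset[OF _ W(3)]
    unfolding E_sections_def by blast+
  show ?thesis
    unfolding section_field_def[abs_def]
    by (subst gpartial_sum[OF c W(1,2) _ i x])
      (auto intro!: smooth_field_scaleR smooth_field_add W s sum.cong
        simp: gpartial_add[OF c W(1,2) _ _ i x] smooth_field_scaleR W s gpartial_scaleR[OF c W(1,2) _ i x])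
qed

text \<open>Evaluates the bracket of a momentum-free field with the part of a transformed momentum
  that is linear in the old momenta.\<close>

lemma gpartial_chain:
  assumes c: "c \<in> charts B" and d: "d \<in> charts B" and W: "openin M W" "W \<subseteq> fst c" "W \<subseteq> fst d"
    and j: "j < n" and x: "x \<in> W" and F: "smooth_field W F"
  shows "(\<Sum>i<n. partial d j (\<lambda>y. snd c y i) x *\<^sub>R gpartial c i F x) = gpartial d j F x"
proof (rule gp_eqI)
  fix P :: "nat multiset" and S :: "odd_gen set"
  show "coef (\<Sum>i<n. partial d j (\<lambda>y. snd c y i) x *\<^sub>R gpartial c i F x) (P, S) = coef (gpartial d j F x) (P, S)"
    using partial_chain[OF c d W j x smooth_field_coef[OF F]]
    by (simp add: coef_sum coef_gpartial[OF c W(1,2) F _ x] coef_gpartial[OF d W(1,3) F j x])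
qed

lemma partial_sum_mult:
  assumes "c \<in> charts B" "openin M W" "W \<subseteq> fst c" "i < n" "x \<in> W"
    and f: "\<And>a. a \<in> I \<Longrightarrow> smooth B W (f a)" and g: "\<And>a. a \<in> I \<Longrightarrow> smooth B W (g a)"
  shows "partial c i (\<lambda>y. \<Sum>a\<in>I. f a y * g a y) x =
    (\<Sum>a\<in>I. partial c i (f a) x * g a x + f a x * partial c i (g a) x)"
proof -
  have "partial c i (\<lambda>y. \<Sum>a\<in>I. f a y * g a y) x = (\<Sum>a\<in>I. partial c i (\<lambda>y. f a y * g a y) x)"
    by (rule partial_sum[OF assms(1-5)]) (intro smooth_mult assms(2) f g)
  also have "\<dots> = (\<Sum>a\<in>I. partial c i (f a) x * g a x + f a x * partial c i (g a) x)"
    by (intro sum.cong refl partial_mult[OF assms(1-5)] f g)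
  finally show ?thesis .
qed

lemma vector_E_section: "X \<in> sections B \<Longrightarrow> (\<lambda>x. (X x, \<lambda>v. 0)) \<in> E_sections B"
  using smooth_const[OF open_frame]
  by (simp add: E_sections_def dual_sections_def dual_fibre_def)

lemma dual_E_section: "\<xi> \<in> dual_sections B \<Longrightarrow> (\<lambda>x. (0, \<xi> x)) \<in> E_sections B"
  using zero_section by (simp add: E_sections_def)

text \<open>On odd generators only the value of \<open>N\<close> at the point enters, for any
  \<open>w'\<close>, since \<open>dp\<close> kills them; its derivatives enter through
  \<open>act_pvar\<close>.\<close>

lemma act_endo_gens:
  assumes "\<alpha> < r"
  shows "act n r (endo_field N e x) w' (ovar (Tau \<alpha>)) =
      (\<Sum>\<beta><r. fc e \<alpha> x (N x (snd e \<beta> x)) *\<^sub>R ovar (Tau \<beta>))"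
    and "act n r (endo_field N e x) w' (ovar (Theta \<alpha>)) =
      - (\<Sum>\<gamma><r. fc e \<gamma> x (N x (snd e \<alpha> x)) *\<^sub>R ovar (Theta \<gamma>))"
proof -
  have "(\<Sum>\<beta><r. \<Sum>\<gamma><r. fc e \<beta> x (N x (snd e \<gamma> x)) *\<^sub>R dr (Theta \<alpha>) (ovar (Tau \<gamma>) * ovar (Theta \<beta>))) =
      (\<Sum>\<beta><r. if \<beta> = \<alpha> then \<Sum>\<gamma><r. fc e \<beta> x (N x (snd e \<gamma> x)) *\<^sub>R ovar (Tau \<gamma>) else 0)"
    by (intro sum.cong) (auto simp: dr_mult)
  then show "act n r (endo_field N e x) w' (ovar (Tau \<alpha>)) =
      (\<Sum>\<beta><r. fc e \<alpha> x (N x (snd e \<beta> x)) *\<^sub>R ovar (Tau \<beta>))"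
    using assms by (simp add: act_ovar endo_field_def linear_simps)
  have "(\<Sum>\<beta><r. \<Sum>\<gamma><r. fc e \<beta> x (N x (snd e \<gamma> x)) *\<^sub>R dr (Tau \<alpha>) (ovar (Tau \<gamma>) * ovar (Theta \<beta>))) =
      (\<Sum>\<beta><r. \<Sum>\<gamma><r. if \<gamma> = \<alpha> then - (fc e \<beta> x (N x (snd e \<gamma> x)) *\<^sub>R ovar (Theta \<beta>)) else 0)"
    by (intro sum.cong) (auto simp: dr_mult)
  then show "act n r (endo_field N e x) w' (ovar (Theta \<alpha>)) =
      - (\<Sum>\<gamma><r. fc e \<gamma> x (N x (snd e \<alpha> x)) *\<^sub>R ovar (Theta \<gamma>))"
    using assms by (simp add: act_ovar endo_field_def linear_simps sum_negf)
qed

lemma act_section_gens: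
  assumes "\<alpha> < r"
  shows "act n r (section_field u e x) w' (ovar (Tau \<alpha>)) = fc e \<alpha> x (fst (u x)) *\<^sub>R 1"
    and "act n r (section_field u e x) w' (ovar (Theta \<alpha>)) = snd (u x) (snd e \<alpha> x) *\<^sub>R 1"
proof -
  have "(\<Sum>\<beta><r. dr (Theta \<alpha>) (fc e \<beta> x (fst (u x)) *\<^sub>R ovar (Theta \<beta>) + snd (u x) (snd e \<beta> x) *\<^sub>R ovar (Tau \<beta>))) =
      (\<Sum>\<beta><r. if \<beta> = \<alpha> then fc e \<beta> x (fst (u x)) *\<^sub>R 1 else 0)"
    by (intro sum.cong) (auto simp: linear_simps)
  then show "act n r (section_field u e x) w' (ovar (Tau \<alpha>)) = fc e \<alpha> x (fst (u x)) *\<^sub>R 1"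
    using assms by (simp add: act_ovar section_field_def linear_sum[OF linear_dr])
  have "(\<Sum>\<beta><r. dr (Tau \<alpha>) (fc e \<beta> x (fst (u x)) *\<^sub>R ovar (Theta \<beta>) + snd (u x) (snd e \<beta> x) *\<^sub>R ovar (Tau \<beta>))) =
      (\<Sum>\<beta><r. if \<beta> = \<alpha> then snd (u x) (snd e \<beta> x) *\<^sub>R 1 else 0)"
    by (intro sum.cong) (auto simp: linear_simps)
  then show "act n r (section_field u e x) w' (ovar (Theta \<alpha>)) = snd (u x) (snd e \<alpha> x) *\<^sub>R 1"
    using assms by (simp add: act_ovar section_field_def linear_sum[OF linear_dr])
qed

lemma parity_endo_field [simp]: "parity (endo_field N e x) = endo_field N e x"
  by (simp add: endo_field_def linear_simps parity_mult)

lemma parity_section_field [simp]: "parity (section_field u e x) = - section_field u e x"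
  by (simp add: section_field_def linear_simps sum_negf[symmetric])

lemma dp_endo_field [simp]: "dp i (endo_field N e x) = 0"
  by (simp add: endo_field_def linear_simps dp_mult)

lemma dp_section_field [simp]: "dp i (section_field u e x) = 0"
  by (simp add: section_field_def linear_simps)

definition act_endo where
  "act_endo N c e x = act n r (endo_field N e x) (\<lambda>i. gpartial c i (endo_field N e) x)"

definition act_section where
  "act_section u c e x = act n r (section_field u e x) (\<lambda>i. gpartial c i (section_field u e) x)"

lemma linear_act_endo: "linear (act_endo N c e x)"
  unfolding act_endo_def by (rule linear_act)

lemma linear_act_section: "linear (act_section u c e x)"
  unfolding act_section_def by (rule linear_act)

lemmas act_field_simps = linear_rules[OF linear_act_endo] linear_rules[OF linear_act_section]

context
  fixes c e x
  assumes c: "c \<in> charts B" and e: "e \<in> frames B" and x: "x \<in> fst c \<inter> fst e"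
begin

lemma parity_gpartial_endo:
  assumes N: "endomorphism B N" and i: "i < n"
  shows "parity (gpartial c i (endo_field N e) x) = gpartial c i (endo_field N e) x"
    "dp j (gpartial c i (endo_field N e) x) = 0"
  by (simp_all add: gpartial_endo_field[OF N e c open_domain[OF c e] _ _ i x] linear_simps parity_mult dp_mult)

lemma parity_gpartial_section:
  assumes u: "u \<in> E_sections B" and i: "i < n"
  shows "parity (gpartial c i (section_field u e) x) = - gpartial c i (section_field u e) x"
  by (simp add: gpartial_section_field[OF u e c open_domain[OF c e] _ _ i x] linear_simps sum_negf[symmetric])

lemma act_endo_mult:
  assumes N: "endomorphism B N"
  shows "act_endo N c e x (a * b) = act_endo N c e x a * b + a * act_endo N c e x b"
  unfolding act_endo_def by (rule act_mult_even) (simp_all add: parity_gpartial_endo[OF N])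

lemma act_section_mult:
  assumes u: "u \<in> E_sections B"
  shows "act_section u c e x (a * b) = act_section u c e x a * b + parity a * act_section u c e x b"
  unfolding act_section_def by (rule act_mult_odd) (simp_all add: parity_gpartial_section[OF u])

end

section \<open>Invariance of the actions under changes of coordinates\<close>

context
  fixes c e c' e' x
  assumes c: "c \<in> charts B" and e: "e \<in> frames B" and c': "c' \<in> charts B" and e': "e' \<in> frames B"
    and x: "x \<in> fst c \<inter> fst e \<inter> fst c' \<inter> fst e'"
begin

interpretation S: gp_subst "p_image c e c' e' x" "odd_image e e' x"
  by (rule gp_subst_change)

abbreviation "\<tau>' \<alpha> \<equiv> \<Sum>\<delta><r. fc e' \<alpha> x (snd e \<delta> x) *\<^sub>R ovar (Tau \<delta>)"
abbreviation "\<theta>' \<alpha> \<equiv> \<Sum>\<gamma><r. fc e \<gamma> x (snd e' \<alpha> x) *\<^sub>R ovar (Theta \<gamma>)"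
abbreviation "d\<tau>' j \<alpha> \<equiv> \<Sum>\<delta><r. partial c' j (\<lambda>y. fc e' \<alpha> y (snd e \<delta> y)) x *\<^sub>R ovar (Tau \<delta>)"

lemma domain_facts:
  "x \<in> fst e" "x \<in> fst e'" "x \<in> fst c \<inter> fst e" "x \<in> fst c' \<inter> fst e'"
  "openin M (fst c \<inter> fst e \<inter> fst c' \<inter> fst e')"
  using x by (auto intro!: openin_Int open_chart open_frame c e c' e')

text \<open>The quadratic term is the derivative of \<open>\<tau>'\<close> paired with
  \<open>\<theta>'\<close>; in this form the Leibniz rule applies to it directly.\<close>

lemma p_image_eq:
  assumes "j < n"
  shows "p_image c e c' e' x j = (\<Sum>i<n. partial c' j (\<lambda>y. snd c y i) x *\<^sub>R pvar i) + (\<Sum>\<alpha><r. d\<tau>' j \<alpha> * \<theta>' \<alpha>)"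
proof -
  let ?t = "\<lambda>\<gamma> \<delta> \<alpha>. (fc e \<gamma> x (snd e' \<alpha> x) * partial c' j (\<lambda>y. fc e' \<alpha> y (snd e \<delta> y)) x) *\<^sub>R
        (ovar (Tau \<delta>) * ovar (Theta \<gamma>))"
  have "(\<Sum>\<gamma><r. \<Sum>\<delta><r. \<Sum>\<alpha><r. ?t \<gamma> \<delta> \<alpha>) = (\<Sum>\<gamma><r. \<Sum>\<alpha><r. \<Sum>\<delta><r. ?t \<gamma> \<delta> \<alpha>)"
    by (intro sum.cong refl sum.swap)
  also have "\<dots> = (\<Sum>\<alpha><r. \<Sum>\<gamma><r. \<Sum>\<delta><r. ?t \<gamma> \<delta> \<alpha>)"
    by (rule sum.swap)
  also have "\<dots> = (\<Sum>\<alpha><r. \<Sum>\<delta><r. \<Sum>\<gamma><r. ?t \<gamma> \<delta> \<alpha>)"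
    by (intro sum.cong refl sum.swap)
  also have "\<dots> = (\<Sum>\<alpha><r. d\<tau>' j \<alpha> * \<theta>' \<alpha>)"
    by (simp add: sum_product mult.commute)
  finally show ?thesis using assms by (simp add: p_image_def)
qed

text \<open>The two transition matrices are inverse to each other. This lets all terms be collected
  as multiples of the \<open>\<theta>'\<close>.\<close>

lemma Theta_in_terms_of_image:
  assumes "\<gamma> < r"
  shows "ovar (Theta \<gamma>) = (\<Sum>\<alpha><r. fc e' \<alpha> x (snd e \<gamma> x) *\<^sub>R \<theta>' \<alpha>)"
proof -
  have "(\<Sum>\<alpha><r. fc e' \<alpha> x (snd e \<gamma> x) *\<^sub>R \<theta>' \<alpha>) =
      (\<Sum>\<beta><r. (\<Sum>\<alpha><r. fc e \<beta> x (snd e' \<alpha> x) * fc e' \<alpha> x (snd e \<gamma> x)) *\<^sub>R ovar (Theta \<beta>))"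
    by (simp add: scaleR_sum_left scaleR_sum_right mult.commute) (rule sum.swap)
  also have "\<dots> = (\<Sum>\<beta><r. if \<beta> = \<gamma> then ovar (Theta \<beta>) else 0)"
    by (intro sum.cong) (auto simp: coeff_change_inverse[OF e' e domain_facts(2,1) _ assms])
  finally show ?thesis using assms by simp
qed

text \<open>Both sides are the component of \<open>N\<close> applied to a frame vector of
  \<open>e\<close>, taken in \<open>e'\<close>. The point \<open>y\<close> is arbitrary, so that the
  identity can be differentiated.\<close>

lemma endo_change:
  assumes N: "endomorphism B N" and "\<alpha> < r"
  shows "y \<in> fst e \<Longrightarrow> y \<in> fst e' \<Longrightarrow> \<beta> < r \<Longrightarrow>
    (\<Sum>\<gamma><r. fc e' \<alpha> y (snd e \<gamma> y) * fc e \<gamma> y (N y (snd e \<beta> y))) =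
    (\<Sum>\<gamma><r. fc e' \<alpha> y (N y (snd e' \<gamma> y)) * fc e' \<gamma> y (snd e \<beta> y))"
  using coeff_change[OF e e' _ _ endo_fibre(1)[OF N frame_in_fibre[OF e]], of y \<beta> \<alpha>]
    endo_coeff[OF N e' _ frame_in_fibre[OF e], of y \<beta> \<alpha>] by simp

text \<open>On the odd generators this is the transformation law of the matrix of \<open>N\<close>.
  On \<open>pvar j\<close> it is the derivative of that law, in which the quadratic term of
  \<open>p_image\<close> accounts for the derivatives of the transition matrix.\<close>

lemma tr_intertwines_endo:
  assumes N: "endomorphism B N"
  shows "act_endo N c e x (tr c e c' e' x a) = tr c e c' e' x (act_endo N c' e' x a)"
  unfolding tr_def
proof (rule S.subst_intertwines[where s = "\<lambda>a. a" and D = "act_endo N c e x" and D' = "act_endo N c' e' x"])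
  note d = domain_facts
  note D_mult = act_endo_mult[OF c e d(3) N]
  show "linear (act_endo N c e x)" "linear (act_endo N c' e' x)" by (rule linear_act_endo)+
  show "act_endo N c e x (a * b) = act_endo N c e x a * b + a * act_endo N c e x b" for a b
    by (rule D_mult)
  show "act_endo N c' e' x (a * b) = act_endo N c' e' x a * b + a * act_endo N c' e' x b" for a b
    by (rule act_endo_mult[OF c' e' d(4) N])
  define L where "L \<delta> = (\<Sum>\<beta><r. fc e \<delta> x (N x (snd e \<beta> x)) *\<^sub>R ovar (Tau \<beta>))" for \<delta>
  have D_Tau: "act_endo N c e x (ovar (Tau \<delta>)) = L \<delta>" if "\<delta> < r" for \<delta>
    unfolding act_endo_def L_def by (rule act_endo_gens(1)[OF that])
  have D_Theta: "act_endo N c e x (ovar (Theta \<delta>)) = - (\<Sum>\<gamma><r. fc e \<gamma> x (N x (snd e \<delta> x)) *\<^sub>R ovar (Theta \<gamma>))"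
    if "\<delta> < r" for \<delta>
    unfolding act_endo_def by (rule act_endo_gens(2)[OF that])
  have D_\<tau>': "act_endo N c e x (\<tau>' \<alpha>) = (\<Sum>\<beta><r. fc e' \<alpha> x (N x (snd e' \<beta> x)) *\<^sub>R \<tau>' \<beta>)" if "\<alpha> < r" for \<alpha>
  proof -
    have "act_endo N c e x (\<tau>' \<alpha>) =
        (\<Sum>\<beta><r. (\<Sum>\<gamma><r. fc e' \<alpha> x (snd e \<gamma> x) * fc e \<gamma> x (N x (snd e \<beta> x))) *\<^sub>R ovar (Tau \<beta>))"
      by (simp add: act_field_simps D_Tau L_def scaleR_sum_left scaleR_sum_right cong: sum.cong_simp) (rule sum.swap)
    also have "\<dots> = (\<Sum>\<beta><r. (\<Sum>\<gamma><r. fc e' \<alpha> x (N x (snd e' \<gamma> x)) * fc e' \<gamma> x (snd e \<beta> x)) *\<^sub>R ovar (Tau \<beta>))"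
      by (intro sum.cong refl) (simp add: endo_change[OF N that d(1,2)])
    also have "\<dots> = (\<Sum>\<beta><r. fc e' \<alpha> x (N x (snd e' \<beta> x)) *\<^sub>R \<tau>' \<beta>)"
      by (simp add: scaleR_sum_left scaleR_sum_right) (rule sum.swap)
    finally show ?thesis .
  qed
  have D_\<theta>': "act_endo N c e x (\<theta>' \<alpha>) = - (\<Sum>\<beta><r. fc e' \<beta> x (N x (snd e' \<alpha> x)) *\<^sub>R \<theta>' \<beta>)" if "\<alpha> < r" for \<alpha>
  proof -
    have "act_endo N c e x (\<theta>' \<alpha>) =
        - (\<Sum>\<beta><r. (\<Sum>\<gamma><r. fc e \<beta> x (N x (snd e \<gamma> x)) * fc e \<gamma> x (snd e' \<alpha> x)) *\<^sub>R ovar (Theta \<beta>))"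
      by (simp add: act_field_simps D_Theta sum_negf scaleR_sum_left scaleR_sum_right mult.commute cong: sum.cong_simp)
        (rule sum.swap)
    also have "\<dots> = - (\<Sum>\<beta><r. (\<Sum>\<gamma><r. fc e \<beta> x (snd e' \<gamma> x) * fc e' \<gamma> x (N x (snd e' \<alpha> x))) *\<^sub>R ovar (Theta \<beta>))"
      using endo_coeff[OF N e d(1) frame_in_fibre[OF e' d(2) that]]
        coeff_change[OF e' e d(2,1) endo_fibre(1)[OF N frame_in_fibre[OF e' d(2) that]]] by simp
    also have "\<dots> = - (\<Sum>\<beta><r. fc e' \<beta> x (N x (snd e' \<alpha> x)) *\<^sub>R \<theta>' \<beta>)"
      by (simp add: scaleR_sum_left scaleR_sum_right mult.commute) (rule sum.swap)
    finally show ?thesis .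
  qed
  show "act_endo N c e x (odd_image e e' x g) = S.subst (act_endo N c' e' x (ovar g))" for g
  proof (cases "g \<in> odd_gens r")
    case True
    then show ?thesis
      by (cases g)
        (simp_all add: D_\<tau>' D_\<theta>' act_endo_def[of N c' e'] act_endo_gens S.subst_simps cong: sum.cong_simp)
  next
    case False
    then show ?thesis
      by (cases g) (simp_all add: act_field_simps act_endo_def[of N c' e'] act_ovar S.subst_simps)
  qed
  show "act_endo N c e x (p_image c e c' e' x j) = S.subst (act_endo N c' e' x (pvar j))" for j
  proof (cases "j < n")
    case True
    let ?W = "fst c \<inter> fst e \<inter> fst c' \<inter> fst e'"
    let ?dx = "\<lambda>f. partial c' j f x"
    have W: "?W \<subseteq> fst c" "?W \<subseteq> fst c'" "?W \<subseteq> fst e" "?W \<subseteq> fst e'" by auto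
    note pr = c' d(5) W(2) True x
    define dL where "dL \<gamma> = (\<Sum>\<beta><r. ?dx (\<lambda>y. fc e \<gamma> y (N y (snd e \<beta> y))) *\<^sub>R ovar (Tau \<beta>))" for \<gamma>
    define dn' where "dn' \<alpha> \<beta> = ?dx (\<lambda>y. fc e' \<alpha> y (N y (snd e' \<beta> y)))" for \<alpha> \<beta>
    have sm: "smooth B ?W (\<lambda>y. fc e' \<alpha> y (snd e \<beta> y))" "smooth B ?W (\<lambda>y. fc e \<alpha> y (N y (snd e \<beta> y)))"
      "smooth B ?W (\<lambda>y. fc e' \<alpha> y (N y (snd e' \<beta> y)))" if "\<alpha> < r" "\<beta> < r" for \<alpha> \<beta>
      using smooth_change[OF e e' that] endo_smooth[OF N e that] endo_smooth[OF N e' that]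
      by (auto elim!: smooth_subset)
    \<comment> \<open>The derivative of \<open>endo_change\<close> along the \<open>j\<close>-th
      coordinate of \<open>c'\<close>, contracted with the \<open>Tau\<close> generators.\<close>
    have key: "(\<Sum>\<gamma><r. ?dx (\<lambda>y. fc e' \<alpha> y (snd e \<gamma> y)) *\<^sub>R L \<gamma>) + (\<Sum>\<gamma><r. fc e' \<alpha> x (snd e \<gamma> x) *\<^sub>R dL \<gamma>) =
        (\<Sum>\<beta><r. dn' \<alpha> \<beta> *\<^sub>R \<tau>' \<beta>) + (\<Sum>\<beta><r. fc e' \<alpha> x (N x (snd e' \<beta> x)) *\<^sub>R d\<tau>' j \<beta>)" if \<alpha>: "\<alpha> < r" for \<alpha>
    proof -
      have "(\<Sum>\<gamma><r. ?dx (\<lambda>y. fc e' \<alpha> y (snd e \<gamma> y)) * fc e \<gamma> x (N x (snd e \<beta> x)) +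
            fc e' \<alpha> x (snd e \<gamma> x) * ?dx (\<lambda>y. fc e \<gamma> y (N y (snd e \<beta> y)))) =
          (\<Sum>\<gamma><r. dn' \<alpha> \<gamma> * fc e' \<gamma> x (snd e \<beta> x) +
            fc e' \<alpha> x (N x (snd e' \<gamma> x)) * ?dx (\<lambda>y. fc e' \<gamma> y (snd e \<beta> y)))" if \<beta>: "\<beta> < r" for \<beta>
      proof -
        have "?dx (\<lambda>y. \<Sum>\<gamma><r. fc e' \<alpha> y (snd e \<gamma> y) * fc e \<gamma> y (N y (snd e \<beta> y))) =
            ?dx (\<lambda>y. \<Sum>\<gamma><r. fc e' \<alpha> y (N y (snd e' \<gamma> y)) * fc e' \<gamma> y (snd e \<beta> y))"
          by (rule partial_cong[OF pr]) (use endo_change[OF N \<alpha> _ _ \<beta>] in auto)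
        moreover have "?dx (\<lambda>y. \<Sum>\<gamma><r. fc e' \<alpha> y (snd e \<gamma> y) * fc e \<gamma> y (N y (snd e \<beta> y))) =
            (\<Sum>\<gamma><r. ?dx (\<lambda>y. fc e' \<alpha> y (snd e \<gamma> y)) * fc e \<gamma> x (N x (snd e \<beta> x)) +
              fc e' \<alpha> x (snd e \<gamma> x) * ?dx (\<lambda>y. fc e \<gamma> y (N y (snd e \<beta> y))))"
          by (rule partial_sum_mult[OF pr]) (simp_all add: sm \<alpha> \<beta>)
        moreover have "?dx (\<lambda>y. \<Sum>\<gamma><r. fc e' \<alpha> y (N y (snd e' \<gamma> y)) * fc e' \<gamma> y (snd e \<beta> y)) =
            (\<Sum>\<gamma><r. dn' \<alpha> \<gamma> * fc e' \<gamma> x (snd e \<beta> x) +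
              fc e' \<alpha> x (N x (snd e' \<gamma> x)) * ?dx (\<lambda>y. fc e' \<gamma> y (snd e \<beta> y)))"
          unfolding dn'_def by (rule partial_sum_mult[OF pr]) (simp_all add: sm \<alpha> \<beta>)
        ultimately show ?thesis by simp
      qed
      then have "(\<Sum>\<beta><r. (\<Sum>\<gamma><r. ?dx (\<lambda>y. fc e' \<alpha> y (snd e \<gamma> y)) * fc e \<gamma> x (N x (snd e \<beta> x)) +
            fc e' \<alpha> x (snd e \<gamma> x) * ?dx (\<lambda>y. fc e \<gamma> y (N y (snd e \<beta> y)))) *\<^sub>R ovar (Tau \<beta>)) =
          (\<Sum>\<beta><r. (\<Sum>\<gamma><r. dn' \<alpha> \<gamma> * fc e' \<gamma> x (snd e \<beta> x) +
            fc e' \<alpha> x (N x (snd e' \<gamma> x)) * ?dx (\<lambda>y. fc e' \<gamma> y (snd e \<beta> y))) *\<^sub>R ovar (Tau \<beta>))"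
        by (intro sum.cong refl) simp
      then show ?thesis
        unfolding scaleR_sum_left
        by (subst (asm) (1 2) sum.swap)
          (simp add: L_def dL_def scaleR_sum_right scaleR_add_left sum.distrib)
    qed
    \<comment> \<open>The linear part of \<open>p_image\<close> differentiates the matrix of
      \<open>N\<close> along the new coordinate; the result is then rewritten with
      \<open>\<theta>'\<close> to match the quadratic part.\<close>
    have "act_endo N c e x (\<Sum>i<n. partial c' j (\<lambda>y. snd c y i) x *\<^sub>R pvar i) =
        (\<Sum>i<n. partial c' j (\<lambda>y. snd c y i) x *\<^sub>R gpartial c i (endo_field N e) x)"
      by (simp add: act_field_simps) (simp add: act_endo_def act_pvar)
    also have "\<dots> = gpartial c' j (endo_field N e) x"
      by (rule gpartial_chain[OF c c' d(5) W(1,2) True x smooth_endo_field[OF N e d(5) W(3)]])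
    also have "\<dots> = (\<Sum>\<gamma><r. dL \<gamma> * ovar (Theta \<gamma>))"
      by (simp add: gpartial_endo_field[OF N e c' d(5) W(2,3) True x] dL_def sum_distrib_right)
    also have "\<dots> = (\<Sum>\<gamma><r. \<Sum>\<alpha><r. (fc e' \<alpha> x (snd e \<gamma> x) *\<^sub>R dL \<gamma>) * \<theta>' \<alpha>)"
    proof (intro sum.cong refl)
      fix \<gamma> assume "\<gamma> \<in> {..<r}"
      then have "dL \<gamma> * ovar (Theta \<gamma>) = dL \<gamma> * (\<Sum>\<alpha><r. fc e' \<alpha> x (snd e \<gamma> x) *\<^sub>R \<theta>' \<alpha>)"
        using Theta_in_terms_of_image by simp
      then show "dL \<gamma> * ovar (Theta \<gamma>) = (\<Sum>\<alpha><r. (fc e' \<alpha> x (snd e \<gamma> x) *\<^sub>R dL \<gamma>) * \<theta>' \<alpha>)"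
        by (simp only: sum_distrib_left[of "dL \<gamma>"] mult_scaleR_left mult_scaleR_right)
    qed
    also have "\<dots> = (\<Sum>\<alpha><r. (\<Sum>\<gamma><r. fc e' \<alpha> x (snd e \<gamma> x) *\<^sub>R dL \<gamma>) * \<theta>' \<alpha>)"
      by (subst sum.swap) (simp only: sum_distrib_right[of _ _ "\<theta>' _"])
    finally have 1: "act_endo N c e x (\<Sum>i<n. partial c' j (\<lambda>y. snd c y i) x *\<^sub>R pvar i) =
        (\<Sum>\<alpha><r. (\<Sum>\<gamma><r. fc e' \<alpha> x (snd e \<gamma> x) *\<^sub>R dL \<gamma>) * \<theta>' \<alpha>)" .
    \<comment> \<open>The Leibniz rule on the quadratic part. The terms coming from the action on
      \<open>\<theta>' \<alpha>\<close> are reindexed below, so that every term carries the factor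
      \<open>\<theta>' \<alpha>\<close>.\<close>
    have "act_endo N c e x (d\<tau>' j \<alpha> * \<theta>' \<alpha>) = (\<Sum>\<gamma><r. ?dx (\<lambda>y. fc e' \<alpha> y (snd e \<gamma> y)) *\<^sub>R L \<gamma>) * \<theta>' \<alpha> -
        (\<Sum>\<beta><r. (fc e' \<beta> x (N x (snd e' \<alpha> x)) *\<^sub>R d\<tau>' j \<alpha>) * \<theta>' \<beta>)" if "\<alpha> < r" for \<alpha>
    proof -
      have "act_endo N c e x (d\<tau>' j \<alpha>) = (\<Sum>\<gamma><r. ?dx (\<lambda>y. fc e' \<alpha> y (snd e \<gamma> y)) *\<^sub>R L \<gamma>)"
        by (simp add: act_field_simps D_Tau cong: sum.cong_simp)
      moreover have "d\<tau>' j \<alpha> * (\<Sum>\<beta><r. fc e' \<beta> x (N x (snd e' \<alpha> x)) *\<^sub>R \<theta>' \<beta>) =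
          (\<Sum>\<beta><r. (fc e' \<beta> x (N x (snd e' \<alpha> x)) *\<^sub>R d\<tau>' j \<alpha>) * \<theta>' \<beta>)"
        by (simp only: sum_distrib_left[of "d\<tau>' j \<alpha>"] mult_scaleR_left mult_scaleR_right)
      ultimately show ?thesis unfolding D_mult D_\<theta>'[OF that] by simp
    qed
    then have "act_endo N c e x (\<Sum>\<alpha><r. d\<tau>' j \<alpha> * \<theta>' \<alpha>) =
        (\<Sum>\<alpha><r. (\<Sum>\<gamma><r. ?dx (\<lambda>y. fc e' \<alpha> y (snd e \<gamma> y)) *\<^sub>R L \<gamma>) * \<theta>' \<alpha> -
        (\<Sum>\<beta><r. (fc e' \<beta> x (N x (snd e' \<alpha> x)) *\<^sub>R d\<tau>' j \<alpha>) * \<theta>' \<beta>))"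
      unfolding linear_sum[OF linear_act_endo] by (intro sum.cong refl) simp
    also have "\<dots> = (\<Sum>\<alpha><r. (\<Sum>\<gamma><r. ?dx (\<lambda>y. fc e' \<alpha> y (snd e \<gamma> y)) *\<^sub>R L \<gamma>) * \<theta>' \<alpha>) -
        (\<Sum>\<alpha><r. (\<Sum>\<beta><r. fc e' \<alpha> x (N x (snd e' \<beta> x)) *\<^sub>R d\<tau>' j \<beta>) * \<theta>' \<alpha>)"
    proof -
      have "(\<Sum>\<alpha><r. \<Sum>\<beta><r. (fc e' \<beta> x (N x (snd e' \<alpha> x)) *\<^sub>R d\<tau>' j \<alpha>) * \<theta>' \<beta>) =
          (\<Sum>\<alpha><r. (\<Sum>\<beta><r. fc e' \<alpha> x (N x (snd e' \<beta> x)) *\<^sub>R d\<tau>' j \<beta>) * \<theta>' \<alpha>)"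
        by (subst sum.swap) (simp only: sum_distrib_right[of _ _ "\<theta>' _"])
      then show ?thesis unfolding sum_subtractf by simp
    qed
    finally have 2: "act_endo N c e x (\<Sum>\<alpha><r. d\<tau>' j \<alpha> * \<theta>' \<alpha>) = \<dots>" .
    have "act_endo N c e x (p_image c e c' e' x j) = (\<Sum>\<alpha><r. (\<Sum>\<beta><r. dn' \<alpha> \<beta> *\<^sub>R \<tau>' \<beta>) * \<theta>' \<alpha>)"
    proof -
      have "act_endo N c e x (p_image c e c' e' x j) =
          (\<Sum>\<alpha><r. ((\<Sum>\<gamma><r. ?dx (\<lambda>y. fc e' \<alpha> y (snd e \<gamma> y)) *\<^sub>R L \<gamma>) + (\<Sum>\<gamma><r. fc e' \<alpha> x (snd e \<gamma> x) *\<^sub>R dL \<gamma>)) * \<theta>' \<alpha> -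
            (\<Sum>\<beta><r. fc e' \<alpha> x (N x (snd e' \<beta> x)) *\<^sub>R d\<tau>' j \<beta>) * \<theta>' \<alpha>)"
        unfolding p_image_eq[OF True] linear_add[OF linear_act_endo] 1 2
        by (simp only: distrib_right sum.distrib sum_subtractf algebra_simps)
      also have "\<dots> = (\<Sum>\<alpha><r. (\<Sum>\<beta><r. dn' \<alpha> \<beta> *\<^sub>R \<tau>' \<beta>) * \<theta>' \<alpha>)"
      proof (intro sum.cong refl)
        fix \<alpha> assume "\<alpha> \<in> {..<r}"
        then have \<alpha>: "\<alpha> < r" by simp
        show "((\<Sum>\<gamma><r. ?dx (\<lambda>y. fc e' \<alpha> y (snd e \<gamma> y)) *\<^sub>R L \<gamma>) + (\<Sum>\<gamma><r. fc e' \<alpha> x (snd e \<gamma> x) *\<^sub>R dL \<gamma>)) * \<theta>' \<alpha> -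
            (\<Sum>\<beta><r. fc e' \<alpha> x (N x (snd e' \<beta> x)) *\<^sub>R d\<tau>' j \<beta>) * \<theta>' \<alpha> = (\<Sum>\<beta><r. dn' \<alpha> \<beta> *\<^sub>R \<tau>' \<beta>) * \<theta>' \<alpha>"
          unfolding key[OF \<alpha>] by (simp only: distrib_right add_diff_cancel_right')
      qed
      finally show ?thesis .
    qed
    moreover have "S.subst (act_endo N c' e' x (pvar j)) = (\<Sum>\<alpha><r. (\<Sum>\<beta><r. dn' \<alpha> \<beta> *\<^sub>R \<tau>' \<beta>) * \<theta>' \<alpha>)"
      using True
      by (simp add: act_endo_def act_pvar gpartial_endo_field[OF N e' c' d(5) W(2,4) True x]
          S.subst_simps S.subst_mult dn'_def sum_distrib_right cong: sum.cong_simp)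
    ultimately show ?thesis by simp
  next
    case False
    then show ?thesis by (simp add: p_image_def act_field_simps act_endo_def[of N c'] act_pvar S.subst_simps)
  qed
qed simp_all

text \<open>The bracket with a section is an odd derivation, hence the twist \<open>parity\<close>.
  The law to be differentiated is now that of the components of \<open>X\<close>, and the quadratic
  term again supplies the derivatives of the transition matrix.\<close>

lemma tr_intertwines_section:
  assumes X: "X \<in> sections B"
  shows "act_section (\<lambda>x. (X x, \<lambda>v. 0)) c e x (tr c e c' e' x a) =
    tr c e c' e' x (act_section (\<lambda>x. (X x, \<lambda>v. 0)) c' e' x a)"
proof -
  define u where "u = (\<lambda>x. (X x, (\<lambda>v. 0) :: 'v \<Rightarrow> real))"
  have u: "u \<in> E_sections B" unfolding u_def by (rule vector_E_section[OF X])
  have uX: "fst (u y) = X y" "snd (u y) v = 0" for y v by (simp_all add: u_def)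
  note d = domain_facts
  note D_mult = act_section_mult[OF c e d(3) u]
  have D_Tau: "act_section u c e x (ovar (Tau \<delta>)) = fc e \<delta> x (X x) *\<^sub>R 1" if "\<delta> < r" for \<delta>
    unfolding act_section_def using act_section_gens(1)[OF that] by (simp add: uX)
  have D_Theta: "act_section u c e x (ovar (Theta \<delta>)) = 0" if "\<delta> < r" for \<delta>
    unfolding act_section_def using act_section_gens(2)[OF that] by (simp add: uX)
  have co: "(\<Sum>\<delta><r. fc e' \<alpha> y (snd e \<delta> y) * fc e \<delta> y (X y)) = fc e' \<alpha> y (X y)" if "y \<in> fst e" "y \<in> fst e'" for \<alpha> y
    using coeff_change[OF e e' that section_in_fibre[OF X]] by simp
  have D_\<tau>': "act_section u c e x (\<tau>' \<alpha>) = fc e' \<alpha> x (X x) *\<^sub>R 1" for \<alpha>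
    by (simp add: act_field_simps D_Tau co[OF d(1,2), symmetric] scaleR_sum_left cong: sum.cong_simp)
  have D_\<theta>': "act_section u c e x (\<theta>' \<alpha>) = 0" for \<alpha>
    by (simp add: act_field_simps D_Theta cong: sum.cong_simp)
  have "act_section u c e x (tr c e c' e' x a) = tr c e c' e' x (act_section u c' e' x a)"
    unfolding tr_def
  proof (rule S.subst_intertwines[where s = parity and D = "act_section u c e x" and D' = "act_section u c' e' x"])
    show "linear (act_section u c e x)" "linear (act_section u c' e' x)" by (rule linear_act_section)+
    show "act_section u c e x (a * b) = act_section u c e x a * b + parity a * act_section u c e x b" for a b
      by (rule D_mult)
    show "act_section u c' e' x (a * b) = act_section u c' e' x a * b + parity a * act_section u c' e' x b" for a b
      by (rule act_section_mult[OF c' e' d(4) u])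
    show "S.subst (parity a) = parity (S.subst a)" for a by (rule S.subst_parity)
    show "act_section u c e x (odd_image e e' x g) = S.subst (act_section u c' e' x (ovar g))" for g
    proof (cases "g \<in> odd_gens r")
      case True
      then show ?thesis
        by (cases g)
          (simp_all add: D_\<tau>' D_\<theta>' act_section_def[of u c' e'] act_section_gens uX S.subst_simps)
    next
      case False
      then show ?thesis
        by (cases g) (simp_all add: act_field_simps act_section_def[of u c' e'] act_ovar S.subst_simps)
    qed
    show "act_section u c e x (p_image c e c' e' x j) = S.subst (act_section u c' e' x (pvar j))" for j
    proof (cases "j < n")
      case True
      let ?W = "fst c \<inter> fst e \<inter> fst c' \<inter> fst e'"
      let ?dx = "\<lambda>f. partial c' j f x"
      have W: "?W \<subseteq> fst c" "?W \<subseteq> fst c'" "?W \<subseteq> fst e" "?W \<subseteq> fst e'" by auto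
      note pr = c' d(5) W(2) True x
      have sm: "smooth B ?W (\<lambda>y. fc e' \<alpha> y (snd e \<beta> y))" if "\<alpha> < r" "\<beta> < r" for \<alpha> \<beta>
        using smooth_change[OF e e' that] by (auto elim!: smooth_subset)
      have sX: "smooth B ?W (\<lambda>y. fc e \<alpha> y (X y))" if "\<alpha> < r" for \<alpha>
        using section_smooth[OF X e that] by (rule smooth_subset) auto
      \<comment> \<open>The derivative of the transformation law \<open>co\<close> along the
        \<open>j\<close>-th coordinate of \<open>c'\<close>.\<close>
      have key: "(\<Sum>\<gamma><r. ?dx (\<lambda>y. fc e' \<alpha> y (snd e \<gamma> y)) * fc e \<gamma> x (X x) +
          fc e' \<alpha> x (snd e \<gamma> x) * ?dx (\<lambda>y. fc e \<gamma> y (X y))) = ?dx (\<lambda>y. fc e' \<alpha> y (X y))" if "\<alpha> < r" for \<alpha>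
      proof -
        have "?dx (\<lambda>y. \<Sum>\<gamma><r. fc e' \<alpha> y (snd e \<gamma> y) * fc e \<gamma> y (X y)) =
            (\<Sum>\<gamma><r. ?dx (\<lambda>y. fc e' \<alpha> y (snd e \<gamma> y)) * fc e \<gamma> x (X x) +
              fc e' \<alpha> x (snd e \<gamma> x) * ?dx (\<lambda>y. fc e \<gamma> y (X y)))"
          by (rule partial_sum_mult[OF pr]) (simp_all add: sm sX that)
        moreover have "?dx (\<lambda>y. \<Sum>\<gamma><r. fc e' \<alpha> y (snd e \<gamma> y) * fc e \<gamma> y (X y)) = ?dx (\<lambda>y. fc e' \<alpha> y (X y))"
          by (rule partial_cong[OF pr]) (use co in auto)
        ultimately show ?thesis by simp
      qed
      have "act_section u c e x (\<Sum>i<n. partial c' j (\<lambda>y. snd c y i) x *\<^sub>R pvar i) =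
          (\<Sum>i<n. partial c' j (\<lambda>y. snd c y i) x *\<^sub>R gpartial c i (section_field u e) x)"
        by (simp add: act_field_simps) (simp add: act_section_def act_pvar)
      also have "\<dots> = gpartial c' j (section_field u e) x"
        by (rule gpartial_chain[OF c c' d(5) W(1,2) True x smooth_section_field[OF u e d(5) W(3)]])
      also have "\<dots> = (\<Sum>\<gamma><r. ?dx (\<lambda>y. fc e \<gamma> y (X y)) *\<^sub>R ovar (Theta \<gamma>))"
        by (simp add: gpartial_section_field[OF u e c' d(5) W(2,3) True x] uX)
      also have "\<dots> = (\<Sum>\<gamma><r. \<Sum>\<alpha><r. (fc e' \<alpha> x (snd e \<gamma> x) * ?dx (\<lambda>y. fc e \<gamma> y (X y))) *\<^sub>R \<theta>' \<alpha>)"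
      proof (intro sum.cong refl)
        fix \<gamma> assume "\<gamma> \<in> {..<r}"
        then have "?dx (\<lambda>y. fc e \<gamma> y (X y)) *\<^sub>R ovar (Theta \<gamma>) =
            ?dx (\<lambda>y. fc e \<gamma> y (X y)) *\<^sub>R (\<Sum>\<alpha><r. fc e' \<alpha> x (snd e \<gamma> x) *\<^sub>R \<theta>' \<alpha>)"
          using Theta_in_terms_of_image by simp
        then show "?dx (\<lambda>y. fc e \<gamma> y (X y)) *\<^sub>R ovar (Theta \<gamma>) =
            (\<Sum>\<alpha><r. (fc e' \<alpha> x (snd e \<gamma> x) * ?dx (\<lambda>y. fc e \<gamma> y (X y))) *\<^sub>R \<theta>' \<alpha>)"
          by (simp only: scaleR_sum_right[of _ "\<lambda>\<alpha>. fc e' \<alpha> x (snd e \<gamma> x) *\<^sub>R \<theta>' \<alpha>"] scaleR_scaleR mult.commute)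
      qed
      also have "\<dots> = (\<Sum>\<alpha><r. (\<Sum>\<gamma><r. fc e' \<alpha> x (snd e \<gamma> x) * ?dx (\<lambda>y. fc e \<gamma> y (X y))) *\<^sub>R \<theta>' \<alpha>)"
        by (subst sum.swap) (simp only: scaleR_sum_left)
      finally have 1: "act_section u c e x (\<Sum>i<n. partial c' j (\<lambda>y. snd c y i) x *\<^sub>R pvar i) = \<dots>" .
      have "act_section u c e x (d\<tau>' j \<alpha> * \<theta>' \<alpha>) =
          (\<Sum>\<gamma><r. ?dx (\<lambda>y. fc e' \<alpha> y (snd e \<gamma> y)) * fc e \<gamma> x (X x)) *\<^sub>R \<theta>' \<alpha>" for \<alpha>
      proof -
        have "act_section u c e x (d\<tau>' j \<alpha>) = (\<Sum>\<gamma><r. ?dx (\<lambda>y. fc e' \<alpha> y (snd e \<gamma> y)) * fc e \<gamma> x (X x)) *\<^sub>R 1"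
          by (simp add: act_field_simps D_Tau scaleR_sum_left cong: sum.cong_simp)
        then show ?thesis unfolding D_mult D_\<theta>' by simp
      qed
      then have "act_section u c e x (\<Sum>\<alpha><r. d\<tau>' j \<alpha> * \<theta>' \<alpha>) =
          (\<Sum>\<alpha><r. (\<Sum>\<gamma><r. ?dx (\<lambda>y. fc e' \<alpha> y (snd e \<gamma> y)) * fc e \<gamma> x (X x)) *\<^sub>R \<theta>' \<alpha>)"
        unfolding linear_sum[OF linear_act_section] by (intro sum.cong refl)
      with 1 have "act_section u c e x (p_image c e c' e' x j) =
          (\<Sum>\<alpha><r. (\<Sum>\<gamma><r. ?dx (\<lambda>y. fc e' \<alpha> y (snd e \<gamma> y)) * fc e \<gamma> x (X x) +
          fc e' \<alpha> x (snd e \<gamma> x) * ?dx (\<lambda>y. fc e \<gamma> y (X y))) *\<^sub>R \<theta>' \<alpha>)"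
        unfolding p_image_eq[OF True] linear_add[OF linear_act_section]
        by (simp only: sum.distrib scaleR_add_left add.commute)
      also have "\<dots> = (\<Sum>\<alpha><r. ?dx (\<lambda>y. fc e' \<alpha> y (X y)) *\<^sub>R \<theta>' \<alpha>)"
        by (intro sum.cong refl) (simp only: key lessThan_iff)
      also have "\<dots> = S.subst (act_section u c' e' x (pvar j))"
        using True
        by (simp add: act_section_def act_pvar gpartial_section_field[OF u e' c' d(5) W(2,4) True x]
            uX S.subst_simps cong: sum.cong_simp)
      finally show ?thesis .
    next
      case False
      then show ?thesis by (simp add: p_image_def act_field_simps act_section_def[of u c'] act_pvar S.subst_simps)
    qed
  qed simp_all
  then show ?thesis by (simp add: u_def)
qed

end

end

section \<open>Derived brackets and the Nijenhuis torsion\<close>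

lemma linear_span_into:
  assumes "linear D" "\<And>g. g \<in> G \<Longrightarrow> D g \<in> span H" "a \<in> span G"
  shows "D a \<in> span H"
proof -
  have "D a \<in> D ` span G" using assms(3) by blast
  also have "\<dots> = span (D ` G)" using linear_span_image[OF assms(1)] by simp
  also have "\<dots> \<subseteq> span H" by (rule span_minimal) (use assms(2) in auto)
  finally show ?thesis .
qed

text \<open>Lie algebroid structures have values in the span of \<open>lie_gens\<close>; one bracket
  with a section leads to the span of \<open>p_tau_theta_gens\<close>, a second one to that of
  \<open>theta_gens\<close>.\<close>

definition theta_gens :: "nat \<Rightarrow> gp set" where
  "theta_gens r = {ovar (Theta \<gamma>) | \<gamma>. \<gamma> < r}"

definition p_tau_theta_gens :: "nat \<Rightarrow> nat \<Rightarrow> gp set" where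
  "p_tau_theta_gens n r = {pvar i | i. i < n} \<union> {ovar (Tau \<alpha>) * ovar (Theta \<gamma>) | \<alpha> \<gamma>. \<alpha> < r \<and> \<gamma> < r}"

definition lie_gens :: "nat \<Rightarrow> nat \<Rightarrow> gp set" where
  "lie_gens n r = {pvar i * ovar (Tau \<alpha>) | i \<alpha>. i < n \<and> \<alpha> < r} \<union>
     {ovar (Tau \<alpha>) * (ovar (Tau \<beta>) * ovar (Theta \<gamma>)) | \<alpha> \<beta> \<gamma>. \<alpha> < r \<and> \<beta> < r \<and> \<gamma> < r}"

lemma theta_in_span: "\<gamma> < r \<Longrightarrow> ovar (Theta \<gamma>) \<in> span (theta_gens r)"
  by (rule span_base) (auto simp: theta_gens_def)

lemma p_in_span: "i < n \<Longrightarrow> pvar i \<in> span (p_tau_theta_gens n r)"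
  and tau_theta_in_span: "\<alpha> < r \<Longrightarrow> \<gamma> < r \<Longrightarrow> ovar (Tau \<alpha>) * ovar (Theta \<gamma>) \<in> span (p_tau_theta_gens n r)"
  by (rule span_base, auto simp: p_tau_theta_gens_def)+

lemma p_tau_in_span: "i < n \<Longrightarrow> \<alpha> < r \<Longrightarrow> pvar i * ovar (Tau \<alpha>) \<in> span (lie_gens n r)"
  unfolding lie_gens_def by (rule span_base, rule UnI1) blast

lemma tau_tau_theta_in_span:
  "\<alpha> < r \<Longrightarrow> \<beta> < r \<Longrightarrow> \<gamma> < r \<Longrightarrow> ovar (Tau \<alpha>) * (ovar (Tau \<beta>) * ovar (Theta \<gamma>)) \<in> span (lie_gens n r)"
  unfolding lie_gens_def by (rule span_base, rule UnI2, rule CollectI, rule exI[of _ \<alpha>], rule exI[of _ \<beta>], rule exI[of _ \<gamma>]) simp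

lemma lie_gens_cases:
  assumes "g \<in> lie_gens n r"
  obtains i \<alpha> where "i < n" "\<alpha> < r" "g = pvar i * ovar (Tau \<alpha>)"
  | \<alpha> \<beta> \<gamma> where "\<alpha> < r" "\<beta> < r" "\<gamma> < r" "g = ovar (Tau \<alpha>) * (ovar (Tau \<beta>) * ovar (Theta \<gamma>))"
  using assms unfolding lie_gens_def by blast

lemma p_tau_theta_gens_cases:
  assumes "g \<in> p_tau_theta_gens n r"
  obtains i where "i < n" "g = pvar i"
  | \<alpha> \<gamma> where "\<alpha> < r" "\<gamma> < r" "g = ovar (Tau \<alpha>) * ovar (Theta \<gamma>)"
  using assms unfolding p_tau_theta_gens_def by blast

lemma parity_lie:
  assumes "a \<in> span (lie_gens n r)"
  shows "parity a = - a"
proof -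
  \<comment> \<open>\<open>span {}\<close> is \<open>{0}\<close>, so a linear map that kills the
    generators kills their span.\<close>
  have "parity a + a \<in> span {}"
    by (rule linear_span_into[OF linear_compose_add[OF linear_parity linear_ident] _ assms])
      (auto elim!: lie_gens_cases simp: parity_mult)
  then show ?thesis by (simp add: eq_neg_iff_add_eq_0)
qed

lemma parity_p_tau_theta:
  assumes "a \<in> span (p_tau_theta_gens n r)"
  shows "parity a = a"
proof -
  have "parity a - a \<in> span {}"
    by (rule linear_span_into[OF linear_compose_sub[OF linear_parity linear_ident] _ assms])
      (auto elim!: p_tau_theta_gens_cases simp: parity_mult)
  then show ?thesis by simp
qed

text \<open>The shape condition on monomials in \<open>lie_algebroid\<close>.\<close>

definition lie_form :: "mono \<Rightarrow> bool" where
  "lie_form m \<longleftrightarrow> (\<exists>\<alpha> i. m = ({#i#}, {Tau \<alpha>})) \<or> (\<exists>\<alpha> \<beta> \<gamma>. m = ({#}, {Tau \<alpha>, Tau \<beta>, Theta \<gamma>}))"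

lemma tau_tau_theta_mon:
  "ovar (Tau \<alpha>) * (ovar (Tau \<beta>) * ovar (Theta \<gamma>)) =
    (if \<alpha> = \<beta> then 0 else koszul {Tau \<alpha>} {Tau \<beta>, Theta \<gamma>} *\<^sub>R mon ({#}, {Tau \<alpha>, Tau \<beta>, Theta \<gamma>}))"
  by (simp add: ovar_Tau_Theta ovar_mon)

lemma p_tau_mon: "pvar i * ovar g = mon ({#i#}, {g})"
  by (simp add: ovar_def pvar_mon)

lemma span_lie_coef:
  assumes "a \<in> span (lie_gens n r)" "coef a m \<noteq> 0"
  shows "lie_form m \<and> m \<in> monomials n r 3"
proof -
  let ?V = "{a. \<forall>m. coef a m \<noteq> 0 \<longrightarrow> lie_form m \<and> m \<in> monomials n r 3}"
  have "subspace ?V" unfolding subspace_def by (auto, metis add_0, metis add_0)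
  moreover have "lie_gens n r \<subseteq> ?V"
  proof
    fix g assume "g \<in> lie_gens n r"
    then show "g \<in> ?V"
    proof (cases rule: lie_gens_cases)
      case (1 i \<alpha>)
      then show ?thesis
        unfolding 1(3) p_tau_mon
        by (auto simp: coef_mon lie_form_def monomials_def split: if_splits)
    next
      case (2 \<alpha> \<beta> \<gamma>)
      then show ?thesis
        unfolding 2(4) tau_tau_theta_mon
        by (auto simp: coef_mon lie_form_def monomials_def split: if_splits)
    qed
  qed
  ultimately have "span (lie_gens n r) \<subseteq> ?V" by (rule span_minimal[rotated])
  then show ?thesis using assms by blast
qed

text \<open>With \<open>span_lie_coef\<close> this describes the span of \<open>lie_gens\<close> by
  coefficients, which links \<open>lie_algebroid\<close> to arguments on generators.\<close>

lemma in_span_lie: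
  assumes "\<And>m. coef a m \<noteq> 0 \<Longrightarrow> lie_form m \<and> m \<in> monomials n r 3"
  shows "a \<in> span (lie_gens n r)"
proof -
  have "a = (\<Sum>m\<in>monomials n r 3. coef a m *\<^sub>R mon m)"
    by (rule gp_expand[OF finite_monomials]) (use assms in blast)
  also have "\<dots> \<in> span (lie_gens n r)"
  proof (rule span_sum)
    fix m assume m: "m \<in> monomials n r 3"
    show "coef a m *\<^sub>R mon m \<in> span (lie_gens n r)"
    proof (cases "coef a m = 0")
      case False
      then have "lie_form m" using assms by blast
      then have "mon m \<in> span (lie_gens n r)"
        unfolding lie_form_def
      proof (elim disjE exE)
        fix \<alpha> i assume eq: "m = ({#i#}, {Tau \<alpha>})"
        with m show ?thesis using p_tau_in_span[of i n \<alpha> r] by (auto simp: p_tau_mon monomials_def)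
      next
        fix \<alpha> \<beta> \<gamma> assume eq: "m = ({#}, {Tau \<alpha>, Tau \<beta>, Theta \<gamma>})"
        with m have i: "\<alpha> < r" "\<beta> < r" "\<gamma> < r" and "card {Tau \<alpha>, Tau \<beta>, Theta \<gamma>} = 3"
          by (auto simp: monomials_def)
        \<comment> \<open>For \<open>\<alpha> = \<beta>\<close> the set would have only two elements
          and the monomial degree 2.\<close>
        then have "\<alpha> \<noteq> \<beta>" by auto
        let ?k = "koszul {Tau \<alpha>} {Tau \<beta>, Theta \<gamma>}"
        have "?k *\<^sub>R (ovar (Tau \<alpha>) * (ovar (Tau \<beta>) * ovar (Theta \<gamma>))) = mon m"
          using \<open>\<alpha> \<noteq> \<beta>\<close> by (simp add: tau_tau_theta_mon eq)
        then show ?thesis using span_scale[OF tau_tau_theta_in_span[OF i], of ?k n] by simp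
      qed
      then show ?thesis by (rule span_scale)
    qed (simp add: span_zero)
  qed
  finally show ?thesis .
qed

text \<open>The counterpart of \<open>brk_even_skew\<close> with evenness required of the other
  argument: \<open>{X, \<mu>}\<close> is even, while the section \<open>Y\<close> is odd.\<close>

lemma brk_even_section:
  assumes "parity a = a" "\<And>i. i < n \<Longrightarrow> dp i w = 0"
  shows "brk n r a a' w w' = - act n r w w' a"
proof -
  have "dp i a * w' i = w' i * dp i a" for i
    by (rule even_comm) (simp add: assms(1) flip: dp_parity)
  then show ?thesis
    using odd_br_even_skew[OF assms(1), of r w] assms(2) by (simp add: brk_def act_def sum_negf)
qed

lemma parity_act:
  assumes "parity w = w" "\<And>i. i < n \<Longrightarrow> parity (w' i) = w' i"
  shows "parity (act n r w w' a) = act n r w w' (parity a)"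
  using assms by (simp add: act_def odd_br_def linear_simps parity_mult dp_parity parity_dr parity_dl)

section \<open>Sections and endomorphisms acting on these spans\<close>

context smooth_bundle
begin

abbreviation "vec_field X \<equiv> section_field (\<lambda>x. (X x, \<lambda>v. 0))"
abbreviation "act_vec X \<equiv> act_section (\<lambda>x. (X x, \<lambda>v. 0))"

lemma vec_field_eq: "vec_field X e x = (\<Sum>\<gamma><r. fc e \<gamma> x (X x) *\<^sub>R ovar (Theta \<gamma>))"
  by (simp add: section_field_def)

lemma coef_theta_sum: "\<gamma> < r \<Longrightarrow> coef (\<Sum>\<gamma><r. v \<gamma> *\<^sub>R ovar (Theta \<gamma>)) ({#}, {Theta \<gamma>}) = v \<gamma>"
proof -
  assume \<gamma>: "\<gamma> < r"
  have "(\<Sum>\<delta><r. v \<delta> * coef (ovar (Theta \<delta>)) ({#}, {Theta \<gamma>})) = (\<Sum>\<delta><r. if \<delta> = \<gamma> then v \<delta> else 0)"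
    by (intro sum.cong) (auto simp: coef_ovar gmono_def)
  then show ?thesis using \<gamma> by (simp add: coef_sum)
qed

lemma span_theta_expand:
  assumes "a \<in> span (theta_gens r)"
  shows "a = (\<Sum>\<gamma><r. coef a ({#}, {Theta \<gamma>}) *\<^sub>R ovar (Theta \<gamma>))"
proof -
  define L where "L a = (\<Sum>\<gamma><r. coef a ({#}, {Theta \<gamma>}) *\<^sub>R ovar (Theta \<gamma>))" for a
  have "linear L"
    by (rule linearI) (simp_all add: L_def scaleR_add_left sum.distrib scaleR_sum_right)
  have "L a - a \<in> span {}"
  proof (rule linear_span_into[OF linear_compose_sub[OF \<open>linear L\<close> linear_ident] _ assms])
    fix g assume "g \<in> theta_gens r"
    then obtain \<delta> where \<delta>: "\<delta> < r" "g = ovar (Theta \<delta>)" by (auto simp: theta_gens_def)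
    have "L g = (\<Sum>\<gamma><r. if \<gamma> = \<delta> then ovar (Theta \<gamma>) else 0)"
      unfolding L_def \<delta>(2) by (intro sum.cong) (auto simp: coef_ovar gmono_def)
    then show "L g - g \<in> span {}" using \<delta> by simp
  qed
  then show ?thesis by (simp add: L_def)
qed

context
  fixes c e x
  assumes c: "c \<in> charts B" and e: "e \<in> frames B" and x: "x \<in> fst c \<inter> fst e"
begin

lemma act_vec_gens:
  assumes "X \<in> sections B"
  shows "\<alpha> < r \<Longrightarrow> act_vec X c e x (ovar (Tau \<alpha>)) = fc e \<alpha> x (X x) *\<^sub>R 1"
    "\<alpha> < r \<Longrightarrow> act_vec X c e x (ovar (Theta \<alpha>)) = 0"
    "i < n \<Longrightarrow> act_vec X c e x (pvar i) = (\<Sum>\<gamma><r. partial c i (\<lambda>y. fc e \<gamma> y (X y)) x *\<^sub>R ovar (Theta \<gamma>))"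
  using gpartial_section_field[OF vector_E_section[OF assms] e c open_domain[OF c e] Int_lower1 Int_lower2 _ x, of i]
  by (simp_all add: act_section_def act_section_gens act_pvar)

lemma act_vec_mult:
  assumes "X \<in> sections B"
  shows "act_vec X c e x (a * b) = act_vec X c e x a * b + parity a * act_vec X c e x b"
  by (rule act_section_mult[OF c e x vector_E_section[OF assms]])

lemma act_vec_p_tau_theta:
  assumes X: "X \<in> sections B" and a: "a \<in> span (p_tau_theta_gens n r)"
  shows "act_vec X c e x a \<in> span (theta_gens r)"
proof (rule linear_span_into[OF linear_act_section _ a])
  fix g assume "g \<in> p_tau_theta_gens n r"
  then show "act_vec X c e x g \<in> span (theta_gens r)"
    by (cases rule: p_tau_theta_gens_cases)
      (auto simp: act_vec_mult[OF X] act_vec_gens[OF X] intro!: span_sum span_scale theta_in_span)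
qed

text \<open>The bracket with a vector section replaces a \<open>Tau\<close> by a number and a
  momentum by a combination of \<open>Theta\<close>, and it kills each \<open>Theta\<close>.\<close>

lemma act_vec_lie:
  assumes X: "X \<in> sections B" and a: "a \<in> span (lie_gens n r)"
  shows "act_vec X c e x a \<in> span (p_tau_theta_gens n r)"
proof (rule linear_span_into[OF linear_act_section _ a])
  fix g assume "g \<in> lie_gens n r"
  then show "act_vec X c e x g \<in> span (p_tau_theta_gens n r)"
  proof (cases rule: lie_gens_cases)
    case (1 i \<alpha>)
    have "ovar (Theta \<gamma>) * ovar (Tau \<alpha>) = - (ovar (Tau \<alpha>) * ovar (Theta \<gamma>))" for \<gamma>
      by (rule odd_anticomm) simp_all
    then show ?thesis using 1
      by (auto simp: act_vec_mult[OF X] act_vec_gens[OF X] sum_distrib_right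
          intro!: span_add span_neg span_sum span_scale p_in_span tau_theta_in_span)
  next
    case (2 \<alpha> \<beta> \<gamma>)
    then show ?thesis
      by (auto simp: act_vec_mult[OF X] act_vec_gens[OF X]
          intro!: span_diff span_scale tau_theta_in_span)
  qed
qed

text \<open>\<open>{N, \<cdot>}\<close> replaces an odd generator by others of the same kind and a
  momentum by products of a \<open>Tau\<close> and a \<open>Theta\<close>; both preserve the shape
  of a Lie algebroid structure.\<close>

lemma act_endo_lie:
  assumes N: "endomorphism B N" and a: "a \<in> span (lie_gens n r)"
  shows "act_endo N c e x a \<in> span (lie_gens n r)"
proof (rule linear_span_into[OF linear_act_endo _ a])
  note D_mult = act_endo_mult[OF c e x N]
  note D_gens = act_endo_gens[of _ N e x "\<lambda>i. gpartial c i (endo_field N e) x", folded act_endo_def]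
  fix g assume "g \<in> lie_gens n r"
  then show "act_endo N c e x g \<in> span (lie_gens n r)"
  proof (cases rule: lie_gens_cases)
    case (1 i \<alpha>)
    have "ovar (Tau \<beta>) * ovar (Theta \<gamma>) * ovar (Tau \<alpha>) = - (ovar (Tau \<beta>) * (ovar (Tau \<alpha>) * ovar (Theta \<gamma>)))" for \<beta> \<gamma>
      using odd_anticomm[of "ovar (Theta \<gamma>)" "ovar (Tau \<alpha>)"] by (simp add: mult.assoc)
    moreover have "act_endo N c e x (pvar i) = (\<Sum>\<alpha><r. \<Sum>\<beta><r.
        partial c i (\<lambda>y. fc e \<alpha> y (N y (snd e \<beta> y))) x *\<^sub>R (ovar (Tau \<beta>) * ovar (Theta \<alpha>)))"
      using gpartial_endo_field[OF N e c open_domain[OF c e] Int_lower1 Int_lower2 1(1) x] 1(1)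
      by (simp add: act_endo_def act_pvar)
    ultimately show ?thesis using 1
      by (auto simp: D_mult D_gens sum_distrib_right sum_distrib_left
          intro!: span_add span_neg span_sum span_scale p_tau_in_span tau_tau_theta_in_span)
  next
    case (2 \<alpha> \<beta> \<gamma>)
    then show ?thesis
      by (auto simp: D_mult D_gens sum_distrib_right sum_distrib_left distrib_left right_diff_distrib
          intro!: span_add span_neg span_diff span_sum span_scale tau_tau_theta_in_span)
  qed
qed

lemma act_vec_act_endo:
  assumes N: "endomorphism B N" and X: "X \<in> sections B"
  shows "act_vec X c e x (act_endo N c e x a) =
    act_endo N c e x (act_vec X c e x a) + act_vec (\<lambda>y. N y (X y)) c e x a"
proof -
  have NX: "(\<lambda>y. N y (X y)) \<in> sections B" by (rule endo_section[OF N X])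
  note D_mult = act_endo_mult[OF c e x N]
  note D_gens = act_endo_gens[of _ N e x "\<lambda>i. gpartial c i (endo_field N e) x", folded act_endo_def]
  \<comment> \<open>\<open>{N, \<cdot>}\<close> preserves parity, which makes the commutator
    \<open>?D\<close> again an odd derivation.\<close>
  have par: "parity (act_endo N c e x a) = act_endo N c e x (parity a)" for a
    unfolding act_endo_def by (rule parity_act) (simp_all add: parity_gpartial_endo[OF c e x N])
  have NX_coeff: "fc e \<alpha> y (N y (X y)) = (\<Sum>\<beta><r. fc e \<alpha> y (N y (snd e \<beta> y)) * fc e \<beta> y (X y))" if "y \<in> fst e" for \<alpha> y
    by (rule endo_coeff[OF N e that section_in_fibre[OF X]])
  have xe: "x \<in> fst e" using x by simp
  let ?D = "\<lambda>a. act_vec X c e x (act_endo N c e x a) - act_endo N c e x (act_vec X c e x a)"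
  have "?D a = act_vec (\<lambda>y. N y (X y)) c e x a"
  proof (rule derivations_eqI[where s = parity and D = ?D and D' = "act_vec (\<lambda>y. N y (X y)) c e x"])
    show "linear ?D"
      by (intro linear_compose_sub linear_compose[OF linear_act_endo linear_act_section, unfolded o_def]
          linear_compose[OF linear_act_section linear_act_endo, unfolded o_def])
    show "linear (act_vec (\<lambda>y. N y (X y)) c e x)" by (rule linear_act_section)
    show "?D (a * b) = ?D a * b + parity a * ?D b" for a b
      by (simp add: D_mult act_vec_mult[OF X] act_field_simps par algebra_simps)
    show "act_vec (\<lambda>y. N y (X y)) c e x (a * b) =
        act_vec (\<lambda>y. N y (X y)) c e x a * b + parity a * act_vec (\<lambda>y. N y (X y)) c e x b" for a b
      by (rule act_vec_mult[OF NX])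
    have one: "act_endo N c e x 1 = 0" using D_mult[of 1 1] by simp
    show "?D (ovar g) = act_vec (\<lambda>y. N y (X y)) c e x (ovar g)" for g
    proof (cases "g \<in> odd_gens r")
      case True
      show ?thesis
      proof (cases g)
        case (Tau \<alpha>)
        with True show ?thesis
          by (simp add: D_gens act_vec_gens[OF X] act_vec_gens[OF NX] act_field_simps one NX_coeff[OF xe]
              scaleR_sum_left cong: sum.cong_simp)
      next
        case (Theta \<alpha>)
        with True show ?thesis
          by (simp add: D_gens act_vec_gens[OF X] act_vec_gens[OF NX] act_field_simps cong: sum.cong_simp)
      qed
    next
      case False
      then show ?thesis by (simp add: act_section_def act_endo_def act_ovar act_simps)
    qed
    show "?D (pvar i) = act_vec (\<lambda>y. N y (X y)) c e x (pvar i)" for i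
    proof (cases "i < n")
      case True
      note pr = c open_domain[OF c e] Int_lower1 True x
      let ?dx = "\<lambda>f. partial c i f x"
      have "act_vec X c e x (act_endo N c e x (pvar i)) =
          (\<Sum>\<alpha><r. \<Sum>\<beta><r. (?dx (\<lambda>y. fc e \<alpha> y (N y (snd e \<beta> y))) * fc e \<beta> x (X x)) *\<^sub>R ovar (Theta \<alpha>))"
        using gpartial_endo_field[OF N e c open_domain[OF c e] Int_lower1 Int_lower2 True x] True
        by (simp add: act_endo_def act_pvar act_field_simps act_vec_mult[OF X] act_vec_gens[OF X] cong: sum.cong_simp)
      moreover have "act_endo N c e x (act_vec X c e x (pvar i)) =
          - (\<Sum>\<alpha><r. \<Sum>\<beta><r. (fc e \<alpha> x (N x (snd e \<beta> x)) * ?dx (\<lambda>y. fc e \<beta> y (X y))) *\<^sub>R ovar (Theta \<alpha>))"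
      proof -
        have "act_endo N c e x (act_vec X c e x (pvar i)) =
            - (\<Sum>\<beta><r. \<Sum>\<alpha><r. (fc e \<alpha> x (N x (snd e \<beta> x)) * ?dx (\<lambda>y. fc e \<beta> y (X y))) *\<^sub>R ovar (Theta \<alpha>))"
          by (simp add: act_vec_gens[OF X] True act_field_simps D_gens scaleR_sum_right sum_negf mult.commute cong: sum.cong_simp)
        then show ?thesis by (subst sum.swap) simp
      qed
      \<comment> \<open>On \<open>pvar i\<close> the commutator identity is the product rule for the
        components of \<open>N X\<close>.\<close>
      moreover have "?dx (\<lambda>y. fc e \<alpha> y (N y (X y))) =
          (\<Sum>\<beta><r. ?dx (\<lambda>y. fc e \<alpha> y (N y (snd e \<beta> y))) * fc e \<beta> x (X x) +
            fc e \<alpha> x (N x (snd e \<beta> x)) * ?dx (\<lambda>y. fc e \<beta> y (X y)))" if "\<alpha> < r" for \<alpha>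
      proof -
        have "?dx (\<lambda>y. fc e \<alpha> y (N y (X y))) = ?dx (\<lambda>y. \<Sum>\<beta><r. fc e \<alpha> y (N y (snd e \<beta> y)) * fc e \<beta> y (X y))"
          by (rule partial_cong[OF pr]) (use NX_coeff in auto)
        also have "\<dots> = (\<Sum>\<beta><r. ?dx (\<lambda>y. fc e \<alpha> y (N y (snd e \<beta> y))) * fc e \<beta> x (X x) +
            fc e \<alpha> x (N x (snd e \<beta> x)) * ?dx (\<lambda>y. fc e \<beta> y (X y)))"
        proof (rule partial_sum_mult[OF pr])
          fix \<beta> assume "\<beta> \<in> {..<r}"
          then have \<beta>: "\<beta> < r" by simp
          show "smooth B (fst c \<inter> fst e) (\<lambda>y. fc e \<alpha> y (N y (snd e \<beta> y)))"
            by (rule smooth_subset[OF endo_smooth[OF N e that \<beta>]]) simp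
          show "smooth B (fst c \<inter> fst e) (\<lambda>y. fc e \<beta> y (X y))"
            by (rule smooth_subset[OF section_smooth[OF X e \<beta>]]) simp
        qed
        finally show ?thesis .
      qed
      ultimately show ?thesis
        by (simp add: act_vec_gens(3)[OF NX True] sum.distrib scaleR_add_left scaleR_sum_left cong: sum.cong_simp)
    next
      case False
      then show ?thesis by (simp add: act_section_def act_endo_def act_pvar act_simps)
    qed
  qed simp
  then show ?thesis by (simp add: algebra_simps)
qed

text \<open>The sign is that of skew symmetry: \<open>{X, N} = N X\<close> and \<open>N\<close> is
  even.\<close>

lemma act_endo_vec_field:
  assumes N: "endomorphism B N" and X: "X \<in> sections B"
  shows "act_endo N c e x (vec_field X e x) = - vec_field (\<lambda>y. N y (X y)) e x"
proof -
  note D_gens = act_endo_gens[of _ N e x "\<lambda>i. gpartial c i (endo_field N e) x", folded act_endo_def]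
  have xe: "x \<in> fst e" using x by simp
  have "act_endo N c e x (vec_field X e x) =
      - (\<Sum>\<beta><r. \<Sum>\<alpha><r. (fc e \<alpha> x (N x (snd e \<beta> x)) * fc e \<beta> x (X x)) *\<^sub>R ovar (Theta \<alpha>))"
    by (simp add: vec_field_eq act_field_simps D_gens scaleR_sum_right sum_negf mult.commute cong: sum.cong_simp)
  also have "\<dots> = - vec_field (\<lambda>y. N y (X y)) e x"
    by (subst sum.swap) (simp add: vec_field_eq endo_coeff[OF N e xe section_in_fibre[OF X]] scaleR_sum_left)
  finally show ?thesis .
qed

text \<open>With a jet chosen by \<open>section_with_jet\<close>, the action of a section becomes a
  coordinate operation: \<open>s = 1\<close>, \<open>t = 0\<close> gives
  \<open>dl (Tau \<alpha>)\<close>, and \<open>s = 0\<close> with one nonzero slope isolates one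
  momentum.\<close>

lemma act_vec_jet:
  assumes X: "X \<in> sections B" and \<alpha>: "\<alpha> < r"
    and "\<And>\<beta>. \<beta> < r \<Longrightarrow> fc e \<beta> x (X x) = (if \<beta> = \<alpha> then s else 0)"
    and "\<And>i \<beta>. i < n \<Longrightarrow> \<beta> < r \<Longrightarrow> partial c i (\<lambda>y. fc e \<beta> y (X y)) x = (if \<beta> = \<alpha> then t i else 0)"
  shows "act_vec X c e x a = (\<Sum>i<n. t i *\<^sub>R (ovar (Theta \<alpha>) * dp i a)) + s *\<^sub>R dl (Tau \<alpha>) a"
proof -
  have "vec_field X e x = (\<Sum>\<beta><r. if \<beta> = \<alpha> then s *\<^sub>R ovar (Theta \<beta>) else 0)"
    unfolding vec_field_eq by (intro sum.cong) (simp_all add: assms(3))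
  then have v: "vec_field X e x = s *\<^sub>R ovar (Theta \<alpha>)" using \<alpha> by simp
  have dv: "gpartial c i (vec_field X e) x = t i *\<^sub>R ovar (Theta \<alpha>)" if "i < n" for i
  proof -
    have "gpartial c i (vec_field X e) x = (\<Sum>\<beta><r. if \<beta> = \<alpha> then t i *\<^sub>R ovar (Theta \<beta>) else 0)"
      unfolding gpartial_section_field[OF vector_E_section[OF X] e c open_domain[OF c e] Int_lower1 Int_lower2 that x]
      by (intro sum.cong) (simp_all add: assms(4)[OF that])
    then show ?thesis using \<alpha> by simp
  qed
  have "(\<Sum>u\<in>odd_gens r. dr u (ovar (Theta \<alpha>)) * dl (dual_gen u) a) =
      (\<Sum>u\<in>odd_gens r. if u = Theta \<alpha> then dl (Tau \<alpha>) a else 0)"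
    by (intro sum.cong) auto
  then have "odd_br r (ovar (Theta \<alpha>)) a = dl (Tau \<alpha>) a"
    using \<alpha> by (simp add: odd_br_def)
  then show ?thesis
    by (simp add: act_section_def act_def v dv odd_br_simps cong: sum.cong_simp)
qed

end

section \<open>From pointwise actions to brackets of functions\<close>

lemma regular_endo: "endomorphism B N \<Longrightarrow> regular (endo_gfun B N)"
  unfolding endo_gfun_eq by (intro regular_gf smooth_endo_field open_domain Int_lower2)

lemma fld_endo:
  "c \<in> charts B \<Longrightarrow> e \<in> frames B \<Longrightarrow> x \<in> fst c \<inter> fst e \<Longrightarrow> fld (endo_gfun B N) c e x = endo_field N e x"
  unfolding endo_gfun_eq by (simp add: fld_gf)

lemma regular_section: "u \<in> E_sections B \<Longrightarrow> regular (section_gfun B u)"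
  unfolding section_gfun_eq by (intro regular_gf smooth_section_field open_domain Int_lower2)

lemma fld_section:
  "c \<in> charts B \<Longrightarrow> e \<in> frames B \<Longrightarrow> x \<in> fst c \<inter> fst e \<Longrightarrow> fld (section_gfun B u) c e x = section_field u e x"
  unfolding section_gfun_eq by (simp add: fld_gf)

context
  fixes c e
  assumes c: "c \<in> charts B" and e: "e \<in> frames B"
begin

lemma gpartial_fld_cong:
  assumes "i < n" "x \<in> fst c \<inter> fst e" "\<And>y. y \<in> fst c \<inter> fst e \<Longrightarrow> F y = G y"
  shows "gpartial c i F x = gpartial c i G x"
  by (rule gpartial_cong[OF c open_domain[OF c e] Int_lower1 assms])

lemma brk_cong: "(\<And>i. i < n \<Longrightarrow> a' i = a'' i) \<Longrightarrow> (\<And>i. i < n \<Longrightarrow> b' i = b'' i) \<Longrightarrow>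
    brk n r a a' b b' = brk n r a a'' b b''"
  by (simp add: brk_def)

lemma fld_endo_bracket:
  assumes N: "endomorphism B N" and a: "regular a" and x: "x \<in> fst c \<inter> fst e"
  shows "fld (big_bracket B (endo_gfun B N) a) c e x = act_endo N c e x (fld a c e x)"
proof -
  have "gpartial c i (fld (endo_gfun B N) c e) x = gpartial c i (endo_field N e) x" if "i < n" for i
    by (rule gpartial_fld_cong[OF that x]) (rule fld_endo[OF c e])
  then show ?thesis
    unfolding fld_big_bracket[OF regular_endo[OF N] a c e x] brk_fld_def fld_endo[OF c e x] act_endo_def
    by (subst brk_eq_act) (simp_all add: act_def)
qed

lemma fld_bracket_endo:
  assumes N: "endomorphism B N" and a: "regular a" and x: "x \<in> fst c \<inter> fst e"
  shows "fld (big_bracket B a (endo_gfun B N)) c e x = - act_endo N c e x (fld a c e x)"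
proof -
  have g: "gpartial c i (fld (endo_gfun B N) c e) x = gpartial c i (endo_field N e) x" if "i < n" for i
    by (rule gpartial_fld_cong[OF that x]) (rule fld_endo[OF c e])
  show ?thesis
    unfolding fld_big_bracket[OF a regular_endo[OF N] c e x] brk_fld_def fld_endo[OF c e x] act_endo_def
    by (subst brk_even_skew) (simp_all add: act_def g parity_gpartial_endo[OF c e x N])
qed

lemma fld_section_bracket:
  assumes u: "u \<in> E_sections B" and a: "regular a" and x: "x \<in> fst c \<inter> fst e"
  shows "fld (big_bracket B (section_gfun B u) a) c e x = act_section u c e x (fld a c e x)"
proof -
  have "gpartial c i (fld (section_gfun B u) c e) x = gpartial c i (section_field u e) x" if "i < n" for i
    by (rule gpartial_fld_cong[OF that x]) (rule fld_section[OF c e])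
  then show ?thesis
    unfolding fld_big_bracket[OF regular_section[OF u] a c e x] brk_fld_def fld_section[OF c e x] act_section_def
    by (subst brk_eq_act) (simp_all add: act_def)
qed

lemma fld_bracket_section:
  assumes u: "u \<in> E_sections B" and a: "regular a" "parity (fld a c e x) = fld a c e x" and x: "x \<in> fst c \<inter> fst e"
  shows "fld (big_bracket B a (section_gfun B u)) c e x = - act_section u c e x (fld a c e x)"
proof -
  have "gpartial c i (fld (section_gfun B u) c e) x = gpartial c i (section_field u e) x" if "i < n" for i
    by (rule gpartial_fld_cong[OF that x]) (rule fld_section[OF c e])
  then show ?thesis
    unfolding fld_big_bracket[OF a(1) regular_section[OF u] c e x] brk_fld_def fld_section[OF c e x] act_section_def
    by (subst brk_even_section[OF a(2)]) (simp_all add: act_def)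
qed

text \<open>\<open>{N, {a, b}} = {{N, a}, b} + {a, {N, b}}\<close>.\<close>

lemma act_endo_brk_fld:
  assumes N: "endomorphism B N" and a: "regular a" and b: "regular b" and x: "x \<in> fst c \<inter> fst e"
  shows "act_endo N c e x (brk_fld a b c e x) =
    brk_fld (big_bracket B (endo_gfun B N) a) b c e x + brk_fld a (big_bracket B (endo_gfun B N) b) c e x"
proof -
  let ?W = "fst c \<inter> fst e"
  note W = open_domain[OF c e] Int_lower1[of "fst c" "fst e"]
  have w: "smooth_field ?W (endo_field N e)"
    by (rule smooth_endo_field[OF N e W(1)]) simp
  have g: "gpartial c i (fld (big_bracket B (endo_gfun B N) f) c e) x =
      act n r (gpartial c i (endo_field N e) x) (\<lambda>j. gpartial c i (gpartial c j (endo_field N e)) x) (fld f c e x) +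
      act n r (endo_field N e x) (\<lambda>j. gpartial c j (endo_field N e) x) (gpartial c i (fld f c e) x)"
    if "i < n" "regular f" for f i
  proof -
    have "gpartial c i (fld (big_bracket B (endo_gfun B N) f) c e) x =
        gpartial c i (\<lambda>y. act n r (endo_field N e y) (\<lambda>j. gpartial c j (endo_field N e) y) (fld f c e y)) x"
      by (rule gpartial_fld_cong[OF that(1) x]) (simp add: fld_endo_bracket[OF N that(2)] act_endo_def)
    then show ?thesis by (simp add: gpartial_act[OF c W w regular_smooth[OF that(2) c e] that(1) x])
  qed
  have par2: "parity (gpartial c i (gpartial c j (endo_field N e)) x) = gpartial c i (gpartial c j (endo_field N e)) x"
    if "i < n" "j < n" for i j
  proof -
    have "parity (gpartial c i (gpartial c j (endo_field N e)) x) =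
        gpartial c i (\<lambda>y. parity (gpartial c j (endo_field N e) y)) x"
      using gpartial_parity[OF c W smooth_field_gpartial[OF c W w that(2)] that(1) x] by simp
    also have "\<dots> = gpartial c i (gpartial c j (endo_field N e)) x"
      by (rule gpartial_fld_cong[OF that(1) x]) (simp add: parity_gpartial_endo[OF c e _ N that(2)])
    finally show ?thesis .
  qed
  have "act_endo N c e x (brk_fld a b c e x) =
      brk n r (act_endo N c e x (fld a c e x)) (\<lambda>i. gpartial c i (fld (big_bracket B (endo_gfun B N) a) c e) x)
        (fld b c e x) (\<lambda>i. gpartial c i (fld b c e) x) +
      brk n r (fld a c e x) (\<lambda>i. gpartial c i (fld a c e) x)
        (act_endo N c e x (fld b c e x)) (\<lambda>i. gpartial c i (fld (big_bracket B (endo_gfun B N) b) c e) x)"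
    unfolding act_endo_def brk_fld_def
    by (subst brk_Jacobi[where w'' = "\<lambda>i j. gpartial c i (gpartial c j (endo_field N e)) x"])
      (simp_all add: parity_gpartial_endo[OF c e x N] par2 gpartial_commute[OF c W w _ _ x] g a b cong: brk_cong)
  then show ?thesis
    by (simp add: brk_fld_def fld_endo_bracket[OF N a x] fld_endo_bracket[OF N b x])
qed

text \<open>Parity is assumed on the whole domain because the derivatives in \<open>brk_fld\<close>
  have to be odd as well.\<close>

lemma brk_fld_odd_sym:
  assumes a: "regular a" and b: "regular b" and x: "x \<in> fst c \<inter> fst e"
    and p: "\<And>y. y \<in> fst c \<inter> fst e \<Longrightarrow> parity (fld a c e y) = - fld a c e y"
      "\<And>y. y \<in> fst c \<inter> fst e \<Longrightarrow> parity (fld b c e y) = - fld b c e y"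
  shows "brk_fld a b c e x = brk_fld b a c e x"
proof -
  note W = open_domain[OF c e] Int_lower1[of "fst c" "fst e"]
  have "parity (gpartial c i (fld f c e) x) = - gpartial c i (fld f c e) x"
    if "i < n" "regular f" "\<And>y. y \<in> fst c \<inter> fst e \<Longrightarrow> parity (fld f c e y) = - fld f c e y" for f i
  proof -
    note s = regular_smooth[OF that(2) c e]
    have "parity (gpartial c i (fld f c e) x) = gpartial c i (\<lambda>y. parity (fld f c e y)) x"
      using gpartial_parity[OF c W s that(1) x] by simp
    also have "\<dots> = gpartial c i (\<lambda>y. - fld f c e y) x"
      by (rule gpartial_fld_cong[OF that(1) x that(3)])
    finally show ?thesis using gpartial_uminus[OF c W s that(1) x] by simp
  qed
  then show ?thesis
    unfolding brk_fld_def by (intro brk_odd_sym) (use a b p x in auto)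
qed

end

section \<open>The element of degree 2 that represents the block matrix\<close>

lemma endo_gfun_graded:
  assumes N: "endomorphism B N"
  shows "endo_gfun B N \<in> graded_functions B 2"
proof (rule graded_functionsI[OF regular_endo[OF N]])
  fix c e x m assume c: "c \<in> charts B" and e: "e \<in> frames B" and x: "x \<in> fst c \<inter> fst e"
    and nz: "coef (fld (endo_gfun B N) c e x) m \<noteq> 0"
  show "m \<in> monomials n r 2"
  proof (rule ccontr)
    assume "m \<notin> monomials n r 2"
    then have "coef (mon ({#}, {Tau \<beta>, Theta \<alpha>})) m = 0" if "\<alpha> < r" "\<beta> < r" for \<alpha> \<beta>
      using that by (auto simp: coef_mon monomials_def)
    then show False using nz
      by (simp add: fld_endo[OF c e x] endo_field_def coef_sum ovar_Tau_Theta)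
  qed
next
  fix c e c' e' x
  assume c: "c \<in> charts B" and e: "e \<in> frames B" and c': "c' \<in> charts B" and e': "e' \<in> frames B"
    and x: "x \<in> fst c \<inter> fst e \<inter> fst c' \<inter> fst e'"
  then have x1: "x \<in> fst c \<inter> fst e" "x \<in> fst c' \<inter> fst e'" and xe: "x \<in> fst e" "x \<in> fst e'" by auto
  interpret gp_subst "p_image c e c' e' x" "odd_image e e' x" by (rule gp_subst_change)
  let ?g = "\<lambda>\<alpha> \<beta>. fc e' \<alpha> x (snd e \<beta> x)" and ?N = "\<lambda>\<alpha> \<beta>. fc e \<alpha> x (N x (snd e \<beta> x))"
    and ?N' = "\<lambda>\<alpha> \<beta>. fc e' \<alpha> x (N x (snd e' \<beta> x))"
  let ?\<tau>' = "\<lambda>\<alpha>. \<Sum>\<delta><r. ?g \<alpha> \<delta> *\<^sub>R ovar (Tau \<delta>)"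
    and ?\<theta>' = "\<lambda>\<alpha>. \<Sum>\<gamma><r. fc e \<gamma> x (snd e' \<alpha> x) *\<^sub>R ovar (Theta \<gamma>)"
  let ?L = "\<lambda>\<gamma>. \<Sum>\<beta><r. ?N \<gamma> \<beta> *\<^sub>R ovar (Tau \<beta>)"
  \<comment> \<open>Once the \<open>Theta\<close> are expressed by \<open>?\<theta>'\<close>, the
    transformation law of the matrix of \<open>N\<close> turns the remaining factors into
    \<open>?\<tau>'\<close>.\<close>
  have "endo_field N e x = (\<Sum>\<gamma><r. ?L \<gamma> * ovar (Theta \<gamma>))"
    by (simp add: endo_field_def sum_distrib_right)
  also have "\<dots> = (\<Sum>\<gamma><r. \<Sum>\<alpha><r. (?g \<alpha> \<gamma> *\<^sub>R ?L \<gamma>) * ?\<theta>' \<alpha>)"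
  proof (intro sum.cong refl)
    fix \<gamma> assume "\<gamma> \<in> {..<r}"
    then have "?L \<gamma> * ovar (Theta \<gamma>) = ?L \<gamma> * (\<Sum>\<alpha><r. ?g \<alpha> \<gamma> *\<^sub>R ?\<theta>' \<alpha>)"
      using Theta_in_terms_of_image[OF c e c' e' x] by simp
    then show "?L \<gamma> * ovar (Theta \<gamma>) = (\<Sum>\<alpha><r. (?g \<alpha> \<gamma> *\<^sub>R ?L \<gamma>) * ?\<theta>' \<alpha>)"
      by (simp only: sum_distrib_left[of "?L \<gamma>"] mult_scaleR_left mult_scaleR_right)
  qed
  also have "\<dots> = (\<Sum>\<alpha><r. (\<Sum>\<gamma><r. ?g \<alpha> \<gamma> *\<^sub>R ?L \<gamma>) * ?\<theta>' \<alpha>)"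
    by (subst sum.swap) (simp only: sum_distrib_right[of _ _ "?\<theta>' _"])
  also have "\<dots> = (\<Sum>\<alpha><r. (\<Sum>\<beta><r. ?N' \<alpha> \<beta> *\<^sub>R ?\<tau>' \<beta>) * ?\<theta>' \<alpha>)"
  proof (intro sum.cong refl)
    fix \<alpha> assume "\<alpha> \<in> {..<r}"
    then have \<alpha>: "\<alpha> < r" by simp
    have "(\<Sum>\<gamma><r. ?g \<alpha> \<gamma> *\<^sub>R ?L \<gamma>) = (\<Sum>\<beta><r. (\<Sum>\<gamma><r. ?g \<alpha> \<gamma> * ?N \<gamma> \<beta>) *\<^sub>R ovar (Tau \<beta>))"
      by (simp add: scaleR_sum_left scaleR_sum_right) (rule sum.swap)
    also have "\<dots> = (\<Sum>\<beta><r. (\<Sum>\<gamma><r. ?N' \<alpha> \<gamma> * ?g \<gamma> \<beta>) *\<^sub>R ovar (Tau \<beta>))"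
      by (intro sum.cong refl) (simp add: endo_change[OF c e c' e' x N \<alpha> xe])
    also have "\<dots> = (\<Sum>\<beta><r. ?N' \<alpha> \<beta> *\<^sub>R ?\<tau>' \<beta>)"
      by (simp add: scaleR_sum_left scaleR_sum_right) (rule sum.swap)
    finally show "(\<Sum>\<gamma><r. ?g \<alpha> \<gamma> *\<^sub>R ?L \<gamma>) * ?\<theta>' \<alpha> = (\<Sum>\<beta><r. ?N' \<alpha> \<beta> *\<^sub>R ?\<tau>' \<beta>) * ?\<theta>' \<alpha>"
      by simp
  qed
  also have "\<dots> = tr c e c' e' x (endo_field N e' x)"
    by (simp add: tr_def endo_field_def subst_simps subst_mult sum_distrib_right cong: sum.cong_simp)
  finally show "fld (endo_gfun B N) c e x = tr c e c' e' x (fld (endo_gfun B N) c' e' x)"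
    by (simp add: fld_endo[OF c e x1(1)] fld_endo[OF c' e' x1(2)])
qed

text \<open>This is the characterization in \<open>tilde\<close>: \<open>{X, N} = N X\<close> for
  vector sections, while for covectors the bracket is minus the transpose, the second diagonal
  block.\<close>

lemma block_endo_bracket:
  assumes N: "endomorphism B N" and u: "u \<in> E_sections B"
  shows "section_gfun B (\<lambda>x. block_endo N x (u x)) = big_bracket B (section_gfun B u) (endo_gfun B N)"
proof -
  have X: "(\<lambda>x. fst (u x)) \<in> sections B" and \<xi>: "(\<lambda>x. snd (u x)) \<in> dual_sections B"
    using u by (auto simp: E_sections_def)
  have Nu: "(\<lambda>x. block_endo N x (u x)) \<in> E_sections B"
    using skew_block_endo[OF N] u by (simp add: skew_endomorphism_def E_endomorphism_def)
  show ?thesis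
  proof (rule regular_eqI[OF regular_section[OF Nu] regular_big_bracket[OF regular_section[OF u] regular_endo[OF N]]])
    fix c e x assume c: "c \<in> charts B" and e: "e \<in> frames B" and x: "x \<in> fst c \<inter> fst e"
    then have xe: "x \<in> fst e" by simp
    note D_gens = act_endo_gens[of _ N e x "\<lambda>i. gpartial c i (endo_field N e) x", folded act_endo_def]
    let ?X = "\<lambda>\<alpha>. fc e \<alpha> x (fst (u x))" and ?\<xi> = "\<lambda>\<alpha>. snd (u x) (snd e \<alpha> x)"
      and ?N = "\<lambda>\<alpha> \<beta>. fc e \<alpha> x (N x (snd e \<beta> x))"
    have xi: "snd (u x) (N x (snd e \<alpha> x)) = (\<Sum>\<beta><r. ?N \<beta> \<alpha> * ?\<xi> \<beta>)" if "\<alpha> < r" for \<alpha>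
      using dual_fibre_expand[OF _ e xe endo_fibre(1)[OF N frame_in_fibre[OF e xe that]], of "snd (u x)"] \<xi>
      by (simp add: dual_sections_def)
    have "- act_endo N c e x (section_field u e x) =
        (\<Sum>\<beta><r. \<Sum>\<alpha><r. (?N \<alpha> \<beta> * ?X \<beta>) *\<^sub>R ovar (Theta \<alpha>)) - (\<Sum>\<beta><r. \<Sum>\<alpha><r. (?N \<beta> \<alpha> * ?\<xi> \<beta>) *\<^sub>R ovar (Tau \<alpha>))"
      by (simp add: section_field_def act_field_simps D_gens scaleR_sum_right sum_negf sum.distrib mult.commute
          sum_subtractf cong: sum.cong_simp)
    also have "\<dots> = (\<Sum>\<alpha><r. \<Sum>\<beta><r. (?N \<alpha> \<beta> * ?X \<beta>) *\<^sub>R ovar (Theta \<alpha>)) - (\<Sum>\<alpha><r. \<Sum>\<beta><r. (?N \<beta> \<alpha> * ?\<xi> \<beta>) *\<^sub>R ovar (Tau \<alpha>))"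
      by (intro arg_cong2[where f = minus] sum.swap)
    also have "\<dots> = section_field (\<lambda>x. block_endo N x (u x)) e x"
      by (simp add: section_field_def block_endo_def transpose_endo_def xi endo_coeff[OF N e xe section_in_fibre[OF X]]
          scaleR_sum_left sum.distrib sum_negf sum_subtractf cong: sum.cong_simp)
    finally show "fld (section_gfun B (\<lambda>x. block_endo N x (u x))) c e x =
        fld (big_bracket B (section_gfun B u) (endo_gfun B N)) c e x"
      by (simp add: fld_section[OF c e x] fld_bracket_endo[OF c e N regular_section[OF u] x])
  qed
qed

lemma act_dual_section_value:
  assumes c: "c \<in> charts B" and e: "e \<in> frames B" and x: "x \<in> fst c \<inter> fst e"
    and \<xi>: "\<xi> \<in> dual_sections B" and \<alpha>: "\<alpha> < r"
    and "\<And>\<beta>. \<beta> < r \<Longrightarrow> \<xi> x (snd e \<beta> x) = (if \<beta> = \<alpha> then 1 else 0)"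
    and "\<And>i \<beta>. i < n \<Longrightarrow> \<beta> < r \<Longrightarrow> partial c i (\<lambda>y. \<xi> y (snd e \<beta> y)) x = 0"
  shows "act_section (\<lambda>x. (0, \<xi> x)) c e x a = dl (Theta \<alpha>) a"
proof -
  let ?u = "\<lambda>x. (0 :: 'v, \<xi> x)"
  have xe: "x \<in> fst e" using x by simp
  have "section_field ?u e x = (\<Sum>\<beta><r. if \<beta> = \<alpha> then ovar (Tau \<beta>) else 0)"
    unfolding section_field_def by (intro sum.cong) (simp_all add: assms(6) coeff_0[OF e xe])
  then have v: "section_field ?u e x = ovar (Tau \<alpha>)" using \<alpha> by simp
  have z: "partial c i (\<lambda>y. fc e \<beta> y 0) x = 0" if "i < n" for i \<beta>
  proof -
    have "partial c i (\<lambda>y. fc e \<beta> y 0) x = partial c i (\<lambda>y. 0) x"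
      by (rule partial_cong[OF c open_domain[OF c e] Int_lower1 that x]) (simp add: coeff_0[OF e])
    then show ?thesis by simp
  qed
  have dv: "gpartial c i (section_field ?u e) x = 0" if "i < n" for i
    unfolding gpartial_section_field[OF dual_E_section[OF \<xi>] e c open_domain[OF c e] Int_lower1 Int_lower2 that x]
    by (simp add: z[OF that] assms(7)[OF that])
  have "(\<Sum>u\<in>odd_gens r. dr u (ovar (Tau \<alpha>)) * dl (dual_gen u) a) =
      (\<Sum>u\<in>odd_gens r. if u = Tau \<alpha> then dl (Theta \<alpha>) a else 0)"
    by (intro sum.cong) auto
  then have "odd_br r (ovar (Tau \<alpha>)) a = dl (Theta \<alpha>) a"
    using \<alpha> by (simp add: odd_br_def)
  then show ?thesis
    by (simp add: act_section_def act_def v dv cong: sum.cong_simp)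
qed

lemma dl_Tau_eq_act_vec:
  assumes c: "c \<in> charts B" and e: "e \<in> frames B" and x: "x \<in> fst c \<inter> fst e" and \<alpha>: "\<alpha> < r"
  obtains X where "X \<in> sections B" "\<And>a. act_vec X c e x a = dl (Tau \<alpha>) a"
proof -
  obtain X where X: "X \<in> sections B"
    "\<And>\<beta>. \<beta> < r \<Longrightarrow> fc e \<beta> x (X x) = (if \<beta> = \<alpha> then 1 else 0)"
    "\<And>i \<beta>. i < n \<Longrightarrow> \<beta> < r \<Longrightarrow> partial c i (\<lambda>y. fc e \<beta> y (X y)) x = (if \<beta> = \<alpha> then 0 else 0)"
    using section_with_jet[OF c e x \<alpha>, of 1 "\<lambda>i. 0"] by blast
  show ?thesis
    by (rule that[OF X(1)]) (simp add: act_vec_jet[OF c e x X(1) \<alpha> X(2,3)])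
qed

text \<open>A section that vanishes at \<open>x\<close> acts there only through the derivatives of
  its components, and so detects momenta.\<close>

lemma Theta_dp_eq_act_vec:
  assumes c: "c \<in> charts B" and e: "e \<in> frames B" and x: "x \<in> fst c \<inter> fst e" and \<alpha>: "\<alpha> < r" and i: "i < n"
  obtains X where "X \<in> sections B" "\<And>a. act_vec X c e x a = ovar (Theta \<alpha>) * dp i a"
proof -
  obtain X where X: "X \<in> sections B"
    "\<And>\<beta>. \<beta> < r \<Longrightarrow> fc e \<beta> x (X x) = (if \<beta> = \<alpha> then 0 else 0)"
    "\<And>j \<beta>. j < n \<Longrightarrow> \<beta> < r \<Longrightarrow> partial c j (\<lambda>y. fc e \<beta> y (X y)) x = (if \<beta> = \<alpha> then (if j = i then 1 else 0) else 0)"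
    using section_with_jet[OF c e x \<alpha>, of 0 "\<lambda>j. if j = i then 1 else 0"] by blast
  have "(\<Sum>j<n. (if j = i then 1 else 0) *\<^sub>R (ovar (Theta \<alpha>) * dp j a)) =
      (\<Sum>j<n. if j = i then ovar (Theta \<alpha>) * dp j a else 0)" for a
    by (intro sum.cong) auto
  then show ?thesis
    using i by (intro that[OF X(1)]) (simp add: act_vec_jet[OF c e x X(1) \<alpha> X(2,3)])
qed

text \<open>Recovers a constant coefficient after the multiplication by an odd generator that
  \<open>Theta_dp_eq_act_vec\<close> brings along.\<close>

lemma coef_ovar_mult_singleton: "coef (ovar g * a) ({#}, {g}) = coef a ({#}, {})"
proof -
  have "Pow {g} = {{}, {g}}" by auto
  then show ?thesis
    by (simp add: coef_mult gmul_def coef_ovar gmono_def)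
qed

text \<open>Uniqueness: the difference \<open>?d\<close> of two candidates is annihilated by all
  sections. Frame vectors and covectors, extended with zero derivatives at \<open>x\<close>, detect
  every monomial that contains an odd generator. A single momentum is seen only by a section that
  vanishes at \<open>x\<close>, and its coefficient appears multiplied by \<open>Theta 0\<close>;
  this is where positive rank enters.\<close>

lemma tilde_block_endo:
  assumes N: "endomorphism B N" and r: "0 < r"
  shows "tilde B (block_endo N) = endo_gfun B N"
  unfolding tilde_def
proof (rule the_equality)
  show "endo_gfun B N \<in> graded_functions B 2 \<and>
      (\<forall>u\<in>E_sections B. section_gfun B (\<lambda>x. block_endo N x (u x)) = big_bracket B (section_gfun B u) (endo_gfun B N))"
    using endo_gfun_graded[OF N] block_endo_bracket[OF N] by blast
  fix a assume a: "a \<in> graded_functions B 2 \<and>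
      (\<forall>u\<in>E_sections B. section_gfun B (\<lambda>x. block_endo N x (u x)) = big_bracket B (section_gfun B u) a)"
  note reg = graded_functions_regular(1)[OF conjunct1[OF a]]
  show "a = endo_gfun B N"
  proof (rule regular_eqI[OF reg regular_endo[OF N]])
    fix c e x assume c: "c \<in> charts B" and e: "e \<in> frames B" and x: "x \<in> fst c \<inter> fst e"
    let ?d = "fld a c e x - fld (endo_gfun B N) c e x"
    have D: "act_section u c e x ?d = 0" if u: "u \<in> E_sections B" for u
    proof -
      have "big_bracket B (section_gfun B u) a = big_bracket B (section_gfun B u) (endo_gfun B N)"
        using a block_endo_bracket[OF N u] u by simp
      then have "act_section u c e x (fld a c e x) = act_section u c e x (fld (endo_gfun B N) c e x)"
        using fld_section_bracket[OF c e u reg x] fld_section_bracket[OF c e u regular_endo[OF N] x] by simp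
      then show ?thesis by (simp add: act_field_simps)
    qed
    have 1: "dl (Tau \<alpha>) ?d = 0" if \<alpha>: "\<alpha> < r" for \<alpha>
      using dl_Tau_eq_act_vec[OF c e x \<alpha>] D[OF vector_E_section] by metis
    have 2: "dl (Theta \<alpha>) ?d = 0" if \<alpha>: "\<alpha> < r" for \<alpha>
    proof -
      obtain \<xi> where \<xi>: "\<xi> \<in> dual_sections B"
        "\<And>\<beta>. \<beta> < r \<Longrightarrow> \<xi> x (snd e \<beta> x) = (if \<beta> = \<alpha> then 1 else 0)"
        "\<And>i \<beta>. i < n \<Longrightarrow> \<beta> < r \<Longrightarrow> partial c i (\<lambda>y. \<xi> y (snd e \<beta> y)) x = 0"
        using dual_section_with_value[OF c e x \<alpha>] by blast
      show ?thesis
        using act_dual_section_value[OF c e x \<xi>(1) \<alpha> \<xi>(2,3)] D[OF dual_E_section[OF \<xi>(1)]] by simp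
    qed
    have 3: "ovar (Theta 0) * dp i ?d = 0" if i: "i < n" for i
      using Theta_dp_eq_act_vec[OF c e x r i] D[OF vector_E_section] by metis
    have "?d = 0"
    proof (rule gp_eqI)
      fix P S
      show "coef ?d (P, S) = coef 0 (P, S)"
      proof (rule ccontr)
        assume "coef ?d (P, S) \<noteq> coef 0 (P, S)"
        then have nz: "coef ?d (P, S) \<noteq> 0" by simp
        then have "coef (fld a c e x) (P, S) \<noteq> 0 \<or> coef (fld (endo_gfun B N) c e x) (P, S) \<noteq> 0" by auto
        then have m: "(P, S) \<in> monomials n r 2"
          using graded_functions_regular(2)[OF conjunct1[OF a] c e x]
            graded_functions_regular(2)[OF endo_gfun_graded[OF N] c e x] by blast
        have fS: "finite S" by (rule finite_monomial[OF m])
        show False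
        proof (cases "S = {}")
          case True
          then have "size P = 1" using m by (simp add: monomials_def)
          then obtain i where P: "P = {#i#}" using size_1_singleton_mset by blast
          then have "i < n" using m by (simp add: monomials_def)
          from 3[OF this] have "coef (ovar (Theta 0) * dp i ?d) ({#}, {Theta 0}) = 0" by simp
          then show False using nz True P
            by (simp only: coef_ovar_mult_singleton coef_dp_eq) simp
        next
          case False
          then obtain g where g: "g \<in> S" by blast
          then have "dl g ?d = 0" using 1 2 m by (cases g) (auto simp: monomials_def)
          then have "coef (dl g ?d) (P, S - {g}) = 0" by simp
          then have "koszul {g} (S - {g}) * coef ?d (P, S) = 0"
            using g fS by (simp only: coef_dl_eq) (simp add: insert_absorb)
          then show False using nz koszul_square[of "{g}" "S - {g}"] by (metis mult_eq_0_iff zero_neq_one)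
        qed
      qed
    qed
    then show "fld a c e x = fld (endo_gfun B N) c e x" by simp
  qed
qed

section \<open>The zero structure, and the case of rank zero\<close>

lemma big_bracket_zero: "big_bracket B a zero_gfun = zero_gfun" "big_bracket B zero_gfun a = zero_gfun"
proof -
  have "gmul u (\<lambda>m. 0) = (\<lambda>m. 0)" "gmul (\<lambda>m. 0) u = (\<lambda>m. 0)" for u
    by (auto simp: gmul_def fun_eq_iff)
  moreover have "d_p i (\<lambda>m. 0) = (\<lambda>m. 0)" "d_left g (\<lambda>m. 0) = (\<lambda>m. 0)" "d_right g (\<lambda>m. 0) = (\<lambda>m. 0)" for i g
    by (auto simp: d_p_def d_left_def d_right_def fun_eq_iff)
  ultimately have z: "gmul u (\<lambda>m. 0) = (\<lambda>m. 0)" "gmul (\<lambda>m. 0) u = (\<lambda>m. 0)"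
    "d_p i (\<lambda>m. 0) = (\<lambda>m. 0)" "d_left g (\<lambda>m. 0) = (\<lambda>m. 0)" "d_right g (\<lambda>m. 0) = (\<lambda>m. 0)" for u i g
    by blast+
  show "big_bracket B a zero_gfun = zero_gfun" "big_bracket B zero_gfun a = zero_gfun"
    unfolding big_bracket_def zero_gfun_def partial_const z by (auto simp: fun_eq_iff)
qed

lemma zero_graded: "zero_gfun \<in> graded_functions B k"
proof (rule graded_functionsI[OF regular_zero])
  fix c e c' e' x
  interpret gp_subst "p_image c e c' e' x" "odd_image e e' x" by (rule gp_subst_change)
  show "fld zero_gfun c e x = tr c e c' e' x (fld zero_gfun c' e' x)"
    by (simp add: fld_zero tr_def subst_simps)
qed (simp add: fld_zero)

lemma zero_lie_algebroid: "lie_algebroid B zero_gfun"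
  using zero_graded big_bracket_zero by (simp add: lie_algebroid_def zero_gfun_def)

lemma zero_dual_lie_algebroid: "dual_lie_algebroid B zero_gfun"
  using zero_graded big_bracket_zero by (simp add: dual_lie_algebroid_def zero_gfun_def)

text \<open>Without odd generators all degrees are even, so there is nothing in degree 3.\<close>

lemma rank_zero_graded:
  assumes "r = 0" "a \<in> graded_functions B 3"
  shows "a = zero_gfun"
proof (intro ext)
  fix c e x m
  have "a c e x m \<noteq> 0 \<Longrightarrow> m \<in> monomials n r 3"
    using assms(2) unfolding graded_functions_def by blast
  moreover have "m \<notin> monomials n r 3"
  proof
    assume "m \<in> monomials n r 3"
    then have "2 * size (fst m) = 3" using assms(1) by (auto simp: monomials_def)
    then show False by presburger
  qed
  ultimately show "a c e x m = zero_gfun c e x m" by (auto simp: zero_gfun_def)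
qed

section \<open>The bracket of sections as a section\<close>

context
  fixes \<mu>
  assumes \<mu>: "lie_algebroid B \<mu>"
begin

lemma graded_\<mu>: "\<mu> \<in> graded_functions B 3"
  using \<mu> by (simp add: lie_algebroid_def)

lemma regular_\<mu>: "regular \<mu>"
  by (rule graded_functions_regular(1)[OF graded_\<mu>])

lemma fld_\<mu>_span:
  assumes "c \<in> charts B" "e \<in> frames B" "x \<in> fst c \<inter> fst e"
  shows "fld \<mu> c e x \<in> span (lie_gens n r)"
proof (rule in_span_lie)
  fix m assume nz: "coef (fld \<mu> c e x) m \<noteq> 0"
  then have "\<mu> c e x m \<noteq> 0" by (simp add: coef_fld[OF assms regular_\<mu>])
  then have "lie_form m" using \<mu> unfolding lie_algebroid_def lie_form_def by blast
  then show "lie_form m \<and> m \<in> monomials n r 3"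
    using graded_functions_regular(2)[OF graded_\<mu> assms nz] by blast
qed

definition vec_bracket where
  "vec_bracket X Y c e x = act_vec Y c e x (act_vec X c e x (fld \<mu> c e x))"

lemma vec_bracket_span:
  assumes "c \<in> charts B" "e \<in> frames B" "x \<in> fst c \<inter> fst e" "X \<in> sections B" "Y \<in> sections B"
  shows "vec_bracket X Y c e x \<in> span (theta_gens r)"
  unfolding vec_bracket_def
  by (intro act_vec_p_tau_theta act_vec_lie fld_\<mu>_span assms)

text \<open>The minus sign appears because the outer bracket has the even element
  \<open>{X, \<mu>}\<close> on the left and is rewritten as an action of \<open>Y\<close>.\<close>

lemma fld_vec_bracket:
  assumes X: "X \<in> sections B" and Y: "Y \<in> sections B"
    and c: "c \<in> charts B" and e: "e \<in> frames B" and x: "x \<in> fst c \<inter> fst e"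
  shows "fld (big_bracket B (big_bracket B (vector_gfun B X) \<mu>) (vector_gfun B Y)) c e x = - vec_bracket X Y c e x"
proof -
  note uX = vector_E_section[OF X] and uY = vector_E_section[OF Y]
  have reg: "regular (big_bracket B (vector_gfun B X) \<mu>)"
    by (rule regular_big_bracket[OF regular_section[OF uX] regular_\<mu>])
  have f: "fld (big_bracket B (vector_gfun B X) \<mu>) c e x = act_vec X c e x (fld \<mu> c e x)"
    by (rule fld_section_bracket[OF c e uX regular_\<mu> x])
  have "parity (act_vec X c e x (fld \<mu> c e x)) = act_vec X c e x (fld \<mu> c e x)"
    by (rule parity_p_tau_theta) (rule act_vec_lie[OF c e x X fld_\<mu>_span[OF c e x]])
  then show ?thesis
    using fld_bracket_section[OF c e uY reg _ x] by (simp add: f vec_bracket_def)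
qed

text \<open>The definite description in \<open>lie_bracket\<close> calls for an actual section. In
  each chart and frame the coefficients of the derived bracket define a vector \<open>W\<close>; it
  is independent of the choices because the actions of \<open>X\<close> and \<open>Y\<close> commute
  with \<open>tr\<close> and \<open>\<mu>\<close> is invariant.\<close>

lemma lie_bracket_exists:
  assumes X: "X \<in> sections B" and Y: "Y \<in> sections B"
  obtains Z where "Z \<in> sections B"
    "\<And>c e x. c \<in> charts B \<Longrightarrow> e \<in> frames B \<Longrightarrow> x \<in> fst c \<inter> fst e \<Longrightarrow> vec_field Z e x = - vec_bracket X Y c e x"
proof -
  let ?V = "\<lambda>c e x \<gamma>. - coef (vec_bracket X Y c e x) ({#}, {Theta \<gamma>})"
  have expand: "- vec_bracket X Y c e x = (\<Sum>\<gamma><r. ?V c e x \<gamma> *\<^sub>R ovar (Theta \<gamma>))"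
    if "c \<in> charts B" "e \<in> frames B" "x \<in> fst c \<inter> fst e" for c e x
    using span_theta_expand[OF vec_bracket_span[OF that X Y]] by (simp add: sum_negf)
  define W where "W c e x = (\<Sum>\<gamma><r. ?V c e x \<gamma> *\<^sub>R snd e \<gamma> x)" for c e x
  have inv: "W c e x = W c' e' x"
    if c: "c \<in> charts B" and e: "e \<in> frames B" and x: "x \<in> fst c \<inter> fst e"
      and c': "c' \<in> charts B" and e': "e' \<in> frames B" and x': "x \<in> fst c' \<inter> fst e'" for c e c' e' x
  proof -
    have xx: "x \<in> fst c \<inter> fst e \<inter> fst c' \<inter> fst e'" and xe: "x \<in> fst e" "x \<in> fst e'" using x x' by auto
    interpret gp_subst "p_image c e c' e' x" "odd_image e e' x" by (rule gp_subst_change)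
    have "- vec_bracket X Y c e x = tr c e c' e' x (- vec_bracket X Y c' e' x)"
      unfolding vec_bracket_def graded_functions_regular(3)[OF graded_\<mu> c e c' e' xx]
        tr_intertwines_section[OF c e c' e' xx X] tr_intertwines_section[OF c e c' e' xx Y]
      by (simp add: tr_def subst_simps)
    also have "\<dots> = (\<Sum>\<gamma><r. ?V c' e' x \<gamma> *\<^sub>R (\<Sum>\<beta><r. fc e \<beta> x (snd e' \<gamma> x) *\<^sub>R ovar (Theta \<beta>)))"
      unfolding expand[OF c' e' x'] by (simp add: tr_def subst_simps cong: sum.cong_simp)
    also have "\<dots> = (\<Sum>\<beta><r. (\<Sum>\<gamma><r. ?V c' e' x \<gamma> * fc e \<beta> x (snd e' \<gamma> x)) *\<^sub>R ovar (Theta \<beta>))"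
      unfolding scaleR_sum_left scaleR_sum_right scaleR_scaleR by (rule sum.swap)
    finally have "coef (- vec_bracket X Y c e x) ({#}, {Theta \<beta>}) = (\<Sum>\<gamma><r. ?V c' e' x \<gamma> * fc e \<beta> x (snd e' \<gamma> x))"
      if "\<beta> < r" for \<beta>
      using coef_theta_sum[OF that] by simp
    then have V: "?V c e x \<beta> = (\<Sum>\<gamma><r. ?V c' e' x \<gamma> * fc e \<beta> x (snd e' \<gamma> x))" if "\<beta> < r" for \<beta>
      using that by simp
    have "W c e x = (\<Sum>\<beta><r. (\<Sum>\<gamma><r. ?V c' e' x \<gamma> * fc e \<beta> x (snd e' \<gamma> x)) *\<^sub>R snd e \<beta> x)"
      unfolding W_def by (intro sum.cong refl) (simp only: V lessThan_iff)
    also have "\<dots> = (\<Sum>\<gamma><r. ?V c' e' x \<gamma> *\<^sub>R (\<Sum>\<beta><r. fc e \<beta> x (snd e' \<gamma> x) *\<^sub>R snd e \<beta> x))"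
      unfolding scaleR_sum_left scaleR_sum_right scaleR_scaleR by (rule sum.swap)
    also have "\<dots> = W c' e' x"
      unfolding W_def using coeff_expand[OF e xe(1) frame_in_fibre[OF e' xe(2)]] by (intro sum.cong refl) simp
    finally show ?thesis .
  qed
  \<comment> \<open>By \<open>inv\<close> any chart and frame around \<open>x\<close> may be chosen;
    off the base the fibre is \<open>{0}\<close>.\<close>
  define Z where "Z x = (if x \<in> topspace M then
      W (SOME c. c \<in> charts B \<and> x \<in> fst c) (SOME e. e \<in> frames B \<and> x \<in> fst e) x else 0)" for x
  have ZW: "Z x = W c e x" if c: "c \<in> charts B" and e: "e \<in> frames B" and x: "x \<in> fst c \<inter> fst e" for c e x
  proof -
    have xM: "x \<in> topspace M" using x openin_subset[OF open_chart[OF c]] by blast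
    let ?c = "SOME c. c \<in> charts B \<and> x \<in> fst c" and ?e = "SOME e. e \<in> frames B \<and> x \<in> fst e"
    have "?c \<in> charts B \<and> x \<in> fst ?c" by (rule someI[where x = c]) (use c x in auto)
    moreover have "?e \<in> frames B \<and> x \<in> fst ?e" by (rule someI[where x = e]) (use e x in auto)
    ultimately show ?thesis using inv[OF c e x, of ?c ?e] xM by (simp add: Z_def)
  qed
  have Zf: "Z x \<in> fibre B x" for x
  proof (cases "x \<in> topspace M")
    case True
    then obtain c e where ce: "c \<in> charts B" "e \<in> frames B" "x \<in> fst c \<inter> fst e"
      using chart_cover frame_cover by blast
    then have "x \<in> fst e" by blast
    then show ?thesis unfolding ZW[OF ce] W_def
      by (intro fibre_sum fibre_scale frame_in_fibre[OF ce(2)]) auto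
  qed (simp add: Z_def)
  have co: "fc e \<gamma> x (Z x) = ?V c e x \<gamma>"
    if "c \<in> charts B" "e \<in> frames B" "x \<in> fst c \<inter> fst e" "\<gamma> < r" for c e x \<gamma>
  proof -
    have "x \<in> fst e" using that(3) by blast
    then show ?thesis unfolding ZW[OF that(1-3)] W_def by (rule coeff_sum_frame[OF that(2) _ that(4)])
  qed
  have reg: "regular (big_bracket B (big_bracket B (vector_gfun B X) \<mu>) (vector_gfun B Y))"
    by (intro regular_big_bracket regular_section vector_E_section X Y regular_\<mu>)
  have "Z \<in> sections B"
  proof (rule sectionI[OF Zf])
    fix e \<gamma> assume e: "e \<in> frames B" and \<gamma>: "\<gamma> < r"
    show "smooth B (fst e) (\<lambda>x. fc e \<gamma> x (Z x))"
    proof (rule smooth_local[OF open_frame[OF e]])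
      fix x assume x: "x \<in> fst e"
      then have "x \<in> topspace M" using openin_subset[OF open_frame[OF e]] by blast
      then obtain c where c: "c \<in> charts B" "x \<in> fst c" using chart_cover by blast
      \<comment> \<open>The components are coefficients of the derived bracket, which is
        regular.\<close>
      have "smooth B (fst c \<inter> fst e) (\<lambda>x. fc e \<gamma> x (Z x))"
        by (rule smooth_cong[OF open_domain[OF c(1) e] _ smooth_field_coef[OF regular_smooth[OF reg c(1) e], of "({#}, {Theta \<gamma>})"]])
          (simp add: fld_vec_bracket[OF X Y c(1) e] co[OF c(1) e _ \<gamma>])
      then show "\<exists>U. openin M U \<and> x \<in> U \<and> smooth B (U \<inter> fst e) (\<lambda>x. fc e \<gamma> x (Z x))"
        using c open_chart by blast
    qed
  qed
  moreover have "vec_field Z e x = - vec_bracket X Y c e x"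
    if "c \<in> charts B" "e \<in> frames B" "x \<in> fst c \<inter> fst e" for c e x
    unfolding vec_field_eq expand[OF that] by (intro sum.cong refl) (simp add: co[OF that])
  ultimately show ?thesis using that by blast
qed

text \<open>Uniqueness in the definite description: the components of a section can be read off from
  its local expression.\<close>

lemma lie_bracket_field:
  assumes X: "X \<in> sections B" and Y: "Y \<in> sections B"
  shows "lie_bracket B \<mu> X Y \<in> sections B"
    and "c \<in> charts B \<Longrightarrow> e \<in> frames B \<Longrightarrow> x \<in> fst c \<inter> fst e \<Longrightarrow>
      vec_field (lie_bracket B \<mu> X Y) e x = - vec_bracket X Y c e x"
proof -
  obtain Z where Z: "Z \<in> sections B"
    "\<And>c e x. c \<in> charts B \<Longrightarrow> e \<in> frames B \<Longrightarrow> x \<in> fst c \<inter> fst e \<Longrightarrow> vec_field Z e x = - vec_bracket X Y c e x"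
    using lie_bracket_exists[OF X Y] by blast
  have reg: "regular (big_bracket B (big_bracket B (vector_gfun B X) \<mu>) (vector_gfun B Y))"
    by (intro regular_big_bracket regular_section vector_E_section X Y regular_\<mu>)
  have "lie_bracket B \<mu> X Y = Z"
    unfolding lie_bracket_def
  proof (rule the_equality)
    have "vector_gfun B Z = big_bracket B (big_bracket B (vector_gfun B X) \<mu>) (vector_gfun B Y)"
      by (rule regular_eqI[OF regular_section[OF vector_E_section[OF Z(1)]] reg])
        (simp add: fld_section fld_vec_bracket[OF X Y] Z(2))
    then show "Z \<in> sections B \<and> vector_gfun B Z = big_bracket B (big_bracket B (vector_gfun B X) \<mu>) (vector_gfun B Y)"
      using Z(1) by blast
    fix Z' assume Z': "Z' \<in> sections B \<and> vector_gfun B Z' = big_bracket B (big_bracket B (vector_gfun B X) \<mu>) (vector_gfun B Y)"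
    show "Z' = Z"
    proof (rule section_eqI[OF conjunct1[OF Z'] Z(1)])
      fix e x \<alpha> assume e: "e \<in> frames B" and xe: "x \<in> fst e" and \<alpha>: "\<alpha> < r"
      then have "x \<in> topspace M" using openin_subset[OF open_frame[OF e]] by blast
      then obtain c where c: "c \<in> charts B" "x \<in> fst c" using chart_cover by blast
      with xe have x: "x \<in> fst c \<inter> fst e" by blast
      have "vec_field Z' e x = vec_field Z e x"
        using fld_section[OF c(1) e x, of "\<lambda>x. (Z' x, \<lambda>v. 0)"] conjunct2[OF Z'] fld_vec_bracket[OF X Y c(1) e x] Z(2)[OF c(1) e x]
        by simp
      then show "fc e \<alpha> x (Z' x) = fc e \<alpha> x (Z x)"
        unfolding vec_field_eq by (metis coef_theta_sum[OF \<alpha>])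
    qed
  qed
  then show "lie_bracket B \<mu> X Y \<in> sections B"
    and "c \<in> charts B \<Longrightarrow> e \<in> frames B \<Longrightarrow> x \<in> fst c \<inter> fst e \<Longrightarrow>
      vec_field (lie_bracket B \<mu> X Y) e x = - vec_bracket X Y c e x"
    using Z by simp_all
qed

section \<open>The deformed structure and the Nijenhuis condition\<close>

context
  fixes N
  assumes N: "endomorphism B N"
begin

abbreviation "\<mu>\<^sub>N \<equiv> big_bracket B (endo_gfun B N) \<mu>"

lemma fld_\<mu>\<^sub>N:
  "c \<in> charts B \<Longrightarrow> e \<in> frames B \<Longrightarrow> x \<in> fst c \<inter> fst e \<Longrightarrow> fld \<mu>\<^sub>N c e x = act_endo N c e x (fld \<mu> c e x)"
  by (rule fld_endo_bracket[OF _ _ N regular_\<mu>])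

lemma regular_\<mu>\<^sub>N: "regular \<mu>\<^sub>N"
  by (rule regular_big_bracket[OF regular_endo[OF N] regular_\<mu>])

lemma fld_\<mu>\<^sub>N_span:
  "c \<in> charts B \<Longrightarrow> e \<in> frames B \<Longrightarrow> x \<in> fst c \<inter> fst e \<Longrightarrow> fld \<mu>\<^sub>N c e x \<in> span (lie_gens n r)"
  unfolding fld_\<mu>\<^sub>N by (intro act_endo_lie N fld_\<mu>_span)

lemma graded_\<mu>\<^sub>N: "\<mu>\<^sub>N \<in> graded_functions B 3"
proof (rule graded_functionsI[OF regular_\<mu>\<^sub>N])
  show "m \<in> monomials n r 3"
    if "c \<in> charts B" "e \<in> frames B" "x \<in> fst c \<inter> fst e" "coef (fld \<mu>\<^sub>N c e x) m \<noteq> 0" for c e x m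
    using span_lie_coef[OF fld_\<mu>\<^sub>N_span[OF that(1-3)] that(4)] by blast
  fix c e c' e' x
  assume *: "c \<in> charts B" "e \<in> frames B" "c' \<in> charts B" "e' \<in> frames B" "x \<in> fst c \<inter> fst e \<inter> fst c' \<inter> fst e'"
  then have x: "x \<in> fst c \<inter> fst e" "x \<in> fst c' \<inter> fst e'" by auto
  show "fld \<mu>\<^sub>N c e x = tr c e c' e' x (fld \<mu>\<^sub>N c' e' x)"
    by (simp only: fld_\<mu>\<^sub>N[OF *(1,2) x(1)] fld_\<mu>\<^sub>N[OF *(3,4) x(2)] graded_functions_regular(3)[OF graded_\<mu> *]
        tr_intertwines_endo[OF * N])
qed

lemma \<mu>\<^sub>N_lie_form: "\<mu>\<^sub>N c e x m \<noteq> 0 \<Longrightarrow> lie_form m"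
proof -
  assume nz: "\<mu>\<^sub>N c e x m \<noteq> 0"
  then have ce: "c \<in> charts B" "e \<in> frames B" "x \<in> fst c \<inter> fst e"
    using graded_\<mu>\<^sub>N unfolding graded_functions_def by blast+
  with nz have "coef (fld \<mu>\<^sub>N c e x) m \<noteq> 0" by (simp add: coef_fld[OF ce regular_\<mu>\<^sub>N])
  then show "lie_form m" using span_lie_coef[OF fld_\<mu>\<^sub>N_span[OF ce]] by blast
qed

end

lemma \<mu>_bracket_deformed:
  assumes N: "endomorphism B N" and c: "c \<in> charts B" and e: "e \<in> frames B" and x: "x \<in> fst c \<inter> fst e"
  shows "brk_fld \<mu> (big_bracket B (endo_gfun B N) \<mu>) c e x = 0"
proof -
  let ?b = "big_bracket B (endo_gfun B N) \<mu>"
  have "big_bracket B \<mu> \<mu> = zero_gfun" using \<mu> by (simp add: lie_algebroid_def)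
  then have "brk_fld \<mu> \<mu> c e x = 0"
    using fld_big_bracket[OF regular_\<mu> regular_\<mu> c e x] by (simp add: fld_zero)
  then have "brk_fld ?b \<mu> c e x + brk_fld \<mu> ?b c e x = 0"
    using act_endo_brk_fld[OF c e N regular_\<mu> regular_\<mu> x] by (simp add: act_field_simps)
  moreover have "brk_fld ?b \<mu> c e x = brk_fld \<mu> ?b c e x"
    by (rule brk_fld_odd_sym[OF c e regular_\<mu>\<^sub>N[OF N] regular_\<mu> x])
      (auto intro!: parity_lie fld_\<mu>\<^sub>N_span[OF N c e] fld_\<mu>_span[OF c e])
  ultimately have "2 *\<^sub>R brk_fld \<mu> ?b c e x = 0" by (simp add: scaleR_2)
  then show ?thesis by simp
qed

text \<open>The derived bracket of \<open>{N, {N, \<mu>}} - {N\<^sup>2, \<mu>}\<close> is twice the torsion.\<close>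

lemma nijenhuis_derived_bracket:
  assumes N: "endomorphism B N" and nij: "nijenhuis_tensor B \<mu> N"
    and c: "c \<in> charts B" and e: "e \<in> frames B" and x: "x \<in> fst c \<inter> fst e"
    and X: "X \<in> sections B" and Y: "Y \<in> sections B"
  shows "act_vec Y c e x (act_vec X c e x (act_endo N c e x (act_endo N c e x (fld \<mu> c e x)))) =
    act_vec Y c e x (act_vec X c e x (act_endo (\<lambda>x v. N x (N x v)) c e x (fld \<mu> c e x)))"
proof -
  have xe: "x \<in> fst e" using x by simp
  let ?N2 = "\<lambda>x v. N x (N x v)"
  note N2 = endo_compose[OF N]
  define D where "D = act_endo N c e x"
  define nX where "nX = (\<lambda>X y. N y (X y))"
  define lb where "lb = lie_bracket B \<mu>"
  define v where "v w = (\<Sum>\<gamma><r. fc e \<gamma> x w *\<^sub>R ovar (Theta \<gamma>))" for w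
  define \<beta> where "\<beta> X Y = vec_bracket X Y c e x" for X Y
  have nX_sec: "nX X \<in> sections B" if "X \<in> sections B" for X
    unfolding nX_def by (rule endo_section[OF N that])
  have lb_sec: "lb X Y \<in> sections B" if "X \<in> sections B" "Y \<in> sections B" for X Y
    unfolding lb_def by (rule lie_bracket_field(1)[OF that])
  have \<beta>_eq: "\<beta> X Y = - v (lb X Y x)" if "X \<in> sections B" "Y \<in> sections B" for X Y
    using lie_bracket_field(2)[OF that c e x] by (simp add: \<beta>_def v_def lb_def vec_field_eq)
  have D_v: "D (v (Z x)) = - v (N x (Z x))" if "Z \<in> sections B" for Z
    using act_endo_vec_field[OF c e x N that] by (simp add: D_def v_def vec_field_eq)
  have D2_v: "act_endo ?N2 c e x (v (Z x)) = - v (N x (N x (Z x)))" if "Z \<in> sections B" for Z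
    using act_endo_vec_field[OF c e x N2 that] by (simp add: v_def vec_field_eq)
  have comm: "act_vec X c e x (D a) = D (act_vec X c e x a) + act_vec (nX X) c e x a" if "X \<in> sections B" for X a
    unfolding D_def nX_def by (rule act_vec_act_endo[OF c e x N that])
  have D_lin: "D (a + b) = D a + D b" "D (a - b) = D a - D b" "D (- a) = - D a" for a b
    unfolding D_def by (simp_all add: act_field_simps)
  \<comment> \<open>Moves \<open>D\<close> out past both sections at the cost of terms with
    \<open>N X\<close> and \<open>N Y\<close>. It is used twice, for \<open>D (D \<mu>)\<close> and
    for each \<open>D \<mu>\<close> that arises.\<close>
  have two: "act_vec Y c e x (act_vec X c e x (D a)) = D (act_vec Y c e x (act_vec X c e x a)) +
      act_vec (nX Y) c e x (act_vec X c e x a) + act_vec Y c e x (act_vec (nX X) c e x a)"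
    if "X \<in> sections B" "Y \<in> sections B" for X Y a
    by (simp add: comm that act_field_simps)
  have E: "act_vec Y c e x (act_vec X c e x (D (fld \<mu> c e x))) = D (\<beta> X Y) + \<beta> X (nX Y) + \<beta> (nX X) Y"
    if "X \<in> sections B" "Y \<in> sections B" for X Y
    unfolding two[OF that] \<beta>_def vec_bracket_def ..
  have NN: "D (v (N x (lb X Y x))) = - v (N x (N x (lb X Y x)))"
    using D_v[OF nX_sec[OF lb_sec[OF X Y]]] by (simp add: nX_def)
  have lhs: "act_vec Y c e x (act_vec X c e x (D (D (fld \<mu> c e x)))) =
      - v (N x (N x (lb X Y x))) + 2 *\<^sub>R v (N x (lb X (nX Y) x)) + 2 *\<^sub>R v (N x (lb (nX X) Y x))
      - 2 *\<^sub>R v (lb (nX X) (nX Y) x) - v (lb X (nX (nX Y)) x) - v (lb (nX (nX X)) Y x)"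
    unfolding two[OF X Y, of "D (fld \<mu> c e x)"] E[OF X Y] E[OF X nX_sec[OF Y]] E[OF nX_sec[OF X] Y]
    by (simp add: \<beta>_eq nX_sec X Y D_lin D_v lb_sec NN scaleR_2)
  have rhs: "act_vec Y c e x (act_vec X c e x (act_endo ?N2 c e x (fld \<mu> c e x))) =
      v (N x (N x (lb X Y x))) - v (lb X (nX (nX Y)) x) - v (lb (nX (nX X)) Y x)"
  proof -
    have "act_vec Y c e x (act_vec X c e x (act_endo ?N2 c e x (fld \<mu> c e x))) =
        act_endo ?N2 c e x (\<beta> X Y) + \<beta> X (nX (nX Y)) + \<beta> (nX (nX X)) Y"
      unfolding act_vec_act_endo[OF c e x N2 X] act_vec_act_endo[OF c e x N2 Y] linear_add[OF linear_act_section]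
        \<beta>_def vec_bracket_def nX_def by simp
    then show ?thesis
      by (simp add: \<beta>_eq nX_sec X Y lb_sec D2_v linear_neg[OF linear_act_endo])
  qed
  have fib: "lb X Y x \<in> fibre B x" if "X \<in> sections B" "Y \<in> sections B" for X Y
    using section_in_fibre[OF lb_sec[OF that]] .
  note Nf = endo_fibre(1)[OF N]
  have "nijenhuis_torsion B \<mu> N X Y = (\<lambda>x. 0)" using nij X Y by (simp add: nijenhuis_tensor_def)
  \<comment> \<open>Subtracting \<open>rhs\<close> from \<open>lhs\<close> leaves \<open>-2\<close>
    times the local expression of the torsion, so the vanishing torsion is solved for
    \<open>[N X, N Y]\<close> and substituted.\<close>
  then have "lb (nX X) (nX Y) x = N x (lb (nX X) Y x + lb X (nX Y) x - N x (lb X Y x))"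
    unfolding nijenhuis_torsion_def deformed_bracket_def lb_def nX_def by (metis eq_iff_diff_eq_0)
  also have "\<dots> = N x (lb (nX X) Y x) + N x (lb X (nX Y) x) - N x (N x (lb X Y x))"
    by (simp add: endo_diff[OF N] endo_fibre(2)[OF N] fib nX_sec X Y fibre_add Nf)
  finally have "v (lb (nX X) (nX Y) x) = v (N x (lb (nX X) Y x)) + v (N x (lb X (nX Y) x)) - v (N x (N x (lb X Y x)))"
    by (simp add: v_def coeff_add[OF e xe] coeff_diff[OF e xe] fib nX_sec X Y fibre_add Nf
        scaleR_add_left scaleR_diff_left sum.distrib sum_subtractf)
  with lhs rhs show ?thesis
    unfolding D_def by (simp add: scaleR_2)
qed

lemma nijenhuis_square:
  assumes N: "endomorphism B N" and nij: "nijenhuis_tensor B \<mu> N"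
    and c: "c \<in> charts B" and e: "e \<in> frames B" and x: "x \<in> fst c \<inter> fst e"
  shows "act_endo N c e x (act_endo N c e x (fld \<mu> c e x)) = act_endo (\<lambda>x v. N x (N x v)) c e x (fld \<mu> c e x)"
proof -
  let ?K = "act_endo N c e x (act_endo N c e x (fld \<mu> c e x)) - act_endo (\<lambda>x v. N x (N x v)) c e x (fld \<mu> c e x)"
  have K: "?K \<in> span (lie_gens n r)"
    by (intro span_diff act_endo_lie[OF c e x] N endo_compose[OF N] fld_\<mu>_span[OF c e x])
  have D: "act_vec Y c e x (act_vec X c e x ?K) = 0" if "X \<in> sections B" "Y \<in> sections B" for X Y
    using nijenhuis_derived_bracket[OF N nij c e x that] by (simp add: act_field_simps)
  have k0: "koszul S T \<noteq> 0" for S T by (metis koszul_square mult_zero_left zero_neq_one)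
  have "?K = 0"
  proof (rule gp_eqI)
    fix P S
    show "coef ?K (P, S) = coef 0 (P, S)"
    proof (rule ccontr)
      assume "coef ?K (P, S) \<noteq> coef 0 (P, S)"
      then have nz: "coef ?K (P, S) \<noteq> 0" by simp
      from span_lie_coef[OF K nz] have form: "lie_form (P, S)" and m: "(P, S) \<in> monomials n r 3" by blast+
      from form show False
        unfolding lie_form_def
      proof (elim disjE exE)
        \<comment> \<open>\<open>X\<close> removes \<open>Tau \<alpha>\<close> and \<open>Y\<close>,
          which vanishes at \<open>x\<close>, turns the momentum into \<open>Theta \<alpha>\<close>;
          what is left at \<open>Theta \<alpha>\<close> is the coefficient up to sign.\<close>
        fix \<alpha> i assume eq: "(P, S) = ({#i#}, {Tau \<alpha>})"
        then have \<alpha>: "\<alpha> < r" and i: "i < n" using m by (auto simp: monomials_def)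
        obtain X where X: "X \<in> sections B" "\<And>a. act_vec X c e x a = dl (Tau \<alpha>) a"
          using dl_Tau_eq_act_vec[OF c e x \<alpha>] by blast
        obtain Y where Y: "Y \<in> sections B" "\<And>a. act_vec Y c e x a = ovar (Theta \<alpha>) * dp i a"
          using Theta_dp_eq_act_vec[OF c e x \<alpha> i] by blast
        have "ovar (Theta \<alpha>) * dp i (dl (Tau \<alpha>) ?K) = 0" using D[OF X(1) Y(1)] X(2) Y(2) by simp
        then have "coef (ovar (Theta \<alpha>) * dp i (dl (Tau \<alpha>) ?K)) ({#}, {Theta \<alpha>}) = 0" by simp
        then show False using nz eq k0 by (simp only: coef_ovar_mult_singleton coef_dp_eq coef_dl_eq) simp
      next
        \<comment> \<open>Two frame vectors remove the two \<open>Tau\<close>, which are distinct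
          because the monomial has degree 3, and the coefficient is read off at
          \<open>Theta \<gamma>\<close>.\<close>
        fix \<alpha> \<beta> \<gamma> assume eq: "(P, S) = ({#}, {Tau \<alpha>, Tau \<beta>, Theta \<gamma>})"
        then have \<alpha>: "\<alpha> < r" and \<beta>: "\<beta> < r" and card: "card {Tau \<alpha>, Tau \<beta>, Theta \<gamma>} = 3"
          using m by (auto simp: monomials_def)
        then have ne: "\<alpha> \<noteq> \<beta>" by auto
        obtain X where X: "X \<in> sections B" "\<And>a. act_vec X c e x a = dl (Tau \<alpha>) a"
          using dl_Tau_eq_act_vec[OF c e x \<alpha>] by blast
        obtain Y where Y: "Y \<in> sections B" "\<And>a. act_vec Y c e x a = dl (Tau \<beta>) a"
          using dl_Tau_eq_act_vec[OF c e x \<beta>] by blast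
        have "dl (Tau \<beta>) (dl (Tau \<alpha>) ?K) = 0" using D[OF X(1) Y(1)] X(2) Y(2) by simp
        then have "coef (dl (Tau \<beta>) (dl (Tau \<alpha>) ?K)) ({#}, {Theta \<gamma>}) = 0" by simp
        then show False using nz eq k0 ne by (simp only: coef_dl_eq) simp
      qed
    qed
  qed
  then show ?thesis by simp
qed

text \<open>The condition for a weak deforming tensor has \<open>N\<close> on the right, in
  \<open>{\<mu>\<^sub>N, N}\<close>, whereas the Jacobi identity is used for
  \<open>{N, \<mu>\<^sub>N}\<close>; the two differ by a sign. The relation is assumed on the whole
  domain, as derivatives are involved.\<close>

lemma brk_fld_uminus:
  assumes b: "regular b" and c: "c \<in> charts B" and e: "e \<in> frames B" and x: "x \<in> fst c \<inter> fst e"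
    and f: "\<And>y. y \<in> fst c \<inter> fst e \<Longrightarrow> fld b' c e y = - fld b c e y"
  shows "brk_fld a b' c e x = - brk_fld a b c e x"
proof -
  have "gpartial c i (fld b' c e) x = - gpartial c i (fld b c e) x" if "i < n" for i
  proof -
    have "gpartial c i (fld b' c e) x = gpartial c i (\<lambda>y. - fld b c e y) x"
      by (rule gpartial_fld_cong[OF c e that x f])
    then show ?thesis
      using gpartial_uminus[OF c open_domain[OF c e] Int_lower1 regular_smooth[OF b c e] that x] by simp
  qed
  then show ?thesis
    by (simp add: brk_fld_def brk_def f[OF x] linear_simps odd_br_simps sum_negf[symmetric])
qed

lemma nijenhuis_main:
  assumes N: "endomorphism B N" and nij: "nijenhuis_tensor B \<mu> N"
  defines "\<nu> \<equiv> big_bracket B (endo_gfun B N) \<mu>"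
  shows "big_bracket B \<mu> (big_bracket B \<nu> (endo_gfun B N)) = zero_gfun"
    and "big_bracket B \<nu> \<nu> = zero_gfun"
    and "\<nu> \<in> graded_functions B 3"
    and "lie_algebroid B \<nu>"
proof -
  note N2 = endo_compose[OF N]
  note r\<nu> = regular_\<mu>\<^sub>N[OF N, folded \<nu>_def]
  let ?\<nu>N = "big_bracket B (endo_gfun B N) \<nu>"
  have r\<nu>N: "regular ?\<nu>N" by (rule regular_big_bracket[OF regular_endo[OF N] r\<nu>])
  have "?\<nu>N = big_bracket B (endo_gfun B (\<lambda>x v. N x (N x v))) \<mu>"
  proof (rule regular_eqI[OF r\<nu>N regular_\<mu>\<^sub>N[OF N2]])
    fix c e x assume c: "c \<in> charts B" and e: "e \<in> frames B" and x: "x \<in> fst c \<inter> fst e"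
    show "fld ?\<nu>N c e x = fld (big_bracket B (endo_gfun B (\<lambda>x v. N x (N x v))) \<mu>) c e x"
      unfolding fld_endo_bracket[OF c e N r\<nu> x] fld_\<mu>\<^sub>N[OF N2 c e x]
      unfolding \<nu>_def fld_\<mu>\<^sub>N[OF N c e x] by (rule nijenhuis_square[OF N nij c e x])
  qed
  then have z: "brk_fld \<mu> ?\<nu>N c e x = 0" if "c \<in> charts B" "e \<in> frames B" "x \<in> fst c \<inter> fst e" for c e x
    using \<mu>_bracket_deformed[OF N2 that] by simp
  have r3: "regular (big_bracket B \<nu> (endo_gfun B N))" by (rule regular_big_bracket[OF r\<nu> regular_endo[OF N]])
  show "big_bracket B \<mu> (big_bracket B \<nu> (endo_gfun B N)) = zero_gfun"
  proof (rule regular_eqI[OF regular_big_bracket[OF regular_\<mu> r3] regular_zero])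
    fix c e x assume *: "c \<in> charts B" "e \<in> frames B" "x \<in> fst c \<inter> fst e"
    have "brk_fld \<mu> (big_bracket B \<nu> (endo_gfun B N)) c e x = - brk_fld \<mu> ?\<nu>N c e x"
      by (rule brk_fld_uminus[OF r\<nu>N *])
        (simp add: fld_bracket_endo[OF *(1,2) N r\<nu>] fld_endo_bracket[OF *(1,2) N r\<nu>])
    then show "fld (big_bracket B \<mu> (big_bracket B \<nu> (endo_gfun B N))) c e x = fld zero_gfun c e x"
      by (simp add: fld_big_bracket[OF regular_\<mu> r3 *] fld_zero z[OF *])
  qed
  show \<nu>\<nu>: "big_bracket B \<nu> \<nu> = zero_gfun"
  proof (rule regular_eqI[OF regular_big_bracket[OF r\<nu> r\<nu>] regular_zero])
    fix c e x assume *: "c \<in> charts B" "e \<in> frames B" "x \<in> fst c \<inter> fst e"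
    have "act_endo N c e x (brk_fld \<mu> \<nu> c e x) = brk_fld \<nu> \<nu> c e x + brk_fld \<mu> ?\<nu>N c e x"
      using act_endo_brk_fld[OF *(1,2) N regular_\<mu> r\<nu> *(3)] by (simp add: \<nu>_def)
    moreover have "brk_fld \<mu> \<nu> c e x = 0" unfolding \<nu>_def by (rule \<mu>_bracket_deformed[OF N *])
    ultimately show "fld (big_bracket B \<nu> \<nu>) c e x = fld zero_gfun c e x"
      by (simp add: fld_big_bracket[OF r\<nu> r\<nu> *] fld_zero z[OF *] act_field_simps)
  qed
  show g: "\<nu> \<in> graded_functions B 3" unfolding \<nu>_def by (rule graded_\<mu>\<^sub>N[OF N])
  show "lie_algebroid B \<nu>"
    using g \<nu>\<nu> \<mu>\<^sub>N_lie_form[OF N] unfolding lie_algebroid_def lie_form_def \<nu>_def by blast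
qed

end

end

theorem theorem4p14:
  fixes B :: "('m, 'v::real_vector) vbundle"
    and \<mu> :: "('m, 'v) gfun"
    and N :: "'m \<Rightarrow> 'v \<Rightarrow> 'v"
  assumes "vector_bundle B"
    and "lie_algebroid B \<mu>"
    and "endomorphism B N"
    and "nijenhuis_tensor B \<mu> N"
  shows "weak_deforming_tensor B \<mu> (block_endo N) \<and>
    courant_algebroid B (big_bracket B (tilde B (block_endo N)) \<mu>) \<and>
    lie_bialgebroid B (deformed_structure B \<mu> N) zero_gfun \<and>
    big_bracket B (tilde B (block_endo N)) \<mu> = double (deformed_structure B \<mu> N) zero_gfun"
proof -
  interpret smooth_bundle B by unfold_locales (rule assms(1))
  have courant: "courant_algebroid B \<mu>"
    using assms(2) by (simp add: lie_algebroid_def courant_algebroid_def)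
  have double: "double a zero_gfun = a" for a :: "('m, 'v) gfun"
    by (simp add: double_def add_gfun_def zero_gfun_def)
  show ?thesis
  proof (cases "rnk B = 0")
    case True
    then have "\<mu> = zero_gfun" using rank_zero_graded graded_\<mu>[OF assms(2)] by blast
    then show ?thesis
      using courant skew_block_endo[OF assms(3)] zero_lie_algebroid zero_dual_lie_algebroid
      by (simp add: weak_deforming_tensor_def deformed_structure_def lie_bialgebroid_def big_bracket_zero double)
  next
    case False
    then have "tilde B (block_endo N) = endo_gfun B N" by (intro tilde_block_endo[OF assms(3)]) simp
    then show ?thesis
      using courant skew_block_endo[OF assms(3)] nijenhuis_main[OF assms(2-4)] zero_dual_lie_algebroid
      by (simp add: weak_deforming_tensor_def deformed_structure_def lie_bialgebroid_def courant_algebroid_def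
          big_bracket_zero double)
  qed
qed

end
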